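(* For any positive integer $s$, there exists a non-bipartite stable graph $F$ such that the following holds. There is a constant $\epsilon>0$ such that for every sufficiently large integer $n$ (and integers $q$): (1) if $1\le q\le \epsilon n^{1-1/s}$, then $h_F(n,q)=t_F(n,q)$; and (2) if $n^{1-1/s}/\epsilon\le q\le \epsilon n$, then $h_F(n,q)<t_F(n,q)$.
   Context: All graphs are finite and simple. $\mathrm{ex}(n,F)$ is the maximum number of edges in an $n$-vertex graph not containing $F$ as a (not necessarily induced) subgraph; an $n$-vertex $F$-free graph with $\mathrm{ex}(n,F)$ edges is an extremal graph for $F$. The number of copies of $F$ in $G$ is the number of edge-preserving injections $V(F)\to V(G)$ divided by the number of automorphisms of $F$ (for $F$ without isolated vertices, this is the number of edge subsets of $G$ that induce a copy of $F$). $h_F(n,q)$ is the minimum number of copies of $F$ in an $n$-vertex graph with $\mathrm{ex}(n,F)+q$ edges. $t_F(n,q)$ is the minimum number of copies of $F$ in graphs obtained from an $n$-vertex extremal graph for $F$ by adding $q$ new edges. A graph $F$ is stable if, for all sufficiently large $n$, $\mathrm{ex}(n,F)$ is achieved by a unique (up to isomorphism) $n$-vertex graph $H(n)$, and every $n$-vertex $F$-free graph with $(1-o(1))\,\mathrm{ex}(n,F)$ edges can be obtained from $H(n)$ by changing (adding or deleting) at most $o(n^2)$ edges. *)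

theory Defs
  imports Complex_Main "HOL-Library.FuncSet" "HOL-Library.Ramsey"
begin

datatype 'a sgraph = SGraph (verts: "'a set") (edges: "'a set set")

definition simple_graph :: "'a sgraph \<Rightarrow> bool" where
  "simple_graph G \<longleftrightarrow> finite (verts G) \<and> edges G \<subseteq> [verts G]\<^bsup>2\<^esup>"

definition bipartite :: "'a sgraph \<Rightarrow> bool" where
  "bipartite G \<longleftrightarrow> (\<exists>A B. A \<union> B = verts G \<and> A \<inter> B = {} \<and>
     (\<forall>e\<in>edges G. \<exists>a\<in>A. \<exists>b\<in>B. e = {a, b}))"

definition embeddings :: "'a sgraph \<Rightarrow> 'b sgraph \<Rightarrow> ('a \<Rightarrow> 'b) set" where
  "embeddings F G = {f \<in> verts F \<rightarrow>\<^sub>E verts G. inj_on f (verts F) \<and> (\<forall>e\<in>edges F. f ` e \<in> edges G)}"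

definition isomorphisms :: "'a sgraph \<Rightarrow> 'b sgraph \<Rightarrow> ('a \<Rightarrow> 'b) set" where
  "isomorphisms G H = {f \<in> verts G \<rightarrow>\<^sub>E verts H. bij_betw f (verts G) (verts H) \<and> (`) f ` edges G = edges H}"

definition isomorphic :: "'a sgraph \<Rightarrow> 'b sgraph \<Rightarrow> bool" where
  "isomorphic G H \<longleftrightarrow> isomorphisms G H \<noteq> {}"

text \<open>The division below is exact, see \<open>card_automorphisms_dvd\<close>.\<close>

definition num_copies :: "'a sgraph \<Rightarrow> 'b sgraph \<Rightarrow> nat" where
  "num_copies F G = card (embeddings F G) div card (isomorphisms F F)"

lemma card_automorphisms_dvd:
  assumes F: "simple_graph F" and G: "simple_graph G"
  shows "card (isomorphisms F F) dvd card (embeddings F G)"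
proof -
  define V where "V = verts F"
  define key where "key f = (f ` V, (`) f ` edges F)" for f :: "'a \<Rightarrow> 'b"
  define C where "C = (\<lambda>p. {f \<in> embeddings F G. key f = p}) ` key ` embeddings F G"
  have fin: "finite (embeddings F G)"
    using F G finite_PiE[of "verts F" "\<lambda>_. verts G"]
    by (auto simp: embeddings_def simple_graph_def)
  have sub: "e \<subseteq> V" if "e \<in> edges F" for e
    using F that by (auto simp: simple_graph_def nsets_def V_def)
  have U: "\<Union>C = embeddings F G"
    by (auto simp: C_def)
  have card_fibre: "card {f \<in> embeddings F G. key f = key f0} = card (isomorphisms F F)"
    if f0: "f0 \<in> embeddings F G" for f0
  proof -
    let ?A = "isomorphisms F F" and ?B = "{f \<in> embeddings F G. key f = key f0}"
    have inj0: "inj_on f0 V" and ext0: "f0 \<in> V \<rightarrow>\<^sub>E verts G"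
      and ed0: "\<And>e. e \<in> edges F \<Longrightarrow> f0 ` e \<in> edges G"
      using f0 by (auto simp: embeddings_def V_def)
    have "bij_betw (\<lambda>a. compose V f0 a) ?A ?B"
    proof (rule bij_betw_byWitness[where f' = "\<lambda>g. compose V (inv_into V f0) g"])
      show "\<forall>a\<in>?A. compose V (inv_into V f0) (compose V f0 a) = a"
      proof
        fix a assume "a \<in> ?A"
        then have a: "a \<in> V \<rightarrow>\<^sub>E V" by (auto simp: isomorphisms_def V_def)
        show "compose V (inv_into V f0) (compose V f0 a) = a"
          using a inj0 by (intro ext) (auto simp: compose_def PiE_def extensional_def Pi_def)
      qed
    next
      show "\<forall>g\<in>?B. compose V f0 (compose V (inv_into V f0) g) = g"
      proof
        fix g assume "g \<in> ?B"
        then have g: "g \<in> V \<rightarrow>\<^sub>E verts G" "g ` V = f0 ` V"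
          by (auto simp: embeddings_def V_def key_def)
        have "f0 (inv_into V f0 (g x)) = g x" if "x \<in> V" for x
          using g that by (intro f_inv_into_f) blast
        then show "compose V f0 (compose V (inv_into V f0) g) = g"
          using g by (intro ext) (auto simp: compose_def PiE_def extensional_def)
      qed
    next
      show "(\<lambda>a. compose V f0 a) ` ?A \<subseteq> ?B"
      proof clarify
        fix a assume "a \<in> ?A"
        then have a: "a \<in> V \<rightarrow>\<^sub>E V" "inj_on a V" "a ` V = V" "(`) a ` edges F = edges F"
          by (auto simp: isomorphisms_def V_def bij_betw_def)
        have im: "compose V f0 a ` e = f0 ` (a ` e)" if "e \<subseteq> V" for e
          using that by (force simp: compose_def)
        have ime: "compose V f0 a ` e = f0 ` (a ` e)" if "e \<in> edges F" for e
          using im sub that by blast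
        have ae: "a ` e \<in> edges F" if "e \<in> edges F" for e
          using a(4) that by blast
        have "(`) (compose V f0 a) ` edges F = (`) f0 ` ((`) a ` edges F)"
          using ime by (auto simp: image_image)
        then have k: "key (compose V f0 a) = key f0"
          using im[of V] a by (simp add: key_def)
        have "compose V f0 a \<in> V \<rightarrow>\<^sub>E verts G"
          using a(1) ext0 by (auto simp: compose_def PiE_def extensional_def Pi_def)
        moreover have "inj_on (compose V f0 a) V"
        proof (rule inj_onI)
          fix x y assume xy: "x \<in> V" "y \<in> V" "compose V f0 a x = compose V f0 a y"
          then have "a x = a y"
            using a(3) inj0 by (auto simp: compose_def dest: inj_onD)
          then show "x = y" using a(2) xy by (auto dest: inj_onD)
        qed
        moreover have "\<forall>e\<in>edges F. compose V f0 a ` e \<in> edges G"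
          using ime ae ed0 by simp
        ultimately show "compose V f0 a \<in> embeddings F G \<and> key (compose V f0 a) = key f0"
          using k by (simp add: embeddings_def V_def)
      qed
    next
      show "(\<lambda>g. compose V (inv_into V f0) g) ` ?B \<subseteq> ?A"
      proof clarify
        fix g assume "g \<in> embeddings F G" "key g = key f0"
        then have g: "inj_on g V" "g ` V = f0 ` V" "(`) g ` edges F = (`) f0 ` edges F"
          by (auto simp: embeddings_def V_def key_def)
        let ?a = "compose V (inv_into V f0) g"
        have im: "?a ` e = inv_into V f0 ` (g ` e)" if "e \<subseteq> V" for e
          using that by (force simp: compose_def)
        have imV: "?a ` V = V"
          using im[of V] g(2) inj0 by (simp add: inv_into_image_cancel)
        have "inj_on ?a V"
        proof -
          have "inj_on (inv_into V f0 \<circ> g) V"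
            using g(1,2) by (intro comp_inj_on) (simp_all add: inj_on_inv_into)
          then show ?thesis by (simp add: inj_on_def compose_def)
        qed
        moreover have "(`) ?a ` edges F = edges F"
        proof -
          have "(`) ?a ` edges F = (`) (inv_into V f0) ` ((`) g ` edges F)"
            using im sub by (auto simp: image_image)
          also have "\<dots> = (\<lambda>e. inv_into V f0 ` (f0 ` e)) ` edges F"
            unfolding g(3) by (simp add: image_image)
          also have "\<dots> = (\<lambda>e. e) ` edges F"
            by (intro image_cong refl inv_into_image_cancel inj0 sub)
          finally show ?thesis by simp
        qed
        moreover have "?a \<in> V \<rightarrow>\<^sub>E V"
          using imV by (auto simp: compose_def)
        ultimately show "?a \<in> isomorphisms F F"
          using imV by (simp add: isomorphisms_def V_def bij_betw_def)
      qed
    qed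
    then show ?thesis by (simp add: bij_betw_same_card)
  qed
  have "card (isomorphisms F F) dvd card (\<Union>C)"
  proof (rule dvd_partition)
    show "finite (\<Union>C)" using fin U by simp
    show "\<forall>c\<in>C. card (isomorphisms F F) dvd card c"
      using card_fibre by (auto simp: C_def)
    show "\<forall>c1\<in>C. \<forall>c2\<in>C. c1 \<noteq> c2 \<longrightarrow> c1 \<inter> c2 = {}"
      by (auto simp: C_def)
  qed
  then show ?thesis using U by simp
qed

definition n_graph :: "nat \<Rightarrow> nat sgraph \<Rightarrow> bool" where
  "n_graph n G \<longleftrightarrow> simple_graph G \<and> card (verts G) = n"

definition free_of :: "'a sgraph \<Rightarrow> 'b sgraph \<Rightarrow> bool" where
  "free_of F G \<longleftrightarrow> embeddings F G = {}"

text \<open>The set below is finite, and it is nonempty as soon as \<open>F\<close> has an edge.\<close>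

definition ex_num :: "nat \<Rightarrow> 'a sgraph \<Rightarrow> nat" where
  "ex_num n F = Max {card (edges G) | G. n_graph n G \<and> free_of F G}"

definition extremal :: "nat \<Rightarrow> 'a sgraph \<Rightarrow> nat sgraph \<Rightarrow> bool" where
  "extremal n F G \<longleftrightarrow> n_graph n G \<and> free_of F G \<and> card (edges G) = ex_num n F"

text \<open>
  \<open>Inf\<close> on \<^typ>\<open>nat\<close> is the minimum of a nonempty set. For a non-bipartite \<open>F\<close> and
  \<open>q = O(n)\<close>, both sets below are nonempty for all large \<open>n\<close>, as
  \<open>n choose 2 - ex_num n F\<close> then grows quadratically.
\<close>

definition h_num :: "'a sgraph \<Rightarrow> nat \<Rightarrow> nat \<Rightarrow> nat" where
  "h_num F n q = Inf {num_copies F G | G. n_graph n G \<and> card (edges G) = ex_num n F + q}"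

definition t_num :: "'a sgraph \<Rightarrow> nat \<Rightarrow> nat \<Rightarrow> nat" where
  "t_num F n q = Inf {num_copies F G | G. n_graph n G \<and>
     (\<exists>H. extremal n F H \<and> verts H = verts G \<and> edges H \<subseteq> edges G \<and>
          card (edges G - edges H) = q)}"

text \<open>
  The \<open>o\<close>-terms are spelled out: for every \<open>\<epsilon> > 0\<close> there is \<open>\<delta> > 0\<close> such that every large
  \<open>F\<close>-free graph with at least \<open>(1 - \<delta>) ex(n, F)\<close> edges differs in at most \<open>\<epsilon> n\<^sup>2\<close> edges
  from some copy of \<open>H n\<close> on its own vertex set.
\<close>

definition stable_graph :: "'a sgraph \<Rightarrow> bool" where
  "stable_graph F \<longleftrightarrow> (\<exists>H :: nat \<Rightarrow> nat sgraph.
     (\<exists>N. \<forall>n\<ge>N. extremal n F (H n) \<and> (\<forall>G. extremal n F G \<longrightarrow> isomorphic G (H n))) \<and>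
     (\<forall>\<epsilon>>0. \<exists>\<delta>>0. \<exists>N. \<forall>n\<ge>N. \<forall>G.
        n_graph n G \<and> free_of F G \<and> real (card (edges G)) \<ge> (1 - \<delta>) * real (ex_num n F) \<longrightarrow>
        (\<exists>H'. simple_graph H' \<and> verts H' = verts G \<and> isomorphic (H n) H' \<and>
              real (card (sym_diff (edges G) (edges H'))) \<le> \<epsilon> * (real n)\<^sup>2)))"

end

theory Submission
  imports Defs "HOL-Library.Disjoint_Sets" "HOL-Library.Nat_Bijection"
begin

text \<open>
  The graph \<open>F\<close> is built so that its extremal graph is the join \<open>H\<close> of an apex vertex \<open>X\<close> and a
  balanced complete bipartite graph, and a new edge inside a part creates about \<open>C * n ^ (k - 3)\<close>
  copies of \<open>F\<close>, where \<open>k\<close> is the order of \<open>F\<close>. Any two independent new edges create additional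
  copies of order \<open>n ^ (k - 4)\<close> that avoid \<open>X\<close>, and any \<open>s\<close> new edges at a common vertex \<open>z\<close> create
  additional copies of order \<open>n ^ (k - 2 - s)\<close>, all of which use the edge \<open>Xz\<close>. So adding \<open>q\<close> edges
  to \<open>H\<close> has an extra cost of order at least \<open>q ^ s * n ^ (k - 2 - s)\<close>, which a star attains.
  Deleting \<open>Xz\<close> and adding one more star edge instead has extra cost about \<open>C * n ^ (k - 3)\<close>, which is
  cheaper once \<open>q\<close> exceeds the order of \<open>n powr (1 - 1 / s)\<close>. Below that order, every graph with as
  many edges that does not contain \<open>H\<close> has at least \<open>q + 1\<close> edges inside the parts, and already
  the one surplus edge costs more than all the stars.
\<close>

text \<open>Counts must be compared to a precision below \<open>main_term\<close>, so the shape of a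
  competitor has to be known exactly. A graph far from bipartite has many triangles and, as F is
  three-colourable, order \<open>n ^ k\<close> copies. In a nearly bipartite one a maximum cut has
  at least \<open>n / 4\<close> inner edges, because \<open>apex_size n\<close> exceeds every
  bipartite edge count by that much. Linearly many inner edges without a vertex of linear inner
  degree cost order \<open>n ^ (k - 2)\<close> copies, and so do two vertices of linear degree to
  both sides. Both are too expensive for \<open>q \<le> \<epsilon> * n\<close>, so exactly one apex
  survives. The star terms are visible only if the terms in \<open>q * n ^ (k - 3)\<close> cancel.
  For s \<ge> 2 the graph F is therefore chosen so that a copy with a single inner edge never uses
  an edge from the apex to that inner edge: deleting \<open>Xz\<close> leaves these copies intact
  and destroys only star copies. For s = 1 the star copies are themselves single-edge copies, and
  the equality range is empty once \<epsilon> < 1.\<close>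

section \<open>Counting maps and embeddings\<close>

text \<open>Applied with \<open>X\<close> a set of embeddings and \<open>P\<close> a set of
  configurations of inner edges: classes of embeddings belonging to different configurations are
  disjoint, so their sizes add up.\<close>

lemma card_ge_disjoint_family:
  fixes m :: real
  assumes "finite X" "finite P" "\<And>p. p \<in> P \<Longrightarrow> Y p \<subseteq> X" "disjoint_family_on Y P"
    "\<And>p. p \<in> P \<Longrightarrow> m \<le> real (card (Y p))"
  shows "real (card P) * m \<le> real (card X)"
proof -
  have "real (card P) * m = (\<Sum>p\<in>P. m)" by simp
  also have "\<dots> \<le> (\<Sum>p\<in>P. real (card (Y p)))" using assms(5) by (rule sum_mono)
  also have "\<dots> = real (card (\<Union>p\<in>P. Y p))"
    using assms by (subst card_UN_disjoint') (auto intro: finite_subset)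
  also have "\<dots> \<le> real (card X)"
    using assms(1,3) by (intro of_nat_mono card_mono) auto
  finally show ?thesis .
qed

text \<open>The key \<open>h f\<close> fixes f on \<open>J\<close>, so f is encoded by its key and
  its restriction to \<open>I - J\<close>.\<close>

lemma card_functions_le:
  assumes fin: "finite I" "finite V" "finite P" and J: "J \<subseteq> I"
    and ext: "\<And>f. f \<in> \<Phi> \<Longrightarrow> f \<in> I \<rightarrow>\<^sub>E V"
    and h: "\<And>f. f \<in> \<Phi> \<Longrightarrow> h f \<in> P"
    and det: "\<And>f f' v. f \<in> \<Phi> \<Longrightarrow> f' \<in> \<Phi> \<Longrightarrow> h f = h f' \<Longrightarrow> v \<in> J \<Longrightarrow> f v = f' v"
  shows "card \<Phi> \<le> card P * card V ^ card (I - J)"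
proof -
  let ?g = "\<lambda>f. (h f, restrict f (I - J))"
  have inj: "inj_on ?g \<Phi>"
  proof (rule inj_onI)
    fix f f' assume a: "f \<in> \<Phi>" "f' \<in> \<Phi>" "?g f = ?g f'"
    show "f = f'"
    proof (rule PiE_ext[OF ext[OF a(1)] ext[OF a(2)]])
      fix v assume v: "v \<in> I"
      show "f v = f' v"
      proof (cases "v \<in> J")
        case True then show ?thesis using det a by auto
      next
        case False
        have "restrict f (I - J) v = restrict f' (I - J) v" using a(3) by simp
        then show ?thesis using False v by simp
      qed
    qed
  qed
  have sub: "?g ` \<Phi> \<subseteq> P \<times> ((I - J) \<rightarrow>\<^sub>E V)"
    using h ext by (auto simp: PiE_def Pi_def)
  have "card \<Phi> = card (?g ` \<Phi>)" using inj by (simp add: card_image)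
  also have "\<dots> \<le> card (P \<times> ((I - J) \<rightarrow>\<^sub>E V))"
    using fin by (intro card_mono sub finite_cartesian_product finite_PiE) auto
  also have "\<dots> = card P * card V ^ card (I - J)"
    using fin by (simp add: card_cartesian_product card_PiE)
  finally show ?thesis .
qed

lemma simple_graph_edge:
  assumes "simple_graph G" "{a, b} \<in> edges G"
  shows "a \<in> verts G" "b \<in> verts G" "a \<noteq> b"
proof -
  have "{a, b} \<subseteq> verts G \<and> card {a, b} = 2" using assms by (auto simp: simple_graph_def nsets_def)
  then show "a \<in> verts G" "b \<in> verts G" "a \<noteq> b" by auto
qed

lemma simple_graph_edgeE:
  assumes "simple_graph G" "e \<in> edges G"
  obtains a b where "e = {a, b}" "a \<in> verts G" "b \<in> verts G" "a \<noteq> b"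
proof -
  have "e \<subseteq> verts G" "card e = 2" using assms by (auto simp: simple_graph_def nsets_def)
  then show ?thesis using that by (auto simp: card_2_iff)
qed

lemma finite_edges: "simple_graph G \<Longrightarrow> finite (edges G)"
  by (auto simp: simple_graph_def finite_imp_finite_nsets intro: finite_subset)

lemma finite_embeddings:
  "simple_graph F \<Longrightarrow> simple_graph G \<Longrightarrow> finite (embeddings F G)"
  using finite_PiE[of "verts F" "\<lambda>_. verts G"]
  by (auto simp: embeddings_def simple_graph_def)

text \<open>Union bound. The vertices outside \<open>T\<close> are placed independently in their
  sets \<open>S v\<close>. For each ordered pair of vertices, collisions take at most a fraction
  \<open>1 / n\<close> of \<open>n ^ (k - card T)\<close> and placements on a non-edge at most a
  fraction \<delta>; there are \<open>k ^ 2\<close> pairs.\<close>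

lemma extension_count:
  fixes F :: "'a sgraph" and G :: "'b sgraph" and \<delta> :: real
  assumes F: "simple_graph F" and G: "simple_graph G" and n: "n = card (verts G)" "n > 0"
    and k: "k = card (verts F)"
    and T: "T \<subseteq> verts F" "inj_on g T" "g ` T \<subseteq> verts G"
    and S: "\<And>v. v \<in> verts F - T \<Longrightarrow> S v \<subseteq> verts G - g ` T"
    and TT: "\<And>a b. {a, b} \<in> edges F \<Longrightarrow> a \<in> T \<Longrightarrow> b \<in> T \<Longrightarrow> {g a, g b} \<in> edges G"
    and TS: "\<And>a b. {a, b} \<in> edges F \<Longrightarrow> a \<in> T \<Longrightarrow> b \<in> verts F - T \<Longrightarrow>
       real (card {y \<in> S b. {g a, y} \<notin> edges G}) \<le> \<delta> * n"
    and SS: "\<And>a b. {a, b} \<in> edges F \<Longrightarrow> a \<in> verts F - T \<Longrightarrow> b \<in> verts F - T \<Longrightarrow>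
       real (card {(y, y') \<in> S a \<times> S b. {y, y'} \<notin> edges G}) \<le> \<delta> * n\<^sup>2"
    and \<delta>: "\<delta> \<ge> 0"
  shows "(\<Prod>v\<in>verts F - T. real (card (S v))) - real k ^ 2 * (\<delta> + 1 / n) * real n ^ (k - card T)
    \<le> card {f \<in> embeddings F G. (\<forall>v\<in>T. f v = g v) \<and> (\<forall>v\<in>verts F - T. f v \<in> S v)}"
    (is "_ \<le> real (card ?R)")
proof -
  define I where "I = verts F"
  define V where "V = verts G"
  have fI: "finite I" and fV: "finite V" using F G by (auto simp: simple_graph_def I_def V_def)
  have fT: "finite T" using T fI finite_subset I_def by auto
  \<comment> \<open>All placements, including those that are not embeddings; the values on
    \<open>T\<close> are singletons, so only the other vertices contribute to the product.\<close>
  define \<Omega> where "\<Omega> = (\<Pi>\<^sub>E v\<in>I. if v \<in> T then {g v} else S v)"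
  have SV: "S v \<subseteq> V" if "v \<in> I - T" for v using S that by (auto simp: I_def V_def)
  have fS: "finite (S v)" if "v \<in> I - T" for v using SV[OF that] fV finite_subset by auto
  have f\<Omega>: "finite \<Omega>" unfolding \<Omega>_def using fI fS by (intro finite_PiE) auto
  have c\<Omega>: "card \<Omega> = (\<Prod>v\<in>I - T. card (S v))"
  proof -
    have "card \<Omega> = (\<Prod>v\<in>I. if v \<in> T then 1 else card (S v))"
      unfolding \<Omega>_def using fI by (subst card_PiE) (auto intro!: prod.cong)
    also have "\<dots> = (\<Prod>v\<in>I - T. card (S v))"
      using fI by (intro prod.mono_neutral_cong_right) auto
    finally show ?thesis .
  qed
  have \<Omega>ext: "f \<in> I \<rightarrow>\<^sub>E V" if "f \<in> \<Omega>" for f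
  proof -
    have "(\<Pi>\<^sub>E v\<in>I. if v \<in> T then {g v} else S v) \<subseteq> I \<rightarrow>\<^sub>E V"
      using SV T by (intro PiE_mono) (auto simp: V_def)
    then show ?thesis using that by (auto simp: \<Omega>_def)
  qed
  have \<Omega>T: "f v = g v" if "f \<in> \<Omega>" "v \<in> T" for f v
    using that T by (auto simp: \<Omega>_def I_def dest!: PiE_mem[where x = v] split: if_splits)
  have \<Omega>S: "f v \<in> S v" if "f \<in> \<Omega>" "v \<in> I - T" for f v
    using that T by (auto simp: \<Omega>_def I_def dest!: PiE_mem[where x = v] split: if_splits)
  \<comment> \<open>\<open>B1 p\<close> collects the collisions of the pair \<open>p\<close>,
    \<open>B2 p\<close> the placements that send an edge \<open>p\<close> to a non-edge. Collisions
    with \<open>T\<close> cannot occur because \<open>S v\<close> avoids the image of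
    \<open>T\<close>.\<close>
  define B1 where "B1 p = {f \<in> \<Omega>. fst p \<in> I - T \<and> snd p \<in> I - T \<and> fst p \<noteq> snd p \<and> f (fst p) = f (snd p)}" for p
  define B2 where "B2 p = {f \<in> \<Omega>. {fst p, snd p} \<in> edges F \<and> {f (fst p), f (snd p)} \<notin> edges G}" for p
  let ?m = "k - card T"
  have km: "card (I - T) = ?m" using T k fT by (simp add: card_Diff_subset I_def)
  have b1: "real (card (B1 p)) \<le> (1 / n) * real n ^ ?m" for p
  proof (cases "fst p \<in> I - T \<and> snd p \<in> I - T \<and> fst p \<noteq> snd p")
    case False
    then have "B1 p = {}" unfolding B1_def by auto
    then show ?thesis by simp
  next
    case True
    then obtain a b where p: "p = (a, b)" "a \<in> I - T" "b \<in> I - T" "a \<noteq> b" by (cases p) auto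
    have "card (B1 p) \<le> card V * card V ^ card (I - (T \<union> {a, b}))"
    proof (rule card_functions_le[where h = "\<lambda>f. f a" and J = "T \<union> {a, b}"])
      fix f f' v assume a: "f \<in> B1 p" "f' \<in> B1 p" "f a = f' a" "v \<in> T \<union> {a, b}"
      then show "f v = f' v" using \<Omega>T[of f v] \<Omega>T[of f' v] p by (auto simp: B1_def)
    next
      fix f assume "f \<in> B1 p"
      then show "f a \<in> V" using \<Omega>ext[of f] p by (auto simp: B1_def)
    next
      fix f assume "f \<in> B1 p"
      then show "f \<in> I \<rightarrow>\<^sub>E V" using \<Omega>ext[of f] by (auto simp: B1_def)
    qed (use fI fV T p in \<open>auto simp: I_def\<close>)
    moreover have "card (I - (T \<union> {a, b})) = ?m - 2"
    proof -
      have "I - (T \<union> {a, b}) = (I - T) - {a, b}" by auto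
      then have "card (I - (T \<union> {a, b})) = card (I - T) - card {a, b}"
        using p by (simp add: card_Diff_subset)
      then show ?thesis using km p by simp
    qed
    moreover have "2 \<le> ?m"
    proof -
      have "card {a, b} \<le> card (I - T)" using p fI by (intro card_mono) auto
      then show ?thesis using km p by simp
    qed
    ultimately have "card (B1 p) \<le> n ^ Suc (?m - 2)" "Suc (Suc (?m - 2)) = ?m" using n by (simp_all add: V_def)
    then have "real (card (B1 p)) \<le> real n ^ Suc (?m - 2)"
      and e: "real n ^ ?m = real n * real n ^ Suc (?m - 2)"
      by (metis of_nat_le_iff of_nat_power) (metis \<open>Suc (Suc (?m - 2)) = ?m\<close> power_Suc)
    then show ?thesis using n unfolding e by simp
  qed
  have b2: "real (card (B2 p)) \<le> \<delta> * real n ^ ?m" for p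
  proof -
    obtain a b where p: "p = (a, b)" by (cases p) auto
    have single: "real (card (B2 p)) \<le> \<delta> * real n ^ ?m"
      if ab: "{a, b} \<in> edges F" "a' \<in> T" "b' \<in> I - T" "{a', b'} = {a, b}" for a' b'
    proof -
      let ?P = "{y \<in> S b'. {g a', y} \<notin> edges G}"
      have "card (B2 p) \<le> card ?P * card V ^ card (I - (T \<union> {b'}))"
      proof (rule card_functions_le[where h = "\<lambda>f. f b'"])
        fix f f' v assume a: "f \<in> B2 p" "f' \<in> B2 p" "f b' = f' b'" "v \<in> T \<union> {b'}"
        then show "f v = f' v" using \<Omega>T[of f v] \<Omega>T[of f' v] by (auto simp: B2_def)
      next
        fix f assume f: "f \<in> B2 p"
        then have "{f a', f b'} \<notin> edges G" using ab p
          by (auto simp: B2_def doubleton_eq_iff insert_commute)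
        moreover have "f a' = g a'" "f b' \<in> S b'" using f \<Omega>T[of f a'] \<Omega>S[of f b'] ab by (auto simp: B2_def)
        ultimately show "f b' \<in> ?P" by simp
      next
        fix f assume "f \<in> B2 p"
        then show "f \<in> I \<rightarrow>\<^sub>E V" using \<Omega>ext[of f] by (auto simp: B2_def)
      next
        show "finite ?P" using fS[OF ab(3)] by simp
      qed (use fI fV T ab in \<open>auto simp: I_def\<close>)
      moreover have "card (I - (T \<union> {b'})) = ?m - 1"
      proof -
        have "I - (T \<union> {b'}) = (I - T) - {b'}" by auto
        then show ?thesis using km ab by simp
      qed
      ultimately have "card (B2 p) \<le> card ?P * n ^ (?m - 1)"
        using n(1) by (simp only: V_def)
      from of_nat_mono[OF this, where 'a = real]
      have "real (card (B2 p)) \<le> real (card ?P) * real n ^ (?m - 1)"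
        by simp
      also have "\<dots> \<le> (\<delta> * n) * real n ^ (?m - 1)"
      proof (rule mult_right_mono)
        have "{a', b'} \<in> edges F" using ab by simp
        then show "real (card ?P) \<le> \<delta> * n" using TS[of a' b'] ab by (simp add: I_def)
      qed simp
      also have "\<dots> = \<delta> * real n ^ ?m"
      proof -
        have "?m \<noteq> 0" using km ab fI by (metis card_0_eq empty_iff finite_Diff)
        then have "real n ^ ?m = real n * real n ^ (?m - 1)" by (metis power_eq_if)
        then show ?thesis by simp
      qed
      finally show ?thesis .
    qed
    have none: ?thesis if "B2 p = {}" using that \<delta> by simp
    consider "{a, b} \<notin> edges F" | "{a, b} \<in> edges F" "a \<in> T" "b \<in> T"
      | "{a, b} \<in> edges F" "a \<in> T" "b \<in> I - T" | "{a, b} \<in> edges F" "b \<in> T" "a \<in> I - T"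
      | "{a, b} \<in> edges F" "a \<in> I - T" "b \<in> I - T"
      using simple_graph_edge[OF F] unfolding I_def by blast
    then show ?thesis
    proof cases
      case 1 then show ?thesis by (intro none) (auto simp: B2_def p)
    next
      case 2
      have "{f a, f b} \<in> edges G" if "f \<in> \<Omega>" for f
        using TT[OF 2] \<Omega>T[OF that 2(2)] \<Omega>T[OF that 2(3)] by simp
      then show ?thesis by (intro none) (auto simp: B2_def p)
    next
      case 3 then show ?thesis by (intro single[of a b]) auto
    next
      case 4 then show ?thesis by (intro single[of b a]) auto
    next
      case 5
      have ab: "a \<noteq> b" using simple_graph_edge[OF F 5(1)] by simp
      let ?P = "{(y, y') \<in> S a \<times> S b. {y, y'} \<notin> edges G}"
      have "card (B2 p) \<le> card ?P * card V ^ card (I - (T \<union> {a, b}))"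
      proof (rule card_functions_le[where h = "\<lambda>f. (f a, f b)"])
        fix f f' v assume a: "f \<in> B2 p" "f' \<in> B2 p" "(f a, f b) = (f' a, f' b)" "v \<in> T \<union> {a, b}"
        then show "f v = f' v" using \<Omega>T[of f v] \<Omega>T[of f' v] by (auto simp: B2_def)
      next
        fix f assume f: "f \<in> B2 p"
        then show "(f a, f b) \<in> ?P" using \<Omega>S[of f a] \<Omega>S[of f b] 5 by (auto simp: B2_def p)
      next
        fix f assume "f \<in> B2 p"
        then show "f \<in> I \<rightarrow>\<^sub>E V" using \<Omega>ext[of f] by (auto simp: B2_def)
      next
        show "finite ?P" using fS[OF 5(2)] fS[OF 5(3)]
          by (intro finite_subset[of ?P "S a \<times> S b"]) auto
      qed (use fI fV T 5 in \<open>auto simp: I_def\<close>)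
      moreover have "card (I - (T \<union> {a, b})) = ?m - 2"
      proof -
        have "I - (T \<union> {a, b}) = (I - T) - {a, b}" by auto
        then have "card (I - (T \<union> {a, b})) = card (I - T) - card {a, b}"
          using 5 by (simp add: card_Diff_subset)
        then show ?thesis using km ab by simp
      qed
      ultimately have "card (B2 p) \<le> card ?P * n ^ (?m - 2)"
        using n(1) by (simp only: V_def)
      from of_nat_mono[OF this, where 'a = real]
      have "real (card (B2 p)) \<le> real (card ?P) * real n ^ (?m - 2)"
        by simp
      also have "\<dots> \<le> (\<delta> * n\<^sup>2) * real n ^ (?m - 2)"
        using SS[OF 5(1)] 5 by (intro mult_right_mono) (auto simp: I_def)
      also have "\<dots> = \<delta> * real n ^ ?m"
      proof -
        have "card {a, b} \<le> card (I - T)" using 5 fI by (intro card_mono) auto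
        then have "?m = 2 + (?m - 2)" using km ab by simp
        then have "real n ^ ?m = real n ^ 2 * real n ^ (?m - 2)" by (metis power_add)
        then show ?thesis by simp
      qed
      finally show ?thesis .
    qed
  qed
  have good: "\<Omega> - (\<Union>p\<in>I \<times> I. B1 p \<union> B2 p) \<subseteq> ?R"
  proof
    fix f assume f: "f \<in> \<Omega> - (\<Union>p\<in>I \<times> I. B1 p \<union> B2 p)"
    then have f\<Omega>: "f \<in> \<Omega>" by simp
    have e: "{f a, f b} \<in> edges G" if "{a, b} \<in> edges F" for a b
      using f that simple_graph_edge[OF F that] by (auto simp: B2_def I_def)
    have "inj_on f I"
    proof (rule inj_onI)
      fix a b assume ab: "a \<in> I" "b \<in> I" "f a = f b"
      show "a = b"
      proof (rule ccontr)
        assume ne: "a \<noteq> b"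
        consider "a \<in> I - T" "b \<in> I - T" | "a \<in> T" "b \<in> T" | "a \<in> T" "b \<in> I - T" | "b \<in> T" "a \<in> I - T"
          using ab by auto
        then show False
        proof cases
          case 1 then show False using f ab ne by (auto simp: B1_def)
        next
          case 2 then show False using \<Omega>T[OF f\<Omega>] ab ne T(2) by (auto dest: inj_onD)
        next
          case 3
          then have "f b \<in> S b" "f a \<in> g ` T" using \<Omega>T[OF f\<Omega> 3(1)] \<Omega>S[OF f\<Omega> 3(2)] by auto
          then show False using S[of b] 3 ab by (auto simp: I_def)
        next
          case 4
          then have "f a \<in> S a" "f b \<in> g ` T" using \<Omega>T[OF f\<Omega> 4(1)] \<Omega>S[OF f\<Omega> 4(2)] by auto
          then show False using S[of a] 4 ab by (auto simp: I_def)
        qed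
      qed
    qed
    moreover have "\<forall>e\<in>edges F. f ` e \<in> edges G"
    proof
      fix d assume d: "d \<in> edges F"
      then obtain a b where "d = {a, b}" using simple_graph_edgeE[OF F] by metis
      then show "f ` d \<in> edges G" using e d by simp
    qed
    ultimately show "f \<in> ?R"
      using \<Omega>ext[OF f\<Omega>] \<Omega>T[OF f\<Omega>] \<Omega>S[OF f\<Omega>] by (auto simp: embeddings_def I_def V_def)
  qed
  have "real (card (\<Union>p\<in>I \<times> I. B1 p \<union> B2 p)) \<le> real (\<Sum>p\<in>I \<times> I. card (B1 p \<union> B2 p))"
    using fI by (intro of_nat_mono card_UN_le) auto
  also have "\<dots> \<le> (\<Sum>p\<in>I \<times> I. \<delta> * real n ^ ?m + (1 / n) * real n ^ ?m)"
    unfolding of_nat_sum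
  proof (rule sum_mono)
    fix p
    have "real (card (B1 p \<union> B2 p)) \<le> real (card (B1 p) + card (B2 p))" by (intro of_nat_mono card_Un_le)
    then show "real (card (B1 p \<union> B2 p)) \<le> \<delta> * real n ^ ?m + (1 / n) * real n ^ ?m"
      using b1[of p] b2[of p] by simp
  qed
  also have "\<dots> = real k ^ 2 * (\<delta> + 1 / n) * real n ^ ?m"
    using k by (simp add: I_def card_cartesian_product power2_eq_square algebra_simps)
  finally have bad: "real (card (\<Union>p\<in>I \<times> I. B1 p \<union> B2 p)) \<le> real k ^ 2 * (\<delta> + 1 / n) * real n ^ ?m" .
  have sub: "(\<Union>p\<in>I \<times> I. B1 p \<union> B2 p) \<subseteq> \<Omega>" by (auto simp: B1_def B2_def)
  have "real (card \<Omega>) - real (card (\<Union>p\<in>I \<times> I. B1 p \<union> B2 p)) =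
      real (card (\<Omega> - (\<Union>p\<in>I \<times> I. B1 p \<union> B2 p)))"
    using sub f\<Omega> by (subst card_Diff_subset) (auto intro: finite_subset of_nat_diff[symmetric] card_mono)
  also have "\<dots> \<le> real (card ?R)"
    using good finite_embeddings[OF F G] by (intro of_nat_mono card_mono) auto
  finally show ?thesis using bad c\<Omega> by (simp add: I_def)
qed

text \<open>The convex function \<open>t ^ k\<close> lies above its tangent at \<mu>; this is
  Bernoulli's inequality after dividing by \<open>\<mu> ^ k\<close>.\<close>

lemma power_tangent:
  fixes a \<mu> :: real
  assumes "a \<ge> 0" "\<mu> > 0"
  shows "\<mu> ^ k + k * \<mu> ^ k * (a / \<mu> - 1) \<le> a ^ k"
proof -
  have "1 + real k * (a / \<mu> - 1) \<le> (1 + (a / \<mu> - 1)) ^ k"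
    using assms by (intro Bernoulli_inequality) auto
  then have "\<mu> ^ k * (1 + real k * (a / \<mu> - 1)) \<le> \<mu> ^ k * (a / \<mu>) ^ k"
    using assms by (intro mult_left_mono) auto
  then show ?thesis using assms by (simp add: power_divide algebra_simps)
qed

text \<open>The tangent inequality at \<mu> is summed; the linear parts add up to something
  nonnegative because the average of f is at least \<mu>. A power mean inequality for a lower bound
  on the average.\<close>

lemma sum_power_ge:
  fixes f :: "'a \<Rightarrow> real" and \<mu> :: real
  assumes "finite J" "\<And>j. j \<in> J \<Longrightarrow> f j \<ge> 0" "\<mu> \<ge> 0" "card J * \<mu> \<le> (\<Sum>j\<in>J. f j)"
  shows "card J * \<mu> ^ k \<le> (\<Sum>j\<in>J. f j ^ k)"
proof (cases "\<mu> = 0")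
  case True
  then show ?thesis
  proof (cases k)
    case (Suc m)
    then show ?thesis using True assms by (auto intro!: sum_nonneg)
  qed simp
next
  case False
  then have \<mu>: "\<mu> > 0" using assms by simp
  have "(\<Sum>j\<in>J. \<mu> ^ k + k * \<mu> ^ k * (f j / \<mu> - 1)) =
      card J * \<mu> ^ k + k * \<mu> ^ k * ((\<Sum>j\<in>J. f j) / \<mu> - card J)"
    by (simp add: sum.distrib sum_subtractf sum_divide_distrib flip: sum_distrib_left)
  moreover have "0 \<le> (\<Sum>j\<in>J. f j) / \<mu> - card J" using assms \<mu> by (simp add: field_simps)
  then have "0 \<le> k * \<mu> ^ k * ((\<Sum>j\<in>J. f j) / \<mu> - card J)" using \<mu> by simp
  moreover have "(\<Sum>j\<in>J. \<mu> ^ k + k * \<mu> ^ k * (f j / \<mu> - 1)) \<le> (\<Sum>j\<in>J. f j ^ k)"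
    using assms \<mu> by (intro sum_mono power_tangent) auto
  ultimately show ?thesis by linarith
qed

text \<open>Power mean inequality applied to the degrees \<open>d j\<close>: one coordinate of a
  dense relation can be replaced by a \<open>K\<close>-tuple at the price of raising the density to
  the power \<open>card K\<close>.\<close>

lemma blowup_count:
  fixes \<tau> :: real
  assumes fin: "finite I" "finite J" "finite K" and \<tau>: "\<tau> \<ge> 0"
    and P: "\<tau> * (card I * card J) \<le> card {(i, j) \<in> I \<times> J. P i j}"
  shows "\<tau> ^ card K * (card I ^ card K * card J)
    \<le> card {(f, j) \<in> (K \<rightarrow>\<^sub>E I) \<times> J. \<forall>a\<in>K. P (f a) j}"
proof -
  define d where "d j = card {i \<in> I. P i j}" for j
  have 1: "card {(i, j) \<in> I \<times> J. P i j} = (\<Sum>j\<in>J. d j)"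
  proof -
    have "{(i, j) \<in> I \<times> J. P i j} = prod.swap ` (SIGMA j:J. {i \<in> I. P i j})" by force
    then show ?thesis using fin by (simp add: card_image d_def)
  qed
  have 2: "card {(f, j) \<in> (K \<rightarrow>\<^sub>E I) \<times> J. \<forall>a\<in>K. P (f a) j} = (\<Sum>j\<in>J. d j ^ card K)"
  proof -
    have "{(f, j) \<in> (K \<rightarrow>\<^sub>E I) \<times> J. \<forall>a\<in>K. P (f a) j} = prod.swap ` (SIGMA j:J. K \<rightarrow>\<^sub>E {i \<in> I. P i j})"
      by (force simp: PiE_iff)
    then show ?thesis using fin by (simp add: card_image d_def card_PiE finite_PiE)
  qed
  have "real (card J) * (\<tau> * card I) ^ card K \<le> (\<Sum>j\<in>J. real (d j) ^ card K)"
    using fin \<tau> P unfolding 1 by (intro sum_power_ge) (auto simp: mult_ac of_nat_sum)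
  then show ?thesis unfolding 2 by (simp add: power_mult_distrib mult_ac)
qed

section \<open>Many triangles give many copies\<close>

definition triangles :: "'a sgraph \<Rightarrow> ('a \<times> 'a \<times> 'a) set" where
  "triangles G = {(a, b, c). {a, b} \<in> edges G \<and> {b, c} \<in> edges G \<and> {a, c} \<in> edges G}"

lemma triangles_subset: "simple_graph G \<Longrightarrow> triangles G \<subseteq> verts G \<times> verts G \<times> verts G"
  by (auto simp: triangles_def dest: simple_graph_edge)

lemma card_noninjective_le:
  assumes "finite I" "finite V"
  shows "real (card {f \<in> I \<rightarrow>\<^sub>E V. \<not> inj_on f I}) \<le> real (card I) ^ 2 * real (card V) ^ (card I - 1)"
proof -
  define B where "B p = {f \<in> I \<rightarrow>\<^sub>E V. fst p \<noteq> snd p \<and> f (fst p) = f (snd p)}" for p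
  have b: "card (B p) \<le> card V ^ (card I - 1)" if p: "p \<in> I \<times> I" for p
  proof (cases "fst p = snd p")
    case True
    then show ?thesis by (simp add: B_def)
  next
    case False
    have "card (B p) \<le> card V * card V ^ card (I - {fst p, snd p})"
    proof (rule card_functions_le[where h = "\<lambda>f. f (fst p)"])
      fix f assume "f \<in> B p"
      then have "f \<in> I \<rightarrow>\<^sub>E V" "fst p \<in> I" using p by (auto simp: B_def)
      then show "f (fst p) \<in> V" by (rule PiE_mem)
    next
      show "{fst p, snd p} \<subseteq> I" using p by auto
    next
      fix f f' v assume "f \<in> B p" "f' \<in> B p" "f (fst p) = f' (fst p)" "v \<in> {fst p, snd p}"
      then show "f v = f' v" by (auto simp: B_def)
    next
      fix f assume "f \<in> B p"
      then show "f \<in> I \<rightarrow>\<^sub>E V" by (simp add: B_def)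
    qed (use assms in simp_all)
    moreover have "card (I - {fst p, snd p}) = card I - 2"
      using p False assms by (subst card_Diff_subset) auto
    moreover have "card {fst p, snd p} \<le> card I" using p assms by (intro card_mono) auto
    then have "Suc (card I - 2) = card I - 1" using False by simp
    ultimately show ?thesis by (metis power_Suc)
  qed
  have "{f \<in> I \<rightarrow>\<^sub>E V. \<not> inj_on f I} \<subseteq> (\<Union>p\<in>I \<times> I. B p)"
    by (fastforce simp: B_def inj_on_def)
  then have "card {f \<in> I \<rightarrow>\<^sub>E V. \<not> inj_on f I} \<le> card (\<Union>p\<in>I \<times> I. B p)"
    using assms finite_PiE[of I "\<lambda>_. V"] by (intro card_mono finite_UN_I) (auto simp: B_def)
  also have "\<dots> \<le> (\<Sum>p\<in>I \<times> I. card (B p))" using assms by (intro card_UN_le) auto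
  also have "\<dots> \<le> (\<Sum>p\<in>I \<times> I. card V ^ (card I - 1))" using b by (rule sum_mono)
  finally have "card {f \<in> I \<rightarrow>\<^sub>E V. \<not> inj_on f I} \<le> (card I)\<^sup>2 * card V ^ (card I - 1)"
    by (simp add: card_cartesian_product power2_eq_square)
  from of_nat_mono[OF this, where 'a = real] show ?thesis by simp
qed

text \<open>Apply \<open>blowup_count\<close> to each coordinate of the triangle relation in turn.\<close>

lemma triangles_embeddings:
  fixes F :: "'a sgraph" and G :: "'b sgraph" and col :: "'a \<Rightarrow> nat" and \<tau> :: real
  assumes F: "simple_graph F" and G: "simple_graph G"
    and col: "\<And>a b. {a, b} \<in> edges F \<Longrightarrow> col a \<noteq> col b" "\<And>a. col a < 3"
    and n: "n = card (verts G)" and k: "k = card (verts F)"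
    and \<tau>: "\<tau> \<ge> 0" "\<tau> * real n ^ 3 \<le> card (triangles G)"
  shows "\<tau> ^ (k * k * k) * real n ^ k - real k ^ 2 * real n ^ (k - 1) \<le> card (embeddings F G)"
proof -
  define K where "K = verts F"
  define V where "V = verts G"
  define t where "t a b c \<longleftrightarrow> {a, b} \<in> edges G \<and> {b, c} \<in> edges G \<and> {a, c} \<in> edges G" for a b c
  have fK: "finite K" "finite V" using F G by (auto simp: simple_graph_def K_def V_def)
  have fKV: "finite (K \<rightarrow>\<^sub>E V)" using fK by (auto intro: finite_PiE)
  have cK: "card K = k" "card V = n" "card (K \<rightarrow>\<^sub>E V) = n ^ k"
    using fK k n by (auto simp: K_def V_def card_PiE)
  have "triangles G = {(a, j) \<in> V \<times> (V \<times> V). t a (fst j) (snd j)}"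
    using triangles_subset[OF G] by (auto simp: triangles_def t_def V_def)
  then have 1: "\<tau> * (card V * card (V \<times> V)) \<le> card {(a, j) \<in> V \<times> (V \<times> V). t a (fst j) (snd j)}"
    using \<tau> cK by (simp add: card_cartesian_product power3_eq_cube mult_ac)
  \<comment> \<open>The three blow-ups give in turn \<open>S1\<close>, \<open>S2\<close> and
    \<open>S3\<close>. Membership of (h, f, g) in \<open>S3\<close> says that \<open>f a\<close>,
    \<open>g b\<close>, \<open>h c\<close> form a triangle for all a, b, c in
    \<open>K\<close>.\<close>
  define S1 where "S1 = {(f, j) \<in> (K \<rightarrow>\<^sub>E V) \<times> (V \<times> V). \<forall>a\<in>K. t (f a) (fst j) (snd j)}"
  define P2 where "P2 b j \<longleftrightarrow> (\<forall>a\<in>K. t (fst j a) b (snd j))" for b j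
  define J2 where "J2 = (K \<rightarrow>\<^sub>E V) \<times> V"
  have 2: "\<tau> ^ k * (card V ^ k * card (V \<times> V)) \<le> card S1"
    using blowup_count[OF fK(2) _ fK(1) \<tau>(1) 1] fK unfolding S1_def cK(1) by simp
  have e2: "card S1 = card {(b, j) \<in> V \<times> J2. P2 b j}"
    by (rule bij_betw_same_card[of "\<lambda>(f, (b, c)). (b, (f, c))"],
        rule bij_betw_byWitness[where f' = "\<lambda>(b, (f, c)). (f, (b, c))"])
       (auto simp: S1_def J2_def P2_def)
  have 3: "\<tau> ^ k * (card V * card J2) \<le> card {(b, j) \<in> V \<times> J2. P2 b j}"
    using 2 unfolding e2 J2_def by (simp add: card_cartesian_product cK mult_ac)
  define S2 where "S2 = {(g, j) \<in> (K \<rightarrow>\<^sub>E V) \<times> J2. \<forall>b\<in>K. P2 (g b) j}"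
  have 4: "(\<tau> ^ k) ^ k * (card V ^ k * card J2) \<le> card S2"
    using blowup_count[OF fK(2) _ fK(1) _ 3] fK fKV \<tau>(1) unfolding S2_def cK(1) by (simp add: J2_def)
  define P3 where "P3 c j \<longleftrightarrow> (\<forall>a\<in>K. \<forall>b\<in>K. t (fst j a) (snd j b) c)" for c j
  define J3 where "J3 = (K \<rightarrow>\<^sub>E V) \<times> (K \<rightarrow>\<^sub>E V)"
  have e3: "card S2 = card {(c, j) \<in> V \<times> J3. P3 c j}"
    by (rule bij_betw_same_card[of "\<lambda>(g, (f, c)). (c, (f, g))"],
        rule bij_betw_byWitness[where f' = "\<lambda>(c, (f, g)). (g, (f, c))"])
       (auto simp: S2_def J2_def J3_def P2_def P3_def)
  have 5: "(\<tau> ^ k) ^ k * (card V * card J3) \<le> card {(c, j) \<in> V \<times> J3. P3 c j}"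
    using 4 unfolding e3 J2_def J3_def by (simp add: card_cartesian_product cK mult_ac)
  define S3 where "S3 = {(h, j) \<in> (K \<rightarrow>\<^sub>E V) \<times> J3. \<forall>c\<in>K. P3 (h c) j}"
  have 6: "((\<tau> ^ k) ^ k) ^ k * (card V ^ k * card J3) \<le> card S3"
    using blowup_count[OF fK(2) _ fK(1) _ 5] fK fKV \<tau>(1) unfolding S3_def cK(1) by (simp add: J3_def)
  define Hom where "Hom = {f \<in> K \<rightarrow>\<^sub>E V. \<forall>e\<in>edges F. f ` e \<in> edges G}"
  \<comment> \<open>The leading component picks f, g or h according to the colour and is a
    homomorphism. The other two store the remaining two values at each vertex, so \<open>m\<close>
    is injective and \<open>card S3\<close> is at most
    \<open>card Hom * n ^ (2 * k)\<close>.\<close>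
  define m :: "('a \<Rightarrow> 'b) \<times> ('a \<Rightarrow> 'b) \<times> ('a \<Rightarrow> 'b) \<Rightarrow> ('a \<Rightarrow> 'b) \<times> ('a \<Rightarrow> 'b) \<times> ('a \<Rightarrow> 'b)"
    where "m = (\<lambda>(h, f, g). (restrict (\<lambda>v. if col v = 0 then f v else if col v = 1 then g v else h v) K,
      restrict (\<lambda>v. if col v = 0 then g v else f v) K, restrict (\<lambda>v. if col v = 2 then g v else h v) K))"
  have minj: "inj_on m S3"
  proof (rule inj_onI, clarify)
    fix h f g h' f' g'
    assume a: "(h, f, g) \<in> S3" "(h', f', g') \<in> S3" "m (h, f, g) = m (h', f', g')"
    have "h v = h' v \<and> f v = f' v \<and> g v = g' v" if v: "v \<in> K" for v
    proof -
      have "col v = 0 \<or> col v = 1 \<or> col v = 2" using col(2)[of v] by linarith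
      moreover have "fst (m (h, f, g)) v = fst (m (h', f', g')) v"
        "fst (snd (m (h, f, g))) v = fst (snd (m (h', f', g'))) v"
        "snd (snd (m (h, f, g))) v = snd (snd (m (h', f', g'))) v" using a by auto
      ultimately show ?thesis using v by (auto simp: m_def)
    qed
    moreover have "h \<in> K \<rightarrow>\<^sub>E V" "h' \<in> K \<rightarrow>\<^sub>E V" "f \<in> K \<rightarrow>\<^sub>E V" "f' \<in> K \<rightarrow>\<^sub>E V" "g \<in> K \<rightarrow>\<^sub>E V" "g' \<in> K \<rightarrow>\<^sub>E V"
      using a by (auto simp: S3_def J3_def)
    ultimately have "h = h'" "f = f'" "g = g'" by (auto intro: PiE_ext)
    then show "h = h' \<and> (f, g) = (f', g')" by simp
  qed
  have mto: "m ` S3 \<subseteq> Hom \<times> ((K \<rightarrow>\<^sub>E V) \<times> (K \<rightarrow>\<^sub>E V))"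
  proof (rule image_subsetI)
    fix j assume "j \<in> S3"
    then obtain h f g where j: "j = (h, f, g)" and a: "(h, f, g) \<in> S3" by (cases j) auto
    then have hV: "\<And>v. v \<in> K \<Longrightarrow> h v \<in> V" "\<And>v. v \<in> K \<Longrightarrow> f v \<in> V" "\<And>v. v \<in> K \<Longrightarrow> g v \<in> V"
      by (auto simp: S3_def J3_def PiE_def Pi_def)
    have tt: "t (f a) (g b) (h c)" if "a \<in> K" "b \<in> K" "c \<in> K" for a b c
      using a that by (auto simp: S3_def P3_def)
    let ?\<phi> = "fst (m (h, f, g))"
    have "?\<phi> ` e \<in> edges G" if e: "e \<in> edges F" for e
    proof -
      obtain a b where ab: "e = {a, b}" "a \<in> K" "b \<in> K" using simple_graph_edgeE[OF F e] K_def by metis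
      have "col a = 0 \<or> col a = 1 \<or> col a = 2" "col b = 0 \<or> col b = 1 \<or> col b = 2"
        using col(2)[of a] col(2)[of b] by linarith+
      moreover have "col a \<noteq> col b" using col(1) e ab by simp
      ultimately show ?thesis
        using tt[of a b a] tt[of b a a] tt[of a a b] tt[of b b a] tt[of a b b] tt[of b a b] ab
        by (auto simp: m_def t_def insert_commute)
    qed
    then show "m j \<in> Hom \<times> ((K \<rightarrow>\<^sub>E V) \<times> (K \<rightarrow>\<^sub>E V))"
      using hV by (auto simp: m_def Hom_def j)
  qed
  have fH: "finite Hom" using fKV by (auto simp: Hom_def)
  have "card S3 = card (m ` S3)" using minj by (simp add: card_image)
  also have "\<dots> \<le> card (Hom \<times> ((K \<rightarrow>\<^sub>E V) \<times> (K \<rightarrow>\<^sub>E V)))"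
    using mto fH fKV by (intro card_mono) auto
  also have "\<dots> = card Hom * (n ^ k * n ^ k)" by (simp add: card_cartesian_product cK)
  finally have 7: "real (card S3) \<le> real (card Hom) * (real n ^ k * real n ^ k)"
    by (metis of_nat_le_iff of_nat_mult of_nat_power)
  have 8: "\<tau> ^ (k * k * k) * real n ^ k \<le> card Hom"
  proof (cases "real n ^ k = 0")
    case True
    then show ?thesis by (metis mult_zero_right of_nat_0_le_iff)
  next
    case False
    have "\<tau> ^ (k * k * k) * real n ^ k * (real n ^ k * real n ^ k) \<le> real (card Hom) * (real n ^ k * real n ^ k)"
      using 6 7 by (simp add: power_mult J3_def card_cartesian_product cK mult_ac)
    then show ?thesis using False
      by (metis mult_right_le_imp_le mult_pos_pos of_nat_0_le_iff zero_le_power order_le_less)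
  qed
  have "Hom \<subseteq> embeddings F G \<union> {f \<in> K \<rightarrow>\<^sub>E V. \<not> inj_on f K}"
    by (auto simp: Hom_def embeddings_def K_def V_def)
  then have "card Hom \<le> card (embeddings F G \<union> {f \<in> K \<rightarrow>\<^sub>E V. \<not> inj_on f K})"
    using fKV finite_embeddings[OF F G] by (intro card_mono) auto
  also have "\<dots> \<le> card (embeddings F G) + card {f \<in> K \<rightarrow>\<^sub>E V. \<not> inj_on f K}"
    by (rule card_Un_le)
  finally show ?thesis
    using 8 card_noninjective_le[OF fK] unfolding cK by linarith
qed

section \<open>Edge accounting for a cut\<close>

definition bad_edges :: "'a sgraph \<Rightarrow> 'a set \<Rightarrow> 'a set \<Rightarrow> 'a set set" where
  "bad_edges G A B = {e \<in> edges G. e \<subseteq> A \<or> e \<subseteq> B}"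

text \<open>Pairs directed from \<open>A\<close> to \<open>B\<close> rather than edges: for disjoint
  sides each missing cross edge occurs once, and sums over one side can be read off
  directly.\<close>

definition missing :: "'a sgraph \<Rightarrow> 'a set \<Rightarrow> 'a set \<Rightarrow> ('a \<times> 'a) set" where
  "missing G A B = {(a, b) \<in> A \<times> B. {a, b} \<notin> edges G}"

definition nbrs :: "'a sgraph \<Rightarrow> 'a \<Rightarrow> 'a set" where
  "nbrs G v = {w. {v, w} \<in> edges G}"

lemma nbrs_subset: "simple_graph G \<Longrightarrow> nbrs G v \<subseteq> verts G"
  by (auto simp: nbrs_def dest: simple_graph_edge)

lemma finite_nbrs: "simple_graph G \<Longrightarrow> finite (nbrs G v)"
  using nbrs_subset[of G v] finite_subset by (auto simp: simple_graph_def)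

lemma card_ordered_edges:
  assumes G: "simple_graph G" and E: "E \<subseteq> edges G"
  shows "card {(a, b). {a, b} \<in> E} = 2 * card E"
proof -
  have fE: "finite E" using finite_edges[OF G] E finite_subset by blast
  have "{(a, b). {a, b} \<in> E} = (\<Union>e\<in>E. {(a, b). {a, b} = e})" by auto
  then have "card {(a, b). {a, b} \<in> E} = card (\<Union>e\<in>E. {(a, b). {a, b} = e})" by simp
  also have "\<dots> = (\<Sum>e\<in>E. card {(a, b). {a, b} = e})"
  proof (rule card_UN_disjoint[OF fE])
    show "\<forall>e\<in>E. finite {(a, b). {a, b} = e}"
    proof
      fix e assume "e \<in> E"
      then have "finite e" using E G by (auto simp: simple_graph_def nsets_def)
      then show "finite {(a, b). {a, b} = e}" by (intro finite_subset[OF _ finite_cartesian_product[of e e]]) auto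
    qed
  qed auto
  also have "\<dots> = (\<Sum>e\<in>E. 2)"
  proof (rule sum.cong)
    fix e assume "e \<in> E"
    then obtain a b where ab: "e = {a, b}" "a \<noteq> b" using simple_graph_edgeE[OF G] E by blast
    then have "{(x, y). {x, y} = e} = {(a, b), (b, a)}" by (auto simp: doubleton_eq_iff)
    then show "card {(x, y). {x, y} = e} = 2" using ab by simp
  qed simp
  finally show ?thesis by simp
qed

lemma card_edges_partition:
  assumes G: "simple_graph G" and AB: "A \<union> B = verts G" "A \<inter> B = {}"
  shows "card (edges G) + card (missing G A B) = card A * card B + card (bad_edges G A B)"
proof -
  have fV: "finite A" "finite B" using G AB by (auto simp: simple_graph_def intro: finite_subset)
  define C where "C = {(a, b) \<in> A \<times> B. {a, b} \<in> edges G}"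
  have "card (A \<times> B) = card C + card (missing G A B)"
  proof -
    have "A \<times> B = C \<union> missing G A B" by (auto simp: C_def missing_def)
    moreover have "C \<inter> missing G A B = {}" by (auto simp: C_def missing_def)
    moreover have "finite C" "finite (missing G A B)"
      using fV by (auto simp: C_def missing_def intro: finite_subset[of _ "A \<times> B"])
    ultimately show ?thesis by (simp add: card_Un_disjoint)
  qed
  moreover have "card (edges G) = card C + card (bad_edges G A B)"
  proof -
    let ?h = "\<lambda>(a, b). {a, b}"
    have inj: "inj_on ?h C" using AB by (auto simp: inj_on_def C_def doubleton_eq_iff)
    have "edges G = ?h ` C \<union> bad_edges G A B"
    proof
      show "edges G \<subseteq> ?h ` C \<union> bad_edges G A B"
      proof
        fix e assume e: "e \<in> edges G"
        then obtain a b where ab: "e = {a, b}" "a \<in> verts G" "b \<in> verts G" using simple_graph_edgeE[OF G] by metis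
        then consider "a \<in> A" "b \<in> B" | "a \<in> B" "b \<in> A" | "a \<in> A" "b \<in> A" | "a \<in> B" "b \<in> B" using AB by blast
        then show "e \<in> ?h ` C \<union> bad_edges G A B"
        proof cases
          case 1 then show ?thesis using e ab by (auto simp: C_def)
        next
          case 2
          then have "(b, a) \<in> C" using e ab by (simp add: C_def insert_commute)
          then have "?h (b, a) \<in> ?h ` C" by (rule imageI)
          then show ?thesis using ab by (simp add: insert_commute)
        next
          case 3 then show ?thesis using e ab by (simp add: bad_edges_def)
        next
          case 4 then show ?thesis using e ab by (simp add: bad_edges_def)
        qed
      qed
    qed (auto simp: C_def bad_edges_def)
    moreover have "?h ` C \<inter> bad_edges G A B = {}" using AB by (auto simp: C_def bad_edges_def)
    moreover have "finite (?h ` C)" "finite (bad_edges G A B)"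
      using finite_edges[OF G] fV by (auto simp: C_def bad_edges_def intro: finite_subset[of _ "A \<times> B"])
    ultimately have "card (edges G) = card (?h ` C) + card (bad_edges G A B)" by (simp add: card_Un_disjoint)
    then show ?thesis by (simp add: card_image[OF inj])
  qed
  ultimately show ?thesis using fV by (simp add: card_cartesian_product)
qed

section \<open>Almost bipartite graphs\<close>

text \<open>If \<open>ab\<close> is an edge with \<open>d(a) + d(b)\<close> close to \<open>n\<close> lying in few triangles, and \<open>a\<close>, \<open>b\<close> lie in
  few triangles, then the neighbourhood of \<open>a\<close> is one side of an almost bipartition. Such an edge
  is found by averaging.\<close>

lemma near_bipartite:
  fixes G :: "'a sgraph" and \<tau> :: real
  assumes G: "simple_graph G" and n: "n = card (verts G)" "n > 0" and \<tau>: "0 \<le> \<tau>" "\<tau> \<le> 1 / 8"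
    and e: "(1 / 4 - \<tau>) * real n ^ 2 \<le> card (edges G)"
    and tri: "card (triangles G) \<le> \<tau> * real n ^ 3"
  shows "\<exists>A\<subseteq>verts G. card (bad_edges G A (verts G - A)) \<le> 60 * \<tau> * real n ^ 2"
proof -
  define V where "V = verts G"
  define N where "N = nbrs G"
  define d where "d a = real (card (N a))" for a
  define cd where "cd a b = real (card (N a \<inter> N b))" for a b
  define t where "t a = (\<Sum>b\<in>N a. cd a b)" for a
  have fV: "finite V" using G by (simp add: V_def simple_graph_def)
  have NV: "N a \<subseteq> V" for a using nbrs_subset[OF G] by (simp add: N_def V_def)
  have fN: "finite (N a)" for a using finite_nbrs[OF G] by (simp add: N_def)
  define S where "S = Sigma V N"
  have fS: "finite S" using fV fN by (simp add: S_def)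
  have Sdef2: "S = {(a, b). {a, b} \<in> edges G}"
    using simple_graph_edge[OF G] by (auto simp: S_def N_def nbrs_def V_def)
  have cS: "card S = 2 * card (edges G)"
    unfolding Sdef2 by (rule card_ordered_edges[OF G]) simp
  have symS: "(\<Sum>(a, b)\<in>S. g b) = (\<Sum>(a, b)\<in>S. g a)" for g :: "'a \<Rightarrow> real"
    by (rule sum.reindex_bij_witness[where i = prod.swap and j = prod.swap])
       (auto simp: Sdef2 insert_commute)
  have sS: "(\<Sum>(a, b)\<in>S. g a) = (\<Sum>a\<in>V. d a * g a)" for g :: "'a \<Rightarrow> real"
    using fV fN by (simp add: S_def d_def sum.Sigma[symmetric])
  have tri_eq: "triangles G = (SIGMA a:V. SIGMA b:N a. N a \<inter> N b)"
    using simple_graph_edge[OF G] by (auto simp: triangles_def N_def nbrs_def V_def)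
  have trit: "real (card (triangles G)) = (\<Sum>a\<in>V. t a)"
    unfolding tri_eq t_def cd_def using fV fN by (simp add: card_SigmaI)
  have trcd: "(\<Sum>(a, b)\<in>S. cd a b) = (\<Sum>a\<in>V. t a)"
    using fV fN by (simp add: S_def t_def sum.Sigma[symmetric])
  have dsum: "(\<Sum>a\<in>V. d a) = 2 * card (edges G)"
  proof -
    have "real (card S) = (\<Sum>a\<in>V. d a)" using fV fN by (simp add: S_def d_def)
    then show ?thesis using cS by simp
  qed
  have t0: "t a \<ge> 0" for a by (simp add: t_def cd_def sum_nonneg)
  have dn: "d a \<le> n" for a
    using card_mono[OF fV NV[of a]] by (simp add: d_def n V_def)
  have cV: "card V = n" by (simp add: n V_def)
  let ?e = "real (card (edges G))" and ?T = "real (card (triangles G))"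
  have e8: "real n ^ 2 / 8 \<le> ?e"
  proof -
    have "(1 / 8) * real n ^ 2 \<le> (1 / 4 - \<tau>) * real n ^ 2" using \<tau> by (intro mult_right_mono) auto
    then show ?thesis using e by linarith
  qed
  then have epos: "?e > 0" using n by (smt (verit) zero_less_divide_iff zero_less_power of_nat_0_less_iff)
  \<comment> \<open>Cauchy-Schwarz for the degree sequence.\<close>
  have sq: "n * (2 * ?e / n) ^ 2 \<le> (\<Sum>a\<in>V. d a ^ 2)"
    using sum_power_ge[of V d "2 * ?e / n" 2] fV dsum n cV by (simp add: d_def)
  \<comment> \<open>One \<open>cd a b\<close> turns \<open>d a + d b\<close> into the size of the
    union of the two neighbourhoods, which is at most n. Everything else is a penalty, so a value
    close to n makes the union almost everything and both \<open>t a\<close> and \<open>t b\<close>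
    small.\<close>
  define \<phi> where "\<phi> a b = d a + d b - 2 * cd a b - (t a + t b) / n" for a b
  have "(\<Sum>(a, b)\<in>S. \<phi> a b) = (\<Sum>(a, b)\<in>S. d a) + (\<Sum>(a, b)\<in>S. d b) - 2 * (\<Sum>(a, b)\<in>S. cd a b)
      - ((\<Sum>(a, b)\<in>S. t a) + (\<Sum>(a, b)\<in>S. t b)) / n"
    by (simp add: \<phi>_def case_prod_beta sum.distrib sum_subtractf sum_distrib_left flip: sum_divide_distrib)
  also have "\<dots> = 2 * (\<Sum>a\<in>V. d a ^ 2) - 2 * ?T - 2 * (\<Sum>a\<in>V. d a * t a) / n"
    unfolding symS sS trcd trit by (simp add: power2_eq_square)
  also have "\<dots> \<ge> 2 * (n * (2 * ?e / n) ^ 2) - 4 * ?T"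
  proof -
    have "(\<Sum>a\<in>V. d a * t a) \<le> (\<Sum>a\<in>V. n * t a)"
      using dn t0 by (intro sum_mono mult_right_mono) auto
    also have "\<dots> = n * ?T" by (simp add: trit sum_distrib_left)
    finally have "(\<Sum>a\<in>V. d a * t a) / n \<le> ?T" using n by (simp add: field_simps)
    then show ?thesis using sq by linarith
  qed
  finally have tot: "2 * (n * (2 * ?e / n) ^ 2) - 4 * ?T \<le> (\<Sum>(a, b)\<in>S. \<phi> a b)" .
  \<comment> \<open>The 20 is 4 + 16: \<open>4 * \<tau>\<close> is lost because the average degree
    is only about n / 2, and \<open>16 * \<tau>\<close> pays for the triangles, using that there are
    at least \<open>n ^ 2 / 8\<close> edges.\<close>
  have main: "(2 * ?e) * (n - 20 * \<tau> * n) \<le> 2 * (n * (2 * ?e / n) ^ 2) - 4 * ?T"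
  proof -
    have "2 * (n * (2 * ?e / n) ^ 2) = (2 * ?e) * (4 * ?e / n)"
      using n by (simp add: power2_eq_square field_simps)
    moreover have "n - 4 * \<tau> * n \<le> 4 * ?e / n"
      using e n by (simp add: field_simps power2_eq_square)
    then have "(2 * ?e) * (n - 4 * \<tau> * n) \<le> (2 * ?e) * (4 * ?e / n)" by (intro mult_left_mono) auto
    moreover have "4 * ?T \<le> (2 * ?e) * (16 * \<tau> * n)"
    proof -
      have "4 * (\<tau> * real n ^ 3) = (2 * (real n ^ 2 / 8)) * (16 * \<tau> * n)"
        by (simp add: power2_eq_square power3_eq_cube)
      also have "\<dots> \<le> (2 * ?e) * (16 * \<tau> * n)" using e8 \<tau> by (intro mult_right_mono) auto
      finally show ?thesis using tri by linarith
    qed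
    ultimately show ?thesis by (simp add: algebra_simps)
  qed
  have "\<exists>(a, b)\<in>S. n - 20 * \<tau> * n \<le> \<phi> a b"
  proof (rule ccontr)
    assume "\<not> ?thesis"
    then have lt: "(case p of (a, b) \<Rightarrow> \<phi> a b) < n - 20 * \<tau> * n" if "p \<in> S" for p
      using that by fastforce
    have "S \<noteq> {}" using cS epos by auto
    then have "(\<Sum>(a, b)\<in>S. \<phi> a b) < (\<Sum>p\<in>S. n - 20 * \<tau> * n)"
      by (intro sum_strict_mono fS lt)
    also have "\<dots> = (2 * ?e) * (n - 20 * \<tau> * n)" using cS by simp
    finally show False using main tot by linarith
  qed
  then obtain a b where ab: "(a, b) \<in> S" "n - 20 * \<tau> * n \<le> \<phi> a b" by auto
  have un: "d a + d b - cd a b = card (N a \<union> N b)"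
    using card_Un_Int[OF fN fN, of a b] by (simp add: d_def cd_def flip: of_nat_add)
  have unn: "card (N a \<union> N b) \<le> n" using card_mono[OF fV, of "N a \<union> N b"] NV by (simp add: cV)
  have cd0: "cd a b \<ge> 0" by (simp add: cd_def)
  have unl: "n - 20 * \<tau> * n \<le> real (card (N a \<union> N b))"
    using ab(2) un cd0 t0[of a] t0[of b] n(2) unfolding \<phi>_def
    by (smt (verit) divide_nonneg_nonneg of_nat_0_le_iff)
  have "(t a + t b) / n \<le> 20 * \<tau> * n"
    using ab(2) un cd0 unn unfolding \<phi>_def by linarith
  then have tab: "t a + t b \<le> 20 * \<tau> * real n ^ 2"
    using n by (simp add: field_simps power2_eq_square)
  have inN: "2 * real (card {e \<in> edges G. e \<subseteq> N c}) = t c" for c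
  proof -
    have "2 * card {e \<in> edges G. e \<subseteq> N c} = card {(x, y). {x, y} \<in> {e \<in> edges G. e \<subseteq> N c}}"
      by (rule card_ordered_edges[OF G, symmetric]) auto
    also have "{(x, y). {x, y} \<in> {e \<in> edges G. e \<subseteq> N c}} = (SIGMA b:N c. N c \<inter> N b)"
      by (auto simp: N_def nbrs_def)
    finally have "2 * card {e \<in> edges G. e \<subseteq> N c} = (\<Sum>b\<in>N c. card (N c \<inter> N b))"
      using fN by simp
    then have "real (2 * card {e \<in> edges G. e \<subseteq> N c}) = real (\<Sum>b\<in>N c. card (N c \<inter> N b))" by simp
    then show ?thesis by (simp add: t_def cd_def)
  qed
  \<comment> \<open>An inner edge of the cut lies in \<open>N a\<close>, lies in \<open>N b\<close>,
    or meets the small set \<open>R\<close> outside both neighbourhoods. The edges inside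
    \<open>N c\<close> number half of \<open>t c\<close>.\<close>
  define A where "A = N a"
  define R where "R = V - (N a \<union> N b)"
  have cR: "real (card R) \<le> 20 * \<tau> * n"
    using unl NV fV fN cV card_mono[OF fV, of "N a \<union> N b"]
    by (simp add: R_def card_Diff_subset of_nat_diff)
  have "bad_edges G A (V - A) \<subseteq> {e \<in> edges G. e \<subseteq> N a} \<union> {e \<in> edges G. e \<subseteq> N b} \<union> (\<lambda>(x, y). {x, y}) ` (R \<times> V)"
  proof
    fix e assume e: "e \<in> bad_edges G A (V - A)"
    then have eG: "e \<in> edges G" by (simp add: bad_edges_def)
    obtain x y where xy: "e = {x, y}" "x \<in> V" "y \<in> V" using simple_graph_edgeE[OF G eG] V_def by metis
    consider "e \<subseteq> N a" | "e \<subseteq> N b" | "x \<in> R" | "y \<in> R"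
      using e xy by (auto simp: bad_edges_def A_def R_def)
    then show "e \<in> {e \<in> edges G. e \<subseteq> N a} \<union> {e \<in> edges G. e \<subseteq> N b} \<union> (\<lambda>(x, y). {x, y}) ` (R \<times> V)"
    proof cases
      case 1 then show ?thesis using eG by simp
    next
      case 2 then show ?thesis using eG by simp
    next
      case 3
      then have "(x, y) \<in> R \<times> V" using xy by simp
      then have "(\<lambda>(x, y). {x, y}) (x, y) \<in> (\<lambda>(x, y). {x, y}) ` (R \<times> V)" by (rule imageI)
      then show ?thesis by (simp add: xy(1))
    next
      case 4
      then have "(y, x) \<in> R \<times> V" using xy by simp
      then have "(\<lambda>(x, y). {x, y}) (y, x) \<in> (\<lambda>(x, y). {x, y}) ` (R \<times> V)" by (rule imageI)
      then show ?thesis by (simp add: xy(1) insert_commute)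
    qed
  qed
  then have "card (bad_edges G A (V - A)) \<le>
      card ({e \<in> edges G. e \<subseteq> N a} \<union> {e \<in> edges G. e \<subseteq> N b} \<union> (\<lambda>(x, y). {x, y}) ` (R \<times> V))"
    using finite_edges[OF G] fV by (intro card_mono) (auto simp: R_def)
  also have "\<dots> \<le> card {e \<in> edges G. e \<subseteq> N a} + card {e \<in> edges G. e \<subseteq> N b} + card R * n"
  proof -
    have "card ((\<lambda>(x, y). {x, y}) ` (R \<times> V)) \<le> card (R \<times> V)"
      using fV by (intro card_image_le) (auto simp: R_def)
    then have "card ((\<lambda>(x, y). {x, y}) ` (R \<times> V)) \<le> card R * n" by (simp add: card_cartesian_product cV)
    then show ?thesis using card_Un_le[of "{e \<in> edges G. e \<subseteq> N a} \<union> {e \<in> edges G. e \<subseteq> N b}"]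
        card_Un_le[of "{e \<in> edges G. e \<subseteq> N a}" "{e \<in> edges G. e \<subseteq> N b}"] by (meson add_mono order_trans)
  qed
  finally have "real (card (bad_edges G A (V - A))) \<le>
      real (card {e \<in> edges G. e \<subseteq> N a}) + real (card {e \<in> edges G. e \<subseteq> N b}) + real (card R) * n"
    by (simp flip: of_nat_add of_nat_mult)
  also have "real (card R) * n \<le> 20 * \<tau> * n * n" using cR by (intro mult_right_mono) auto
  finally have "real (card (bad_edges G A (V - A))) \<le> 60 * \<tau> * real n ^ 2"
    using inN[of a] inN[of b] tab \<tau> t0[of a] t0[of b]
    by (simp add: power2_eq_square algebra_simps)
  then show ?thesis using NV unfolding A_def V_def by blast
qed

lemma bad_edges_commute: "bad_edges G A B = bad_edges G B A"
  by (auto simp: bad_edges_def)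

lemma finite_bad_edges: "simple_graph G \<Longrightarrow> finite (bad_edges G A B)"
  using finite_edges[of G] by (simp add: bad_edges_def)

lemma card_edges_at_le:
  assumes G: "simple_graph G" and E: "E \<subseteq> edges G" and w: "\<And>e. e \<in> E \<Longrightarrow> w \<in> e \<and> e \<subseteq> A"
  shows "card E \<le> card (nbrs G w \<inter> A)"
proof -
  have "E \<subseteq> (\<lambda>v. {w, v}) ` (nbrs G w \<inter> A)"
  proof
    fix e assume e: "e \<in> E"
    then obtain a b where ab: "e = {a, b}" using simple_graph_edgeE[OF G] E by blast
    then have "w = a \<or> w = b" "a \<in> A" "b \<in> A" "{a, b} \<in> edges G" using w[OF e] E e by auto
    then have "\<exists>v. e = {w, v} \<and> v \<in> nbrs G w \<inter> A"
      using ab by (auto simp: nbrs_def insert_commute)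
    then show "e \<in> (\<lambda>v. {w, v}) ` (nbrs G w \<inter> A)" by auto
  qed
  then have "card E \<le> card ((\<lambda>v. {w, v}) ` (nbrs G w \<inter> A))"
    using finite_nbrs[OF G] by (intro card_mono) auto
  also have "\<dots> \<le> card (nbrs G w \<inter> A)" using finite_nbrs[OF G] by (intro card_image_le) auto
  finally show ?thesis .
qed

lemma card_bad_edges_remove:
  assumes G: "simple_graph G" and w: "w \<in> A" "w \<notin> B"
  shows "card (bad_edges G A B) = card (bad_edges G (A - {w}) B) + card (nbrs G w \<inter> A)"
proof -
  let ?h = "\<lambda>v. {w, v}"
  have "bad_edges G A B = bad_edges G (A - {w}) B \<union> ?h ` (nbrs G w \<inter> A)"
  proof
    show "bad_edges G A B \<subseteq> bad_edges G (A - {w}) B \<union> ?h ` (nbrs G w \<inter> A)"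
    proof
      fix e assume e: "e \<in> bad_edges G A B"
      then have eG: "e \<in> edges G" by (simp add: bad_edges_def)
      then obtain a b where ab: "e = {a, b}" "e \<in> edges G" using simple_graph_edgeE[OF G] by metis
      show "e \<in> bad_edges G (A - {w}) B \<union> ?h ` (nbrs G w \<inter> A)"
      proof (cases "w \<in> e")
        case True
        then have "e \<subseteq> A" using e w by (auto simp: bad_edges_def)
        then have "\<exists>v. e = {w, v} \<and> v \<in> nbrs G w \<inter> A"
          using True ab by (auto simp: nbrs_def insert_commute)
        then show ?thesis by auto
      qed (use e in \<open>auto simp: bad_edges_def\<close>)
    qed
    show "bad_edges G (A - {w}) B \<union> ?h ` (nbrs G w \<inter> A) \<subseteq> bad_edges G A B"
      using w by (auto simp: bad_edges_def nbrs_def)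
  qed
  moreover have "bad_edges G (A - {w}) B \<inter> ?h ` (nbrs G w \<inter> A) = {}"
    using w by (auto simp: bad_edges_def)
  moreover have "card (?h ` (nbrs G w \<inter> A)) = card (nbrs G w \<inter> A)"
    by (rule card_image) (auto simp: inj_on_def doubleton_eq_iff)
  ultimately show ?thesis
    using finite_bad_edges[OF G] finite_nbrs[OF G] by (simp add: card_Un_disjoint)
qed

text \<open>The cut has the fewest inner edges among all cuts. Moving w to the other side exchanges
  its inner degree for its outer degree, so the inner one cannot be larger.\<close>

lemma max_cut:
  assumes G: "simple_graph G" and A0: "A0 \<subseteq> verts G"
  obtains A where "A \<subseteq> verts G"
    "card (bad_edges G A (verts G - A)) \<le> card (bad_edges G A0 (verts G - A0))"
    "\<And>w. w \<in> A \<Longrightarrow> card (nbrs G w \<inter> A) \<le> card (nbrs G w \<inter> (verts G - A))"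
    "\<And>w. w \<in> verts G - A \<Longrightarrow> card (nbrs G w \<inter> (verts G - A)) \<le> card (nbrs G w \<inter> A)"
proof -
  define V where "V = verts G"
  define b where "b A = card (bad_edges G A (V - A))" for A
  obtain A where A: "A \<subseteq> V" "\<And>A'. A' \<subseteq> V \<Longrightarrow> b A \<le> b A'"
    using ex_has_least_nat[of "\<lambda>A. A \<subseteq> V" A0 b] A0 V_def by auto
  have move: "card (nbrs G w \<inter> C) \<le> card (nbrs G w \<inter> D)"
    if w: "w \<in> C" "C \<inter> D = {}" and
      le: "card (bad_edges G C D) \<le> card (bad_edges G (C - {w}) (insert w D))" for C D w
  proof -
    have wn: "w \<notin> nbrs G w" using simple_graph_edge(3)[OF G, of w w] by (auto simp: nbrs_def)
    have wD: "w \<notin> D" using w by auto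
    have "card (bad_edges G (insert w D) (C - {w})) =
        card (bad_edges G (insert w D - {w}) (C - {w})) + card (nbrs G w \<inter> insert w D)"
      by (rule card_bad_edges_remove[OF G]) auto
    moreover have "insert w D - {w} = D" using wD by auto
    moreover have "nbrs G w \<inter> insert w D = nbrs G w \<inter> D" using wn by auto
    ultimately show ?thesis
      using le card_bad_edges_remove[OF G w(1) wD] by (simp add: bad_edges_commute)
  qed
  show ?thesis
  proof (rule that[of A])
    show "A \<subseteq> verts G" using A V_def by simp
    show "card (bad_edges G A (verts G - A)) \<le> card (bad_edges G A0 (verts G - A0))"
      using A(2)[of A0] A0 by (simp add: b_def V_def)
  next
    fix w assume w: "w \<in> A"
    have "V - (A - {w}) = insert w (V - A)" using w A by auto
    then show "card (nbrs G w \<inter> A) \<le> card (nbrs G w \<inter> (verts G - A))"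
      using A(2)[of "A - {w}"] A(1) w by (intro move) (auto simp: b_def V_def)
  next
    fix w assume w: "w \<in> verts G - A"
    have "V - insert w A = V - A - {w}" by auto
    then show "card (nbrs G w \<inter> (verts G - A)) \<le> card (nbrs G w \<inter> A)"
      using A(2)[of "insert w A"] A(1) w by (intro move) (auto simp: b_def V_def bad_edges_commute)
  qed
qed

text \<open>At most \<open>2 * D\<close> edges meet a given edge, \<open>D\<close> at each end, and
  the edge itself is among them.\<close>

lemma disjoint_pairs_count:
  fixes D :: real
  assumes fin: "finite E" and E: "\<And>e. e \<in> E \<Longrightarrow> \<exists>a b. e = {a, b}"
    and D: "\<And>w. card {e \<in> E. w \<in> e} \<le> D"
  shows "card E * (card E - 2 * D) \<le> card {(e, e') \<in> E \<times> E. e \<inter> e' = {}}"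
proof -
  have *: "card E - 2 * D \<le> card {e' \<in> E. e \<inter> e' = {}}" if e: "e \<in> E" for e
  proof -
    obtain a b where ab: "e = {a, b}" using E e by blast
    have "E \<subseteq> {e' \<in> E. e \<inter> e' = {}} \<union> {e' \<in> E. a \<in> e'} \<union> {e' \<in> E. b \<in> e'}" using ab by auto
    then have "card E \<le> card ({e' \<in> E. e \<inter> e' = {}} \<union> {e' \<in> E. a \<in> e'} \<union> {e' \<in> E. b \<in> e'})"
      using fin by (intro card_mono) auto
    also have "\<dots> \<le> card {e' \<in> E. e \<inter> e' = {}} + card {e' \<in> E. a \<in> e'} + card {e' \<in> E. b \<in> e'}"
      by (meson add_mono card_Un_le order_refl order_trans)
    finally show ?thesis using D[of a] D[of b] by linarith
  qed
  have "{(e, e') \<in> E \<times> E. e \<inter> e' = {}} = (SIGMA e:E. {e' \<in> E. e \<inter> e' = {}})" by auto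
  then have "real (card {(e, e') \<in> E \<times> E. e \<inter> e' = {}}) = (\<Sum>e\<in>E. real (card {e' \<in> E. e \<inter> e' = {}}))"
    using fin by simp
  also have "\<dots> \<ge> (\<Sum>e\<in>E. card E - 2 * D)" using * by (intro sum_mono) auto
  finally show ?thesis by simp
qed

section \<open>Templates and their copies\<close>

text \<open>A type \<open>(x, z, u, C)\<close> describes how \<open>F\<close> sits in an apex vertex joined to a complete bipartite
  graph plus one extra edge: \<open>x\<close> is mapped to the apex, \<open>zu\<close> to the extra edge, and \<open>C\<close> to the side
  containing that edge.\<close>

definition types :: "'a sgraph \<Rightarrow> ('a \<times> 'a \<times> 'a \<times> 'a set) set" where
  "types F = {(x, z, u, C). x \<in> verts F \<and> C \<subseteq> verts F - {x} \<and> z \<in> C \<and> u \<in> C \<and> {z, u} \<in> edges F \<and>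
     (\<forall>a b. {a, b} \<in> edges F \<longrightarrow> a \<noteq> x \<longrightarrow> b \<noteq> x \<longrightarrow> {a, b} \<noteq> {z, u} \<longrightarrow> (a \<in> C) \<noteq> (b \<in> C))}"

text \<open>Copies of these types survive deletion of the edge from the apex to the image of
  \<open>z\<close>. For s \<ge> 2 this is no restriction; for s = 1 the types left out are what
  makes the deletion pay.\<close>

definition types1 :: "'a sgraph \<Rightarrow> ('a \<times> 'a \<times> 'a \<times> 'a set) set" where
  "types1 F = {(x, z, u, C) \<in> types F. {x, z} \<notin> edges F}"

text \<open>Copies of these types use no edge between the apex and the extra edge, so they are
  guaranteed even where the apex is not joined to everything.\<close>

definition types2 :: "'a sgraph \<Rightarrow> ('a \<times> 'a \<times> 'a \<times> 'a set) set" where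
  "types2 F = {(x, z, u, C) \<in> types F. {x, z} \<notin> edges F \<and> {x, u} \<notin> edges F}"

text \<open>F placed in a complete bipartite graph with two independent edges added, in one side or
  in different sides. Edges of F between the two pairs are forbidden, because the corresponding
  cross edges between two given inner edges of G may be absent.\<close>

definition two_edge_pattern ::
    "'a sgraph \<Rightarrow> bool \<Rightarrow> 'a set \<Rightarrow> 'a \<Rightarrow> 'a \<Rightarrow> 'a \<Rightarrow> 'a \<Rightarrow> bool" where
  "two_edge_pattern F same C a1 b1 a2 b2 \<longleftrightarrow> distinct [a1, b1, a2, b2] \<and>
     {a1, b1} \<in> edges F \<and> {a2, b2} \<in> edges F \<and> a1 \<in> C \<and> b1 \<in> C \<and>
     (a2 \<in> C) = same \<and> (b2 \<in> C) = same \<and>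
     (\<forall>a\<in>{a1, b1}. \<forall>b\<in>{a2, b2}. {a, b} \<notin> edges F) \<and>
     (\<forall>a b. {a, b} \<in> edges F \<longrightarrow> {a, b} \<noteq> {a1, b1} \<longrightarrow> {a, b} \<noteq> {a2, b2} \<longrightarrow> (a \<in> C) \<noteq> (b \<in> C))"

text \<open>The analysis uses only these properties of F. By \<open>critical\<close> no single
  vertex meets all odd cycles, so the core without inner edges is F-free. In
  \<open>star_types\<close>, x is the preimage of the apex, z that of the star centre, c the side,
  and \<open>D\<close> the far ends of the star edges used; it is asked only for s \<ge> 2, since at
  s = 1 the equality range is empty. \<open>type_ex\<close> gives a positive main term and the
  copies through two centres, \<open>star_ex\<close> and \<open>pattern_ex\<close> the extra copies
  on stars and on independent edges, and \<open>three_col\<close> lets dense triangles be blown up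
  to F.\<close>

locale template =
  fixes F :: "'a sgraph" and s :: nat
  assumes simple: "simple_graph F"
    and s1: "s \<ge> 1"
    and critical: "\<And>x c. \<exists>a b. {a, b} \<in> edges F \<and> a \<noteq> x \<and> b \<noteq> x \<and> c a = (c b :: bool)"
    and star_types: "\<And>x z (c :: 'a \<Rightarrow> bool) D. s \<ge> 2 \<Longrightarrow> x \<in> verts F \<Longrightarrow> z \<in> verts F \<Longrightarrow> x \<noteq> z \<Longrightarrow>
       (\<And>a b. {a, b} \<in> edges F \<Longrightarrow> {a, b} \<inter> {x, z} = {} \<Longrightarrow> c a \<noteq> c b) \<Longrightarrow>
       D = {w. {z, w} \<in> edges F \<and> w \<noteq> x \<and> c w = c z} \<Longrightarrow>
       card D \<ge> s + 1 \<or> card D = s \<and> {x, z} \<in> edges F \<or>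
       (\<exists>w. D = {w} \<and> {x, z} \<notin> edges F \<and> {x, w} \<notin> edges F)"
    and type_ex: "\<exists>(x, z, u, C)\<in>types2 F. \<forall>v. \<not> ({x, v} \<in> edges F \<and> {z, v} \<in> edges F)"
    and star_ex: "\<exists>x z C L. x \<in> verts F \<and> C \<subseteq> verts F - {x} \<and> z \<in> C \<and> {x, z} \<in> edges F \<and> L \<subseteq> C - {z} \<and>
       card L = s \<and> (\<forall>l\<in>L. {z, l} \<in> edges F) \<and>
       (\<forall>a b. {a, b} \<in> edges F \<longrightarrow> a \<noteq> x \<longrightarrow> b \<noteq> x \<longrightarrow> (a \<in> C) = (b \<in> C) \<longrightarrow> (\<exists>l\<in>L. {a, b} = {z, l}))"
    and pattern_ex: "\<And>same. \<exists>C a1 b1 a2 b2. two_edge_pattern F same C a1 b1 a2 b2"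
    and large: "s + 3 \<le> card (verts F)"
    and three_col: "\<exists>col :: 'a \<Rightarrow> nat. (\<forall>a b. {a, b} \<in> edges F \<longrightarrow> col a \<noteq> col b) \<and> (\<forall>a. col a < 3)"
begin

abbreviation k :: nat where "k \<equiv> card (verts F)"

lemma finite_verts [simp]: "finite (verts F)"
  using simple by (simp add: simple_graph_def)

lemma k_pos: "k > 0"
proof -
  obtain a b where "{a, b} \<in> edges F" using critical by blast
  then have "a \<in> verts F" using simple_graph_edge[OF simple] by blast
  then show ?thesis by (auto simp: card_gt_0_iff)
qed

text \<open>Supersaturation: triangles of density \<open>\<tau>0\<close> would force embeddings of
  density about \<open>\<tau>0 ^ (k * k * k)\<close>, so few embeddings mean few triangles, and
  \<open>near_bipartite\<close> applies.\<close>

lemma few_embeddings_near_bipartite: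
  fixes \<delta> :: real
  assumes "\<delta> > 0"
  shows "\<exists>\<tau>>0. \<exists>N. \<forall>n\<ge>N. \<forall>G :: 'b sgraph. simple_graph G \<longrightarrow> card (verts G) = n \<longrightarrow>
    (1 / 4 - \<tau>) * real n ^ 2 \<le> card (edges G) \<longrightarrow> card (embeddings F G) \<le> \<tau> * real n ^ k \<longrightarrow>
    (\<exists>A\<subseteq>verts G. card (bad_edges G A (verts G - A)) \<le> \<delta> * real n ^ 2)"
proof -
  define \<tau>0 where "\<tau>0 = min (1 / 8) (\<delta> / 60)"
  have \<tau>0: "\<tau>0 > 0" "\<tau>0 \<le> 1 / 8" "60 * \<tau>0 \<le> \<delta>" using assms by (auto simp: \<tau>0_def)
  define \<tau>1 where "\<tau>1 = \<tau>0 ^ (k * k * k)"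
  have \<tau>1: "\<tau>1 > 0" using \<tau>0 by (simp add: \<tau>1_def)
  \<comment> \<open>Half of \<open>\<tau>1\<close> is given up to non-injective maps for large n; a
    quarter keeps the contradiction strict.\<close>
  define \<tau> where "\<tau> = min \<tau>0 (\<tau>1 / 4)"
  have \<tau>: "\<tau> > 0" "\<tau> \<le> \<tau>0" "\<tau> \<le> \<tau>1 / 4" using \<tau>0 \<tau>1 by (auto simp: \<tau>_def)
  define N where "N = nat \<lceil>2 * real k ^ 2 / \<tau>1\<rceil> + 1"
  show ?thesis
  proof (intro exI[of _ \<tau>] exI[of _ N] conjI allI impI \<tau>(1))
    fix n and G :: "'b sgraph"
    assume n: "N \<le> n" and G: "simple_graph G" "card (verts G) = n"
      and e: "(1 / 4 - \<tau>) * real n ^ 2 \<le> card (edges G)"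
      and emb: "card (embeddings F G) \<le> \<tau> * real n ^ k"
    have n0: "n > 0" using n by (simp add: N_def)
    have big: "2 * real k ^ 2 / \<tau>1 \<le> real n" using n unfolding N_def by linarith
    have "card (triangles G) \<le> \<tau>0 * real n ^ 3"
    proof (rule ccontr)
      assume "\<not> ?thesis"
      then have t: "\<tau>0 * real n ^ 3 \<le> card (triangles G)" by simp
      obtain col :: "'a \<Rightarrow> nat" where "\<forall>a b. {a, b} \<in> edges F \<longrightarrow> col a \<noteq> col b" "\<forall>a. col a < 3"
        using three_col by blast
      then have "\<tau>1 * real n ^ k - real k ^ 2 * real n ^ (k - 1) \<le> card (embeddings F G)"
        unfolding \<tau>1_def using \<tau>0 t G
        by (intro triangles_embeddings[OF simple G(1), where col = col]) auto
      moreover have nk: "real n ^ k = real n * real n ^ (k - 1)" using k_pos by (metis power_eq_if not_gr0)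
      have "real k ^ 2 \<le> \<tau>1 / 2 * real n" using big \<tau>1 by (simp add: field_simps)
      then have "real k ^ 2 * real n ^ (k - 1) \<le> \<tau>1 / 2 * real n ^ k"
        unfolding nk by (metis mult.assoc mult_right_mono of_nat_0_le_iff zero_le_power)
      moreover have "\<tau> * real n ^ k \<le> \<tau>1 / 4 * real n ^ k" using \<tau> by (intro mult_right_mono) auto
      moreover have "\<tau>1 * real n ^ k > 0" using \<tau>1 n0 by simp
      ultimately show False using emb by linarith
    qed
    moreover have "(1 / 4 - \<tau>0) * real n ^ 2 \<le> (1 / 4 - \<tau>) * real n ^ 2"
      using \<tau> by (intro mult_right_mono) auto
    ultimately obtain A where "A \<subseteq> verts G" "card (bad_edges G A (verts G - A)) \<le> 60 * \<tau>0 * real n ^ 2"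
      using near_bipartite[OF G(1) G(2)[symmetric] n0, of \<tau>0] \<tau>0 e by auto
    moreover have "60 * \<tau>0 * real n ^ 2 \<le> \<delta> * real n ^ 2" using \<tau>0 by (intro mult_right_mono) auto
    ultimately show "\<exists>A\<subseteq>verts G. card (bad_edges G A (verts G - A)) \<le> \<delta> * real n ^ 2"
      by (meson order_trans)
  qed
qed

end

text \<open>Absorbs the error of \<open>extension_count\<close> into half of its main term, once
  \<delta> and \<open>1 / n\<close> are below a constant that does not depend on n.\<close>

lemma power_minus_error:
  fixes \<alpha> :: real
  assumes "\<alpha> > 0"
  shows "\<exists>\<eta>>0. \<exists>N. \<forall>n\<ge>N. \<forall>\<delta>. 0 \<le> \<delta> \<longrightarrow> \<delta> \<le> \<eta> \<longrightarrow>
    \<alpha> ^ m / 2 * real n ^ m \<le> (\<alpha> * real n) ^ m - real k ^ 2 * (\<delta> + 1 / real n) * real n ^ m"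
proof -
  define \<eta> where "\<eta> = \<alpha> ^ m / (4 * (real k ^ 2 + 1))"
  have k1: "real k ^ 2 + 1 > 0" by (smt (verit) zero_le_power2)
  have \<eta>: "\<eta> > 0" using assms k1 by (simp add: \<eta>_def)
  have eq: "\<eta> * (real k ^ 2 + 1) = \<alpha> ^ m / 4" using k1 by (simp add: \<eta>_def field_simps)
  show ?thesis
  proof (intro exI[of _ \<eta>] conjI exI[of _ "nat \<lceil>1 / \<eta>\<rceil> + 1"] allI impI \<eta>)
    fix n :: nat and \<delta> :: real assume n: "nat \<lceil>1 / \<eta>\<rceil> + 1 \<le> n" and \<delta>: "0 \<le> \<delta>" "\<delta> \<le> \<eta>"
    have "1 / \<eta> \<le> real n" "real n > 0" using n by linarith+
    then have "1 / real n \<le> \<eta>" using \<eta> by (simp add: field_simps)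
    then have "real k ^ 2 * (\<delta> + 1 / real n) \<le> real k ^ 2 * (2 * \<eta>)" using \<delta> by (intro mult_left_mono) auto
    also have "\<dots> \<le> 2 * (\<eta> * (real k ^ 2 + 1))" using \<eta> by (simp add: algebra_simps)
    also have "\<dots> = \<alpha> ^ m / 2" using eq by simp
    finally have "real k ^ 2 * (\<delta> + 1 / real n) * real n ^ m \<le> \<alpha> ^ m / 2 * real n ^ m"
      by (intro mult_right_mono) auto
    then show "\<alpha> ^ m / 2 * real n ^ m \<le> (\<alpha> * real n) ^ m - real k ^ 2 * (\<delta> + 1 / real n) * real n ^ m"
      by (simp add: power_mult_distrib)
  qed
qed

lemma card_missing_commute: "card (missing G A B) = card (missing G B A)"
  by (rule bij_betw_same_card[of prod.swap], rule bij_betw_byWitness[where f' = prod.swap])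
     (auto simp: missing_def insert_commute)

lemma power_le_prod:
  fixes f :: "'a \<Rightarrow> real"
  assumes "finite I" "\<And>i. i \<in> I \<Longrightarrow> a \<le> f i" "0 \<le> a"
  shows "a ^ card I \<le> (\<Prod>i\<in>I. f i)"
proof -
  have "a ^ card I = (\<Prod>i\<in>I. a)" by simp
  also have "\<dots> \<le> (\<Prod>i\<in>I. f i)" using assms by (intro prod_mono) auto
  finally show ?thesis .
qed

text \<open>\<open>extension_count\<close> for the recurring situation: outside \<open>T\<close> the
  graph F is bipartite with classes given by \<open>C\<close>, and these go to the two sides of an
  almost complete bipartite graph, with at least r choices for each vertex.\<close>

lemma bipartite_extension_count:
  fixes F :: "'a sgraph" and G :: "'b sgraph" and \<delta> r :: real
  assumes F: "simple_graph F" and G: "simple_graph G" and n: "n = card (verts G)" "n > 0"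
    and k: "k = card (verts F)"
    and PQ: "P \<subseteq> verts G" "Q \<subseteq> verts G"
    and miss: "card (missing G P Q) \<le> \<delta> * real n ^ 2"
    and T: "T \<subseteq> verts F" "inj_on g T" "g ` T \<subseteq> verts G"
    and TT: "\<And>a b. {a, b} \<in> edges F \<Longrightarrow> a \<in> T \<Longrightarrow> b \<in> T \<Longrightarrow> {g a, g b} \<in> edges G"
    and S: "\<And>v. v \<in> verts F - T \<Longrightarrow> S v \<subseteq> (if v \<in> C then P else Q) - g ` T"
    and Sr: "\<And>v. v \<in> verts F - T \<Longrightarrow> r \<le> card (S v)" and r: "r \<ge> 0"
    and TS: "\<And>a b. {a, b} \<in> edges F \<Longrightarrow> a \<in> T \<Longrightarrow> b \<in> verts F - T \<Longrightarrow>
       real (card {y \<in> S b. {g a, y} \<notin> edges G}) \<le> \<delta> * n"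
    and bi: "\<And>a b. {a, b} \<in> edges F \<Longrightarrow> a \<notin> T \<Longrightarrow> b \<notin> T \<Longrightarrow> (a \<in> C) \<noteq> (b \<in> C)"
    and \<delta>: "\<delta> \<ge> 0"
  shows "r ^ (k - card T) - real k ^ 2 * (\<delta> + 1 / n) * real n ^ (k - card T)
    \<le> card {f \<in> embeddings F G. (\<forall>v\<in>T. f v = g v) \<and> (\<forall>v\<in>verts F - T. f v \<in> S v)}"
proof -
  have fF: "finite (verts F)" using F by (simp add: simple_graph_def)
  have fPQ: "finite P" "finite Q" using PQ G finite_subset by (auto simp: simple_graph_def)
  have fm: "finite (missing G P Q)" "finite (missing G Q P)"
    using fPQ by (auto simp: missing_def intro: finite_subset[of _ "P \<times> Q"] finite_subset[of _ "Q \<times> P"])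
  have "card (verts F - T) = k - card T" using T(1) fF k by (simp add: card_Diff_subset finite_subset)
  then have "r ^ (k - card T) \<le> (\<Prod>v\<in>verts F - T. real (card (S v)))"
    using power_le_prod[of "verts F - T" r "\<lambda>v. real (card (S v))"] Sr r fF by simp
  moreover have "(\<Prod>v\<in>verts F - T. real (card (S v))) - real k ^ 2 * (\<delta> + 1 / n) * real n ^ (k - card T)
    \<le> card {f \<in> embeddings F G. (\<forall>v\<in>T. f v = g v) \<and> (\<forall>v\<in>verts F - T. f v \<in> S v)}"
  proof (rule extension_count[OF F G n k T])
    fix v assume "v \<in> verts F - T"
    then show "S v \<subseteq> verts G - g ` T" using S[of v] PQ by (auto split: if_splits)
  next
    fix a b assume ab: "{a, b} \<in> edges F" "a \<in> verts F - T" "b \<in> verts F - T"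
    have "card {(y, y') \<in> S a \<times> S b. {y, y'} \<notin> edges G} \<le> card (missing G P Q)"
    proof (cases "a \<in> C")
      case True
      then have "b \<notin> C" using bi[OF ab(1)] ab by auto
      then have "{(y, y') \<in> S a \<times> S b. {y, y'} \<notin> edges G} \<subseteq> missing G P Q"
        using True S[OF ab(2)] S[OF ab(3)] by (auto simp: missing_def)
      then show ?thesis using fm by (intro card_mono) auto
    next
      case False
      then have "b \<in> C" using bi[OF ab(1)] ab by auto
      then have "{(y, y') \<in> S a \<times> S b. {y, y'} \<notin> edges G} \<subseteq> missing G Q P"
        using False S[OF ab(2)] S[OF ab(3)] by (auto simp: missing_def)
      then show ?thesis using fm by (subst card_missing_commute) (intro card_mono)
    qed
    then show "real (card {(y, y') \<in> S a \<times> S b. {y, y'} \<notin> edges G}) \<le> \<delta> * real n ^ 2"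
      using miss by simp
  qed (use TT TS \<delta> in auto)
  ultimately show ?thesis by linarith
qed

context template
begin

section \<open>Copies through two independent inner edges\<close>

text \<open>The two pattern edges are mapped to the two given edges. Since F has no edges between
  them, this needs no further edge of G, and each of the other \<open>k - 4\<close> vertices has
  linearly many choices, as the four ends miss few vertices of the opposite side.\<close>

lemma pair_extension:
  fixes same :: bool
  assumes pat: "two_edge_pattern F same C a1 b1 a2 b2"
  shows "\<exists>\<sigma>>0. \<exists>\<eta>>0. \<exists>N. \<forall>n\<ge>N. \<forall>G :: 'b sgraph. \<forall>P Q p1 q1 p2 q2.
    simple_graph G \<longrightarrow> card (verts G) = n \<longrightarrow> P \<inter> Q = {} \<longrightarrow> P \<union> Q \<subseteq> verts G \<longrightarrow>
    real n / 3 \<le> card P \<longrightarrow> real n / 3 \<le> card Q \<longrightarrow> card (missing G P Q) \<le> \<eta> * real n ^ 2 \<longrightarrow>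
    {p1, q1} \<in> edges G \<longrightarrow> {p2, q2} \<in> edges G \<longrightarrow> {p1, q1} \<subseteq> P \<longrightarrow> {p2, q2} \<subseteq> (if same then P else Q) \<longrightarrow>
    {p1, q1} \<inter> {p2, q2} = {} \<longrightarrow>
    (\<forall>w\<in>{p1, q1, p2, q2}. (w \<in> P \<longrightarrow> card {y \<in> Q. {w, y} \<notin> edges G} \<le> \<eta> * real n) \<and>
       (w \<in> Q \<longrightarrow> card {y \<in> P. {w, y} \<notin> edges G} \<le> \<eta> * real n)) \<longrightarrow>
    \<sigma> * real n ^ (k - 4) \<le> card {f \<in> embeddings F G. f ` verts F \<subseteq> P \<union> Q \<and>
       f ` {a1, b1} = {p1, q1} \<and> f ` {a2, b2} = {p2, q2}}"
proof -
  define T where "T = {a1, b1, a2, b2}"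
  have pd: "distinct [a1, b1, a2, b2]" and pe: "{a1, b1} \<in> edges F" "{a2, b2} \<in> edges F"
    and pC: "a1 \<in> C" "b1 \<in> C" "(a2 \<in> C) = same" "(b2 \<in> C) = same"
    and pn: "\<And>a b. a \<in> {a1, b1} \<Longrightarrow> b \<in> {a2, b2} \<Longrightarrow> {a, b} \<notin> edges F"
    and pb: "\<And>a b. {a, b} \<in> edges F \<Longrightarrow> {a, b} \<noteq> {a1, b1} \<Longrightarrow> {a, b} \<noteq> {a2, b2} \<Longrightarrow> (a \<in> C) \<noteq> (b \<in> C)"
    using pat unfolding two_edge_pattern_def by blast+
  have cT: "card T = 4" using pd by (simp add: T_def)
  have TV: "T \<subseteq> verts F" using simple_graph_edge[OF simple pe(1)] simple_graph_edge[OF simple pe(2)]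
    by (simp add: T_def)
  obtain \<eta> N where \<eta>: "\<eta> > 0" and N: "\<And>n \<delta>. n \<ge> N \<Longrightarrow> 0 \<le> \<delta> \<Longrightarrow> \<delta> \<le> \<eta> \<Longrightarrow>
    (1 / 4) ^ (k - 4) / 2 * real n ^ (k - 4) \<le> (1 / 4 * real n) ^ (k - 4) - real k ^ 2 * (\<delta> + 1 / real n) * real n ^ (k - 4)"
    using power_minus_error[of "1 / 4" "k - 4" k] by auto
  have \<sigma>: "(1 / 4 :: real) ^ (k - 4) / 2 > 0" by simp
  show ?thesis
  proof (rule exI[of _ "(1 / 4) ^ (k - 4) / 2"], rule conjI[OF \<sigma>], rule exI[of _ \<eta>], rule conjI[OF \<eta>],
      rule exI[of _ "max N 48"], intro allI impI)
    fix n and G :: "'b sgraph" and P Q p1 q1 p2 q2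
    assume n: "max N 48 \<le> n" and G: "simple_graph G" "card (verts G) = n" and disj: "P \<inter> Q = {}" "P \<union> Q \<subseteq> verts G"
      and cP: "real n / 3 \<le> card P" and cQ: "real n / 3 \<le> card Q" and miss: "card (missing G P Q) \<le> \<eta> * real n ^ 2"
      and e: "{p1, q1} \<in> edges G" "{p2, q2} \<in> edges G" and p1: "{p1, q1} \<subseteq> P" and p2: "{p2, q2} \<subseteq> (if same then P else Q)"
      and dj: "{p1, q1} \<inter> {p2, q2} = {}"
      and tp: "\<forall>w\<in>{p1, q1, p2, q2}. (w \<in> P \<longrightarrow> card {y \<in> Q. {w, y} \<notin> edges G} \<le> \<eta> * real n) \<and>
       (w \<in> Q \<longrightarrow> card {y \<in> P. {w, y} \<notin> edges G} \<le> \<eta> * real n)"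
    have fPQ: "finite P" "finite Q" using disj G finite_subset by (auto simp: simple_graph_def)
    define g where "g v = (if v = a1 then p1 else if v = b1 then q1 else if v = a2 then p2 else q2)" for v
    have g: "g a1 = p1" "g b1 = q1" "g a2 = p2" "g b2 = q2" using pd by (auto simp: g_def)
    have gT: "g ` T = {p1, q1, p2, q2}" by (auto simp: T_def g)
    have ginj: "inj_on g T"
    proof -
      have "p1 \<noteq> q1" "p2 \<noteq> q2" using simple_graph_edge(3)[OF G(1)] e by auto
      then have "card (g ` T) = 4" using dj unfolding gT by auto
      then show ?thesis using cT by (intro eq_card_imp_inj_on) (auto simp: T_def)
    qed
    define S where "S v = (if v \<in> C then P else Q) - {p1, q1, p2, q2}" for v
    have gside: "g a \<in> (if a \<in> C then P else Q)" if "a \<in> T" for a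
      using that pC p1 p2 by (auto simp: T_def g split: if_splits)
    have "(1 / 4 * real n) ^ (k - card T) - real k ^ 2 * (\<eta> + 1 / real n) * real n ^ (k - card T)
      \<le> card {f \<in> embeddings F G. (\<forall>v\<in>T. f v = g v) \<and> (\<forall>v\<in>verts F - T. f v \<in> S v)}"
    proof (rule bipartite_extension_count[where P = P and Q = Q and C = C])
      fix a b assume ab: "{a, b} \<in> edges F" "a \<in> T" "b \<in> T"
      have "a \<noteq> b" using simple_graph_edge(3)[OF simple] ab by auto
      then have "{a, b} = {a1, b1} \<or> {a, b} = {a2, b2}"
        using ab pn[of a b] pn[of b a] by (auto simp: T_def insert_commute)
      then show "{g a, g b} \<in> edges G" using e g by (auto simp: doubleton_eq_iff insert_commute)
    next
      fix v
      have "card ((if v \<in> C then P else Q) - {p1, q1, p2, q2}) \<ge> card (if v \<in> C then P else Q) - card {p1, q1, p2, q2}"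
        by (rule diff_card_le_card_Diff) simp
      moreover have "card {p1, q1, p2, q2} \<le> 4" by (simp add: card_insert_if)
      ultimately have "real (card (S v)) \<ge> real n / 3 - 4"
        using cP cQ by (auto simp: S_def split: if_splits)
      \<comment> \<open>At most four vertices are lost from a side of size n / 3; this is where n
        \<ge> 48 enters.\<close>
      then show "1 / 4 * real n \<le> card (S v)" using n by simp
    next
      fix a b assume ab: "{a, b} \<in> edges F" "a \<in> T" "b \<in> verts F - T"
      then have "(a \<in> C) \<noteq> (b \<in> C)" by (intro pb) (auto simp: T_def)
      then have sub: "{y \<in> S b. {g a, y} \<notin> edges G} \<subseteq> {y \<in> (if a \<in> C then Q else P). {g a, y} \<notin> edges G}"
        by (auto simp: S_def)
      then have "card {y \<in> S b. {g a, y} \<notin> edges G} \<le> card {y \<in> (if a \<in> C then Q else P). {g a, y} \<notin> edges G}"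
        using fPQ by (intro card_mono) auto
      moreover have "g a \<in> {p1, q1, p2, q2}" using gT ab by auto
      then have "card {y \<in> (if a \<in> C then Q else P). {g a, y} \<notin> edges G} \<le> \<eta> * n"
        using tp gside[OF ab(2)] by (auto split: if_splits)
      ultimately show "real (card {y \<in> S b. {g a, y} \<notin> edges G}) \<le> \<eta> * n" by linarith
    next
      fix a b assume "{a, b} \<in> edges F" "a \<notin> T" "b \<notin> T"
      then show "(a \<in> C) \<noteq> (b \<in> C)" by (intro pb) (auto simp: T_def doubleton_eq_iff)
    next
      fix v show "S v \<subseteq> (if v \<in> C then P else Q) - g ` T" by (simp add: S_def gT)
    next
      show "g ` T \<subseteq> verts G" using gside disj by (force split: if_splits)
    qed (use simple G n TV ginj disj miss \<eta> in auto)
    also have "\<dots> \<le> card {f \<in> embeddings F G. f ` verts F \<subseteq> P \<union> Q \<and>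
       f ` {a1, b1} = {p1, q1} \<and> f ` {a2, b2} = {p2, q2}}"
    proof (intro of_nat_mono card_mono)
      show "{f \<in> embeddings F G. (\<forall>v\<in>T. f v = g v) \<and> (\<forall>v\<in>verts F - T. f v \<in> S v)} \<subseteq>
        {f \<in> embeddings F G. f ` verts F \<subseteq> P \<union> Q \<and> f ` {a1, b1} = {p1, q1} \<and> f ` {a2, b2} = {p2, q2}}"
      proof
        fix f assume f: "f \<in> {f \<in> embeddings F G. (\<forall>v\<in>T. f v = g v) \<and> (\<forall>v\<in>verts F - T. f v \<in> S v)}"
        have "f v \<in> P \<union> Q" if "v \<in> verts F" for v
        proof (cases "v \<in> T")
          case True then show ?thesis using f gside[of v] by (auto split: if_splits)
        next
          case False then have "f v \<in> S v" using f that by blast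
          then show ?thesis by (auto simp: S_def split: if_splits)
        qed
        moreover have "f a1 = p1" "f b1 = q1" "f a2 = p2" "f b2 = q2" using f g by (auto simp: T_def)
        ultimately show "f \<in> {f \<in> embeddings F G. f ` verts F \<subseteq> P \<union> Q \<and> f ` {a1, b1} = {p1, q1} \<and> f ` {a2, b2} = {p2, q2}}"
          using f by auto
      qed
    qed (use finite_embeddings[OF simple G(1)] in auto)
    finally have "(1 / 4 * real n) ^ (k - 4) - real k ^ 2 * (\<eta> + 1 / real n) * real n ^ (k - 4)
      \<le> card {f \<in> embeddings F G. f ` verts F \<subseteq> P \<union> Q \<and>
       f ` {a1, b1} = {p1, q1} \<and> f ` {a2, b2} = {p2, q2}}" unfolding cT .
    moreover have "(1 / 4) ^ (k - 4) / 2 * real n ^ (k - 4) \<le>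
      (1 / 4 * real n) ^ (k - 4) - real k ^ 2 * (\<eta> + 1 / real n) * real n ^ (k - 4)"
      using n \<eta> by (intro N) auto
    ultimately show "(1 / 4) ^ (k - 4) / 2 * real n ^ (k - 4) \<le> card {f \<in> embeddings F G. f ` verts F \<subseteq> P \<union> Q \<and>
       f ` {a1, b1} = {p1, q1} \<and> f ` {a2, b2} = {p2, q2}}"
      by linarith
  qed
qed


text \<open>Embeddings obtained from pairs lying in different sides may coincide, which costs a factor of four.\<close>

lemma pairs_count:
  "\<exists>\<sigma>>0. \<exists>\<eta>>0. \<exists>N. \<forall>n\<ge>N. \<forall>G :: 'b sgraph. \<forall>A B E.
    simple_graph G \<longrightarrow> card (verts G) = n \<longrightarrow> A \<inter> B = {} \<longrightarrow> A \<union> B \<subseteq> verts G \<longrightarrow>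
    real n / 3 \<le> card A \<longrightarrow> real n / 3 \<le> card B \<longrightarrow> card (missing G A B) \<le> \<eta> * real n ^ 2 \<longrightarrow>
    E \<subseteq> bad_edges G A B \<longrightarrow>
    (\<forall>e\<in>E. \<forall>w\<in>e. (w \<in> A \<longrightarrow> card {y \<in> B. {w, y} \<notin> edges G} \<le> \<eta> * real n) \<and>
       (w \<in> B \<longrightarrow> card {y \<in> A. {w, y} \<notin> edges G} \<le> \<eta> * real n)) \<longrightarrow>
    card {(e, e') \<in> E \<times> E. e \<inter> e' = {}} * (\<sigma> * real n ^ (k - 4)) \<le>
      card {f \<in> embeddings F G. f ` verts F \<subseteq> A \<union> B}"
proof -
  obtain C a1 b1 a2 b2 where pt: "two_edge_pattern F True C a1 b1 a2 b2" using pattern_ex by blast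
  obtain C' a1' b1' a2' b2' where pf: "two_edge_pattern F False C' a1' b1' a2' b2'" using pattern_ex by blast
  define pr where "pr same = (if same then ({a1, b1}, {a2, b2}) else ({a1', b1'}, {a2', b2'}))" for same
  define R where "R same G P Q \<sigma> \<eta> n = (\<forall>p1 q1 p2 q2.
    simple_graph G \<longrightarrow> card (verts G) = n \<longrightarrow> P \<inter> Q = {} \<longrightarrow> P \<union> Q \<subseteq> verts G \<longrightarrow>
    real n / 3 \<le> card P \<longrightarrow> real n / 3 \<le> card Q \<longrightarrow> card (missing G P Q) \<le> \<eta> * real n ^ 2 \<longrightarrow>
    {p1, q1} \<in> edges G \<longrightarrow> {p2, q2} \<in> edges G \<longrightarrow> {p1, q1} \<subseteq> P \<longrightarrow> {p2, q2} \<subseteq> (if same then P else Q) \<longrightarrow>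
    {p1, q1} \<inter> {p2, q2} = {} \<longrightarrow>
    (\<forall>w\<in>{p1, q1, p2, q2}. (w \<in> P \<longrightarrow> card {y \<in> Q. {w, y} \<notin> edges G} \<le> \<eta> * real n) \<and>
       (w \<in> Q \<longrightarrow> card {y \<in> P. {w, y} \<notin> edges G} \<le> \<eta> * real n)) \<longrightarrow>
    \<sigma> * real n ^ (k - 4) \<le> card {f \<in> embeddings F G. f ` verts F \<subseteq> P \<union> Q \<and>
       f ` fst (pr same) = {p1, q1} \<and> f ` snd (pr same) = {p2, q2}})"
    for same and G :: "'b sgraph" and P Q and \<sigma> \<eta> :: real and n :: nat
  have R_ex: "\<exists>\<sigma>>0. \<exists>\<eta>>0. \<exists>N. \<forall>n\<ge>N. \<forall>G P Q. R same G P Q \<sigma> \<eta> n" for same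
  proof (cases same)
    case True
    then show ?thesis using pair_extension[OF pt, where ?'b = 'b] unfolding R_def pr_def by simp
  next
    case False
    then show ?thesis using pair_extension[OF pf, where ?'b = 'b] unfolding R_def pr_def by simp
  qed
  obtain \<sigma>1 \<eta>1 N1 where 1: "\<sigma>1 > 0" "\<eta>1 > 0" "\<And>n G P Q. n \<ge> N1 \<Longrightarrow> R True G P Q \<sigma>1 \<eta>1 n" using R_ex[of True] by blast
  obtain \<sigma>2 \<eta>2 N2 where 2: "\<sigma>2 > 0" "\<eta>2 > 0" "\<And>n G P Q. n \<ge> N2 \<Longrightarrow> R False G P Q \<sigma>2 \<eta>2 n" using R_ex[of False] by blast
  define \<sigma> where "\<sigma> = min \<sigma>1 \<sigma>2 / 4"
  define \<eta> where "\<eta> = min \<eta>1 \<eta>2"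
  have pos: "\<sigma> > 0" "\<eta> > 0" using 1 2 by (auto simp: \<sigma>_def \<eta>_def)
  have R': "R same G P Q (4 * \<sigma>) \<eta> n" if n: "n \<ge> max N1 N2" for same G P Q n
  proof -
    obtain \<sigma>' \<eta>' where r: "R same G P Q \<sigma>' \<eta>' n" "4 * \<sigma> \<le> \<sigma>'" "\<eta> \<le> \<eta>'"
      using 1(3)[of n G P Q] 2(3)[of n G P Q] n by (cases same) (auto simp: \<sigma>_def \<eta>_def)
    have m: "4 * \<sigma> * real n ^ (k - 4) \<le> \<sigma>' * real n ^ (k - 4)" using r by (intro mult_right_mono) auto
    have e1: "\<eta> * real n \<le> \<eta>' * real n" and e2: "\<eta> * real n ^ 2 \<le> \<eta>' * real n ^ 2"
      using r by (auto intro: mult_right_mono)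
    show ?thesis
      unfolding R_def
    proof (intro allI impI)
      fix p1 q1 p2 q2
      assume a: "simple_graph G" "card (verts G) = n" "P \<inter> Q = {}" "P \<union> Q \<subseteq> verts G"
        "real n / 3 \<le> card P" "real n / 3 \<le> card Q" "card (missing G P Q) \<le> \<eta> * real n ^ 2"
        "{p1, q1} \<in> edges G" "{p2, q2} \<in> edges G" "{p1, q1} \<subseteq> P" "{p2, q2} \<subseteq> (if same then P else Q)"
        "{p1, q1} \<inter> {p2, q2} = {}"
        and w: "\<forall>w\<in>{p1, q1, p2, q2}. (w \<in> P \<longrightarrow> card {y \<in> Q. {w, y} \<notin> edges G} \<le> \<eta> * real n) \<and>
           (w \<in> Q \<longrightarrow> card {y \<in> P. {w, y} \<notin> edges G} \<le> \<eta> * real n)"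
      have w': "\<forall>w\<in>{p1, q1, p2, q2}. (w \<in> P \<longrightarrow> card {y \<in> Q. {w, y} \<notin> edges G} \<le> \<eta>' * real n) \<and>
           (w \<in> Q \<longrightarrow> card {y \<in> P. {w, y} \<notin> edges G} \<le> \<eta>' * real n)"
        using w e1 by (blast intro: order_trans)
      have "card (missing G P Q) \<le> \<eta>' * real n ^ 2" using a(7) e2 by linarith
      then have "\<sigma>' * real n ^ (k - 4) \<le> card {f \<in> embeddings F G. f ` verts F \<subseteq> P \<union> Q \<and>
         f ` fst (pr same) = {p1, q1} \<and> f ` snd (pr same) = {p2, q2}}"
        by (intro r(1)[unfolded R_def, rule_format] a(1-6,8-12) bspec[OF w'])
      then show "4 * \<sigma> * real n ^ (k - 4) \<le> card {f \<in> embeddings F G. f ` verts F \<subseteq> P \<union> Q \<and>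
         f ` fst (pr same) = {p1, q1} \<and> f ` snd (pr same) = {p2, q2}}" using m by linarith
    qed
  qed
  show ?thesis
  proof (rule exI[of _ \<sigma>], rule conjI[OF pos(1)], rule exI[of _ \<eta>], rule conjI[OF pos(2)],
      rule exI[of _ "max N1 N2"], intro allI impI)
    fix n and G :: "'b sgraph" and A B E
    assume n: "max N1 N2 \<le> n" and G: "simple_graph G" "card (verts G) = n" and AB: "A \<inter> B = {}" "A \<union> B \<subseteq> verts G"
      and cA: "real n / 3 \<le> card A" and cB: "real n / 3 \<le> card B"
      and miss: "card (missing G A B) \<le> \<eta> * real n ^ 2"
      and E: "E \<subseteq> bad_edges G A B"
      and tp: "\<forall>e\<in>E. \<forall>w\<in>e. (w \<in> A \<longrightarrow> card {y \<in> B. {w, y} \<notin> edges G} \<le> \<eta> * real n) \<and>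
       (w \<in> B \<longrightarrow> card {y \<in> A. {w, y} \<notin> edges G} \<le> \<eta> * real n)"
    define X where "X = {f \<in> embeddings F G. f ` verts F \<subseteq> A \<union> B}"
    have fX: "finite X" using finite_embeddings[OF simple G(1)] by (simp add: X_def)
    have fE: "finite E" using E finite_bad_edges[OF G(1)] finite_subset by blast
    have EG: "e \<in> edges G" if "e \<in> E" for e using E that by (auto simp: bad_edges_def)
    \<comment> \<open>Within one class (both edges in one fixed side, or in different sides in a
      fixed order) an embedding determines the ordered pair of edges as the images of the two
      pattern edges, so the families are disjoint.\<close>
    have cls: "card Pr * (4 * \<sigma> * real n ^ (k - 4)) \<le> card X"
      if Pr: "Pr \<subseteq> {(e, e') \<in> E \<times> E. e \<inter> e' = {} \<and> e \<subseteq> P \<and> e' \<subseteq> (if same then P else Q)}"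
        and PQ: "P = A \<and> Q = B \<or> P = B \<and> Q = A" for Pr P Q same
    proof (rule card_ge_disjoint_family[where Y = "\<lambda>p. {f \<in> embeddings F G. f ` verts F \<subseteq> P \<union> Q \<and>
         f ` fst (pr same) = fst p \<and> f ` snd (pr same) = snd p}"])
      show "finite X" by (rule fX)
      show "finite Pr" by (rule finite_subset[OF Pr], rule finite_subset[of _ "E \<times> E"]) (use fE in auto)
      show "disjoint_family_on (\<lambda>p. {f \<in> embeddings F G. f ` verts F \<subseteq> P \<union> Q \<and>
         f ` fst (pr same) = fst p \<and> f ` snd (pr same) = snd p}) Pr"
        by (auto simp: disjoint_family_on_def)
      fix p assume p: "p \<in> Pr"
      show "{f \<in> embeddings F G. f ` verts F \<subseteq> P \<union> Q \<and> f ` fst (pr same) = fst p \<and> f ` snd (pr same) = snd p} \<subseteq> X"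
        using PQ unfolding X_def by (intro Collect_mono) (auto simp only: Un_commute)
      obtain e e' where ee: "p = (e, e')" "e \<in> E" "e' \<in> E" "e \<inter> e' = {}" "e \<subseteq> P" "e' \<subseteq> (if same then P else Q)"
        using p Pr by blast
      obtain p1 q1 where e: "e = {p1, q1}" using simple_graph_edgeE[OF G(1) EG[OF ee(2)]] by metis
      obtain p2 q2 where e': "e' = {p2, q2}" using simple_graph_edgeE[OF G(1) EG[OF ee(3)]] by metis
      have wt: "\<forall>w\<in>{p1, q1, p2, q2}. (w \<in> P \<longrightarrow> card {y \<in> Q. {w, y} \<notin> edges G} \<le> \<eta> * real n) \<and>
           (w \<in> Q \<longrightarrow> card {y \<in> P. {w, y} \<notin> edges G} \<le> \<eta> * real n)"
      proof
        fix w assume "w \<in> {p1, q1, p2, q2}"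
        then have "w \<in> e \<or> w \<in> e'" by (auto simp: e e')
        then have "(w \<in> A \<longrightarrow> card {y \<in> B. {w, y} \<notin> edges G} \<le> \<eta> * real n) \<and>
           (w \<in> B \<longrightarrow> card {y \<in> A. {w, y} \<notin> edges G} \<le> \<eta> * real n)"
          using bspec[OF bspec[OF tp ee(2)], of w] bspec[OF bspec[OF tp ee(3)], of w] by argo
        then show "(w \<in> P \<longrightarrow> card {y \<in> Q. {w, y} \<notin> edges G} \<le> \<eta> * real n) \<and>
           (w \<in> Q \<longrightarrow> card {y \<in> P. {w, y} \<notin> edges G} \<le> \<eta> * real n)"
          using PQ by (elim disjE conjE) simp_all
      qed
      have m: "card (missing G P Q) \<le> \<eta> * real n ^ 2" using miss PQ card_missing_commute[of G A B] by auto
      have pq: "P \<inter> Q = {}" "P \<union> Q \<subseteq> verts G" "real n / 3 \<le> card P" "real n / 3 \<le> card Q" using PQ AB cA cB by auto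
      have "4 * \<sigma> * real n ^ (k - 4) \<le> card {f \<in> embeddings F G. f ` verts F \<subseteq> P \<union> Q \<and>
         f ` fst (pr same) = {p1, q1} \<and> f ` snd (pr same) = {p2, q2}}"
        by (intro R'[OF n, unfolded R_def, rule_format] G m pq EG[OF ee(2), unfolded e]
            EG[OF ee(3), unfolded e'] ee(4,5,6)[unfolded e e'] bspec[OF wt])
      then show "4 * \<sigma> * real n ^ (k - 4) \<le> card {f \<in> embeddings F G. f ` verts F \<subseteq> P \<union> Q \<and>
         f ` fst (pr same) = fst p \<and> f ` snd (pr same) = snd p}" by (simp add: ee(1) e e')
    qed
    define Q0 where "Q0 P Q = {(e, e') \<in> E \<times> E. e \<inter> e' = {} \<and> e \<subseteq> P \<and> e' \<subseteq> Q}" for P Q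
    have fQ0: "finite (Q0 P Q)" for P Q
      by (rule finite_subset[of _ "E \<times> E"]) (use fE in \<open>auto simp: Q0_def\<close>)
    have "(e, e') \<in> (Q0 A A \<union> Q0 B B) \<union> (Q0 A B \<union> Q0 B A)"
      if "e \<in> E" "e' \<in> E" "e \<inter> e' = {}" for e e'
    proof -
      have "e \<subseteq> A \<or> e \<subseteq> B" "e' \<subseteq> A \<or> e' \<subseteq> B" using E that by (auto simp: bad_edges_def)
      then show ?thesis using that unfolding Q0_def by blast
    qed
    then have "{(e, e') \<in> E \<times> E. e \<inter> e' = {}} \<subseteq> (Q0 A A \<union> Q0 B B) \<union> (Q0 A B \<union> Q0 B A)"
      by blast
    then have "card {(e, e') \<in> E \<times> E. e \<inter> e' = {}} \<le> card ((Q0 A A \<union> Q0 B B) \<union> (Q0 A B \<union> Q0 B A))"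
      using fQ0 by (intro card_mono) auto
    also have "\<dots> \<le> (card (Q0 A A) + card (Q0 B B)) + (card (Q0 A B) + card (Q0 B A))"
      by (meson add_mono card_Un_le order_trans)
    finally have "card {(e, e') \<in> E \<times> E. e \<inter> e' = {}} \<le> (card (Q0 A A) + card (Q0 B B)) + (card (Q0 A B) + card (Q0 B A))" .
    from of_nat_mono[OF this, where 'a = real]
    have le: "real (card {(e, e') \<in> E \<times> E. e \<inter> e' = {}}) \<le>
      real (card (Q0 A A)) + real (card (Q0 B B)) + (real (card (Q0 A B)) + real (card (Q0 B A)))" by simp
    have "card (Q0 A A) * (4 * \<sigma> * real n ^ (k - 4)) \<le> card X" by (rule cls[of _ A True B]) (auto simp: Q0_def)
    moreover have "card (Q0 B B) * (4 * \<sigma> * real n ^ (k - 4)) \<le> card X" by (rule cls[of _ B True A]) (auto simp: Q0_def)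
    moreover have "card (Q0 A B) * (4 * \<sigma> * real n ^ (k - 4)) \<le> card X" by (rule cls[of _ A False B]) (auto simp: Q0_def)
    moreover have "card (Q0 B A) * (4 * \<sigma> * real n ^ (k - 4)) \<le> card X" by (rule cls[of _ B False A]) (auto simp: Q0_def)
    ultimately have "(real (card (Q0 A A)) + real (card (Q0 B B)) + (real (card (Q0 A B)) + real (card (Q0 B A)))) * (\<sigma> * real n ^ (k - 4)) \<le> card X"
      by (simp add: algebra_simps)
    moreover have "real (card {(e, e') \<in> E \<times> E. e \<inter> e' = {}}) * (\<sigma> * real n ^ (k - 4)) \<le>
      (real (card (Q0 A A)) + real (card (Q0 B B)) + (real (card (Q0 A B)) + real (card (Q0 B A)))) * (\<sigma> * real n ^ (k - 4))"
      using le pos by (intro mult_right_mono) auto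
    ultimately show "card {(e, e') \<in> E \<times> E. e \<inter> e' = {}} * (\<sigma> * real n ^ (k - 4)) \<le>
      card {f \<in> embeddings F G. f ` verts F \<subseteq> A \<union> B}" unfolding X_def by linarith
  qed
qed

lemma k_ge_4: "4 \<le> k"
proof -
  obtain C a1 b1 a2 b2 where pt: "two_edge_pattern F True C a1 b1 a2 b2" using pattern_ex by blast
  then have d: "distinct [a1, b1, a2, b2]" and e: "{a1, b1} \<in> edges F" "{a2, b2} \<in> edges F"
    unfolding two_edge_pattern_def by blast+
  have "card {a1, b1, a2, b2} \<le> k"
    using simple_graph_edge[OF simple e(1)] simple_graph_edge[OF simple e(2)] by (intro card_mono) auto
  then show ?thesis using d by simp
qed

text \<open>Vertices with many missing edges are harmless: they see fewer bad edges than missing ones.\<close>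

lemma many_bad_edges:
  fixes \<kappa> :: real
  assumes \<kappa>: "\<kappa> > 0"
  shows "\<exists>c>0. \<exists>\<delta>>0. \<exists>c0>0. \<exists>N. \<forall>n\<ge>N. \<forall>G :: 'b sgraph. \<forall>A B.
    simple_graph G \<longrightarrow> card (verts G) = n \<longrightarrow> A \<inter> B = {} \<longrightarrow> A \<union> B \<subseteq> verts G \<longrightarrow>
    real n / 3 \<le> card A \<longrightarrow> real n / 3 \<le> card B \<longrightarrow> card (missing G A B) \<le> \<delta> * real n ^ 2 \<longrightarrow>
    (\<forall>w\<in>A. card (nbrs G w \<inter> A) \<le> c * real n) \<longrightarrow> (\<forall>w\<in>B. card (nbrs G w \<inter> B) \<le> c * real n) \<longrightarrow>
    card (missing G A B) \<le> card (bad_edges G A B) \<longrightarrow> \<kappa> * real n \<le> card (bad_edges G A B) \<longrightarrow>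
    c0 * real n ^ (k - 2) \<le> card (embeddings F G)"
proof -
  obtain \<sigma> \<eta> N where \<sigma>: "\<sigma> > 0" and \<eta>: "\<eta> > 0" and N0: "\<forall>n\<ge>N. \<forall>G :: 'b sgraph. \<forall>A B E.
    simple_graph G \<longrightarrow> card (verts G) = n \<longrightarrow> A \<inter> B = {} \<longrightarrow> A \<union> B \<subseteq> verts G \<longrightarrow>
    real n / 3 \<le> card A \<longrightarrow> real n / 3 \<le> card B \<longrightarrow> card (missing G A B) \<le> \<eta> * real n ^ 2 \<longrightarrow>
    E \<subseteq> bad_edges G A B \<longrightarrow>
    (\<forall>e\<in>E. \<forall>w\<in>e. (w \<in> A \<longrightarrow> card {y \<in> B. {w, y} \<notin> edges G} \<le> \<eta> * real n) \<and>
       (w \<in> B \<longrightarrow> card {y \<in> A. {w, y} \<notin> edges G} \<le> \<eta> * real n)) \<longrightarrow>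
    card {(e, e') \<in> E \<times> E. e \<inter> e' = {}} * (\<sigma> * real n ^ (k - 4)) \<le>
      card {f \<in> embeddings F G. f ` verts F \<subseteq> A \<union> B}"
    using pairs_count[where ?'b = 'b] by (elim exE conjE) (rule that; assumption)
  note N = N0[rule_format]
  \<comment> \<open>\<open>4 * c \<le> \<eta>\<close> keeps at least half of the inner edges away
    from atypical vertices, and \<open>8 * c \<le> \<kappa>\<close> keeps the maximum inner degree
    small against the number of remaining edges, as the pair count requires.\<close>
  define c where "c = min (\<eta> / 4) (\<kappa> / 8)"
  have c: "c > 0" "4 * c \<le> \<eta>" "8 * c \<le> \<kappa>" using \<eta> \<kappa> by (auto simp: c_def)
  define c0 where "c0 = \<kappa> ^ 2 / 8 * \<sigma>"
  have c0: "c0 > 0" using \<kappa> \<sigma> by (simp add: c0_def)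
  show ?thesis
  proof (rule exI[of _ c], rule conjI[OF c(1)], rule exI[of _ \<eta>], rule conjI[OF \<eta>],
      rule exI[of _ c0], rule conjI[OF c0], rule exI[of _ "max N 1"], intro allI impI)
    fix n and G :: "'b sgraph" and A B
    assume n: "max N 1 \<le> n" and G: "simple_graph G" "card (verts G) = n" and AB: "A \<inter> B = {}" "A \<union> B \<subseteq> verts G"
      and cA: "real n / 3 \<le> card A" and cB: "real n / 3 \<le> card B"
      and miss: "card (missing G A B) \<le> \<eta> * real n ^ 2"
      and dA: "\<forall>w\<in>A. card (nbrs G w \<inter> A) \<le> c * real n" and dB: "\<forall>w\<in>B. card (nbrs G w \<inter> B) \<le> c * real n"
      and mb: "card (missing G A B) \<le> card (bad_edges G A B)" and big: "\<kappa> * real n \<le> card (bad_edges G A B)"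
    have fAB: "finite A" "finite B" using AB G finite_subset by (auto simp: simple_graph_def)
    have n0: "real n > 0" using n by simp
    define bad where "bad = bad_edges G A B"
    have fbad: "finite bad" using finite_bad_edges[OF G(1)] by (simp add: bad_def)
    \<comment> \<open>Atypical vertices: the missing pairs are at most as many as the inner edges,
      which bounds \<open>WA\<close> and \<open>WB\<close> by double counting.\<close>
    define WA where "WA = {w \<in> A. card {y \<in> B. {w, y} \<notin> edges G} > \<eta> * real n}"
    define WB where "WB = {w \<in> B. card {y \<in> A. {w, y} \<notin> edges G} > \<eta> * real n}"
    have few: "card {w \<in> P. card {y \<in> Q. {w, y} \<notin> edges G} > \<eta> * real n} * (\<eta> * real n) \<le> card (missing G P Q)"
      if "finite P" "finite Q" for P Q
    proof -
      let ?W = "{w \<in> P. card {y \<in> Q. {w, y} \<notin> edges G} > \<eta> * real n}"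
      have "missing G P Q = (SIGMA w:P. {y \<in> Q. {w, y} \<notin> edges G})" by (auto simp: missing_def)
      then have "real (card (missing G P Q)) = (\<Sum>w\<in>P. real (card {y \<in> Q. {w, y} \<notin> edges G}))"
        using that by simp
      moreover have "(\<Sum>w\<in>?W. real (card {y \<in> Q. {w, y} \<notin> edges G})) \<le> (\<Sum>w\<in>P. real (card {y \<in> Q. {w, y} \<notin> edges G}))"
        using that by (intro sum_mono2) auto
      moreover have "(\<Sum>w\<in>?W. \<eta> * real n) \<le> (\<Sum>w\<in>?W. real (card {y \<in> Q. {w, y} \<notin> edges G}))"
        by (intro sum_mono) auto
      ultimately show ?thesis by simp
    qed
    have fewA: "card WA * (\<eta> * real n) \<le> card bad" using few[OF fAB] mb unfolding WA_def bad_def by linarith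
    have fewB: "card WB * (\<eta> * real n) \<le> card bad"
      using few[OF fAB(2,1)] mb card_missing_commute[of G A B] unfolding WB_def bad_def by linarith
    define W where "W = WA \<union> WB"
    have fW: "finite W" using fAB by (auto simp: W_def WA_def WB_def)
    have "card W \<le> card WA + card WB" unfolding W_def by (rule card_Un_le)
    then have "real (card W) * (\<eta> * real n) \<le> (real (card WA) + real (card WB)) * (\<eta> * real n)"
      using \<eta> by (intro mult_right_mono) (auto simp flip: of_nat_add)
    then have fewW: "real (card W) * (\<eta> * real n) \<le> 2 * card bad" using fewA fewB by (simp add: algebra_simps)
    have deg: "card {e \<in> bad. w \<in> e} \<le> c * real n" for w
    proof -
      consider "w \<in> A" | "w \<in> B" | "w \<notin> A \<union> B" by blast
      then show ?thesis
      proof cases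
        case 1
        have "card {e \<in> bad. w \<in> e} \<le> card (nbrs G w \<inter> A)"
          using 1 AB by (intro card_edges_at_le[OF G(1)]) (auto simp: bad_def bad_edges_def)
        then show ?thesis using dA 1 by fastforce
      next
        case 2
        have "card {e \<in> bad. w \<in> e} \<le> card (nbrs G w \<inter> B)"
          using 2 AB by (intro card_edges_at_le[OF G(1)]) (auto simp: bad_def bad_edges_def)
        then show ?thesis using dB 2 by fastforce
      next
        case 3
        then have "{e \<in> bad. w \<in> e} = {}" by (auto simp: bad_def bad_edges_def)
        then have "card {e \<in> bad. w \<in> e} = 0" by (simp only: card.empty)
        then show ?thesis using c by simp
      qed
    qed
    define E where "E = {e \<in> bad. e \<inter> W = {}}"
    have fE: "finite E" using fbad by (simp add: E_def)
    have "bad \<subseteq> E \<union> (\<Union>w\<in>W. {e \<in> bad. w \<in> e})" by (auto simp: E_def)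
    then have "card bad \<le> card (E \<union> (\<Union>w\<in>W. {e \<in> bad. w \<in> e}))" using fE fW fbad by (intro card_mono) auto
    also have "\<dots> \<le> card E + (\<Sum>w\<in>W. card {e \<in> bad. w \<in> e})"
      by (rule order_trans[OF card_Un_le add_left_mono[OF card_UN_le[OF fW]]])
    finally have "real (card bad) \<le> card E + (\<Sum>w\<in>W. real (card {e \<in> bad. w \<in> e}))"
      by (metis of_nat_add of_nat_le_iff of_nat_sum)
    also have "(\<Sum>w\<in>W. real (card {e \<in> bad. w \<in> e})) \<le> (\<Sum>w\<in>W. c * real n)" using deg by (rule sum_mono)
    also have "(\<Sum>w\<in>W. c * real n) = card W * (c * real n)" by simp
    also have "\<dots> \<le> card bad / 2"
    proof -
      have "(4 * c) * (card W * real n) \<le> \<eta> * (card W * real n)"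
        using c by (intro mult_right_mono) auto
      then show ?thesis using fewW by (simp add: mult_ac)
    qed
    finally have E2: "card bad / 2 \<le> card E" by simp
    then have EK: "\<kappa> * real n / 2 \<le> card E" using big unfolding bad_def by linarith
    have "card E * (card E - 2 * (c * real n)) \<le> card {(e, e') \<in> E \<times> E. e \<inter> e' = {}}"
    proof (rule disjoint_pairs_count[OF fE])
      fix e assume "e \<in> E"
      then have "e \<in> edges G" by (auto simp: E_def bad_def bad_edges_def)
      then show "\<exists>a b. e = {a, b}" using simple_graph_edgeE[OF G(1)] by metis
    next
      fix w
      have "card {e \<in> E. w \<in> e} \<le> card {e \<in> bad. w \<in> e}" using fbad by (intro card_mono) (auto simp: E_def)
      then show "card {e \<in> E. w \<in> e} \<le> c * real n" using deg[of w] by linarith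
    qed
    moreover have "(\<kappa> * real n / 2) * (\<kappa> * real n / 4) \<le> card E * (card E - 2 * (c * real n))"
    proof (rule mult_mono)
      have "8 * c * real n \<le> \<kappa> * real n" using c n0 by simp
      then show "\<kappa> * real n / 4 \<le> card E - 2 * (c * real n)" using EK by linarith
    qed (use EK \<kappa> in auto)
    ultimately have pairs: "\<kappa> ^ 2 / 8 * real n ^ 2 \<le> card {(e, e') \<in> E \<times> E. e \<inter> e' = {}}"
      by (simp add: power2_eq_square algebra_simps)
    have "c0 * real n ^ (k - 2) = (\<kappa> ^ 2 / 8 * real n ^ 2) * (\<sigma> * real n ^ (k - 4))"
    proof -
      have "k - 2 = 2 + (k - 4)" using k_ge_4 by simp
      then show ?thesis by (simp add: c0_def power_add power2_eq_square)
    qed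
    also have "\<dots> \<le> card {(e, e') \<in> E \<times> E. e \<inter> e' = {}} * (\<sigma> * real n ^ (k - 4))"
      using pairs \<sigma> by (intro mult_right_mono) auto
    also have "\<dots> \<le> card {f \<in> embeddings F G. f ` verts F \<subseteq> A \<union> B}"
    proof (rule N[OF _ G AB cA cB miss])
      show "E \<subseteq> bad_edges G A B" by (auto simp: E_def bad_def)
    next
      fix e w assume ew: "e \<in> E" "w \<in> e"
      then have "w \<notin> W" by (auto simp: E_def)
      then show "(w \<in> A \<longrightarrow> card {y \<in> B. {w, y} \<notin> edges G} \<le> \<eta> * real n) \<and>
       (w \<in> B \<longrightarrow> card {y \<in> A. {w, y} \<notin> edges G} \<le> \<eta> * real n)"
        by (auto simp: W_def WA_def WB_def)
    qed (use n in auto)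
    also have "\<dots> \<le> card (embeddings F G)"
      using finite_embeddings[OF simple G(1)] by (intro of_nat_mono card_mono) auto
    finally show "c0 * real n ^ (k - 2) \<le> card (embeddings F G)" .
  qed
qed

text \<open>Map x and z of the type in \<open>type_ex\<close> to the two centres. They are not
  adjacent and have no common neighbour, so every other vertex has to respect at most one centre,
  and the only inner edge of the type disappears with z. That leaves linearly many choices for
  \<open>k - 2\<close> vertices.\<close>

lemma two_centres:
  fixes c :: real
  assumes c: "c > 0"
  shows "\<exists>\<delta>>0. \<exists>c0>0. \<exists>N. \<forall>n\<ge>N. \<forall>G :: 'b sgraph. \<forall>A B w w'.
    simple_graph G \<longrightarrow> card (verts G) = n \<longrightarrow> A \<union> B \<subseteq> verts G \<longrightarrow>
    card (missing G A B) \<le> \<delta> * real n ^ 2 \<longrightarrow> w \<in> verts G \<longrightarrow> w' \<in> verts G \<longrightarrow> w \<noteq> w' \<longrightarrow>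
    (\<forall>v\<in>{w, w'}. c * real n \<le> card (nbrs G v \<inter> A) \<and> c * real n \<le> card (nbrs G v \<inter> B)) \<longrightarrow>
    c0 * real n ^ (k - 2) \<le> card (embeddings F G)"
proof -
  obtain x z u C where t2: "(x, z, u, C) \<in> types2 F" and nc: "\<And>v. \<not> ({x, v} \<in> edges F \<and> {z, v} \<in> edges F)"
    using type_ex by fastforce
  have xV: "x \<in> verts F" and CV: "C \<subseteq> verts F - {x}" and zC: "z \<in> C" and uC: "u \<in> C" and zu: "{z, u} \<in> edges F"
    and bi: "\<And>a b. {a, b} \<in> edges F \<Longrightarrow> a \<noteq> x \<Longrightarrow> b \<noteq> x \<Longrightarrow> {a, b} \<noteq> {z, u} \<Longrightarrow> (a \<in> C) \<noteq> (b \<in> C)"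
    and xz: "{x, z} \<notin> edges F"
    using t2 by (auto simp: types2_def types_def)
  have xz': "x \<noteq> z" using CV zC by auto
  define T where "T = {x, z}"
  have cT: "card T = 2" using xz' by (simp add: T_def)
  obtain \<eta> N where \<eta>: "\<eta> > 0" and N: "\<And>n \<delta>. n \<ge> N \<Longrightarrow> 0 \<le> \<delta> \<Longrightarrow> \<delta> \<le> \<eta> \<Longrightarrow>
    (c / 2) ^ (k - 2) / 2 * real n ^ (k - 2) \<le> (c / 2 * real n) ^ (k - 2) - real k ^ 2 * (\<delta> + 1 / real n) * real n ^ (k - 2)"
    using power_minus_error[of "c / 2" "k - 2" k] c by auto
  have c0: "(c / 2) ^ (k - 2) / 2 > 0" using c by simp
  define N' where "N' = max N (nat \<lceil>4 / c\<rceil> + 1)"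
  show ?thesis
  proof (rule exI[of _ \<eta>], rule conjI[OF \<eta>], rule exI[of _ "(c / 2) ^ (k - 2) / 2"], rule conjI[OF c0],
      rule exI[of _ N'], intro allI impI)
    fix n and G :: "'b sgraph" and A B w w'
    assume n: "N' \<le> n" and G: "simple_graph G" "card (verts G) = n" and AB: "A \<union> B \<subseteq> verts G"
      and miss: "card (missing G A B) \<le> \<eta> * real n ^ 2" and w: "w \<in> verts G" "w' \<in> verts G" "w \<noteq> w'"
      and dg: "\<forall>v\<in>{w, w'}. c * real n \<le> card (nbrs G v \<inter> A) \<and> c * real n \<le> card (nbrs G v \<inter> B)"
    have "4 / c \<le> real n" "n \<ge> N" "n > 0" using n unfolding N'_def by linarith+
    then have n4: "4 \<le> c * real n" using c by (simp add: field_simps)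
    have fAB: "finite A" "finite B" using AB G finite_subset by (auto simp: simple_graph_def)
    define g where "g v = (if v = x then w else w')" for v
    have g: "g x = w" "g z = w'" using xz' by (auto simp: g_def)
    have gT: "g ` T = {w, w'}" by (auto simp: T_def g)
    \<comment> \<open>No vertex falls under both tests, so the order of the nested conditionals is
      immaterial.\<close>
    define S0 where "S0 v = (if {x, v} \<in> edges F then nbrs G w else if {z, v} \<in> edges F then nbrs G w' else verts G)
       \<inter> (if v \<in> C then A else B)" for v
    define S where "S v = S0 v - {w, w'}" for v
    have S0: "c * real n \<le> card (S0 v)" for v
    proof -
      have "card (nbrs G w \<inter> D) \<le> card (verts G \<inter> D)" for D
        using nbrs_subset[OF G(1)] G(1) by (intro card_mono) (auto simp: simple_graph_def)
      then show ?thesis using dg by (auto simp: S0_def intro: order_trans[OF _ of_nat_mono])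
    qed
    have "(c / 2 * real n) ^ (k - card T) - real k ^ 2 * (\<eta> + 1 / real n) * real n ^ (k - card T)
      \<le> card {f \<in> embeddings F G. (\<forall>v\<in>T. f v = g v) \<and> (\<forall>v\<in>verts F - T. f v \<in> S v)}"
    proof (rule bipartite_extension_count[where P = A and Q = B and C = C])
      fix a b assume ab: "{a, b} \<in> edges F" "a \<in> T" "b \<in> T"
      then show "{g a, g b} \<in> edges G"
        using xz simple_graph_edge(3)[OF simple ab(1)] by (auto simp: T_def insert_commute)
    next
      fix v
      have "card (S0 v - {w, w'}) \<ge> card (S0 v) - card {w, w'}"
        by (rule diff_card_le_card_Diff) simp
      moreover have "card {w, w'} \<le> 2" by (simp add: card_insert_if)
      ultimately have "real (card (S v)) \<ge> real (card (S0 v)) - 2" by (simp add: S_def)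
      then show "c / 2 * real n \<le> card (S v)" using S0[of v] n4 by simp
    next
      fix a b assume ab: "{a, b} \<in> edges F" "a \<in> T" "b \<in> verts F - T"
      then have "S b \<subseteq> nbrs G (g a)"
        using nc[of b] by (auto simp: S_def S0_def T_def g split: if_splits)
      then have "{y \<in> S b. {g a, y} \<notin> edges G} = {}" by (auto simp: nbrs_def)
      then show "real (card {y \<in> S b. {g a, y} \<notin> edges G}) \<le> \<eta> * n" using \<eta> by (simp only: card.empty) simp
    next
      fix a b assume "{a, b} \<in> edges F" "a \<notin> T" "b \<notin> T"
      then show "(a \<in> C) \<noteq> (b \<in> C)" by (intro bi) (auto simp: T_def doubleton_eq_iff)
    next
      fix v show "S v \<subseteq> (if v \<in> C then A else B) - g ` T" by (auto simp: S_def S0_def gT)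
    next
      show "T \<subseteq> verts F" using xV zC CV by (auto simp: T_def)
      show "inj_on g T" using w by (auto simp: T_def g)
    qed (use simple G n4 AB miss \<eta> w gT \<open>n > 0\<close> in auto)
    also have "\<dots> \<le> card (embeddings F G)"
      using finite_embeddings[OF simple G(1)] by (intro of_nat_mono card_mono) auto
    finally have "(c / 2 * real n) ^ (k - 2) - real k ^ 2 * (\<eta> + 1 / real n) * real n ^ (k - 2)
      \<le> card (embeddings F G)" unfolding cT .
    then show "(c / 2) ^ (k - 2) / 2 * real n ^ (k - 2) \<le> card (embeddings F G)"
      using N[of n \<eta>] \<open>n \<ge> N\<close> \<eta> by linarith
  qed
qed

end

section \<open>Copies through one bad edge\<close>

definition apex_cut :: "'a sgraph \<Rightarrow> 'a \<Rightarrow> 'a set \<Rightarrow> 'a set \<Rightarrow> bool" where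
  "apex_cut G X A B \<longleftrightarrow> verts G = insert X (A \<union> B) \<and> X \<notin> A \<union> B \<and> A \<inter> B = {}"

lemma apex_cut_card:
  assumes "simple_graph G" "apex_cut G X A B"
  shows "finite A" "finite B" "card (verts G) = Suc (card A + card B)"
proof -
  show f: "finite A" "finite B" using assms by (auto simp: apex_cut_def simple_graph_def)
  show "card (verts G) = Suc (card A + card B)"
    using assms f by (auto simp: apex_cut_def card_Un_disjoint)
qed

lemma nbrs_apex:
  assumes "simple_graph G" "apex_cut G X A B"
  shows "nbrs G X \<subseteq> A \<union> B"
  using assms nbrs_subset[of G X] simple_graph_edge(3)[of G X X] by (auto simp: apex_cut_def nbrs_def)

text \<open>\<open>card_edges_partition\<close> with the apex counted on the side of
  \<open>A\<close>: its edges into \<open>A\<close> are then inner edges and its non-neighbours in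
  \<open>B\<close> missing pairs, and the two corrections combine to the degree of the apex.\<close>

lemma card_edges_apex:
  assumes G: "simple_graph G" and cut: "apex_cut G X A B"
  shows "card (edges G) + card (missing G A B) = card A * card B + card (bad_edges G A B) + card (nbrs G X)"
proof -
  note f = apex_cut_card[OF G cut]
  have X: "X \<notin> A" "X \<notin> B" and V: "verts G = insert X (A \<union> B)" and AB: "A \<inter> B = {}"
    using cut by (auto simp: apex_cut_def)
  let ?N = "{y \<in> B. {X, y} \<notin> edges G}"
  have 1: "card (edges G) + card (missing G (insert X A) B) =
      card (insert X A) * card B + card (bad_edges G (insert X A) B)"
    using V X AB by (intro card_edges_partition[OF G]) auto
  have 2: "card (bad_edges G (insert X A) B) = card (bad_edges G A B) + card (nbrs G X \<inter> A)"
  proof -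
    have "nbrs G X \<inter> insert X A = nbrs G X \<inter> A" using simple_graph_edge(3)[OF G, of X X] by (auto simp: nbrs_def)
    then show ?thesis using card_bad_edges_remove[OF G, of X "insert X A" B] X by simp
  qed
  have 3: "card (missing G (insert X A) B) = card (missing G A B) + card ?N"
  proof -
    have "missing G (insert X A) B = missing G A B \<union> Pair X ` ?N" by (auto simp: missing_def)
    moreover have "missing G A B \<inter> Pair X ` ?N = {}" using X by (auto simp: missing_def)
    moreover have "finite (missing G A B)" "finite (Pair X ` ?N)"
      using f by (auto simp: missing_def intro: finite_subset[of _ "A \<times> B"])
    ultimately show ?thesis by (simp add: card_Un_disjoint card_image inj_on_def)
  qed
  have 4: "card B = card (nbrs G X \<inter> B) + card ?N"
  proof -
    have "B = (nbrs G X \<inter> B) \<union> ?N" "(nbrs G X \<inter> B) \<inter> ?N = {}" by (auto simp: nbrs_def)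
    then show ?thesis using f by (metis (no_types, lifting) card_Un_disjoint finite_Un)
  qed
  have 5: "card (nbrs G X) = card (nbrs G X \<inter> A) + card (nbrs G X \<inter> B)"
  proof -
    have "nbrs G X = (nbrs G X \<inter> A) \<union> (nbrs G X \<inter> B)" using nbrs_apex[OF G cut] by auto
    moreover have "(nbrs G X \<inter> A) \<inter> (nbrs G X \<inter> B) = {}" using AB by auto
    ultimately show ?thesis using f by (metis card_Un_disjoint finite_Int)
  qed
  have "card (insert X A) = Suc (card A)" using X f by simp
  then show ?thesis using 1 2 3 4 5 by simp
qed

lemma card_nonneighbours_apex:
  assumes G: "simple_graph G" and cut: "apex_cut G X A B"
  shows "card {v \<in> A \<union> B. {X, v} \<notin> edges G} + card (nbrs G X) = card (verts G) - 1"
proof -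
  note f = apex_cut_card[OF G cut]
  have AB: "A \<inter> B = {}" using cut by (simp add: apex_cut_def)
  let ?P = "{v \<in> A \<union> B. {X, v} \<notin> edges G}"
  have "?P \<union> nbrs G X = A \<union> B" "?P \<inter> nbrs G X = {}" using nbrs_apex[OF G cut] by (auto simp: nbrs_def)
  moreover have "finite ?P" "finite (nbrs G X)" using f finite_nbrs[OF G] by auto
  ultimately have "card ?P + card (nbrs G X) = card (A \<union> B)" by (metis card_Un_disjoint)
  then show ?thesis using f AB by (simp add: card_Un_disjoint)
qed

text \<open>\<open>4 * a * b = (a + b)\<^sup>2 - (a - b)\<^sup>2\<close> bounds the square of the
  difference by \<open>4 * D + 3\<close>. The cruder bound \<open>2 * D + 1\<close> on the
  difference is linear in \<open>D\<close>, like the other losses.\<close>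

lemma balanced_parts:
  fixes a b n D :: nat
  assumes n: "n = Suc (a + b)" and D: "(n - 1)\<^sup>2 div 4 \<le> a * b + D"
  shows "real n / 2 - real D - 1 \<le> real a" "real n / 2 - real D - 1 \<le> real b"
proof -
  have "(n - 1)\<^sup>2 \<le> 4 * ((n - 1)\<^sup>2 div 4) + 3" by presburger
  also have "\<dots> \<le> 4 * (a * b + D) + 3" using D by simp
  finally have "(a + b)\<^sup>2 \<le> 4 * (a * b + D) + 3" using n by simp
  then have "(int a + int b)\<^sup>2 \<le> 4 * (int a * int b + int D) + 3"
    by (metis (mono_tags, lifting) of_nat_add of_nat_le_iff of_nat_mult of_nat_numeral of_nat_power)
  then have le: "(int a - int b)\<^sup>2 \<le> 4 * int D + 3" by (simp add: power2_eq_square algebra_simps)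
  have "\<bar>int a - int b\<bar> \<le> 2 * int D + 1"
  proof (rule ccontr)
    assume "\<not> ?thesis"
    then have "2 * int D + 2 \<le> \<bar>int a - int b\<bar>" by simp
    then have "(2 * int D + 2)\<^sup>2 \<le> \<bar>int a - int b\<bar>\<^sup>2" by (intro power_mono) auto
    then have "(2 * int D + 2)\<^sup>2 \<le> 4 * int D + 3" using le by simp
    moreover have "(2 * int D + 2)\<^sup>2 = 4 * (int D * int D) + 8 * int D + 4" by (simp add: power2_eq_square algebra_simps)
    moreover have "int D * int D \<ge> 0" by simp
    ultimately show False by linarith
  qed
  then show "real n / 2 - real D - 1 \<le> real a" "real n / 2 - real D - 1 \<le> real b" using n by linarith+
qed

lemma power_diff_lower:
  fixes x y :: real
  assumes "0 \<le> y" "y \<le> x"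
  shows "x ^ m - real m * y * x ^ (m - 1) \<le> (x - y) ^ m"
proof (cases "x = 0")
  case True
  then show ?thesis using assms by (cases m) auto
next
  case False
  then have x: "x > 0" using assms by simp
  have "x ^ m + real m * x ^ m * ((x - y) / x - 1) \<le> (x - y) ^ m"
    using power_tangent[of "x - y" x m] x assms by simp
  moreover have "real m * x ^ m * ((x - y) / x - 1) = - (real m * y * x ^ (m - 1))"
    using x by (cases m) (simp_all add: field_simps)
  ultimately show ?thesis by simp
qed

text \<open>The copies responsible for the main term. The star and pair copies counted later fail
  one of the two conditions, so the counts can be added.\<close>

definition single_type :: "'a sgraph \<Rightarrow> 'b \<Rightarrow> 'b set \<Rightarrow> 'b set \<Rightarrow> ('a \<Rightarrow> 'b) \<Rightarrow> bool" where
  "single_type F X A B f \<longleftrightarrow> X \<in> f ` verts F \<and> card {e \<in> edges F. f ` e \<subseteq> A \<or> f ` e \<subseteq> B} = 1"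

context template
begin

lemma types_subset: "types F \<subseteq> verts F \<times> verts F \<times> verts F \<times> Pow (verts F)"
  using simple_graph_edge[OF simple] by (auto simp: types_def)

lemma finite_types [simp]: "finite (types F)"
  by (rule finite_subset[OF types_subset]) auto

lemma finite_types2 [simp]: "finite (types2 F)"
  by (rule finite_subset[OF _ finite_types]) (auto simp: types2_def)

lemma types2_subset: "types2 F \<subseteq> types F" "types2 F \<subseteq> types1 F" "types1 F \<subseteq> types F"
  by (auto simp: types2_def types1_def)

lemma types2_pos: "card (types2 F) > 0"
  using type_ex by (auto simp: card_gt_0_iff)

lemma k_ge_3: "3 \<le> k"
  using k_ge_4 by simp

text \<open>\<open>4 * k\<close> accounts for sides smaller than n / 2 by up to
  \<open>D + 4\<close>, which is at most \<open>4 * (D + 1)\<close>; \<open>k ^ 2\<close> is the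
  error of \<open>extension_count\<close>.\<close>

definition err :: real where "err = 4 * real k + real k ^ 2"

lemma err_pos: "err > 0"
  using k_pos by (simp add: err_def add_pos_nonneg)

text \<open>Every inner edge together with every type yields about \<open>(n / 2) ^ (k - 3)\<close>
  embeddings, and an embedding determines both: exactly one edge of F goes into a side, its image is
  the inner edge, and the sides of the other images give \<open>C\<close>. The number
  \<open>D\<close> bounds all defects at once. If the apex is not joined to everything, only types
  in \<open>types2\<close> are allowed.\<close>

lemma single_extension_count:
  fixes G :: "'b sgraph" and D :: nat
  assumes G: "simple_graph G" and n: "n = card (verts G)" and cut: "apex_cut G X A B"
    and p: "card {v \<in> A \<union> B. {X, v} \<notin> edges G} \<le> D" and miss: "card (missing G A B) \<le> D"
    and imb: "(n - 1)\<^sup>2 div 4 \<le> card A * card B + D" and Dn: "real D + 4 \<le> real n / 2"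
    and TS: "TS \<subseteq> types F" "TS \<subseteq> types2 F \<or> (\<forall>v\<in>A \<union> B. {X, v} \<in> edges G)"
  shows "card (bad_edges G A B) * (card TS * ((real n / 2) ^ (k - 3) - err * (real D + 1) * real n ^ (k - 3) / real n))
    \<le> card {f \<in> embeddings F G. single_type F X A B f}"
proof -
  note f = apex_cut_card[OF G cut]
  have X: "X \<notin> A" "X \<notin> B" and V: "verts G = insert X (A \<union> B)" and AB: "A \<inter> B = {}"
    using cut by (auto simp: apex_cut_def)
  have n0: "real n > 0" using Dn by linarith
  let ?m = "k - 3"
  define bad where "bad = bad_edges G A B"
  define P where "P e = (if e \<subseteq> A then A else B)" for e
  define Q where "Q e = (if e \<subseteq> A then B else A)" for e
  \<comment> \<open>A fixed orientation of each inner edge. It separates the types (x, z, u, C) and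
    (x, u, z, C), whose embeddings would otherwise be the same.\<close>
  define od where "od e = (SOME p. e = {fst p, snd p})" for e :: "'b set"
  have od: "e = {fst (od e), snd (od e)}" if "e \<in> bad" for e
  proof -
    have "e \<in> edges G" using that by (simp add: bad_def bad_edges_def)
    then obtain a b where "e = {a, b}" using simple_graph_edgeE[OF G] by metis
    then have "\<exists>p. e = {fst p, snd p}" by (intro exI[of _ "(a, b)"]) simp
    then show ?thesis unfolding od_def by (rule someI_ex)
  qed
  define Y where "Y q = (case q of (e, x, z, u, C) \<Rightarrow> {f \<in> embeddings F G. f x = X \<and> f z = fst (od e) \<and> f u = snd (od e) \<and>
      (\<forall>v\<in>verts F - {x}. f v \<in> (if v \<in> C then P e else Q e))})" for q
  have mono: "{d \<in> edges F. f ` d \<subseteq> A \<or> f ` d \<subseteq> B} = {{z, u}}" "f ` {z, u} = e"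
    if q: "e \<in> bad" "(x, z, u, C) \<in> types F" "f \<in> Y (e, x, z, u, C)" for f e x z u C
  proof -
    have t: "C \<subseteq> verts F - {x}" "z \<in> C" "u \<in> C" "{z, u} \<in> edges F"
      and tb: "\<And>a b. {a, b} \<in> edges F \<Longrightarrow> a \<noteq> x \<Longrightarrow> b \<noteq> x \<Longrightarrow> {a, b} \<noteq> {z, u} \<Longrightarrow> (a \<in> C) \<noteq> (b \<in> C)"
      using q(2) by (auto simp: types_def)
    have fx: "f x = X" and fz: "f z = fst (od e)" "f u = snd (od e)"
      and fs: "\<And>v. v \<in> verts F \<Longrightarrow> v \<noteq> x \<Longrightarrow> f v \<in> (if v \<in> C then P e else Q e)"
      using q(3) by (auto simp: Y_def)
    show fe: "f ` {z, u} = e" using fz od[OF q(1)] by simp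
    have eAB: "e \<subseteq> A \<or> e \<subseteq> B" using q(1) by (simp add: bad_def bad_edges_def)
    show "{d \<in> edges F. f ` d \<subseteq> A \<or> f ` d \<subseteq> B} = {{z, u}}"
    proof
      show "{{z, u}} \<subseteq> {d \<in> edges F. f ` d \<subseteq> A \<or> f ` d \<subseteq> B}" using t fe eAB by auto
      show "{d \<in> edges F. f ` d \<subseteq> A \<or> f ` d \<subseteq> B} \<subseteq> {{z, u}}"
      proof
        fix d assume d: "d \<in> {d \<in> edges F. f ` d \<subseteq> A \<or> f ` d \<subseteq> B}"
        then have "d \<in> edges F" by simp
        then obtain a b where ab: "d = {a, b}" "a \<in> verts F" "b \<in> verts F" using simple_graph_edgeE[OF simple] by metis
        have "a \<noteq> x" "b \<noteq> x" using d ab fx X by auto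
        then have "f a \<in> (if a \<in> C then P e else Q e)" "f b \<in> (if b \<in> C then P e else Q e)" using fs ab by auto
        then have "(a \<in> C) = (b \<in> C)" using d ab AB unfolding P_def Q_def by (cases "a \<in> C"; cases "b \<in> C"; cases "e \<subseteq> A") auto
        then show "d \<in> {{z, u}}" using tb[of a b] d ab \<open>a \<noteq> x\<close> \<open>b \<noteq> x\<close> by auto
      qed
    qed
  qed
  have lower: "(real n / 2) ^ ?m - err * (real D + 1) * real n ^ ?m / real n \<le> card (Y q)"
    if q: "q \<in> bad \<times> TS" for q
  proof -
    obtain e x z u C where qe: "q = (e, x, z, u, C)" and e: "e \<in> bad" and tS: "(x, z, u, C) \<in> TS"
      using q by auto
    have t: "x \<in> verts F" "C \<subseteq> verts F - {x}" "z \<in> C" "u \<in> C" "{z, u} \<in> edges F"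
      and tb: "\<And>a b. {a, b} \<in> edges F \<Longrightarrow> a \<noteq> x \<Longrightarrow> b \<noteq> x \<Longrightarrow> {a, b} \<noteq> {z, u} \<Longrightarrow> (a \<in> C) \<noteq> (b \<in> C)"
      using tS TS(1) by (auto simp: types_def)
    have eG: "e \<in> edges G" and eP: "e \<subseteq> P e" using e by (auto simp: bad_def bad_edges_def P_def)
    define ze where "ze = fst (od e)"
    define ue where "ue = snd (od e)"
    have ezu: "e = {ze, ue}" using od[OF e] by (simp add: ze_def ue_def)
    have zune: "ze \<noteq> ue" using eG ezu simple_graph_edge(3)[OF G] by auto
    have zP: "ze \<in> P e" "ue \<in> P e" using eP ezu by auto
    have PQ: "P e \<inter> Q e = {}" "P e \<union> Q e = A \<union> B" using AB by (auto simp: P_def Q_def)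
    have PQf: "finite (P e)" "finite (Q e)" using f by (auto simp: P_def Q_def)
    have PQX: "X \<notin> P e" "X \<notin> Q e" using X by (auto simp: P_def Q_def)
    have misPQ: "card (missing G (P e) (Q e)) \<le> D"
      using miss card_missing_commute[of G A B] by (simp add: P_def Q_def)
    have xzu: "x \<noteq> z" "x \<noteq> u" "z \<noteq> u" using t simple_graph_edge(3)[OF simple] by auto
    define T where "T = {x, z, u}"
    have cT: "card T = 3" using xzu by (simp add: T_def)
    define g where "g v = (if v = x then X else if v = z then ze else ue)" for v
    have g: "g x = X" "g z = ze" "g u = ue" using xzu by (auto simp: g_def)
    have gT: "g ` T = {X, ze, ue}" by (auto simp: T_def g)
    define S where "S v = (if v \<in> C then P e else Q e) - {X, ze, ue}" for v
    have r0: "0 \<le> real n / 2 - (real D + 4)" using Dn by simp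
    \<comment> \<open>At most \<open>D\<close> pairs are missing in all, hence at most
      \<open>D\<close> at any vertex, so the density of defects is \<open>D / n\<close>. A side has
      at least n / 2 - D - 1 vertices, of which at most two are ends of the inner edge.\<close>
    have "(real n / 2 - (real D + 4)) ^ (k - card T) - real k ^ 2 * (real D / real n + 1 / real n) * real n ^ (k - card T)
      \<le> card {f \<in> embeddings F G. (\<forall>v\<in>T. f v = g v) \<and> (\<forall>v\<in>verts F - T. f v \<in> S v)}"
    proof (rule bipartite_extension_count[where P = "P e" and Q = "Q e" and C = C])
      fix a b assume ab: "{a, b} \<in> edges F" "a \<in> T" "b \<in> T"
      have "{x, z} \<notin> edges F \<or> {X, ze} \<in> edges G" "{x, u} \<notin> edges F \<or> {X, ue} \<in> edges G"
        using TS(2) tS zP PQ(2) by (auto simp: types2_def)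
      moreover have "a \<noteq> b" using simple_graph_edge(3)[OF simple ab(1)] .
      ultimately show "{g a, g b} \<in> edges G"
        using ab eG ezu by (auto simp: T_def g insert_commute)
    next
      fix v
      have "card (S v) \<ge> card (if v \<in> C then P e else Q e) - card {ze, ue}"
      proof -
        have "S v = (if v \<in> C then P e else Q e) - {ze, ue}" using PQX by (auto simp: S_def)
        then show ?thesis by (metis diff_card_le_card_Diff finite.emptyI finite_insert)
      qed
      moreover have "card {ze, ue} = 2" using zune by simp
      moreover have "real n / 2 - real D - 1 \<le> card (if v \<in> C then P e else Q e)"
        using balanced_parts[OF _ imb] n f by (auto simp: P_def Q_def)
      ultimately show "real n / 2 - (real D + 4) \<le> card (S v)" by linarith
    next
      fix a b assume ab: "{a, b} \<in> edges F" "a \<in> T" "b \<in> verts F - T"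
      have "card {y \<in> S b. {g a, y} \<notin> edges G} \<le> D"
      proof (cases "a = x")
        case True
        have "card {y \<in> S b. {g a, y} \<notin> edges G} \<le> card {v \<in> A \<union> B. {X, v} \<notin> edges G}"
          using True f PQ by (intro card_mono) (auto simp: S_def g split: if_splits)
        then show ?thesis using p by simp
      next
        case False
        then have a: "a = z \<or> a = u" using ab by (auto simp: T_def)
        have "(a \<in> C) \<noteq> (b \<in> C)"
        proof (rule tb[OF ab(1) False])
          show "b \<noteq> x" using ab by (auto simp: T_def)
          show "{a, b} \<noteq> {z, u}" using ab by (auto simp: T_def doubleton_eq_iff)
        qed
        then have "b \<notin> C" using a t by auto
        then have "card {y \<in> S b. {g a, y} \<notin> edges G} \<le> card {y \<in> Q e. {g a, y} \<notin> edges G}"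
          using PQf by (intro card_mono) (auto simp: S_def)
        also have "\<dots> = card (Pair (g a) ` {y \<in> Q e. {g a, y} \<notin> edges G})"
          by (rule card_image[symmetric]) (simp add: inj_on_def)
        also have "\<dots> \<le> card (missing G (P e) (Q e))"
        proof (rule card_mono)
          show "finite (missing G (P e) (Q e))"
            using PQf by (auto simp: missing_def intro: finite_subset[of _ "P e \<times> Q e"])
          have "g a \<in> P e" using a g zP by auto
          then show "Pair (g a) ` {y \<in> Q e. {g a, y} \<notin> edges G} \<subseteq> missing G (P e) (Q e)"
            by (auto simp: missing_def)
        qed
        finally show ?thesis using misPQ by simp
      qed
      then show "real (card {y \<in> S b. {g a, y} \<notin> edges G}) \<le> real D / real n * real n" using n0 by simp
    next
      have "real (card (missing G (P e) (Q e))) \<le> real D * 1" using misPQ by simp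
      also have "\<dots> \<le> real D * real n" using n0 by (intro mult_left_mono) auto
      also have "\<dots> = real D / real n * real n ^ 2" using n0 by (simp add: power2_eq_square)
      finally show "real (card (missing G (P e) (Q e))) \<le> real D / real n * real n ^ 2" .
    next
      fix a b assume "{a, b} \<in> edges F" "a \<notin> T" "b \<notin> T"
      then show "(a \<in> C) \<noteq> (b \<in> C)" by (intro tb) (auto simp: T_def doubleton_eq_iff)
    next
      fix v show "S v \<subseteq> (if v \<in> C then P e else Q e) - g ` T" by (simp add: S_def gT)
    next
      show "T \<subseteq> verts F" using t by (auto simp: T_def)
      have "X \<noteq> ze" "X \<noteq> ue" using zP PQX by auto
      then have "card (g ` T) = 3" using zune unfolding gT by simp
      then show "inj_on g T" using cT by (intro eq_card_imp_inj_on) (auto simp: T_def)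
      show "g ` T \<subseteq> verts G" using zP PQ V unfolding gT by auto
      show "P e \<subseteq> verts G" "Q e \<subseteq> verts G" using PQ V by auto
      show "0 < n" using n0 by simp
    qed (use simple G n r0 in auto)
    also have "\<dots> \<le> card (Y q)"
    proof (intro of_nat_mono card_mono)
      show "finite (Y q)" using finite_embeddings[OF simple G] by (auto simp: Y_def qe)
      show "{f \<in> embeddings F G. (\<forall>v\<in>T. f v = g v) \<and> (\<forall>v\<in>verts F - T. f v \<in> S v)} \<subseteq> Y q"
      proof
        fix h assume h: "h \<in> {f \<in> embeddings F G. (\<forall>v\<in>T. f v = g v) \<and> (\<forall>v\<in>verts F - T. f v \<in> S v)}"
        have hg: "h x = X" "h z = ze" "h u = ue" using h g by (auto simp: T_def)
        have "h v \<in> (if v \<in> C then P e else Q e)" if "v \<in> verts F - {x}" for v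
        proof (cases "v \<in> T")
          case True
          then have "v = z \<or> v = u" using that by (auto simp: T_def)
          then show ?thesis using hg zP t by auto
        next
          case False
          then have "h v \<in> S v" using h that by blast
          then show ?thesis by (auto simp: S_def)
        qed
        then show "h \<in> Y q" using h hg by (simp add: Y_def qe ze_def ue_def)
      qed
    qed
    finally have "(real n / 2 - (real D + 4)) ^ ?m - real k ^ 2 * (real D / real n + 1 / real n) * real n ^ ?m \<le> card (Y q)"
      unfolding cT .
    moreover have "(real n / 2) ^ ?m - real ?m * (real D + 4) * (real n / 2) ^ (?m - 1) \<le> (real n / 2 - (real D + 4)) ^ ?m"
      using Dn by (intro power_diff_lower) auto
    moreover have "real ?m * (real D + 4) * (real n / 2) ^ (?m - 1) \<le> 4 * real k * (real D + 1) * (real n ^ ?m / real n)"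
    proof (cases "?m = 0")
      case False
      then have "real n ^ ?m / real n = real n ^ (?m - 1)" using n0 by (simp add: power_eq_if)
      moreover have "real ?m * (real D + 4) * (real n / 2) ^ (?m - 1) \<le> (real k * (4 * (real D + 1))) * real n ^ (?m - 1)"
        using n0 by (intro mult_mono power_mono) auto
      ultimately show ?thesis by (simp only: mult_ac)
    qed (use n0 in simp)
    moreover have "real k ^ 2 * (real D / real n + 1 / real n) * real n ^ ?m = real k ^ 2 * (real D + 1) * (real n ^ ?m / real n)"
      by (simp add: add_divide_distrib ring_distribs)
    moreover have "err * (real D + 1) * real n ^ ?m / real n =
      4 * real k * (real D + 1) * (real n ^ ?m / real n) + real k ^ 2 * (real D + 1) * (real n ^ ?m / real n)"
      by (simp add: err_def add_divide_distrib ring_distribs)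
    ultimately show ?thesis by linarith
  qed
  have fb: "finite bad" using finite_bad_edges[OF G] by (simp add: bad_def)
  have fTS: "finite TS" using TS(1) finite_subset finite_types by blast
  have "card (bad \<times> TS) * ((real n / 2) ^ ?m - err * (real D + 1) * real n ^ ?m / real n) \<le>
    card {f \<in> embeddings F G. single_type F X A B f}"
  proof (rule card_ge_disjoint_family[where Y = Y, OF _ _ _ _ lower])
    show "finite {f \<in> embeddings F G. single_type F X A B f}" using finite_embeddings[OF simple G] by simp
    show "finite (bad \<times> TS)" using fb fTS by simp
    fix q assume q: "q \<in> bad \<times> TS"
    show "Y q \<subseteq> {f \<in> embeddings F G. single_type F X A B f}"
    proof
      fix h assume h: "h \<in> Y q"
      obtain e x z u C where qe: "q = (e, x, z, u, C)" "e \<in> bad" "(x, z, u, C) \<in> types F" using q TS(1) by auto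
      have "h \<in> embeddings F G" "h x = X" using h by (auto simp: Y_def qe)
      moreover have "x \<in> verts F" using qe by (simp add: types_def)
      ultimately show "h \<in> {f \<in> embeddings F G. single_type F X A B f}"
        using mono(1)[OF qe(2,3)] h qe(1) by (auto simp: single_type_def)
    qed
  next
    show "disjoint_family_on Y (bad \<times> TS)"
      unfolding disjoint_family_on_def
    proof (intro ballI impI)
      fix q q' assume q: "q \<in> bad \<times> TS" "q' \<in> bad \<times> TS" "q \<noteq> q'"
      obtain e x z u C where qe: "q = (e, x, z, u, C)" "e \<in> bad" "(x, z, u, C) \<in> types F" using q TS(1) by auto
      obtain e' x' z' u' C' where qe': "q' = (e', x', z', u', C')" "e' \<in> bad" "(x', z', u', C') \<in> types F" using q TS(1) by auto
      show "Y q \<inter> Y q' = {}"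
      proof (rule ccontr)
        assume "Y q \<inter> Y q' \<noteq> {}"
        then obtain h where h: "h \<in> Y (e, x, z, u, C)" "h \<in> Y (e', x', z', u', C')" using qe qe' by auto
        have "{z, u} = {z', u'}" using mono(1)[OF qe(2,3) h(1)] mono(1)[OF qe'(2,3) h(2)] by simp
        then have ee: "e = e'" using mono(2)[OF qe(2,3) h(1)] mono(2)[OF qe'(2,3) h(2)] by simp
        have inj: "inj_on h (verts F)" using h by (auto simp: Y_def embeddings_def)
        have tv: "x \<in> verts F" "z \<in> verts F" "u \<in> verts F" "x' \<in> verts F" "z' \<in> verts F" "u' \<in> verts F"
          and CC: "C \<subseteq> verts F - {x}" "C' \<subseteq> verts F - {x'}"
          using qe(3) qe'(3) by (auto simp: types_def)
        have hv: "h x = h x'" "h z = h z'" "h u = h u'" using h ee by (auto simp: Y_def)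
        then have xx: "x = x'" "z = z'" "u = u'" using inj tv by (auto dest: inj_onD)
        have "v \<in> C \<longleftrightarrow> v \<in> C'" if v: "v \<in> verts F - {x}" for v
        proof -
          have "\<forall>v\<in>verts F - {x}. h v \<in> (if v \<in> C then P e else Q e)"
            "\<forall>v\<in>verts F - {x'}. h v \<in> (if v \<in> C' then P e' else Q e')"
            using h by (simp_all add: Y_def)
          then have "h v \<in> (if v \<in> C then P e else Q e)" "h v \<in> (if v \<in> C' then P e else Q e)"
            using v ee xx by blast+
          then show ?thesis using AB by (auto simp: P_def Q_def split: if_splits)
        qed
        then have "C = C'" using CC xx by auto
        then show False using q(3) qe(1) qe'(1) ee xx by simp
      qed
    qed
  qed
  then show ?thesis by (simp add: bad_def card_cartesian_product mult_ac)
qed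

end

section \<open>The dichotomy for graphs with few copies\<close>

definition apex_edges :: "'a \<Rightarrow> 'a set \<Rightarrow> 'a set \<Rightarrow> 'a set set" where
  "apex_edges X A B = {e. \<exists>v\<in>A \<union> B. e = {X, v}} \<union> {e. \<exists>a\<in>A. \<exists>b\<in>B. e = {a, b}}"

text \<open>The condition on \<open>card A * card B\<close> says that the sizes differ by at most one.\<close>

definition apex_core :: "'a sgraph \<Rightarrow> 'a \<Rightarrow> 'a set \<Rightarrow> 'a set \<Rightarrow> bool" where
  "apex_core G X A B \<longleftrightarrow> apex_cut G X A B \<and> apex_edges X A B \<subseteq> edges G \<and>
     card A * card B = (card (verts G) - 1)\<^sup>2 div 4"

text \<open>Edge number of a vertex joined to a balanced complete bipartite graph on the other
  \<open>n - 1\<close> vertices.\<close>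

definition apex_size :: "nat \<Rightarrow> nat" where
  "apex_size n = (n - 1)\<^sup>2 div 4 + (n - 1)"

lemma prod_le_quarter: "a * b \<le> (a + b)\<^sup>2 div (4 :: nat)"
proof -
  have "0 \<le> (int a - int b)\<^sup>2" by simp
  then have "4 * (int a * int b) \<le> (int a + int b)\<^sup>2" by (simp add: power2_eq_square algebra_simps)
  then have "4 * (a * b) \<le> (a + b)\<^sup>2"
    by (metis (mono_tags, lifting) of_nat_add of_nat_le_iff of_nat_mult of_nat_numeral of_nat_power)
  then show ?thesis by presburger
qed

lemma apex_size_ge: "n \<ge> 6 \<Longrightarrow> real n ^ 2 / 4 + real n / 4 \<le> real (apex_size n)"
proof -
  assume n: "n \<ge> 6"
  have "(n - 1)\<^sup>2 \<le> 4 * ((n - 1)\<^sup>2 div 4) + 3" by presburger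
  from of_nat_mono[OF this, where 'a = real]
  have "(real n - 1) ^ 2 \<le> 4 * real ((n - 1)\<^sup>2 div 4) + 3" using n by (simp add: of_nat_diff)
  moreover have "real (apex_size n) = real ((n - 1)\<^sup>2 div 4) + (real n - 1)" using n by (simp add: apex_size_def of_nat_diff)
  ultimately show ?thesis using n by (simp add: power2_eq_square algebra_simps)
qed

lemma parts_near_half:
  fixes a b n :: nat and \<delta> :: real
  assumes n: "a + b = n" and ab: "real n ^ 2 / 4 - \<delta> * real n ^ 2 \<le> real a * real b"
    and \<gamma>: "4 * \<delta> \<le> \<gamma> ^ 2" "0 \<le> \<gamma>"
  shows "\<bar>real a - real n / 2\<bar> \<le> \<gamma> * real n / 2" "\<bar>real b - real n / 2\<bar> \<le> \<gamma> * real n / 2"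
proof -
  have nr: "real n = real a + real b" using n by auto
  have "(real a - real b) ^ 2 = real n ^ 2 - 4 * (real a * real b)"
    unfolding nr by (simp add: power2_eq_square algebra_simps)
  also have "\<dots> \<le> (4 * \<delta>) * real n ^ 2" using ab by linarith
  also have "\<dots> \<le> \<gamma> ^ 2 * real n ^ 2" using \<gamma> by (intro mult_right_mono) auto
  also have "\<dots> = (\<gamma> * real n) ^ 2" by (simp add: power_mult_distrib)
  finally have "\<bar>real a - real b\<bar> \<le> \<bar>\<gamma> * real n\<bar>" by (simp only: abs_le_square_iff)
  then have "\<bar>real a - real b\<bar> \<le> \<gamma> * real n" using \<gamma> by simp
  then show "\<bar>real a - real n / 2\<bar> \<le> \<gamma> * real n / 2" "\<bar>real b - real n / 2\<bar> \<le> \<gamma> * real n / 2"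
    using nr by linarith+
qed

lemma missing_mono: "A' \<subseteq> A \<Longrightarrow> B' \<subseteq> B \<Longrightarrow> missing G A' B' \<subseteq> missing G A B"
  by (auto simp: missing_def)

lemma finite_missing: "finite A \<Longrightarrow> finite B \<Longrightarrow> finite (missing G A B)"
  by (auto simp: missing_def intro: finite_subset[of _ "A \<times> B"])

context template
begin

text \<open>Asymptotic number of embeddings per inner edge that hold even in a graph with defects,
  hence \<open>types2\<close> rather than \<open>types\<close>.\<close>

definition main_term :: "nat \<Rightarrow> real" where
  "main_term n = real (card (types2 F)) * (real n / 2) ^ (k - 3)"

text \<open>Each of the \<open>q + D\<close> bad edges loses only a proportion \<open>O(D / n)\<close> of its embeddings, a total loss
  of a small multiple of \<open>D\<close>, whereas the \<open>D\<close> surplus edges gain \<open>D\<close> times the main term.\<close>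

lemma deficient_count:
  "\<exists>\<kappa>>0. \<forall>n>0. \<forall>G :: 'b sgraph. \<forall>X A B q D. simple_graph G \<longrightarrow> n = card (verts G) \<longrightarrow> apex_cut G X A B \<longrightarrow>
    card {v \<in> A \<union> B. {X, v} \<notin> edges G} \<le> D \<longrightarrow> card (missing G A B) \<le> D \<longrightarrow>
    (n - 1)\<^sup>2 div 4 \<le> card A * card B + D \<longrightarrow> card (bad_edges G A B) = q + D \<longrightarrow> D \<ge> 1 \<longrightarrow>
    real (q + D) \<le> \<kappa> * real n \<longrightarrow> 32 \<le> n \<longrightarrow> (real q + 1 / 2) * main_term n \<le> card (embeddings F G)"
proof -
  \<comment> \<open>The bound 1 / 8 leaves room for \<open>D + 4 \<le> n / 2\<close>. With
    \<open>D + 1 \<le> 2 * D\<close>, the other bound makes the total loss at most half of the gain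
    from the \<open>D\<close> surplus edges.\<close>
  define \<kappa> where "\<kappa> = min (1 / 8) ((1 / 2) ^ (k - 3) / (4 * err))"
  have \<kappa>: "\<kappa> > 0" "\<kappa> \<le> 1 / 8" "4 * err * \<kappa> \<le> (1 / 2) ^ (k - 3)"
    using err_pos by (auto simp: \<kappa>_def min_def field_simps)
  show ?thesis
  proof (rule exI[of _ \<kappa>], rule conjI[OF \<kappa>(1)], intro allI impI)
    fix n and G :: "'b sgraph" and X A B and q D :: nat
    assume n: "n > 0" "n = card (verts G)" and G: "simple_graph G" and cut: "apex_cut G X A B"
      and p: "card {v \<in> A \<union> B. {X, v} \<notin> edges G} \<le> D" and miss: "card (missing G A B) \<le> D"
      and imb: "(n - 1)\<^sup>2 div 4 \<le> card A * card B + D" and bad: "card (bad_edges G A B) = q + D"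
      and D: "D \<ge> 1" and qD: "real (q + D) \<le> \<kappa> * real n" and n32: "32 \<le> n"
    have "\<kappa> * real n \<le> real n / 8" using \<kappa>(2) n mult_right_mono[of \<kappa> "1 / 8" "real n"] by simp
    then have "real (q + D) \<le> real n / 8" using qD by linarith
    moreover have "real D \<le> real (q + D)" "32 \<le> real n" using n32 by auto
    ultimately have Dn: "real D + 4 \<le> real n / 2" by linarith
    define x where "x = (real n / 2) ^ (k - 3)"
    define y where "y = real n ^ (k - 3)"
    have xy: "x = (1 / 2) ^ (k - 3) * y" by (simp add: x_def y_def power_divide)
    have y0: "y > 0" using n by (simp add: y_def)
    have count: "card (bad_edges G A B) * (card (types2 F) * (x - err * (real D + 1) * y / real n))
      \<le> card {f \<in> embeddings F G. single_type F X A B f}"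
      unfolding x_def y_def using types2_subset by (intro single_extension_count[OF G n(2) cut p miss imb Dn]) auto
    have "real (q + D) * (err * (real D + 1) * y / real n) \<le> (\<kappa> * real n) * (err * (2 * real D) * y / real n)"
      using qD D err_pos y0 n by (intro mult_mono divide_right_mono mult_right_mono mult_left_mono) auto
    also have "\<dots> = (4 * err * \<kappa>) * (real D * y / 2)" using n by simp
    also have "\<dots> \<le> (1 / 2) ^ (k - 3) * (real D * y / 2)" using \<kappa>(3) y0 by (intro mult_right_mono) auto
    also have "\<dots> = real D * x / 2" by (simp add: xy)
    finally have loss: "real (q + D) * (err * (real D + 1) * y / real n) \<le> real D * x / 2" .
    have x0: "x \<ge> 0" by (simp add: x_def)
    have "x \<le> real D * x" using D x0 by (metis mult_1 mult_right_mono of_nat_1 of_nat_le_iff)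
    then have "(real q + 1 / 2) * x \<le> real (q + D) * (x - err * (real D + 1) * y / real n)"
    proof -
      have "real (q + D) * (x - L) = real q * x + real D * x - real (q + D) * L" for L
        by (simp add: algebra_simps)
      moreover have "(real q + 1 / 2) * x = real q * x + x / 2" by (simp add: algebra_simps)
      ultimately show ?thesis using loss \<open>x \<le> real D * x\<close> by (smt (verit) field_sum_of_halves)
    qed
    then have "real (card (types2 F)) * ((real q + 1 / 2) * x) \<le> real (card (types2 F)) * (real (q + D) * (x - err * (real D + 1) * y / real n))"
      by (rule mult_left_mono) simp
    then have "(real q + 1 / 2) * main_term n \<le> card (bad_edges G A B) * (card (types2 F) * (x - err * (real D + 1) * y / real n))"
      unfolding bad by (simp add: main_term_def x_def mult_ac)
    also note count
    also have "card {f \<in> embeddings F G. single_type F X A B f} \<le> card (embeddings F G)"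
      using finite_embeddings[OF simple G] by (intro card_mono) auto
    finally show "(real q + 1 / 2) * main_term n \<le> card (embeddings F G)" by simp
  qed
qed

text \<open>Unless copies are far too many, there is one vertex of linear degree to both sides of a
  maximum cut. It is taken as apex, and the total defect \<open>D\<close> of the graph against the
  ideal core decides: \<open>D = 0\<close> is a core, and \<open>D \<ge> 1\<close> forces
  \<open>q + D\<close> inner edges. The half in \<open>q + 1 / 2\<close> is the margin by which the
  star construction later wins.\<close>

theorem core_or_many_copies:
  "\<exists>\<epsilon>>0. \<exists>N. \<forall>n\<ge>N. \<forall>G :: 'b sgraph. \<forall>q. simple_graph G \<longrightarrow> card (verts G) = n \<longrightarrow>
    card (edges G) = apex_size n + q \<longrightarrow> real q \<le> \<epsilon> * real n \<longrightarrow>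
    (\<exists>X A B. apex_core G X A B) \<or> (real q + 1 / 2) * main_term n \<le> card (embeddings F G)"
proof -
  obtain \<kappa>0 where \<kappa>0: "\<kappa>0 > 0" and final: "\<forall>n>0. \<forall>G :: 'b sgraph. \<forall>X A B q D. simple_graph G \<longrightarrow> n = card (verts G) \<longrightarrow> apex_cut G X A B \<longrightarrow>
    card {v \<in> A \<union> B. {X, v} \<notin> edges G} \<le> D \<longrightarrow> card (missing G A B) \<le> D \<longrightarrow>
    (n - 1)\<^sup>2 div 4 \<le> card A * card B + D \<longrightarrow> card (bad_edges G A B) = q + D \<longrightarrow> D \<ge> 1 \<longrightarrow>
    real (q + D) \<le> \<kappa>0 * real n \<longrightarrow> 32 \<le> n \<longrightarrow> (real q + 1 / 2) * main_term n \<le> card (embeddings F G)"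
    using deficient_count[where ?'b = 'b] by (elim exE conjE) (rule that; assumption)
  define \<kappa> where "\<kappa> = min \<kappa>0 (1 / 8)"
  have \<kappa>: "\<kappa> > 0" "\<kappa> \<le> \<kappa>0" "\<kappa> \<le> 1 / 8" using \<kappa>0 by (auto simp: \<kappa>_def)
  obtain c \<delta>1 c1 N1 where c: "c > 0" and \<delta>1: "\<delta>1 > 0" and c1: "c1 > 0"
    and many: "\<forall>n\<ge>N1. \<forall>G :: 'b sgraph. \<forall>A B.
    simple_graph G \<longrightarrow> card (verts G) = n \<longrightarrow> A \<inter> B = {} \<longrightarrow> A \<union> B \<subseteq> verts G \<longrightarrow>
    real n / 3 \<le> card A \<longrightarrow> real n / 3 \<le> card B \<longrightarrow> card (missing G A B) \<le> \<delta>1 * real n ^ 2 \<longrightarrow>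
    (\<forall>w\<in>A. card (nbrs G w \<inter> A) \<le> c * real n) \<longrightarrow> (\<forall>w\<in>B. card (nbrs G w \<inter> B) \<le> c * real n) \<longrightarrow>
    card (missing G A B) \<le> card (bad_edges G A B) \<longrightarrow> \<kappa> * real n \<le> card (bad_edges G A B) \<longrightarrow>
    c1 * real n ^ (k - 2) \<le> card (embeddings F G)"
    using many_bad_edges[OF \<kappa>(1), where ?'b = 'b] by (elim exE conjE) (rule that; assumption)
  obtain \<delta>2 c2 N2 where \<delta>2: "\<delta>2 > 0" and c2: "c2 > 0"
    and two: "\<forall>n\<ge>N2. \<forall>G :: 'b sgraph. \<forall>A B w w'.
    simple_graph G \<longrightarrow> card (verts G) = n \<longrightarrow> A \<union> B \<subseteq> verts G \<longrightarrow>
    card (missing G A B) \<le> \<delta>2 * real n ^ 2 \<longrightarrow> w \<in> verts G \<longrightarrow> w' \<in> verts G \<longrightarrow> w \<noteq> w' \<longrightarrow>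
    (\<forall>v\<in>{w, w'}. c * real n \<le> card (nbrs G v \<inter> A) \<and> c * real n \<le> card (nbrs G v \<inter> B)) \<longrightarrow>
    c2 * real n ^ (k - 2) \<le> card (embeddings F G)"
    using two_centres[OF c, where ?'b = 'b] by (elim exE conjE) (rule that; assumption)
  define \<delta> where "\<delta> = min (min \<delta>1 \<delta>2) (1 / 400)"
  have \<delta>: "\<delta> > 0" "\<delta> \<le> \<delta>1" "\<delta> \<le> \<delta>2" "\<delta> \<le> 1 / 400" using \<delta>1 \<delta>2 by (auto simp: \<delta>_def)
  obtain \<tau> N3 where \<tau>: "\<tau> > 0" and near: "\<forall>n\<ge>N3. \<forall>G :: 'b sgraph. simple_graph G \<longrightarrow> card (verts G) = n \<longrightarrow>
    (1 / 4 - \<tau>) * real n ^ 2 \<le> card (edges G) \<longrightarrow> card (embeddings F G) \<le> \<tau> * real n ^ k \<longrightarrow>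
    (\<exists>A\<subseteq>verts G. card (bad_edges G A (verts G - A)) \<le> \<delta> * real n ^ 2)"
    using few_embeddings_near_bipartite[OF \<delta>(1), where ?'b = 'b] by (elim exE conjE) (rule that; assumption)
  define c0 where "c0 = min c1 c2"
  have c0: "c0 > 0" "c0 \<le> c1" "c0 \<le> c2" using c1 c2 by (auto simp: c0_def)
  define T where "T = real (card (types2 F))"
  have T: "T > 0" using types2_pos by (simp add: T_def)
  \<comment> \<open>For such q and large n, \<open>(q + 1 / 2) * main_term n\<close> is at most
    \<open>c0 * n ^ (k - 2)\<close>, so that many copies already settle the claim.\<close>
  define \<epsilon> where "\<epsilon> = c0 / (2 * T)"
  have \<epsilon>: "\<epsilon> > 0" "T * \<epsilon> = c0 / 2" using c0 T by (auto simp: \<epsilon>_def)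
  define N where "N = max (max (max N1 N2) (max N3 32)) (max (nat \<lceil>c0 / \<tau>\<rceil> + 1) (nat \<lceil>T / c0\<rceil> + 1))"
  show ?thesis
  proof (rule exI[of _ \<epsilon>], rule conjI[OF \<epsilon>(1)], rule exI[of _ N], intro allI impI)
    fix n and G :: "'b sgraph" and q
    assume n: "N \<le> n" and G: "simple_graph G" "card (verts G) = n" and e: "card (edges G) = apex_size n + q"
      and q: "real q \<le> \<epsilon> * real n"
    have nN: "n \<ge> N1" "n \<ge> N2" "n \<ge> N3" "n \<ge> 32" using n by (auto simp: N_def)
    have n\<tau>: "c0 / \<tau> \<le> real n" and nT: "T / c0 \<le> real n" using n unfolding N_def by linarith+
    show "(\<exists>X A B. apex_core G X A B) \<or> (real q + 1 / 2) * main_term n \<le> card (embeddings F G)"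
    proof (cases "c0 * real n ^ (k - 2) \<le> card (embeddings F G)")
      case True
      have "(real q + 1 / 2) * main_term n \<le> (real q + 1 / 2) * (T * real n ^ (k - 3))"
        unfolding main_term_def T_def by (intro mult_left_mono power_mono) auto
      also have "\<dots> \<le> c0 * real n ^ (k - 2)"
      proof -
        have "T * real q \<le> T * (\<epsilon> * real n)" using q T by (intro mult_left_mono) auto
        then have "T * real q \<le> c0 / 2 * real n" using \<epsilon>(2) by (simp add: mult.assoc[symmetric])
        moreover have "T \<le> c0 * real n" using nT c0 by (simp add: field_simps)
        ultimately have "(real q + 1 / 2) * T \<le> c0 * real n" by (simp add: algebra_simps)
        then have "(real q + 1 / 2) * T * real n ^ (k - 3) \<le> c0 * real n * real n ^ (k - 3)" by (rule mult_right_mono) simp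
        moreover have "k - 2 = Suc (k - 3)" using k_ge_3 by simp
        ultimately show ?thesis by (simp add: mult_ac)
      qed
      finally show ?thesis using True by linarith
    next
      case few: False
      have fV: "finite (verts G)" using G by (simp add: simple_graph_def)
      have elow: "real n ^ 2 / 4 + real n / 4 \<le> card (edges G)" using apex_size_ge[of n] nN e by simp
      have "card (embeddings F G) \<le> \<tau> * real n ^ k"
      proof -
        have "c0 \<le> \<tau> * real n" using n\<tau> \<tau> by (simp add: field_simps)
        also have "\<dots> \<le> \<tau> * (real n * real n)" using \<tau> nN by (intro mult_left_mono) auto
        finally have "c0 * real n ^ (k - 2) \<le> \<tau> * (real n * real n) * real n ^ (k - 2)" by (rule mult_right_mono) simp
        moreover have "k = Suc (Suc (k - 2))" using k_ge_3 by simp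
        then have "real n ^ k = real n * real n * real n ^ (k - 2)" by (metis power_Suc mult.assoc)
        ultimately show ?thesis using few by (simp add: mult.assoc)
      qed
      moreover have "(1 / 4 - \<tau>) * real n ^ 2 \<le> card (edges G)"
      proof -
        have "(1 / 4 - \<tau>) * real n ^ 2 \<le> 1 / 4 * real n ^ 2" using \<tau> by (intro mult_right_mono) auto
        then show ?thesis using elow by simp
      qed
      ultimately obtain A0 where A0: "A0 \<subseteq> verts G" "card (bad_edges G A0 (verts G - A0)) \<le> \<delta> * real n ^ 2"
        using near nN(3) G by blast
      obtain A where A: "A \<subseteq> verts G"
        and Abad: "card (bad_edges G A (verts G - A)) \<le> card (bad_edges G A0 (verts G - A0))"
        and cutA: "\<And>w. w \<in> A \<Longrightarrow> card (nbrs G w \<inter> A) \<le> card (nbrs G w \<inter> (verts G - A))"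
        and cutB: "\<And>w. w \<in> verts G - A \<Longrightarrow> card (nbrs G w \<inter> (verts G - A)) \<le> card (nbrs G w \<inter> A)"
        using max_cut[OF G(1) A0(1)] by blast
      define B where "B = verts G - A"
      have AB: "A \<union> B = verts G" "A \<inter> B = {}" using A by (auto simp: B_def)
      have fAB: "finite A" "finite B" using fV A by (auto simp: B_def intro: finite_subset)
      have cAB: "card A + card B = n" using card_Un_disjoint[OF fAB AB(2)] AB(1) G(2) by simp
      have bad\<delta>: "card (bad_edges G A B) \<le> \<delta> * real n ^ 2" using Abad A0(2) unfolding B_def by linarith
      have part: "real (card (edges G)) + real (card (missing G A B)) = real (card A) * real (card B) + real (card (bad_edges G A B))"
        using card_edges_partition[OF G(1) AB] by (metis of_nat_add of_nat_mult)
      have "4 * (card A * card B) \<le> n\<^sup>2" using prod_le_quarter[of "card A" "card B"] cAB by (simp add: mult.commute le_div_geq[symmetric] less_eq_div_iff_mult_less_eq)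
      from of_nat_mono[OF this, where 'a = real]
      have ABq: "real (card A) * real (card B) \<le> real n ^ 2 / 4" by simp
      \<comment> \<open>The linear term of \<open>apex_size\<close> cannot be realised across a cut,
        so a linear surplus of inner edges over missing pairs remains. This is what forces an apex
        to exist.\<close>
      have miss_bad: "real (card (missing G A B)) + real n / 4 \<le> card (bad_edges G A B)"
        using part ABq elow by linarith
      have "real n ^ 2 / 4 - \<delta> * real n ^ 2 \<le> real (card A) * real (card B)"
        using part elow bad\<delta> by linarith
      then have "\<bar>real (card A) - real n / 2\<bar> \<le> 1 / 10 * real n / 2" "\<bar>real (card B) - real n / 2\<bar> \<le> 1 / 10 * real n / 2"
        using parts_near_half[OF cAB, of \<delta> "1 / 10"] \<delta>(4) by (auto simp: power2_eq_square)
      then have sizes: "real n * (9 / 20) \<le> card A" "real n * (9 / 20) \<le> card B" by linarith+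
      have miss\<delta>: "card (missing G A B) \<le> \<delta> * real n ^ 2" using miss_bad bad\<delta> nN by linarith
      have \<delta>n: "\<delta> * real n ^ 2 \<le> \<delta>1 * real n ^ 2" "\<delta> * real n ^ 2 \<le> \<delta>2 * real n ^ 2"
        using \<delta> by (auto intro: mult_right_mono)
      have few1: "\<not> c1 * real n ^ (k - 2) \<le> card (embeddings F G)" and few2: "\<not> c2 * real n ^ (k - 2) \<le> card (embeddings F G)"
        using few c0 mult_right_mono[of c0 c1 "real n ^ (k - 2)"] mult_right_mono[of c0 c2 "real n ^ (k - 2)"] by auto
      \<comment> \<open>Otherwise the linearly many inner edges have small degrees everywhere and
        \<open>many_bad_edges\<close> applies.\<close>
      have "\<exists>X P Q. (P = A \<and> Q = B \<or> P = B \<and> Q = A) \<and> X \<in> P \<and> c * real n < card (nbrs G X \<inter> P)"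
      proof (rule ccontr)
        assume no: "\<not> ?thesis"
        have "\<kappa> * real n \<le> card (bad_edges G A B)"
          using miss_bad \<kappa>(3) mult_right_mono[of \<kappa> "1 / 8" "real n"] by simp
        moreover have "\<forall>w\<in>A. card (nbrs G w \<inter> A) \<le> c * real n" "\<forall>w\<in>B. card (nbrs G w \<inter> B) \<le> c * real n"
          using no not_le by blast+
        moreover have "card (missing G A B) \<le> card (bad_edges G A B)" using miss_bad by linarith
        moreover have "card (missing G A B) \<le> \<delta>1 * real n ^ 2" using miss\<delta> \<delta>n by linarith
        moreover have "real n / 3 \<le> card A" "real n / 3 \<le> card B" using sizes by linarith+
        ultimately have "c1 * real n ^ (k - 2) \<le> card (embeddings F G)"
          using many[rule_format, OF nN(1) G AB(2)] AB(1) by simp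
        then show False using few1 by simp
      qed
      then obtain X P Q where PQ: "P = A \<and> Q = B \<or> P = B \<and> Q = A" and XP: "X \<in> P" and Xbig: "c * real n < card (nbrs G X \<inter> P)"
        by blast
      have PQ': "P \<union> Q = verts G" "P \<inter> Q = {}" "finite P" "finite Q" using PQ AB fAB by auto
      have cutP: "card (nbrs G w \<inter> P) \<le> card (nbrs G w \<inter> Q)" if "w \<in> P" for w
        using PQ that cutA[of w] cutB[of w] by (auto simp: B_def)
      have cutQ: "card (nbrs G w \<inter> Q) \<le> card (nbrs G w \<inter> P)" if "w \<in> Q" for w
        using PQ that cutA[of w] cutB[of w] by (auto simp: B_def)
      have missPQ: "card (missing G P Q) \<le> \<delta> * real n ^ 2" using PQ miss\<delta> card_missing_commute[of G A B] by auto
      have sizePQ: "real n * (9 / 20) \<le> card P" "real n * (9 / 20) \<le> card Q" using PQ sizes by auto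
      have XQ: "X \<notin> Q" and XV: "X \<in> verts G" using XP PQ' by auto
      \<comment> \<open>Uniqueness of the apex. By maximality of the cut, linear inner degree of X
        entails linear degree to the other side, so a further vertex of this kind would form two
        centres with X.\<close>
      have small: "\<not> (c * real n \<le> card (nbrs G w \<inter> P) \<and> c * real n \<le> card (nbrs G w \<inter> Q))"
        if w: "w \<in> verts G" "w \<noteq> X" for w
      proof
        assume "c * real n \<le> card (nbrs G w \<inter> P) \<and> c * real n \<le> card (nbrs G w \<inter> Q)"
        moreover have "c * real n \<le> card (nbrs G X \<inter> P) \<and> c * real n \<le> card (nbrs G X \<inter> Q)"
          using Xbig cutP[OF XP] by linarith
        ultimately have "\<forall>v\<in>{X, w}. c * real n \<le> card (nbrs G v \<inter> P) \<and> c * real n \<le> card (nbrs G v \<inter> Q)" by simp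
        moreover have "card (missing G P Q) \<le> \<delta>2 * real n ^ 2" using missPQ \<delta>n by linarith
        ultimately have "c2 * real n ^ (k - 2) \<le> card (embeddings F G)"
          using two nN(2) G PQ'(1) XV w by (metis order_refl)
        then show False using few2 by simp
      qed
      define P' where "P' = P - {X}"
      have cut: "apex_cut G X P' Q" using PQ' XP XQ by (auto simp: apex_cut_def P'_def)
      note f = apex_cut_card[OF G(1) cut]
      have degP: "card (nbrs G w \<inter> P') \<le> c * real n" if "w \<in> P'" for w
      proof -
        have w: "w \<in> P" "w \<noteq> X" using that by (auto simp: P'_def)
        then have "card (nbrs G w \<inter> P) \<le> c * real n" using small[of w] cutP[of w] PQ' by fastforce
        moreover have "card (nbrs G w \<inter> P') \<le> card (nbrs G w \<inter> P)" using PQ' by (intro card_mono) (auto simp: P'_def)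
        ultimately show ?thesis by linarith
      qed
      have degQ: "card (nbrs G w \<inter> Q) \<le> c * real n" if "w \<in> Q" for w
        using that small[of w] cutQ[of w] PQ' XQ by fastforce
      have miss': "card (missing G P' Q) \<le> \<delta>1 * real n ^ 2"
      proof -
        have "card (missing G P' Q) \<le> card (missing G P Q)"
          using PQ' by (intro card_mono finite_missing missing_mono) (auto simp: P'_def)
        then show ?thesis using missPQ \<delta>n by linarith
      qed
      \<comment> \<open>The three defects are imbalance of the sides, non-neighbours of the apex,
        and missing cross pairs. Edge counting shows that their sum is exactly the excess of inner
        edges over q.\<close>
      define D1 where "D1 = (n - 1)\<^sup>2 div 4 - card P' * card Q"
      define D2 where "D2 = card {v \<in> P' \<union> Q. {X, v} \<notin> edges G}"
      define D3 where "D3 = card (missing G P' Q)"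
      define D where "D = D1 + D2 + D3"
      have d1: "card P' * card Q + D1 = (n - 1)\<^sup>2 div 4"
        using prod_le_quarter[of "card P'" "card Q"] f(3) G(2) by (simp add: D1_def)
      have d2: "D2 + card (nbrs G X) = n - 1" using card_nonneighbours_apex[OF G(1) cut] G(2) by (simp add: D2_def)
      have badD: "card (bad_edges G P' Q) = q + D"
        using card_edges_apex[OF G(1) cut] d1 d2 e by (simp add: D_def D3_def apex_size_def)
      show ?thesis
      proof (cases "D = 0")
        case True
        then have "{v \<in> P' \<union> Q. {X, v} \<notin> edges G} = {}" "missing G P' Q = {}"
          using f finite_missing[of P' Q G] by (auto simp: D_def D2_def D3_def)
        then have "apex_edges X P' Q \<subseteq> edges G" by (auto simp: apex_edges_def missing_def)
        moreover have "card P' * card Q = (n - 1)\<^sup>2 div 4" using True d1 by (simp add: D_def)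
        ultimately have "apex_core G X P' Q" using cut G by (simp add: apex_core_def)
        then show ?thesis by blast
      next
        case False
        \<comment> \<open>With X taken out, no vertex has linear inner degree, so linearly many
          inner edges would again give too many copies.\<close>
        have "real (q + D) \<le> \<kappa> * real n"
        proof (rule ccontr)
          assume "\<not> ?thesis"
          then have "\<kappa> * real n \<le> card (bad_edges G P' Q)" using badD by simp
          moreover have "card (missing G P' Q) \<le> card (bad_edges G P' Q)" using badD by (simp add: D_def D3_def)
          moreover have "card P = Suc (card P')" using card_Suc_Diff1[OF PQ'(3) XP] by (simp add: P'_def)
          then have "real n / 3 \<le> card P'" "real n / 3 \<le> card Q" using sizePQ nN(4) by linarith+
          moreover have "P' \<inter> Q = {}" "P' \<union> Q \<subseteq> verts G" using PQ' by (auto simp: P'_def)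
          ultimately have "c1 * real n ^ (k - 2) \<le> card (embeddings F G)"
            by (intro many[rule_format, OF nN(1) G _ _ _ _ miss' degP degQ])
          then show False using few1 by simp
        qed
        also have "\<kappa> * real n \<le> \<kappa>0 * real n" using \<kappa> by (intro mult_right_mono) auto
        finally have qD: "real (q + D) \<le> \<kappa>0 * real n" .
        have "(real q + 1 / 2) * main_term n \<le> card (embeddings F G)"
        proof (rule final[rule_format, OF _ G(1) G(2)[symmetric] cut _ _ _ badD _ qD nN(4)])
          show "card {v \<in> P' \<union> Q. {X, v} \<notin> edges G} \<le> D" unfolding D2_def[symmetric] by (simp add: D_def)
          show "card (missing G P' Q) \<le> D" unfolding D3_def[symmetric] by (simp add: D_def)
          show "(n - 1)\<^sup>2 div 4 \<le> card P' * card Q + D" using d1 by (simp add: D_def)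
          show "1 \<le> D" using False by simp
          show "0 < n" using nN(4) by simp
        qed
        then show ?thesis by simp
      qed
    qed
  qed
qed

end

section \<open>Extremal graphs\<close>

lemma apex_edges_commute: "apex_edges X A B = apex_edges X B A"
  by (auto simp: apex_edges_def insert_commute)

lemma apex_edges_alt: "apex_edges X A B = (\<lambda>v. {X, v}) ` (A \<union> B) \<union> (\<Union>a\<in>A. (\<lambda>b. {a, b}) ` B)"
  unfolding apex_edges_def by blast

lemma image_apex_edges: "(`) f ` apex_edges X A B = apex_edges (f X) (f ` A) (f ` B)"
  by (simp add: apex_edges_alt image_Un image_UN image_image)

lemma apex_edges_bad: "X \<notin> A \<union> B \<Longrightarrow> A \<inter> B = {} \<Longrightarrow> e \<in> apex_edges X A B \<Longrightarrow> \<not> (e \<subseteq> A \<or> e \<subseteq> B)"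
  by (auto simp: apex_edges_def)

lemma not_bad_apex_edges:
  assumes "e = {a, b}" "a \<in> insert X (A \<union> B)" "b \<in> insert X (A \<union> B)" "a \<noteq> b" "\<not> (e \<subseteq> A \<or> e \<subseteq> B)"
  shows "e \<in> apex_edges X A B"
  using assms by (auto simp: apex_edges_def insert_commute)

lemma simple_apex_graph:
  assumes "finite A" "finite B" "X \<notin> A \<union> B" "A \<inter> B = {}"
  shows "simple_graph (SGraph (insert X (A \<union> B)) (apex_edges X A B))"
  unfolding simple_graph_def
proof (intro conjI subsetI)
  fix e assume "e \<in> edges (SGraph (insert X (A \<union> B)) (apex_edges X A B))"
  then consider v where "v \<in> A \<union> B" "e = {X, v}" | a b where "a \<in> A" "b \<in> B" "e = {a, b}"
    by (auto simp: apex_edges_def)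
  then have "e \<subseteq> insert X (A \<union> B) \<and> finite e \<and> card e = 2"
  proof cases
    case 1
    then have "v \<noteq> X" using assms by auto
    then show ?thesis using 1 by auto
  next
    case 2
    then have "a \<noteq> b" using assms by auto
    then show ?thesis using 2 by auto
  qed
  then show "e \<in> [verts (SGraph (insert X (A \<union> B)) (apex_edges X A B))]\<^bsup>2\<^esup>"
    by (auto simp: nsets_def)
qed (use assms in auto)

lemma apex_core_card_edges:
  assumes G: "simple_graph G" and core: "apex_core G X A B"
  shows "card (edges G) = apex_size (card (verts G)) + card (bad_edges G A B)"
    "edges G = apex_edges X A B \<union> bad_edges G A B"
    "\<forall>v\<in>A \<union> B. {X, v} \<in> edges G" "missing G A B = {}"
proof -
  have cut: "apex_cut G X A B" and sub: "apex_edges X A B \<subseteq> edges G"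
    and prod: "card A * card B = (card (verts G) - 1)\<^sup>2 div 4"
    using core by (auto simp: apex_core_def)
  show XX: "\<forall>v\<in>A \<union> B. {X, v} \<in> edges G" using sub by (auto simp: apex_edges_def)
  show m: "missing G A B = {}" using sub by (auto simp: missing_def apex_edges_def)
  have "{v \<in> A \<union> B. {X, v} \<notin> edges G} = {}" using XX by auto
  then have "card (nbrs G X) = card (verts G) - 1"
    using card_nonneighbours_apex[OF G cut] by (simp only: card.empty add_0)
  then show "card (edges G) = apex_size (card (verts G)) + card (bad_edges G A B)"
    using card_edges_apex[OF G cut] prod m by (simp add: apex_size_def)
  show "edges G = apex_edges X A B \<union> bad_edges G A B"
  proof
    show "edges G \<subseteq> apex_edges X A B \<union> bad_edges G A B"
    proof
      fix e assume e: "e \<in> edges G"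
      then obtain a b where ab: "e = {a, b}" "a \<in> verts G" "b \<in> verts G" "a \<noteq> b" using simple_graph_edgeE[OF G] by metis
      show "e \<in> apex_edges X A B \<union> bad_edges G A B"
      proof (cases "e \<subseteq> A \<or> e \<subseteq> B")
        case True
        then show ?thesis using e by (simp add: bad_edges_def)
      next
        case False
        then show ?thesis using not_bad_apex_edges[of e a b X A B] ab cut by (simp add: apex_cut_def)
      qed
    qed
  qed (use sub in \<open>auto simp: bad_edges_def\<close>)
qed

definition apex_graph :: "nat \<Rightarrow> nat sgraph" where
  "apex_graph n = SGraph {..<n} (apex_edges 0 {1..(n - 1) div 2} {(n - 1) div 2 + 1..<n})"

lemma half_prod: "(m div 2) * (m - m div 2) = m\<^sup>2 div (4 :: nat)"
proof (cases "even m")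
  case True
  then obtain j where "m = 2 * j" by blast
  then show ?thesis by (simp add: power2_eq_square)
next
  case False
  then obtain j where "m = 2 * j + 1" by (elim oddE)
  then show ?thesis by (simp add: power2_eq_square algebra_simps)
qed

lemma apex_graph_core:
  assumes "n \<ge> 1"
  shows "simple_graph (apex_graph n)" "card (verts (apex_graph n)) = n"
    "\<exists>X A B. apex_core (apex_graph n) X A B \<and> edges (apex_graph n) = apex_edges X A B"
proof -
  let ?A = "{1..(n - 1) div 2}" and ?B = "{(n - 1) div 2 + 1..<n}"
  have V: "{..<n} = insert 0 (?A \<union> ?B)" using assms by auto
  have d: "(0::nat) \<notin> ?A \<union> ?B" "?A \<inter> ?B = {}" by auto
  have G: "apex_graph n = SGraph (insert 0 (?A \<union> ?B)) (apex_edges 0 ?A ?B)" by (simp only: apex_graph_def V)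
  show "simple_graph (apex_graph n)" unfolding G using d by (intro simple_apex_graph) auto
  show n: "card (verts (apex_graph n)) = n" by (simp add: apex_graph_def)
  have "card ?A * card ?B = (n - 1)\<^sup>2 div 4"
    using half_prod[of "n - 1"] by simp
  then have "apex_core (apex_graph n) 0 ?A ?B"
    unfolding apex_core_def apex_cut_def n using d by (auto simp: G)
  then show "\<exists>X A B. apex_core (apex_graph n) X A B \<and> edges (apex_graph n) = apex_edges X A B"
    by (auto simp: apex_graph_def)
qed

text \<open>By Vieta, a is a root of the quadratic with roots c and d.\<close>

lemma sum_prod_eq_cases:
  fixes a b c d :: nat
  assumes "a + b = c + d" "a * b = c * d"
  shows "a = c \<and> b = d \<or> a = d \<and> b = c"
proof -
  have s: "int a + int b = int c + int d" using assms(1) by simp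
  have p: "int a * int b = int c * int d" using assms(2) by (metis of_nat_mult)
  have "(int a - int c) * (int a - int d) = int a * int a - int a * (int c + int d) + int c * int d"
    by (simp add: algebra_simps)
  also have "\<dots> = 0" unfolding s[symmetric] p[symmetric] by (simp add: algebra_simps)
  finally have "int a = int c \<or> int a = int d" by simp
  then show ?thesis using assms(1) by auto
qed

text \<open>Sum and product of the part sizes agree, so the sizes agree up to exchanging the parts;
  any bijections of the parts then combine with the apex.\<close>

lemma isomorphic_apex:
  assumes G: "simple_graph G" and H: "simple_graph H" and n: "card (verts G) = card (verts H)"
    and GC: "apex_core G X A B" "edges G = apex_edges X A B"
    and HC: "apex_core H X' A' B'" "edges H = apex_edges X' A' B'"
  shows "isomorphic G H"
proof -
  have cG: "apex_cut G X A B" and cH: "apex_cut H X' A' B'" using GC HC by (auto simp: apex_core_def)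
  note fG = apex_cut_card[OF G cG] and fH = apex_cut_card[OF H cH]
  have main: "isomorphic G H"
    if c: "card A = card A'" "card B = card B'" and cH: "apex_cut H X' A' B'" and eH: "edges H = apex_edges X' A' B'"
      and fH: "finite A'" "finite B'" for A' B'
  proof -
    obtain f1 where f1: "bij_betw f1 A A'" using finite_same_card_bij[OF fG(1) fH(1) c(1)] by blast
    obtain f2 where f2: "bij_betw f2 B B'" using finite_same_card_bij[OF fG(2) fH(2) c(2)] by blast
    define f where "f v = (if v = X then X' else if v \<in> A then f1 v else if v \<in> B then f2 v else undefined)" for v
    have dG: "X \<notin> A" "X \<notin> B" "A \<inter> B = {}" "verts G = insert X (A \<union> B)"
      and dH: "X' \<notin> A'" "X' \<notin> B'" "A' \<inter> B' = {}" "verts H = insert X' (A' \<union> B')"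
      using cG cH by (auto simp: apex_cut_def)
    have fA: "bij_betw f A A'" using f1 dG by (subst bij_betw_cong[of A f f1]) (auto simp: f_def)
    have fB: "bij_betw f B B'" using f2 dG by (subst bij_betw_cong[of B f f2]) (auto simp: f_def)
    have fX: "bij_betw f {X} {X'}" by (simp add: f_def bij_betw_def)
    have "bij_betw f ({X} \<union> (A \<union> B)) ({X'} \<union> (A' \<union> B'))"
      using dH by (intro bij_betw_combine fX fA fB) auto
    then have bij: "bij_betw f (verts G) (verts H)" by (simp add: dG dH)
    have "(`) f ` edges G = edges H"
      using fA fB by (simp add: GC(2) eH image_apex_edges bij_betw_def f_def[of X])
    moreover have "f \<in> verts G \<rightarrow>\<^sub>E verts H"
    proof
      fix v assume "v \<in> verts G"
      then show "f v \<in> verts H" using bij by (rule bij_betwE[THEN bspec, rotated])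
    next
      fix v assume "v \<notin> verts G"
      then show "f v = undefined" using dG by (simp add: f_def)
    qed
    ultimately have "f \<in> isomorphisms G H" using bij by (simp add: isomorphisms_def)
    then show ?thesis by (auto simp: isomorphic_def)
  qed
  have "card A + card B = card A' + card B'" using fG fH n by simp
  moreover have "card A * card B = card A' * card B'" using GC HC n by (simp add: apex_core_def)
  ultimately consider "card A = card A'" "card B = card B'" | "card A = card B'" "card B = card A'"
    using sum_prod_eq_cases by blast
  then show ?thesis
  proof cases
    case 1
    then show ?thesis using main cH HC(2) fH by blast
  next
    case 2
    have "apex_cut H X' B' A'" using cH by (auto simp: apex_cut_def)
    then show ?thesis using main[OF 2] HC(2) fH apex_edges_commute by metis
  qed
qed

context template
begin

text \<open>Outside the preimage of the apex, if there is one, the two parts would properly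
  two-colour F, against \<open>critical\<close>.\<close>

lemma no_bad_edges_free:
  assumes G: "simple_graph G" and cut: "apex_cut G X A B" and bad: "bad_edges G A B = {}"
  shows "embeddings F G = {}"
proof (rule ccontr)
  assume "embeddings F G \<noteq> {}"
  then obtain f where f: "f \<in> embeddings F G" by blast
  have inj: "inj_on f (verts F)" and ed: "\<And>e. e \<in> edges F \<Longrightarrow> f ` e \<in> edges G" and fV: "\<And>v. v \<in> verts F \<Longrightarrow> f v \<in> verts G"
    using f by (auto simp: embeddings_def)
  obtain x where x: "\<And>v. v \<in> verts F \<Longrightarrow> v \<noteq> x \<Longrightarrow> f v \<noteq> X"
  proof (cases "\<exists>x\<in>verts F. f x = X")
    case True
    then obtain x where "x \<in> verts F" "f x = X" by blast
    then show ?thesis using inj that[of x] by (auto dest: inj_onD)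
  qed (use that in blast)
  obtain a b where ab: "{a, b} \<in> edges F" "a \<noteq> x" "b \<noteq> x" "(f a \<in> A) = (f b \<in> A)"
    using critical[of x "\<lambda>v. f v \<in> A"] by blast
  have abV: "a \<in> verts F" "b \<in> verts F" using simple_graph_edge[OF simple ab(1)] by auto
  have "f a \<noteq> X" "f b \<noteq> X" using x[OF abV(1) ab(2)] x[OF abV(2) ab(3)] .
  then have "f a \<in> A \<union> B" "f b \<in> A \<union> B" using fV[OF abV(1)] fV[OF abV(2)] cut by (auto simp: apex_cut_def)
  then have "{f a, f b} \<subseteq> A \<or> {f a, f b} \<subseteq> B" using ab(4) cut by (auto simp: apex_cut_def)
  moreover have "{f a, f b} \<in> edges G" using ed[OF ab(1)] by simp
  ultimately have "{f a, f b} \<in> bad_edges G A B" by (simp add: bad_edges_def)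
  then show False using bad by simp
qed

lemma core_count:
  fixes G :: "'b sgraph"
  assumes G: "simple_graph G" and n: "n = card (verts G)" "8 \<le> n" and core: "apex_core G X A B"
    and TS: "TS \<subseteq> types F"
  shows "card (bad_edges G A B) * (card TS * ((real n / 2) ^ (k - 3) - err * real n ^ (k - 3) / real n))
    \<le> card {f \<in> embeddings F G. single_type F X A B f}"
proof -
  note c = apex_core_card_edges[OF G core]
  have cut: "apex_cut G X A B" and prod: "card A * card B = (n - 1)\<^sup>2 div 4"
    using core n by (auto simp: apex_core_def)
  have "{v \<in> A \<union> B. {X, v} \<notin> edges G} = {}" using c(3) by auto
  then have "card {v \<in> A \<union> B. {X, v} \<notin> edges G} = 0" by (simp only: card.empty)
  then show ?thesis
    using single_extension_count[OF G n(1) cut, of 0 TS] c(3,4) prod n TS by simp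
qed

lemma err_small: "\<exists>N. \<forall>n\<ge>N. err * real n ^ (k - 3) / real n < (real n / 2) ^ (k - 3) \<and> 8 \<le> n"
proof (intro exI allI impI conjI)
  fix n assume n: "max 8 (nat \<lceil>err * 2 ^ (k - 3)\<rceil> + 1) \<le> n"
  then have "err * 2 ^ (k - 3) < real n" by linarith
  moreover have n0: "real n > 0" using n by linarith
  ultimately have "err / real n < (1 / 2) ^ (k - 3)" by (simp add: field_simps)
  then have "err / real n * real n ^ (k - 3) < (1 / 2) ^ (k - 3) * real n ^ (k - 3)"
    using n0 by (intro mult_strict_right_mono) auto
  then show "err * real n ^ (k - 3) / real n < (real n / 2) ^ (k - 3)" by (simp add: power_divide)
  show "8 \<le> n" using n by simp
qed

lemma main_term_pos: "n > 0 \<Longrightarrow> main_term n > 0"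
  using types2_pos by (simp add: main_term_def)

lemma embeddings_mono:
  "verts G = verts G' \<Longrightarrow> edges G \<subseteq> edges G' \<Longrightarrow> embeddings F G \<subseteq> embeddings F G'"
  by (auto simp: embeddings_def)

text \<open>The dichotomy for surplus 0 and 1: without copies the graph is a core. A core with one
  inner edge does contain F, by \<open>core_count\<close>, and a core without inner edges does
  not.\<close>

lemma extremal_structure:
  "\<exists>N. \<forall>n\<ge>N. ex_num n F = apex_size n \<and> (\<forall>G. extremal n F G \<longleftrightarrow>
     n_graph n G \<and> (\<exists>X A B. apex_core G X A B \<and> edges G = apex_edges X A B))"
proof -
  obtain \<epsilon> N1 where \<epsilon>: "\<epsilon> > 0" and main: "\<forall>n\<ge>N1. \<forall>G :: nat sgraph. \<forall>q. simple_graph G \<longrightarrow> card (verts G) = n \<longrightarrow>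
    card (edges G) = apex_size n + q \<longrightarrow> real q \<le> \<epsilon> * real n \<longrightarrow>
    (\<exists>X A B. apex_core G X A B) \<or> (real q + 1 / 2) * main_term n \<le> card (embeddings F G)"
    using core_or_many_copies[where ?'b = nat] by (elim exE conjE) (rule that; assumption)
  obtain N2 where N2: "\<And>n. n \<ge> N2 \<Longrightarrow> err * real n ^ (k - 3) / real n < (real n / 2) ^ (k - 3) \<and> 8 \<le> n"
    using err_small by blast
  define N where "N = max (max N1 N2) (nat \<lceil>1 / \<epsilon>\<rceil> + 1)"
  show ?thesis
  proof (rule exI[of _ N], intro allI impI)
    fix n assume n: "N \<le> n"
    have nN: "n \<ge> N1" "n \<ge> N2" using n by (auto simp: N_def)
    have "1 / \<epsilon> \<le> real n" using n unfolding N_def by linarith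
    then have n\<epsilon>: "1 \<le> \<epsilon> * real n" using \<epsilon> by (simp add: field_simps)
    have n8: "8 \<le> n" using N2[OF nN(2)] by simp
    have free_core: "free_of F G" if "n_graph n G" "apex_core G X A B" "edges G = apex_edges X A B" for G X A B
    proof -
      have G: "simple_graph G" using that(1) by (simp add: n_graph_def)
      have cut: "apex_cut G X A B" using that(2) by (simp add: apex_core_def)
      have "bad_edges G A B = {}"
        using apex_edges_bad[of X A B] cut that(3) by (auto simp: bad_edges_def apex_cut_def)
      then show ?thesis using no_bad_edges_free[OF G cut] by (simp add: free_of_def)
    qed
    have size_core: "card (edges G) = apex_size n"
      if "n_graph n G" "apex_core G X A B" "edges G = apex_edges X A B" for G X A B
    proof -
      have G: "simple_graph G" "card (verts G) = n" using that(1) by (auto simp: n_graph_def)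
      have cut: "apex_cut G X A B" using that(2) by (simp add: apex_core_def)
      have "bad_edges G A B = {}"
        using apex_edges_bad[of X A B] cut that(3) by (auto simp: bad_edges_def apex_cut_def)
      then show ?thesis using apex_core_card_edges(1)[OF G(1) that(2)] G by simp
    qed
    have bound: "card (edges G) \<le> apex_size n" if "n_graph n G" "free_of F G" for G
    proof (rule ccontr)
      assume "\<not> ?thesis"
      then have "apex_size n + 1 \<le> card (edges G)" by simp
      \<comment> \<open>Thinning to surplus exactly one brings a graph with any larger number of
        edges into the range of the dichotomy, and deleting edges creates no copies.\<close>
      then obtain E where E: "E \<subseteq> edges G" "card E = apex_size n + 1" using obtain_subset_with_card_n by metis
      define G' where "G' = SGraph (verts G) E"
      have G': "simple_graph G'" "card (verts G') = n" "card (edges G') = apex_size n + 1"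
        using that(1) E by (auto simp: G'_def n_graph_def simple_graph_def)
      have "embeddings F G' \<subseteq> embeddings F G" using E by (intro embeddings_mono) (auto simp: G'_def)
      then have e0: "embeddings F G' = {}" using that(2) by (simp add: free_of_def)
      have "(\<exists>X A B. apex_core G' X A B) \<or> (real 1 + 1 / 2) * main_term n \<le> card (embeddings F G')"
        using n\<epsilon> by (intro main[rule_format, OF nN(1) G']) simp
      moreover have "0 < (real 1 + 1 / 2) * main_term n" using main_term_pos[of n] n8 by simp
      ultimately obtain X A B where core: "apex_core G' X A B" using e0 by auto
      have "card (bad_edges G' A B) = 1" using apex_core_card_edges(1)[OF G'(1) core] G' by simp
      then have "real (card (types F)) * ((real n / 2) ^ (k - 3) - err * real n ^ (k - 3) / real n) \<le>
         card {f \<in> embeddings F G'. single_type F X A B f}"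
        using core_count[OF G'(1) G'(2)[symmetric] n8 core, of "types F"] by simp
      moreover have "card (types F) > 0" using type_ex types2_subset by (auto simp: card_gt_0_iff)
      then have "0 < real (card (types F)) * ((real n / 2) ^ (k - 3) - err * real n ^ (k - 3) / real n)"
        using N2[OF nN(2)] by simp
      ultimately show False using e0 by simp
    qed
    obtain X A B where hn: "n_graph n (apex_graph n)" "apex_core (apex_graph n) X A B" "edges (apex_graph n) = apex_edges X A B"
      using apex_graph_core[of n] n8 by (auto simp: n_graph_def)
    have ex: "ex_num n F = apex_size n"
      unfolding ex_num_def
    proof (rule Max_eqI)
      show "finite {card (edges G) | G. n_graph n G \<and> free_of F G}"
        by (rule finite_subset[of _ "{..apex_size n}"]) (use bound in auto)
      show "apex_size n \<in> {card (edges G) | G. n_graph n G \<and> free_of F G}"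
        using free_core[OF hn] size_core[OF hn] hn(1) by (intro CollectI exI[of _ "apex_graph n"]) auto
    qed (use bound in auto)
    show "ex_num n F = apex_size n \<and> (\<forall>G. extremal n F G \<longleftrightarrow>
     n_graph n G \<and> (\<exists>X A B. apex_core G X A B \<and> edges G = apex_edges X A B))"
    proof (intro conjI allI ex)
      fix G
      show "extremal n F G \<longleftrightarrow> n_graph n G \<and> (\<exists>X A B. apex_core G X A B \<and> edges G = apex_edges X A B)"
      proof
        assume "extremal n F G"
        then have G: "n_graph n G" "free_of F G" "card (edges G) = apex_size n + 0" using ex by (auto simp: extremal_def)
        have sG: "simple_graph G" "card (verts G) = n" using G(1) by (auto simp: n_graph_def)
        have e0: "embeddings F G = {}" using G(2) by (simp add: free_of_def)
        have "(\<exists>X A B. apex_core G X A B) \<or> (real 0 + 1 / 2) * main_term n \<le> card (embeddings F G)"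
          using \<epsilon> by (intro main[rule_format, OF nN(1) sG G(3)]) simp
        moreover have "0 < (real 0 + 1 / 2) * main_term n" using main_term_pos[of n] n8 by simp
        ultimately obtain X A B where core: "apex_core G X A B" using e0 by auto
        have "card (bad_edges G A B) = 0" using apex_core_card_edges(1)[OF sG(1) core] G sG by simp
        then have "bad_edges G A B = {}" using finite_bad_edges[OF sG(1)] by simp
        then have "edges G = apex_edges X A B" using apex_core_card_edges(2)[OF sG(1) core] by simp
        then show "n_graph n G \<and> (\<exists>X A B. apex_core G X A B \<and> edges G = apex_edges X A B)" using core G by blast
      next
        assume "n_graph n G \<and> (\<exists>X A B. apex_core G X A B \<and> edges G = apex_edges X A B)"
        then obtain X A B where G: "n_graph n G" "apex_core G X A B" "edges G = apex_edges X A B" by blast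
        show "extremal n F G" using free_core[OF G] size_core[OF G] ex G(1) by (simp add: extremal_def)
      qed
    qed
  qed
qed

end

section \<open>Upper bounds\<close>

text \<open>Greedy choice: fewer than \<open>card I\<close> values are taken at any time, which the
  slack in the hypothesis absorbs.\<close>

lemma card_inj_PiE_ge:
  assumes "finite I" "\<And>v. v \<in> I \<Longrightarrow> finite (S v)" "\<And>v. v \<in> I \<Longrightarrow> r v + card I \<le> card (S v)"
  shows "(\<Prod>v\<in>I. r v) \<le> card {f \<in> Pi\<^sub>E I S. inj_on f I}"
  using assms
proof (induction I rule: finite_induct)
  case empty
  then show ?case by simp
next
  case (insert a I)
  let ?X = "{f \<in> Pi\<^sub>E I S. inj_on f I}" and ?Y = "{f \<in> Pi\<^sub>E (insert a I) S. inj_on f (insert a I)}"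
  have "r v + card I \<le> card (S v)" if "v \<in> I" for v
    using insert.prems(2)[of v] insert.hyps that by simp
  then have IH: "(\<Prod>v\<in>I. r v) \<le> card ?X" using insert.IH insert.prems(1) by blast
  have fX: "finite ?X" using insert by (intro finite_subset[OF _ finite_PiE[of I S]]) auto
  have fY: "finite ?Y" using insert by (intro finite_subset[OF _ finite_PiE[of "insert a I" S]]) auto
  let ?Z = "SIGMA f:?X. S a - f ` I"
  have ch: "r a \<le> card (S a - f ` I)" for f
  proof -
    have "card (S a) - card (f ` I) \<le> card (S a - f ` I)" using insert.hyps by (intro diff_card_le_card_Diff) auto
    moreover have "card (f ` I) \<le> card I" using insert.hyps by (intro card_image_le) auto
    moreover have "r a + card (insert a I) \<le> card (S a)" using insert.prems(2)[of a] by simp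
    ultimately show ?thesis using insert.hyps by simp
  qed
  have "(\<Prod>v\<in>insert a I. r v) = (\<Prod>v\<in>I. r v) * r a" using insert.hyps by (simp add: mult.commute)
  also have "\<dots> \<le> card ?X * r a" using IH by simp
  also have "\<dots> = (\<Sum>f\<in>?X. r a)" by simp
  also have "\<dots> \<le> (\<Sum>f\<in>?X. card (S a - f ` I))" using ch by (intro sum_mono) auto
  also have "\<dots> = card ?Z" using fX insert.prems(1) by (intro card_SigmaI[symmetric]) auto
  also have "\<dots> \<le> card ?Y"
  proof (rule card_inj_on_le[of "\<lambda>(f, y). f(a := y)"])
    show "inj_on (\<lambda>(f, y). f(a := y)) ?Z"
    proof (rule inj_onI, clarify)
      fix f y f' y' assume a: "f \<in> Pi\<^sub>E I S" "f' \<in> Pi\<^sub>E I S" "f(a := y) = f'(a := y')"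
      have "f v = f' v" if "v \<in> I" for v
      proof -
        have "v \<noteq> a" using that insert.hyps by auto
        then show ?thesis using fun_cong[OF a(3), of v] by simp
      qed
      then have "f = f'" using a by (auto intro: PiE_ext)
      moreover have "y = y'" using fun_cong[OF a(3), of a] by simp
      ultimately show "f = f' \<and> y = y'" by simp
    qed
    show "(\<lambda>(f, y). f(a := y)) ` ?Z \<subseteq> ?Y"
    proof (rule image_subsetI)
      fix p assume "p \<in> ?Z"
      then obtain f y where p: "p = (f, y)" and f: "f \<in> Pi\<^sub>E I S" "inj_on f I" "y \<in> S a" "y \<notin> f ` I" by auto
      have "inj_on (f(a := y)) (insert a I)"
        using f insert.hyps by (auto simp: inj_on_def)
      moreover have "f(a := y) \<in> Pi\<^sub>E (insert a I) S" using f by (auto simp: PiE_def Pi_def extensional_def)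
      ultimately show "(case p of (f, y) \<Rightarrow> f(a := y)) \<in> ?Y" by (simp add: p)
    qed
    show "finite ?Y" by (rule fY)
  qed
  finally show ?case .
qed

context template
begin

text \<open>All inner edges form a star at z. Every embedding uses both X and z, and the star edges
  it uses either make it a single type in \<open>TS\<close> or number at least j. With
  \<open>Xz\<close> present, \<open>star_types\<close> gives j = s; once \<open>Xz\<close> is
  deleted, its alternative with exactly s star edges is impossible, so j = s + 1. For s = 1 without
  \<open>Xz\<close>, anything beyond one star edge already gives two.\<close>

lemma core_upper:
  fixes G :: "'b sgraph"
  assumes G: "simple_graph G" and n: "n = card (verts G)" and cut: "apex_cut G X A B"
    and z: "z \<in> A" and L: "L \<subseteq> A - {z}" and bad: "bad_edges G A B \<subseteq> (\<lambda>l. {z, l}) ` L"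
    and size: "real (card A) \<le> real n / 2" "real (card B) \<le> real n / 2"
    and cases: "s \<ge> 2 \<and> TS = types F \<and> j = s \<or> {X, z} \<notin> edges G \<and> TS = types1 F \<and> j = s + 1"
  shows "card (embeddings F G) \<le> card L * (card TS * (real n / 2) ^ (k - 3))
    + real (k * k * 2 ^ k) * real (card L) ^ j * real n ^ (k - 2 - j)"
proof -
  note f = apex_cut_card[OF G cut]
  have X: "X \<notin> A" "X \<notin> B" and V: "verts G = insert X (A \<union> B)" and AB: "A \<inter> B = {}"
    using cut by (auto simp: apex_cut_def)
  have fV: "finite (verts G)" using G by (simp add: simple_graph_def)
  have fL: "finite L" using L f(1) finite_subset by blast
  have TS: "TS \<subseteq> types F" using cases types2_subset by auto
  have fTS: "finite TS" using TS finite_subset finite_types by blast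
  \<comment> \<open>All maps of a given type over the star edge \<open>zl\<close>, injective or not:
    three values are fixed, the other \<open>k - 3\<close> range over sides of size at most n /
    2.\<close>
  define Z where "Z q = (case q of (l, x, z', u, C) \<Rightarrow> Pi\<^sub>E (verts F) (\<lambda>v. if v = x then {X} else if v = z' then {z}
      else if v = u then {l} else if v \<in> C then A else B))" for q
  \<comment> \<open>Maps with at least j star edges, recorded by a set \<open>J\<close> of j
    vertices sent to leaves: \<open>card L\<close> choices on \<open>J\<close>, n choices for each
    of the other \<open>k - 2 - j\<close> vertices.\<close>
  define W where "W q = (case q of (x, z', J) \<Rightarrow> {h \<in> verts F \<rightarrow>\<^sub>E verts G. h x = X \<and> h z' = z \<and> h ` J \<subseteq> L})" for q
  define I2 where "I2 = {(x, z', J). x \<in> verts F \<and> z' \<in> verts F \<and> J \<subseteq> verts F \<and> x \<noteq> z' \<and> x \<notin> J \<and> z' \<notin> J \<and> card J = j}"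
  have cover: "h \<in> (\<Union>q\<in>L \<times> TS. Z q) \<union> (\<Union>q\<in>I2. W q)" if h: "h \<in> embeddings F G" for h
  proof -
    have inj: "inj_on h (verts F)" and ed: "\<And>e. e \<in> edges F \<Longrightarrow> h ` e \<in> edges G"
      and hE: "h \<in> verts F \<rightarrow>\<^sub>E verts G" and hV: "\<And>v. v \<in> verts F \<Longrightarrow> h v \<in> verts G"
      using h by (auto simp: embeddings_def)
    have same: "\<exists>l\<in>L. {h a, h b} = {z, l}"
      if ab: "{a, b} \<in> edges F" "h a \<noteq> X" "h b \<noteq> X" "(h a \<in> A) = (h b \<in> A)" for a b
    proof -
      have abV: "a \<in> verts F" "b \<in> verts F" using simple_graph_edge[OF simple ab(1)] by auto
      have "h a \<in> A \<union> B" "h b \<in> A \<union> B" using hV[OF abV(1)] hV[OF abV(2)] ab V by auto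
      then have "{h a, h b} \<subseteq> A \<or> {h a, h b} \<subseteq> B" using ab(4) AB by auto
      moreover have "{h a, h b} \<in> edges G" using ed[OF ab(1)] by simp
      ultimately have "{h a, h b} \<in> bad_edges G A B" by (simp add: bad_edges_def)
      then show ?thesis using bad by auto
    qed
    \<comment> \<open>If the apex were missed, deleting the preimage of z would leave F properly
      two-coloured by the parts.\<close>
    have "X \<in> h ` verts F"
    proof (rule ccontr)
      assume no: "X \<notin> h ` verts F"
      obtain x where x: "\<And>v. v \<in> verts F \<Longrightarrow> v \<noteq> x \<Longrightarrow> h v \<noteq> z"
      proof (cases "\<exists>x\<in>verts F. h x = z")
        case True
        then obtain x where "x \<in> verts F" "h x = z" by blast
        then show ?thesis using inj that[of x] by (auto dest: inj_onD)
      qed (use that in blast)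
      obtain a b where ab: "{a, b} \<in> edges F" "a \<noteq> x" "b \<noteq> x" "(h a \<in> A) = (h b \<in> A)"
        using critical[of x "\<lambda>v. h v \<in> A"] by blast
      have abV: "a \<in> verts F" "b \<in> verts F" using simple_graph_edge[OF simple ab(1)] by auto
      have "h a \<noteq> X" "h b \<noteq> X" using no abV by auto
      then obtain l where "{h a, h b} = {z, l}" using same[OF ab(1) _ _ ab(4)] by blast
      then have "h a = z \<or> h b = z" by (auto simp: doubleton_eq_iff)
      then show False using x[OF abV(1) ab(2)] x[OF abV(2) ab(3)] by auto
    qed
    then obtain x where x: "x \<in> verts F" "h x = X" by blast
    have notX: "h v \<noteq> X" if "v \<in> verts F" "v \<noteq> x" for v
      using that x inj by (auto dest: inj_onD)
    obtain a0 b0 where ab0: "{a0, b0} \<in> edges F" "a0 \<noteq> x" "b0 \<noteq> x" "(h a0 \<in> A) = (h b0 \<in> A)"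
      using critical[of x "\<lambda>v. h v \<in> A"] by blast
    have abV0: "a0 \<in> verts F" "b0 \<in> verts F" using simple_graph_edge[OF simple ab0(1)] by auto
    obtain l0 where l0: "{h a0, h b0} = {z, l0}" using same[OF ab0(1) _ _ ab0(4)] notX abV0 ab0 by blast
    then have "h a0 = z \<or> h b0 = z" by (auto simp: doubleton_eq_iff)
    then obtain z' where z': "z' \<in> verts F" "h z' = z" using abV0 by auto
    have xz': "x \<noteq> z'" using x z' z X by auto
    have hz: "h v = z \<Longrightarrow> v \<in> verts F \<Longrightarrow> v = z'" for v using z' inj by (auto dest: inj_onD)
    \<comment> \<open>Inner edges of the image are star edges, so \<open>D\<close> lists the
      vertices joined to \<open>z'\<close> by the inner edges used; all of them go to
      leaves.\<close>
    define D where "D = {w. {z', w} \<in> edges F \<and> w \<noteq> x \<and> (h w \<in> A) = (h z' \<in> A)}"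
    have DV: "D \<subseteq> verts F" using simple_graph_edge(2)[OF simple] by (auto simp: D_def)
    then have fD: "finite D" using finite_subset finite_verts by blast
    have Dz: "x \<notin> D" "z' \<notin> D" using simple_graph_edge(3)[OF simple, of z' z'] by (auto simp: D_def)
    have DL: "h w \<in> L" if w: "w \<in> D" for w
    proof -
      have e: "{z', w} \<in> edges F" "w \<noteq> x" "(h z' \<in> A) = (h w \<in> A)" using w by (auto simp: D_def)
      obtain l where l: "l \<in> L" "{h z', h w} = {z, l}"
        using same[OF e(1) _ _ e(3)] notX[OF z'(1)] notX[of w] DV w xz' e(2) by blast
      have "h w \<noteq> z" using hz[of w] DV w Dz by auto
      then show ?thesis using l z' by (auto simp: doubleton_eq_iff)
    qed
    have proper: "(h a \<in> A) \<noteq> (h b \<in> A)" if ab: "{a, b} \<in> edges F" "{a, b} \<inter> {x, z'} = {}" for a b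
    proof
      assume "(h a \<in> A) = (h b \<in> A)"
      moreover have abV: "a \<in> verts F" "b \<in> verts F" using simple_graph_edge[OF simple ab(1)] by auto
      moreover have "h a \<noteq> X" "h b \<noteq> X" using notX abV ab by auto
      ultimately obtain l where "{h a, h b} = {z, l}" using same[OF ab(1)] by blast
      then have "h a = z \<or> h b = z" by (auto simp: doubleton_eq_iff)
      then show False using hz[of a] hz[of b] abV ab by auto
    qed
    have D0: "D \<noteq> {}"
    proof -
      have "a0 = z' \<or> b0 = z'" using \<open>h a0 = z \<or> h b0 = z\<close> hz abV0 by auto
      then have "b0 \<in> D \<or> a0 \<in> D" using ab0 by (auto simp: D_def insert_commute)
      then show ?thesis by auto
    qed
    have single: ?thesis if w: "D = {w}" and nad: "(x, z', w, {v \<in> verts F - {x}. h v \<in> A}) \<in> types F \<Longrightarrow>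
        (x, z', w, {v \<in> verts F - {x}. h v \<in> A}) \<in> TS" for w
    proof -
      define C where "C = {v \<in> verts F - {x}. h v \<in> A}"
      have wD: "{z', w} \<in> edges F" "w \<noteq> x" "(h w \<in> A) = (h z' \<in> A)" using w by (auto simp: D_def)
      have wV: "w \<in> verts F" using DV w by auto
      have "(x, z', w, C) \<in> types F"
        unfolding types_def
      proof (clarsimp simp: x, intro conjI allI impI)
        show "C \<subseteq> verts F - {x}" by (auto simp: C_def)
        show "z' \<in> C" using z' z xz' by (auto simp: C_def)
        show "w \<in> C" using wV wD z' z by (auto simp: C_def)
        show "{z', w} \<in> edges F" by (rule wD)
        fix a b assume ab: "{a, b} \<in> edges F" "a \<noteq> x" "b \<noteq> x" "{a, b} \<noteq> {z', w}"
        have abV: "a \<in> verts F" "b \<in> verts F" using simple_graph_edge[OF simple ab(1)] by auto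
        have "(h a \<in> A) \<noteq> (h b \<in> A)"
        proof (cases "{a, b} \<inter> {x, z'} = {}")
          case True
          then show ?thesis by (rule proper[OF ab(1)])
        next
          case False
          then have "a = z' \<or> b = z'" using ab by auto
          then show ?thesis
          proof
            assume a: "a = z'"
            then have "b \<notin> D" using ab w by auto
            then show ?thesis using a ab by (auto simp: D_def)
          next
            assume b: "b = z'"
            then have "a \<notin> D" using ab w by auto
            then show ?thesis using b ab by (auto simp: D_def insert_commute)
          qed
        qed
        then show "(a \<in> C) = (b \<notin> C)" using abV ab by (auto simp: C_def)
      qed
      then have tTS: "(x, z', w, C) \<in> TS" using nad by (simp add: C_def)
      have "h \<in> Z (h w, x, z', w, C)"
        unfolding Z_def prod.case
      proof
        fix v assume v: "v \<in> verts F"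
        have "h v \<in> A \<union> B" if "v \<noteq> x" using notX[OF v that] hV[OF v] V by auto
        then show "h v \<in> (if v = x then {X} else if v = z' then {z} else if v = w then {h w} else if v \<in> C then A else B)"
          using x z' v by (auto simp: C_def)
      next
        fix v assume "v \<notin> verts F"
        then show "h v = undefined" using hE by (auto simp: PiE_def extensional_def)
      qed
      moreover have "(h w, x, z', w, C) \<in> L \<times> TS" using tTS DL w by auto
      ultimately show ?thesis by blast
    qed
    have many: ?thesis if cj: "j \<le> card D"
    proof -
      obtain J where J: "J \<subseteq> D" "card J = j" using obtain_subset_with_card_n[OF cj] by metis
      have "(x, z', J) \<in> I2" using J DV Dz x z' xz' by (auto simp: I2_def)
      moreover have "h \<in> W (x, z', J)" using hE x z' J DL by (auto simp: W_def)
      ultimately show ?thesis by blast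
    qed
    have adj: "{x, z'} \<in> edges F \<Longrightarrow> {X, z} \<in> edges G" using ed[of "{x, z'}"] x z' by simp
    show ?thesis
    proof (cases "s \<ge> 2")
      case True
      have "card D \<ge> s + 1 \<or> card D = s \<and> {x, z'} \<in> edges F \<or> (\<exists>w. D = {w} \<and> {x, z'} \<notin> edges F \<and> {x, w} \<notin> edges F)"
        by (rule star_types[OF True x(1) z'(1) xz' proper]) (simp_all add: D_def)
      then consider "card D \<ge> s + 1" | "card D = s" "{x, z'} \<in> edges F" | w where "D = {w}" "{x, z'} \<notin> edges F" by blast
      then show ?thesis
      proof cases
        case 1 then show ?thesis using cases by (intro many) auto
      next
        case 2 then show ?thesis using cases adj by (intro many) auto
      next
        case 3
        then show ?thesis using cases by (intro single[OF 3(1)]) (auto simp: types1_def)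
      qed
    next
      case False
      then have c2: "{X, z} \<notin> edges G" "TS = types1 F" "j = s + 1" using cases by auto
      have s: "s = 1" using False s1 by simp
      show ?thesis
      proof (cases "card D = 1")
        case True
        then obtain w where "D = {w}" by (auto simp: card_1_singleton_iff)
        then show ?thesis using c2 adj by (intro single) (auto simp: types1_def)
      next
        case False
        moreover have "card D \<noteq> 0" using D0 fD by simp
        ultimately show ?thesis using c2 s by (intro many) simp
      qed
    qed
  qed
  have cZ: "real (card (Z q)) \<le> (real n / 2) ^ (k - 3)" if q: "q \<in> L \<times> TS" for q
  proof -
    obtain l x z' u C where qe: "q = (l, x, z', u, C)" "(x, z', u, C) \<in> types F" using q TS by auto
    have t: "x \<in> verts F" "z' \<in> verts F" "u \<in> verts F" "x \<noteq> z'" "x \<noteq> u" "z' \<noteq> u"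
      using qe(2) simple_graph_edge(3)[OF simple] by (auto simp: types_def)
    let ?S = "\<lambda>v. if v = x then {X} else if v = z' then {z} else if v = u then {l} else if v \<in> C then A else B"
    have "card (Z q) = (\<Prod>v\<in>verts F. card (?S v))" by (simp add: Z_def qe card_PiE)
    also have "\<dots> = (\<Prod>v\<in>verts F - {x, z', u}. card (?S v))"
      by (rule prod.mono_neutral_right) auto
    finally have "real (card (Z q)) = (\<Prod>v\<in>verts F - {x, z', u}. real (card (?S v)))" by simp
    also have "\<dots> \<le> (\<Prod>v\<in>verts F - {x, z', u}. real n / 2)"
      using size by (intro prod_mono) auto
    also have "\<dots> = (real n / 2) ^ (k - 3)" using t by (simp add: card_Diff_subset numeral_3_eq_3)
    finally show ?thesis .
  qed
  have cW: "real (card (W q)) \<le> real (card L) ^ j * real n ^ (k - 2 - j)" if q: "q \<in> I2" for q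
  proof -
    obtain x z' J where qe: "q = (x, z', J)" "x \<in> verts F" "z' \<in> verts F" "J \<subseteq> verts F" "x \<noteq> z'" "x \<notin> J" "z' \<notin> J" "card J = j"
      using q by (auto simp: I2_def)
    have fJ: "finite J" using qe finite_subset finite_verts by blast
    have "card (W q) \<le> card (J \<rightarrow>\<^sub>E L) * card (verts G) ^ card (verts F - ({x, z'} \<union> J))"
    proof (rule card_functions_le[where h = "\<lambda>h. restrict h J"])
      fix h h' v assume a: "h \<in> W q" "h' \<in> W q" "restrict h J = restrict h' J" "v \<in> {x, z'} \<union> J"
      show "h v = h' v"
      proof (cases "v \<in> J")
        case True
        then show ?thesis using fun_cong[OF a(3), of v] by simp
      next
        case False
        then show ?thesis using a by (auto simp: W_def qe)
      qed
    next
      fix h assume "h \<in> W q"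
      then show "restrict h J \<in> J \<rightarrow>\<^sub>E L" by (auto simp: W_def qe)
    next
      fix h assume "h \<in> W q"
      then show "h \<in> verts F \<rightarrow>\<^sub>E verts G" by (auto simp: W_def qe)
    qed (use fV fL fJ qe in \<open>auto intro: finite_PiE\<close>)
    moreover have "card (verts F - ({x, z'} \<union> J)) = k - 2 - j"
    proof -
      have "card ({x, z'} \<union> J) = 2 + j" using qe fJ by simp
      then show ?thesis using qe fJ by (subst card_Diff_subset) auto
    qed
    moreover have "card (J \<rightarrow>\<^sub>E L) = card L ^ j" using fJ qe by (simp add: card_PiE)
    ultimately have "card (W q) \<le> card L ^ j * n ^ (k - 2 - j)" using n by simp
    from of_nat_mono[OF this, where 'a = real] show ?thesis by simp
  qed
  have fI2: "finite I2" "card I2 \<le> k * k * 2 ^ k"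
  proof -
    have sub: "I2 \<subseteq> verts F \<times> verts F \<times> Pow (verts F)" by (auto simp: I2_def)
    then show "finite I2" by (rule finite_subset) auto
    have "card I2 \<le> card (verts F \<times> verts F \<times> Pow (verts F))" using sub by (intro card_mono) auto
    then show "card I2 \<le> k * k * 2 ^ k" by (simp add: card_cartesian_product card_Pow mult.assoc)
  qed
  have fZ: "finite (Z q)" for q using f by (auto simp: Z_def split: prod.splits intro!: finite_PiE)
  have fW: "finite (W q)" for q using fV finite_PiE[of "verts F" "\<lambda>_. verts G"] by (auto simp: W_def split: prod.splits)
  have "embeddings F G \<subseteq> (\<Union>q\<in>L \<times> TS. Z q) \<union> (\<Union>q\<in>I2. W q)" using cover by blast
  then have "card (embeddings F G) \<le> card ((\<Union>q\<in>L \<times> TS. Z q) \<union> (\<Union>q\<in>I2. W q))"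
    using fL fTS fI2 fZ fW by (intro card_mono) auto
  also have "\<dots> \<le> card (\<Union>q\<in>L \<times> TS. Z q) + card (\<Union>q\<in>I2. W q)" by (rule card_Un_le)
  also have "\<dots> \<le> (\<Sum>q\<in>L \<times> TS. card (Z q)) + (\<Sum>q\<in>I2. card (W q))"
    using fL fTS fI2 by (intro add_mono card_UN_le) auto
  finally have "card (embeddings F G) \<le> (\<Sum>q\<in>L \<times> TS. card (Z q)) + (\<Sum>q\<in>I2. card (W q))" .
  from of_nat_mono[OF this, where 'a = real]
  have "real (card (embeddings F G)) \<le> (\<Sum>q\<in>L \<times> TS. real (card (Z q))) + (\<Sum>q\<in>I2. real (card (W q)))" by simp
  also have "\<dots> \<le> (\<Sum>q\<in>L \<times> TS. (real n / 2) ^ (k - 3)) + (\<Sum>q\<in>I2. real (card L) ^ j * real n ^ (k - 2 - j))"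
    using cZ cW by (intro add_mono sum_mono) auto
  also have "\<dots> = card L * (card TS * (real n / 2) ^ (k - 3)) + real (card I2) * (real (card L) ^ j * real n ^ (k - 2 - j))"
    by (simp add: card_cartesian_product)
  also have "real (card I2) * (real (card L) ^ j * real n ^ (k - 2 - j)) \<le>
      real (k * k * 2 ^ k) * (real (card L) ^ j * real n ^ (k - 2 - j))"
    using fI2(2) by (intro mult_right_mono of_nat_mono) auto
  finally show ?thesis by (simp add: mult.assoc)
qed

section \<open>Lower bounds\<close>


text \<open>Some z lies on at least a quarter of the inner edges. The configuration of
  \<open>star_ex\<close> is placed with its centre at z and its s leaves among the inner neighbours
  of z. Since s \<ge> 2, these embeddings use at least two inner edges and are therefore not of
  single type.\<close>

lemma star_count:
  fixes G :: "'b sgraph"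
  assumes G: "simple_graph G" and n: "n = card (verts G)" and core: "apex_core G X A B"
    and z: "z \<in> A \<union> B" and deg: "q \<le> 4 * card {e \<in> bad_edges G A B. z \<in> e}"
    and q: "8 * k + 16 \<le> q" and nk: "8 * k + 32 \<le> n" and s2: "s \<ge> 2"
  shows "(1 / 16) ^ k * real q ^ s * real n ^ (k - 2 - s) \<le>
    card {f \<in> embeddings F G. X \<in> f ` verts F \<and> \<not> single_type F X A B f}"
proof -
  obtain x z0 C L where x: "x \<in> verts F" and C: "C \<subseteq> verts F - {x}" and z0: "z0 \<in> C" and L: "L \<subseteq> C - {z0}"
    and cL: "card L = s" and zL: "\<forall>l\<in>L. {z0, l} \<in> edges F"
    and bi: "\<forall>a b. {a, b} \<in> edges F \<longrightarrow> a \<noteq> x \<longrightarrow> b \<noteq> x \<longrightarrow> (a \<in> C) = (b \<in> C) \<longrightarrow> (\<exists>l\<in>L. {a, b} = {z0, l})"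
    using star_ex by blast
  have cut: "apex_cut G X A B" using core by (simp add: apex_core_def)
  note f = apex_cut_card[OF G cut]
  note c = apex_core_card_edges[OF G core]
  have X: "X \<notin> A" "X \<notin> B" and V: "verts G = insert X (A \<union> B)" and AB: "A \<inter> B = {}"
    using cut by (auto simp: apex_cut_def)
  define P where "P = (if z \<in> A then A else B)"
  define Q where "Q = (if z \<in> A then B else A)"
  have zP: "z \<in> P" using z by (auto simp: P_def)
  have PQ: "P \<inter> Q = {}" "P \<union> Q = A \<union> B" "finite P" "finite Q" using AB f by (auto simp: P_def Q_def)
  have cross: "{a, b} \<in> edges G" if "a \<in> P" "b \<in> Q" for a b
  proof -
    have AxB: "{a, b} \<in> edges G" if "a \<in> A" "b \<in> B" for a b using c(4) that by (auto simp: missing_def)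
    show ?thesis using AxB[of a b] AxB[of b a] that by (simp add: P_def Q_def insert_commute split: if_splits)
  qed
  have XPQ: "{X, a} \<in> edges G" if "a \<in> P \<union> Q" for a using c(3) that PQ by auto
  have sz: "real n / 2 - 1 \<le> card P" "real n / 2 - 1 \<le> card Q"
    using balanced_parts[of n "card A" "card B" 0] f(3) n core by (auto simp: P_def Q_def apex_core_def)
  define \<Lambda> where "\<Lambda> = nbrs G z \<inter> P"
  have "card {e \<in> bad_edges G A B. z \<in> e} \<le> card \<Lambda>"
    unfolding \<Lambda>_def using z AB by (intro card_edges_at_le[OF G]) (auto simp: bad_edges_def P_def)
  then have c\<Lambda>: "q \<le> 4 * card \<Lambda>" using deg by linarith
  have z\<Lambda>: "z \<notin> \<Lambda>" using simple_graph_edge(3)[OF G, of z z] by (auto simp: \<Lambda>_def nbrs_def)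
  have f\<Lambda>: "finite \<Lambda>" "\<Lambda> \<subseteq> P" using PQ by (auto simp: \<Lambda>_def)
  define I where "I = verts F - {x, z0}"
  have fI: "finite I" by (simp add: I_def)
  have z0V: "z0 \<in> verts F" "x \<noteq> z0" using z0 C by auto
  have cI: "card I = k - 2" using x z0V by (simp add: I_def card_Diff_subset)
  have LI: "L \<subseteq> I" using L C by (auto simp: I_def)
  then have fL: "finite L" using fI finite_subset by blast
  define S where "S v = (if v \<in> L then \<Lambda> else (if v \<in> C then P else Q) - {z})" for v
  \<comment> \<open>There are at least q / 4 inner neighbours and about n / 2 vertices in a side;
    giving up half of each absorbs the greedy loss of at most k and the rounding. The factor 1 / 16
    below then covers the integer divisions.\<close>
  define r where "r v = (if v \<in> L then q div 8 else n div 4)" for v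
  let ?J = "{h \<in> Pi\<^sub>E I S. inj_on h I}"
  have "(\<Prod>v\<in>I. r v) \<le> card ?J"
  proof (rule card_inj_PiE_ge[OF fI])
    fix v assume "v \<in> I"
    show "finite (S v)" using f\<Lambda> PQ by (simp add: S_def)
    show "r v + card I \<le> card (S v)"
    proof (cases "v \<in> L")
      case True
      have "q div 8 + k \<le> card \<Lambda>" using c\<Lambda> q by linarith
      then show ?thesis using True cI by (simp add: r_def S_def)
    next
      case False
      let ?R = "if v \<in> C then P else Q"
      have "card ?R - card {z} \<le> card (?R - {z})" by (rule diff_card_le_card_Diff) simp
      moreover have "real n / 2 - 1 \<le> card ?R" using sz by simp
      then have "n \<le> 2 * card ?R + 2" by linarith
      moreover have "card {z} = 1" by simp
      ultimately have "n div 4 + k \<le> card (?R - {z})" using nk by linarith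
      then show ?thesis using False cI by (simp add: r_def S_def)
    qed
  qed
  then have J: "real (\<Prod>v\<in>I. r v) \<le> card ?J" by (rule of_nat_mono)
  have "(1 / 16) ^ k * real q ^ s * real n ^ (k - 2 - s) \<le> real (\<Prod>v\<in>I. r v)"
  proof -
    have s2k: "s \<le> k - 2" using card_mono[OF fI LI] cL cI by simp
    have "real (\<Prod>v\<in>I. r v) = (\<Prod>v\<in>I. real (r v))" by simp
    also have "\<dots> = (\<Prod>v\<in>L. real (r v)) * (\<Prod>v\<in>I - L. real (r v))"
      using prod.subset_diff[OF LI fI, of "\<lambda>v. real (r v)"] by (simp add: mult.commute)
    also have "\<dots> = real (q div 8) ^ s * real (n div 4) ^ (k - 2 - s)"
      using cL cI LI fL by (simp add: r_def card_Diff_subset)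
    also have "\<dots> \<ge> (1 / 16 * real q) ^ s * (1 / 16 * real n) ^ (k - 2 - s)"
    proof (intro mult_mono power_mono)
      have "q \<le> 16 * (q div 8)" using q by linarith
      from of_nat_mono[OF this, where 'a = real] show "1 / 16 * real q \<le> real (q div 8)" by simp
      have "n \<le> 16 * (n div 4)" using nk by linarith
      from of_nat_mono[OF this, where 'a = real] show "1 / 16 * real n \<le> real (n div 4)" by simp
    qed auto
    finally have "(1 / 16 * real q) ^ s * (1 / 16 * real n) ^ (k - 2 - s) \<le> real (\<Prod>v\<in>I. r v)" .
    moreover have "(1 / 16 * real q) ^ s * (1 / 16 * real n) ^ (k - 2 - s) =
      (1 / 16) ^ (k - 2) * (real q ^ s * real n ^ (k - 2 - s))"
    proof -
      have "(1 / 16 :: real) ^ (k - 2) = (1 / 16) ^ s * (1 / 16) ^ (k - 2 - s)"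
        using le_add_diff_inverse[OF s2k] by (metis power_add)
      then show ?thesis by (simp add: power_mult_distrib power_divide mult_ac)
    qed
    moreover have "(1 / 16 :: real) ^ k * (real q ^ s * real n ^ (k - 2 - s)) \<le> (1 / 16) ^ (k - 2) * (real q ^ s * real n ^ (k - 2 - s))"
      by (intro mult_right_mono power_decreasing) auto
    ultimately show ?thesis by (simp add: mult.assoc)
  qed
  also note J
  also have "card ?J \<le> card {f \<in> embeddings F G. X \<in> f ` verts F \<and> \<not> single_type F X A B f}"
  proof (rule card_inj_on_le[of "\<lambda>h. h(x := X, z0 := z)"])
    show "finite {f \<in> embeddings F G. X \<in> f ` verts F \<and> \<not> single_type F X A B f}"
      using finite_embeddings[OF simple G] by simp
    show "inj_on (\<lambda>h. h(x := X, z0 := z)) ?J"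
    proof (rule inj_onI)
      fix h h' assume a: "h \<in> ?J" "h' \<in> ?J" "h(x := X, z0 := z) = h'(x := X, z0 := z)"
      have "h v = h' v" if "v \<in> I" for v
      proof -
        have "v \<noteq> x" "v \<noteq> z0" using that by (auto simp: I_def)
        then show ?thesis using fun_cong[OF a(3), of v] by simp
      qed
      then show "h = h'" using a by (auto intro: PiE_ext)
    qed
    show "(\<lambda>h. h(x := X, z0 := z)) ` ?J \<subseteq> {f \<in> embeddings F G. X \<in> f ` verts F \<and> \<not> single_type F X A B f}"
    proof (rule image_subsetI)
      fix h0 assume h0: "h0 \<in> ?J"
      define h where "h = h0(x := X, z0 := z)"
      have hx: "h x = X" and hz: "h z0 = z" and hI: "\<And>v. v \<in> I \<Longrightarrow> h v = h0 v"
        using z0V by (auto simp: h_def I_def)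
      have h0S: "h0 v \<in> S v" if "v \<in> I" for v using h0 that by (auto dest: PiE_mem)
      have hP: "h v \<in> P" if "v \<in> C" for v
      proof (cases "v = z0")
        case True then show ?thesis using hz zP by simp
      next
        case False
        then have "v \<in> I" using that C by (auto simp: I_def)
        then show ?thesis using h0S[of v] hI[of v] that f\<Lambda> by (auto simp: S_def split: if_splits)
      qed
      have hQ: "h v \<in> Q" if "v \<in> verts F" "v \<notin> C" "v \<noteq> x" for v
      proof -
        have "v \<in> I" "v \<notin> L" using that z0 L by (auto simp: I_def)
        then show ?thesis using h0S[of v] hI[of v] that by (auto simp: S_def)
      qed
      have hPQ: "h v \<in> P \<union> Q" if "v \<in> verts F" "v \<noteq> x" for v using hP hQ that by blast
      have hL: "h l \<in> \<Lambda>" if "l \<in> L" for l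
        using h0S[of l] hI[of l] LI that by (auto simp: S_def)
      have hnz: "h v \<noteq> z" if "v \<in> I" for v using h0S[OF that] hI[OF that] z\<Lambda> by (auto simp: S_def split: if_splits)
      have vF: "verts F = insert x (insert z0 I)" using x z0V by (auto simp: I_def)
      have XnP: "X \<notin> P \<union> Q" using X PQ by auto
      have "inj_on h I" using h0 hI by (auto simp: inj_on_def)
      moreover have "h z0 \<notin> h ` I"
      proof
        assume "h z0 \<in> h ` I"
        then obtain v where "v \<in> I" "h z0 = h v" by blast
        then show False using hnz[of v] hz by simp
      qed
      moreover have "h x \<notin> h ` insert z0 I"
      proof -
        have "h v \<noteq> X" if "v \<in> I" for v using hPQ[of v] XnP that by (auto simp: I_def)
        moreover have "z \<noteq> X" using zP XnP by auto
        ultimately show ?thesis unfolding image_insert hx hz by fastforce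
      qed
      ultimately have "inj_on h (verts F)"
        unfolding vF inj_on_insert by auto
      moreover have "h \<in> verts F \<rightarrow>\<^sub>E verts G"
      proof
        fix v assume "v \<in> verts F"
        then show "h v \<in> verts G" using hx hPQ[of v] V PQ by (cases "v = x") auto
      next
        fix v assume "v \<notin> verts F"
        then show "h v = undefined" using h0 x z0V by (auto simp: h_def I_def PiE_def extensional_def)
      qed
      moreover have "h ` e \<in> edges G" if e: "e \<in> edges F" for e
      proof -
        obtain a b where ab: "e = {a, b}" "a \<in> verts F" "b \<in> verts F" "a \<noteq> b" using simple_graph_edgeE[OF simple e] by metis
        consider "a = x" | "b = x" | "a \<noteq> x" "b \<noteq> x" "a \<in> C" "b \<notin> C" | "a \<noteq> x" "b \<noteq> x" "a \<notin> C" "b \<in> C"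
          | "a \<noteq> x" "b \<noteq> x" "(a \<in> C) = (b \<in> C)" by blast
        then show ?thesis
        proof cases
          case 1 then show ?thesis using XPQ[OF hPQ[OF ab(3)]] ab hx by auto
        next
          case 2 then show ?thesis using XPQ[OF hPQ[OF ab(2)]] ab hx by (auto simp: insert_commute)
        next
          case 3 then show ?thesis using cross[OF hP hQ] ab by auto
        next
          case 4 then show ?thesis using cross[OF hP[of b] hQ[of a]] ab by (auto simp: insert_commute)
        next
          case 5
          then obtain l where l: "l \<in> L" "{a, b} = {z0, l}" using bi e ab by blast
          have "{z, h l} \<in> edges G" using hL[OF l(1)] by (simp add: \<Lambda>_def nbrs_def)
          then show ?thesis using l(2) ab hz by simp
        qed
      qed
      ultimately have hE: "h \<in> embeddings F G" by (simp add: embeddings_def)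
      have "\<not> single_type F X A B h"
      proof -
        let ?M = "{e \<in> edges F. h ` e \<subseteq> A \<or> h ` e \<subseteq> B}"
        have "(\<lambda>l. {z0, l}) ` L \<subseteq> ?M"
        proof (rule image_subsetI)
          fix l assume l: "l \<in> L"
          have "h ` {z0, l} \<subseteq> P" using hz zP hL[OF l] f\<Lambda> by auto
          then show "{z0, l} \<in> ?M" using zL l by (auto simp: P_def split: if_splits)
        qed
        then have "card ((\<lambda>l. {z0, l}) ` L) \<le> card ?M" using finite_edges[OF simple] by (intro card_mono) auto
        moreover have "card ((\<lambda>l. {z0, l}) ` L) = s"
          using cL by (subst card_image) (auto simp: inj_on_def doubleton_eq_iff)
        ultimately have "2 \<le> card ?M" using s2 by simp
        then show ?thesis by (simp add: single_type_def)
      qed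
      then show "h0(x := X, z0 := z) \<in> {f \<in> embeddings F G. X \<in> f ` verts F \<and> \<not> single_type F X A B f}"
        using hE hx x by (auto simp: h_def[symmetric])
    qed
  qed
  finally show ?thesis by simp
qed

lemma k_ge_s: "s + 2 \<le> k"
proof -
  obtain x z C L where xz: "x \<in> verts F" "C \<subseteq> verts F - {x}" "z \<in> C" "L \<subseteq> C - {z}" "card L = s"
    using star_ex by blast
  have fL: "finite L" using xz by (meson finite_Diff finite_subset finite_verts)
  have "insert x (insert z L) \<subseteq> verts F" using xz by auto
  then have "card (insert x (insert z L)) \<le> k" by (intro card_mono) auto
  moreover have "z \<notin> L" "x \<notin> insert z L" using xz by auto
  ultimately show ?thesis using fL xz(5) by simp
qed

text \<open>The extra copies come from stars if some vertex sees a quarter of the bad edges, and from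
  pairs of independent bad edges otherwise. For \<open>s = 1\<close> they are single-edge copies using the
  edge between the apex and the bad edge.\<close>

lemma core_lower:
  "\<exists>c>0. \<exists>N. \<forall>n\<ge>N. \<forall>G :: 'b sgraph. \<forall>X A B. simple_graph G \<longrightarrow> card (verts G) = n \<longrightarrow> apex_core G X A B \<longrightarrow>
    N \<le> card (bad_edges G A B) \<longrightarrow> card (bad_edges G A B) \<le> n \<longrightarrow>
    card (bad_edges G A B) * (card (types1 F) * ((real n / 2) ^ (k - 3) - err * real n ^ (k - 3) / real n))
      + c * real (card (bad_edges G A B)) ^ s * real n ^ (k - 2 - s) \<le> card (embeddings F G)"
proof (cases "s = 1")
  case True
  obtain N1 where N1: "\<And>n. n \<ge> N1 \<Longrightarrow> err * real n ^ (k - 3) / real n < (real n / 2) ^ (k - 3) \<and> 8 \<le> n"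
    using err_small by blast
  \<comment> \<open>From here on the loss through \<open>err\<close> is at most half of the main
    power.\<close>
  obtain N where N: "\<And>n. n \<ge> N \<Longrightarrow> 2 * err * real n ^ (k - 3) / real n \<le> (real n / 2) ^ (k - 3)" "N \<ge> N1"
  proof (rule that)
    fix n assume n: "max N1 (nat \<lceil>2 * err * 2 ^ (k - 3)\<rceil> + 1) \<le> n"
    then have "2 * err * 2 ^ (k - 3) < real n" by linarith
    moreover have n0: "real n > 0" using n by linarith
    ultimately have "2 * err / real n \<le> (1 / 2) ^ (k - 3)" by (simp add: field_simps)
    then have "2 * err / real n * real n ^ (k - 3) \<le> (1 / 2) ^ (k - 3) * real n ^ (k - 3)"
      by (intro mult_right_mono) auto
    then show "2 * err * real n ^ (k - 3) / real n \<le> (real n / 2) ^ (k - 3)" by (simp add: power_divide)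
  qed simp
  \<comment> \<open>For s = 1 the configuration of \<open>star_ex\<close> is itself a type, and it
    uses the edge between x and z. So there is at least one type outside \<open>types1\<close>, and
    it contributes the extra term.\<close>
  have t1: "card (types1 F) + 1 \<le> card (types F)"
  proof -
    obtain x z C L where x: "x \<in> verts F" and C: "C \<subseteq> verts F - {x}" and z: "z \<in> C" and xz: "{x, z} \<in> edges F"
      and L: "L \<subseteq> C - {z}" "card L = s" and zL: "\<forall>l\<in>L. {z, l} \<in> edges F"
      and bi: "\<forall>a b. {a, b} \<in> edges F \<longrightarrow> a \<noteq> x \<longrightarrow> b \<noteq> x \<longrightarrow> (a \<in> C) = (b \<in> C) \<longrightarrow> (\<exists>l\<in>L. {a, b} = {z, l})"
      using star_ex by blast
    obtain l where l: "L = {l}" using L True by (auto simp: card_1_singleton_iff)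
    have "(x, z, l, C) \<in> types F" using x C z zL L l bi by (auto simp: types_def)
    moreover have "(x, z, l, C) \<notin> types1 F" using xz by (simp add: types1_def)
    ultimately have "types1 F \<subset> types F" using types2_subset(3) by auto
    then have "card (types1 F) < card (types F)" by (intro psubset_card_mono) auto
    then show ?thesis by simp
  qed
  show ?thesis
  proof (rule exI[of _ "(1 / 2) ^ (k - 3) / 2"], rule conjI, simp, rule exI[of _ N], intro allI impI)
    fix n and G :: "'b sgraph" and X A B
    assume n: "N \<le> n" and G: "simple_graph G" "card (verts G) = n" and core: "apex_core G X A B"
    define q where "q = card (bad_edges G A B)"
    define y where "y = (real n / 2) ^ (k - 3) - err * real n ^ (k - 3) / real n"
    have n8: "8 \<le> n" using N1[of n] N(2) n by simp
    have "q * (card (types F) * y) \<le> card {f \<in> embeddings F G. single_type F X A B f}"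
      unfolding q_def y_def by (rule core_count[OF G(1) G(2)[symmetric] n8 core]) simp
    also have "\<dots> \<le> card (embeddings F G)" using finite_embeddings[OF simple G(1)] by (intro of_nat_mono card_mono) auto
    finally have 1: "q * (card (types F) * y) \<le> card (embeddings F G)" .
    have "2 * err * real n ^ (k - 3) / real n = 2 * (err * real n ^ (k - 3) / real n)" by simp
    then have y2: "(real n / 2) ^ (k - 3) / 2 \<le> y" using N(1)[OF n] unfolding y_def by linarith
    have "0 \<le> (real n / 2) ^ (k - 3) / 2" by simp
    then have y0: "0 \<le> y" using y2 by linarith
    have "real (card (types1 F)) * y + y \<le> card (types F) * y"
      using mult_right_mono[of "real (card (types1 F) + 1)" "real (card (types F))" y] t1 y0
      by (simp add: algebra_simps)
    then have "q * (card (types1 F) * y + y) \<le> q * (card (types F) * y)" by (intro mult_left_mono) auto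
    moreover have "q * ((real n / 2) ^ (k - 3) / 2) \<le> q * y" using y2 by (intro mult_left_mono) auto
    ultimately have "q * (card (types1 F) * y) + q * ((real n / 2) ^ (k - 3) / 2) \<le> card (embeddings F G)"
      using 1 by (simp add: algebra_simps)
    moreover have "q * ((real n / 2) ^ (k - 3) / 2) = (1 / 2) ^ (k - 3) / 2 * real q ^ s * real n ^ (k - 2 - s)"
      using True by (simp add: power_divide numeral_3_eq_3)
    ultimately show "card (bad_edges G A B) * (card (types1 F) * ((real n / 2) ^ (k - 3) - err * real n ^ (k - 3) / real n))
      + (1 / 2) ^ (k - 3) / 2 * real (card (bad_edges G A B)) ^ s * real n ^ (k - 2 - s) \<le> card (embeddings F G)"
      unfolding q_def y_def by linarith
  qed
next
  case False
  then have s2: "s \<ge> 2" using s1 by simp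
  obtain \<sigma> \<eta> N where \<sigma>: "\<sigma> > 0" and \<eta>: "\<eta> > 0" and N0: "\<forall>n\<ge>N. \<forall>G :: 'b sgraph. \<forall>A B E.
    simple_graph G \<longrightarrow> card (verts G) = n \<longrightarrow> A \<inter> B = {} \<longrightarrow> A \<union> B \<subseteq> verts G \<longrightarrow>
    real n / 3 \<le> card A \<longrightarrow> real n / 3 \<le> card B \<longrightarrow> card (missing G A B) \<le> \<eta> * real n ^ 2 \<longrightarrow>
    E \<subseteq> bad_edges G A B \<longrightarrow>
    (\<forall>e\<in>E. \<forall>w\<in>e. (w \<in> A \<longrightarrow> card {y \<in> B. {w, y} \<notin> edges G} \<le> \<eta> * real n) \<and>
       (w \<in> B \<longrightarrow> card {y \<in> A. {w, y} \<notin> edges G} \<le> \<eta> * real n)) \<longrightarrow>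
    card {(e, e') \<in> E \<times> E. e \<inter> e' = {}} * (\<sigma> * real n ^ (k - 4)) \<le>
      card {f \<in> embeddings F G. f ` verts F \<subseteq> A \<union> B}"
    using pairs_count[where ?'b = 'b] by (elim exE conjE) (rule that; assumption)
  note Np = N0[rule_format]
  \<comment> \<open>The two bounds come from \<open>star_count\<close> and from the pair count,
    where \<open>q ^ 2 / 2\<close> pairs contribute \<sigma> each.\<close>
  define c where "c = min ((1 / 16) ^ k) (\<sigma> / 2)"
  have c: "c > 0" "c \<le> (1 / 16) ^ k" "c \<le> \<sigma> / 2" using \<sigma> by (auto simp: c_def)
  define N' where "N' = max N (8 * k + 32)"
  show ?thesis
  proof (rule exI[of _ c], rule conjI[OF c(1)], rule exI[of _ N'], intro allI impI)
    fix n and G :: "'b sgraph" and X A B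
    assume n: "N' \<le> n" and G: "simple_graph G" "card (verts G) = n" and core: "apex_core G X A B"
      and q1: "N' \<le> card (bad_edges G A B)" and q2: "card (bad_edges G A B) \<le> n"
    define q where "q = card (bad_edges G A B)"
    have cut: "apex_cut G X A B" using core by (simp add: apex_core_def)
    note f = apex_cut_card[OF G(1) cut]
    note ce = apex_core_card_edges[OF G(1) core]
    have X: "X \<notin> A" "X \<notin> B" and V: "verts G = insert X (A \<union> B)" and AB: "A \<inter> B = {}"
      using cut by (auto simp: apex_cut_def)
    have n8: "8 \<le> n" and nk: "8 * k + 32 \<le> n" "n \<ge> N" and qk: "8 * k + 16 \<le> q" using n q1 by (auto simp: N'_def q_def)
    have fE: "finite (embeddings F G)" by (rule finite_embeddings[OF simple G(1)])
    let ?S = "{f \<in> embeddings F G. single_type F X A B f}"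
    have S: "q * (card (types1 F) * ((real n / 2) ^ (k - 3) - err * real n ^ (k - 3) / real n)) \<le> card ?S"
      unfolding q_def using types2_subset by (intro core_count[OF G(1) G(2)[symmetric] n8 core]) auto
    \<comment> \<open>Star copies have more than one inner edge and pair copies avoid the apex, so
      neither is of single type and the two counts add.\<close>
    have "\<exists>Y \<subseteq> embeddings F G. Y \<inter> ?S = {} \<and> c * real q ^ s * real n ^ (k - 2 - s) \<le> card Y"
    proof (cases "\<exists>z\<in>A \<union> B. q \<le> 4 * card {e \<in> bad_edges G A B. z \<in> e}")
      case True
      then obtain z where z: "z \<in> A \<union> B" "q \<le> 4 * card {e \<in> bad_edges G A B. z \<in> e}" by blast
      have "c * (real q ^ s * real n ^ (k - 2 - s)) \<le> (1 / 16) ^ k * (real q ^ s * real n ^ (k - 2 - s))"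
        using c by (intro mult_right_mono) auto
      then have "c * real q ^ s * real n ^ (k - 2 - s) \<le> card {f \<in> embeddings F G. X \<in> f ` verts F \<and> \<not> single_type F X A B f}"
        using star_count[OF G(1) G(2)[symmetric] core z qk nk(1) s2] by (simp add: mult.assoc)
      then show ?thesis by (intro exI[of _ "{f \<in> embeddings F G. X \<in> f ` verts F \<and> \<not> single_type F X A B f}"]) auto
    next
      case no: False
      define Y where "Y = {f \<in> embeddings F G. f ` verts F \<subseteq> A \<union> B}"
      have deg: "real (card {e \<in> bad_edges G A B. w \<in> e}) \<le> real q / 4" for w
      proof (cases "w \<in> A \<union> B")
        case True
        then have "4 * card {e \<in> bad_edges G A B. w \<in> e} \<le> q" using no by force
        from of_nat_mono[OF this, where 'a = real] show ?thesis by simp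
      next
        case False
        then have "{e \<in> bad_edges G A B. w \<in> e} = {}" by (auto simp: bad_edges_def)
        then have "card {e \<in> bad_edges G A B. w \<in> e} = 0" by (simp only: card.empty)
        then show ?thesis by simp
      qed
      have "real q * (real q - 2 * (real q / 4)) \<le> card {(e, e') \<in> bad_edges G A B \<times> bad_edges G A B. e \<inter> e' = {}}"
        unfolding q_def
      proof (rule disjoint_pairs_count[OF finite_bad_edges[OF G(1)]])
        fix e assume "e \<in> bad_edges G A B"
        then have "e \<in> edges G" by (simp add: bad_edges_def)
        then show "\<exists>a b. e = {a, b}" using simple_graph_edgeE[OF G(1)] by metis
      qed (rule deg[unfolded q_def])
      then have pr: "real q ^ 2 / 2 \<le> card {(e, e') \<in> bad_edges G A B \<times> bad_edges G A B. e \<inter> e' = {}}"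
        by (simp add: power2_eq_square algebra_simps)
      have sz: "real n / 2 - 1 \<le> card A" "real n / 2 - 1 \<le> card B"
        using balanced_parts[of n "card A" "card B" 0] f(3) G core by (auto simp: apex_core_def)
      have no1: "card {y \<in> B. {w, y} \<notin> edges G} = 0" if "w \<in> A" for w
      proof -
        have "{y \<in> B. {w, y} \<notin> edges G} = {}" using ce(4) that by (auto simp: missing_def)
        then show ?thesis by (simp only: card.empty)
      qed
      have no2: "card {y \<in> A. {w, y} \<notin> edges G} = 0" if "w \<in> B" for w
      proof -
        have "{y \<in> A. {w, y} \<notin> edges G} = {}" using ce(4) that by (auto simp: missing_def insert_commute)
        then show ?thesis by (simp only: card.empty)
      qed
      have "card {(e, e') \<in> bad_edges G A B \<times> bad_edges G A B. e \<inter> e' = {}} * (\<sigma> * real n ^ (k - 4)) \<le> card Y"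
        unfolding Y_def
      proof (rule Np[OF nk(2) G AB])
        show "A \<union> B \<subseteq> verts G" using V by auto
        show "real n / 3 \<le> card A" "real n / 3 \<le> card B" using sz nk(1) by linarith+
        show "card (missing G A B) \<le> \<eta> * real n ^ 2" using ce(4) \<eta> by simp
        show "bad_edges G A B \<subseteq> bad_edges G A B" by simp
        fix e w
        show "(w \<in> A \<longrightarrow> card {y \<in> B. {w, y} \<notin> edges G} \<le> \<eta> * real n) \<and>
          (w \<in> B \<longrightarrow> card {y \<in> A. {w, y} \<notin> edges G} \<le> \<eta> * real n)"
          using \<eta> by (intro conjI impI) (simp_all only: no1 no2 of_nat_0 mult_nonneg_nonneg less_imp_le of_nat_0_le_iff)
      qed
      moreover have "real q ^ 2 / 2 * (\<sigma> * real n ^ (k - 4)) \<le>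
        card {(e, e') \<in> bad_edges G A B \<times> bad_edges G A B. e \<inter> e' = {}} * (\<sigma> * real n ^ (k - 4))"
        using pr \<sigma> by (intro mult_right_mono) auto
      \<comment> \<open>For q \<le> n and s \<ge> 2 the pair count, of order
        \<open>q ^ 2 * n ^ (k - 4)\<close>, dominates the star count.\<close>
      moreover have "c * real q ^ s * real n ^ (k - 2 - s) \<le> real q ^ 2 / 2 * (\<sigma> * real n ^ (k - 4))"
      proof -
        have e1: "real q ^ s = real q ^ 2 * real q ^ (s - 2)" using s2 le_add_diff_inverse[OF s2] by (metis power_add)
        have e2: "real n ^ (k - 4) = real n ^ (s - 2) * real n ^ (k - 2 - s)" 
        proof -
          have "k - 4 = (s - 2) + (k - 2 - s)" using s2 k_ge_s by simp
          then show ?thesis by (metis power_add)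
        qed
        have "real q ^ (s - 2) \<le> real n ^ (s - 2)" using q2 by (intro power_mono) (auto simp: q_def)
        then have "c * (real q ^ 2 * real q ^ (s - 2) * real n ^ (k - 2 - s)) \<le>
          \<sigma> / 2 * (real q ^ 2 * real n ^ (s - 2) * real n ^ (k - 2 - s))"
          using c \<sigma> by (intro mult_mono mult_right_mono mult_left_mono) auto
        then show ?thesis unfolding e1 e2 by (simp add: mult_ac)
      qed
      moreover have "Y \<inter> ?S = {}" using X by (auto simp: Y_def single_type_def)
      moreover have "Y \<subseteq> embeddings F G" by (auto simp: Y_def)
      ultimately show ?thesis by (intro exI[of _ Y]) simp
    qed
    then obtain Y where Y: "Y \<subseteq> embeddings F G" "Y \<inter> ?S = {}" "c * real q ^ s * real n ^ (k - 2 - s) \<le> card Y" by blast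
    have "card (?S \<union> Y) = card ?S + card Y" using fE Y by (intro card_Un_disjoint) (auto intro: finite_subset)
    moreover have "card (?S \<union> Y) \<le> card (embeddings F G)" using fE Y by (intro card_mono) auto
    ultimately have "card ?S + card Y \<le> card (embeddings F G)" by linarith
    from of_nat_mono[OF this, where 'a = real]
    have "real (card ?S) + real (card Y) \<le> card (embeddings F G)" by simp
    then show "card (bad_edges G A B) * (card (types1 F) * ((real n / 2) ^ (k - 3) - err * real n ^ (k - 3) / real n))
      + c * real (card (bad_edges G A B)) ^ s * real n ^ (k - 2 - s) \<le> card (embeddings F G)"
      using S Y(3) unfolding q_def by linarith
  qed
qed

end

section \<open>Stability\<close>

text \<open>Strictness survives because the division by the number of automorphisms is exact;
  rounding would preserve only the weak inequality.\<close>

lemma num_copies_less: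
  assumes F: "simple_graph F" and G: "simple_graph G" "simple_graph G'"
    and less: "card (embeddings F G) < card (embeddings F G')"
  shows "num_copies F G < num_copies F G'"
proof -
  let ?a = "card (isomorphisms F F)"
  have "?a dvd card (embeddings F G)" "?a dvd card (embeddings F G')"
    using card_automorphisms_dvd[OF F] G by auto
  then obtain b c where bc: "card (embeddings F G) = ?a * b" "card (embeddings F G') = ?a * c"
    unfolding dvd_def by blast
  then have "?a * b < ?a * c" using less by simp
  then have "0 < ?a \<and> b < c" by (simp only: mult_less_cancel1)
  then show ?thesis unfolding num_copies_def bc by simp
qed

text \<open>Centre 1 and leaves 2 to m + 1; they stay inside the part following the apex 0 as long
  as \<open>m + 1 \<le> (n - 1) div 2\<close>.\<close>

definition star_graph :: "nat \<Rightarrow> nat \<Rightarrow> nat sgraph" where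
  "star_graph n m = SGraph {..<n} (edges (apex_graph n) \<union> (\<lambda>l. {1, l}) ` {2..m + 1})"

lemma star_graph:
  assumes n: "n \<ge> 3" and m: "m + 1 \<le> (n - 1) div 2"
  defines "A \<equiv> {1..(n - 1) div 2}" and "B \<equiv> {(n - 1) div 2 + 1..<n}"
  shows "simple_graph (star_graph n m)" "card (verts (star_graph n m)) = n" "apex_core (star_graph n m) 0 A B"
    "bad_edges (star_graph n m) A B = (\<lambda>l. {1, l}) ` {2..m + 1}" "card (bad_edges (star_graph n m) A B) = m"
    "1 \<in> A" "{2..m + 1} \<subseteq> A - {1}" "real (card A) \<le> real n / 2" "real (card B) \<le> real n / 2"
    "{0, 1} \<in> edges (star_graph n m)"
proof -
  have V: "{..<n} = insert 0 (A \<union> B)" using n by (auto simp: A_def B_def)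
  have d: "0 \<notin> A \<union> B" "A \<inter> B = {}" by (auto simp: A_def B_def)
  have G: "apex_graph n = SGraph (insert 0 (A \<union> B)) (apex_edges 0 A B)"
    by (simp only: apex_graph_def V[symmetric]) (simp add: A_def B_def)
  show z: "1 \<in> A" and L: "{2..m + 1} \<subseteq> A - {1}" using n m by (auto simp: A_def)
  have S: "star_graph n m = SGraph (insert 0 (A \<union> B)) (apex_edges 0 A B \<union> (\<lambda>l. {1, l}) ` {2..m + 1})"
    by (simp add: star_graph_def G V)
  have fAB: "finite A" "finite B" by (auto simp: A_def B_def)
  have "simple_graph (SGraph (insert 0 (A \<union> B)) (apex_edges 0 A B))"
    using d by (intro simple_apex_graph fAB) auto
  moreover have "{1, l} \<in> [insert 0 (A \<union> B)]\<^bsup>2\<^esup>" if "l \<in> {2..m + 1}" for l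
    using that z L by (auto simp: nsets_def)
  ultimately show "simple_graph (star_graph n m)" by (auto simp: S simple_graph_def)
  show n': "card (verts (star_graph n m)) = n" by (simp add: star_graph_def)
  have "card A * card B = (n - 1)\<^sup>2 div 4"
    using half_prod[of "n - 1"] by (simp add: A_def B_def)
  then show "apex_core (star_graph n m) 0 A B"
    unfolding apex_core_def apex_cut_def n' using d by (auto simp: S)
  show bad: "bad_edges (star_graph n m) A B = (\<lambda>l. {1, l}) ` {2..m + 1}"
  proof
    show "bad_edges (star_graph n m) A B \<subseteq> (\<lambda>l. {1, l}) ` {2..m + 1}"
      using apex_edges_bad[OF d] by (auto simp: bad_edges_def S)
    have "{1, l} \<subseteq> A" if "l \<in> {2..m + 1}" for l using that z L by auto
    then show "(\<lambda>l. {1, l}) ` {2..m + 1} \<subseteq> bad_edges (star_graph n m) A B"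
      unfolding bad_edges_def S by auto
  qed
  show "card (bad_edges (star_graph n m) A B) = m"
    unfolding bad by (subst card_image) (auto simp: inj_on_def doubleton_eq_iff)
  have "2 * card A \<le> n" by (simp add: A_def)
  moreover have "card B = n - 1 - (n - 1) div 2" by (simp add: B_def)
  moreover have "n - 1 \<le> 2 * ((n - 1) div 2) + 1" by linarith
  ultimately have "2 * card A \<le> n" "2 * card B \<le> n" using n by linarith+
  then show "real (card A) \<le> real n / 2" "real (card B) \<le> real n / 2" by linarith+
  show "{0, 1} \<in> edges (star_graph n m)" using z by (auto simp: S apex_edges_def)
qed

context template
begin

text \<open>A type has exactly one inner edge, so its \<open>D\<close> is a singleton. For s \<ge> 2
  this excludes all alternatives of \<open>star_types\<close> except the one in which neither end is
  adjacent to x.\<close>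

lemma types_eq:
  assumes "s \<ge> 2"
  shows "types1 F = types F" "types2 F = types F"
proof -
  have "types F \<subseteq> types2 F"
  proof
    fix \<theta> assume t: "\<theta> \<in> types F"
    obtain x z u C where \<theta>: "\<theta> = (x, z, u, C)" by (cases \<theta>)
    have x: "x \<in> verts F" and C: "C \<subseteq> verts F - {x}" and zu: "z \<in> C" "u \<in> C" "{z, u} \<in> edges F"
      and bi: "\<And>a b. {a, b} \<in> edges F \<Longrightarrow> a \<noteq> x \<Longrightarrow> b \<noteq> x \<Longrightarrow> {a, b} \<noteq> {z, u} \<Longrightarrow> (a \<in> C) \<noteq> (b \<in> C)"
      using t by (auto simp: types_def \<theta>)
    have zV: "z \<in> verts F" "x \<noteq> z" "u \<noteq> x" using zu C by auto
    define D where "D = {w. {z, w} \<in> edges F \<and> w \<noteq> x \<and> (w \<in> C) = (z \<in> C)}"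
    have "D = {u}"
    proof
      show "D \<subseteq> {u}"
      proof
        fix w assume w: "w \<in> D"
        then have "{z, w} = {z, u}" using bi[of z w] zV by (auto simp: D_def)
        then show "w \<in> {u}" by (auto simp: doubleton_eq_iff)
      qed
    qed (use zu zV in \<open>auto simp: D_def\<close>)
    moreover have "card D \<ge> s + 1 \<or> card D = s \<and> {x, z} \<in> edges F \<or> (\<exists>w. D = {w} \<and> {x, z} \<notin> edges F \<and> {x, w} \<notin> edges F)"
    proof (rule star_types[OF assms x zV(1,2)])
      fix a b assume ab: "{a, b} \<in> edges F" "{a, b} \<inter> {x, z} = {}"
      then show "(a \<in> C) \<noteq> (b \<in> C)" by (intro bi) auto
    qed (simp add: D_def)
    ultimately have "{x, z} \<notin> edges F" "{x, u} \<notin> edges F" using assms by auto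
    then show "\<theta> \<in> types2 F" using t by (simp add: \<theta> types2_def)
  qed
  then show "types2 F = types F" "types1 F = types F" using types2_subset by auto
qed

section \<open>Distance to the extremal graph\<close>

lemma card_edges_at_set_le:
  assumes G: "simple_graph G" and M: "finite M"
  shows "card {e \<in> [verts G]\<^bsup>2\<^esup>. e \<inter> M \<noteq> {}} \<le> card M * card (verts G)"
proof -
  have fV: "finite (verts G)" using G by (simp add: simple_graph_def)
  have "{e \<in> [verts G]\<^bsup>2\<^esup>. e \<inter> M \<noteq> {}} \<subseteq> (\<lambda>(a, b). {a, b}) ` (M \<times> verts G)"
  proof
    fix e assume e: "e \<in> {e \<in> [verts G]\<^bsup>2\<^esup>. e \<inter> M \<noteq> {}}"
    then have "e \<subseteq> verts G" "card e = 2" by (auto simp: nsets_def)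
    then obtain a b where ab: "e = {a, b}" "a \<in> verts G" "b \<in> verts G" by (auto simp: card_2_iff)
    then consider "a \<in> M" | "b \<in> M" using e by auto
    then show "e \<in> (\<lambda>(a, b). {a, b}) ` (M \<times> verts G)"
    proof cases
      case 1
      then have "(\<lambda>(a, b). {a, b}) (a, b) \<in> (\<lambda>(a, b). {a, b}) ` (M \<times> verts G)" using ab by (intro imageI) simp
      then show ?thesis by (simp add: ab(1))
    next
      case 2
      then have "(\<lambda>(a, b). {a, b}) (b, a) \<in> (\<lambda>(a, b). {a, b}) ` (M \<times> verts G)" using ab by (intro imageI) simp
      then show ?thesis by (simp add: ab(1) insert_commute)
    qed
  qed
  then have "card {e \<in> [verts G]\<^bsup>2\<^esup>. e \<inter> M \<noteq> {}} \<le> card ((\<lambda>(a, b). {a, b}) ` (M \<times> verts G))"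
    using M fV by (intro card_mono) auto
  also have "\<dots> \<le> card (M \<times> verts G)" using M fV by (intro card_image_le) auto
  finally show ?thesis by (simp add: card_cartesian_product)
qed

text \<open>Few inner edges and almost the extremal edge number leave few missing pairs and nearly
  equal sides. Rebalancing the sides moves a small set of vertices, and G differs from the resulting
  copy only in inner edges, missing pairs, and pairs meeting that set.\<close>

lemma near_extremal:
  fixes \<delta> \<epsilon> :: real and G :: "nat sgraph"
  assumes G: "simple_graph G" and n: "card (verts G) = n" "32 \<le> n" and A: "A \<subseteq> verts G"
    and bad: "card (bad_edges G A (verts G - A)) \<le> \<delta> * real n ^ 2"
    and e: "real n ^ 2 / 4 - \<delta> * real n ^ 2 \<le> card (edges G)"
    and \<delta>: "0 < \<delta>" "12 * \<delta> \<le> \<epsilon>" "32 * \<delta> \<le> \<epsilon> ^ 2" and \<epsilon>: "\<epsilon> > 0" and n\<epsilon>: "16 / \<epsilon> \<le> real n"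
  shows "\<exists>H. simple_graph H \<and> verts H = verts G \<and> isomorphic (apex_graph n) H \<and>
    real (card (sym_diff (edges G) (edges H))) \<le> \<epsilon> * real n ^ 2"
proof -
  define V where "V = verts G"
  have fV: "finite V" using G by (simp add: V_def simple_graph_def)
  define B where "B = V - A"
  have AB: "A \<union> B = V" "A \<inter> B = {}" using A by (auto simp: B_def V_def)
  have fAB: "finite A" "finite B" using fV A by (auto simp: B_def V_def intro: finite_subset)
  have cAB: "card A + card B = n" using card_Un_disjoint[OF fAB AB(2)] AB(1) n(1) by (simp add: V_def)
  have part: "real (card (edges G)) + real (card (missing G A B)) = real (card A) * real (card B) + real (card (bad_edges G A B))"
    using card_edges_partition[OF G AB(1)[unfolded V_def] AB(2)] by (metis of_nat_add of_nat_mult)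
  have bad': "card (bad_edges G A B) \<le> \<delta> * real n ^ 2" using bad by (simp add: B_def V_def)
  have "4 * (card A * card B) \<le> n\<^sup>2" using prod_le_quarter[of "card A" "card B"] cAB by (simp add: mult.commute less_eq_div_iff_mult_less_eq)
  from of_nat_mono[OF this, where 'a = real]
  have ABq: "real (card A) * real (card B) \<le> real n ^ 2 / 4" by simp
  have miss: "card (missing G A B) \<le> 2 * \<delta> * real n ^ 2" using part ABq e bad' by linarith
  have "real n ^ 2 / 4 - (2 * \<delta>) * real n ^ 2 \<le> real (card A) * real (card B)" using part e bad' by linarith
  moreover have "4 * (2 * \<delta>) \<le> (\<epsilon> / 2) ^ 2" using \<delta> by (simp add: power_divide)
  ultimately have half: "\<bar>real (card A) - real n / 2\<bar> \<le> \<epsilon> / 2 * real n / 2"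
    using parts_near_half[OF cAB, of "2 * \<delta>" "\<epsilon> / 2"] \<epsilon> by simp
  have "V \<noteq> {}" using n by (auto simp: V_def)
  \<comment> \<open>Any vertex can serve as apex: it affects fewer than n edges, which is negligible
    at this precision.\<close>
  then obtain X where X: "X \<in> V" by blast
  define m where "m = (n - 1) div 2"
  define A1 where "A1 = A - {X}"
  have cA1: "card A \<le> card A1 + 1" "card A1 \<le> card A" using fAB by (auto simp: A1_def card_Diff_singleton_if)
  have cVX: "card (V - {X}) = n - 1" using X fV n by (simp add: V_def)
  \<comment> \<open>The new part is nested with the old one, so the number of moved vertices is just
    the difference of the two sizes.\<close>
  obtain A' where A': "A' \<subseteq> V - {X}" "card A' = m" "A' \<subseteq> A1 \<or> A1 \<subseteq> A'"
  proof (cases "m \<le> card A1")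
    case True
    then obtain A' where "A' \<subseteq> A1" "card A' = m" using obtain_subset_with_card_n by metis
    then show ?thesis using that[of A'] A by (auto simp: A1_def V_def)
  next
    case False
    have "A1 \<subseteq> V - {X}" using A by (auto simp: A1_def V_def)
    moreover have "m \<le> card (V - {X})" by (simp add: cVX m_def)
    ultimately obtain A' where "A1 \<subseteq> A'" "A' \<subseteq> V - {X}" "card A' = m"
      using exists_subset_between[of A1 m "V - {X}"] False fV by auto
    then show ?thesis using that by blast
  qed
  have fA': "finite A'" using A' fV by (meson finite_Diff finite_subset)
  define B' where "B' = V - {X} - A'"
  have V': "insert X (A' \<union> B') = V" "X \<notin> A' \<union> B'" "A' \<inter> B' = {}" using A' X by (auto simp: B'_def)
  have fB': "finite B'" using fV by (simp add: B'_def)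
  define H where "H = SGraph V (apex_edges X A' B')"
  have sH: "simple_graph H" using simple_apex_graph[OF fA' fB' V'(2,3)] V'(1) by (simp add: H_def)
  have nH: "card (verts H) = n" using n by (simp add: H_def V_def)
  have cB': "card B' = (n - 1) - m" using A' cVX fA' by (simp add: B'_def card_Diff_subset)
  have core: "apex_core H X A' B'"
    using V' A'(2) cB' half_prod[of "n - 1"] nH by (simp add: apex_core_def apex_cut_def H_def m_def)
  have iso: "isomorphic (apex_graph n) H"
  proof -
    obtain X0 A0 B0 where "apex_core (apex_graph n) X0 A0 B0" "edges (apex_graph n) = apex_edges X0 A0 B0"
      using apex_graph_core(3)[of n] n by auto
    then show ?thesis using apex_graph_core(1,2)[of n] n nH sH core
      by (intro isomorphic_apex[where G = "apex_graph n" and H = H]) (auto simp: H_def)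
  qed
  \<comment> \<open>Away from \<open>M\<close> the old and the new partition agree.\<close>
  define M where "M = insert X (sym_diff A1 A')"
  have fM: "finite M" using fAB fA' by (simp add: M_def A1_def)
  have cM: "real (card M) \<le> \<epsilon> / 4 * real n + 4"
  proof -
    have "real (card (sym_diff A1 A')) \<le> \<bar>real (card A1) - real m\<bar>"
    proof (cases "A' \<subseteq> A1")
      case True
      then have "sym_diff A1 A' = A1 - A'" by auto
      then show ?thesis using True A' fA' card_mono[OF _ True] fAB by (simp add: card_Diff_subset A1_def of_nat_diff)
    next
      case False
      then have sub: "A1 \<subseteq> A'" using A' by auto
      then have "sym_diff A1 A' = A' - A1" by auto
      then show ?thesis using sub A' fA' card_mono[OF fA' sub] fAB by (simp add: card_Diff_subset A1_def of_nat_diff)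
    qed
    moreover have "\<bar>real m - real n / 2\<bar> \<le> 2" using n unfolding m_def by linarith
    moreover have "\<bar>real (card A1) - real (card A)\<bar> \<le> 1" using cA1 by linarith
    ultimately have "real (card (sym_diff A1 A')) \<le> \<epsilon> / 4 * real n + 3" using half by linarith
    moreover have "card M \<le> Suc (card (sym_diff A1 A'))" unfolding M_def by (rule card_insert_le_m1) simp_all
    ultimately show ?thesis by linarith
  qed
  let ?h = "\<lambda>(a, b). {a, b}"
  have sub: "sym_diff (edges G) (edges H) \<subseteq> bad_edges G A B \<union> ?h ` missing G A B \<union> {e \<in> [verts G]\<^bsup>2\<^esup>. e \<inter> M \<noteq> {}}"
  proof
    fix e assume e: "e \<in> sym_diff (edges G) (edges H)"
    have e2: "e \<in> [verts G]\<^bsup>2\<^esup>" using e G sH by (auto simp: simple_graph_def H_def V_def)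
    show "e \<in> bad_edges G A B \<union> ?h ` missing G A B \<union> {e \<in> [verts G]\<^bsup>2\<^esup>. e \<inter> M \<noteq> {}}"
    proof (cases "e \<inter> M = {}")
      case True
      have "card e = 2" "e \<subseteq> V" using e2 by (auto simp: nsets_def V_def)
      then obtain a b where ab: "e = {a, b}" "a \<noteq> b" "a \<in> V" "b \<in> V" by (auto simp: card_2_iff)
      have mm: "(v \<in> A) = (v \<in> A')" "(v \<in> B) = (v \<in> B')" if "v \<in> e" for v
      proof -
        have "v \<notin> M" "v \<in> V" using True that \<open>e \<subseteq> V\<close> by blast+
        then have v: "v \<noteq> X" "(v \<in> A1) = (v \<in> A')" by (auto simp: M_def)
        then show "(v \<in> A) = (v \<in> A')" by (simp add: A1_def)
        then show "(v \<in> B) = (v \<in> B')" using v(1) \<open>v \<in> V\<close> by (simp add: B_def B'_def)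
      qed
      have XM: "X \<notin> e" using True by (auto simp: M_def)
      have "(e \<subseteq> A) = (e \<subseteq> A')" unfolding subset_eq by (intro ball_cong refl mm(1))
      moreover have "(e \<subseteq> B) = (e \<subseteq> B')" unfolding subset_eq by (intro ball_cong refl mm(2))
      ultimately have nb: "(e \<subseteq> A \<or> e \<subseteq> B) = (e \<subseteq> A' \<or> e \<subseteq> B')" by simp
      have eH: "e \<in> edges H \<longleftrightarrow> \<not> (e \<subseteq> A \<or> e \<subseteq> B)"
      proof -
        have "e \<in> apex_edges X A' B'" if "\<not> (e \<subseteq> A' \<or> e \<subseteq> B')"
          using not_bad_apex_edges[OF ab(1) _ _ ab(2) that, of X] ab(3,4) V'(1) by simp
        then have "e \<in> apex_edges X A' B' \<longleftrightarrow> \<not> (e \<subseteq> A' \<or> e \<subseteq> B')"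
          using apex_edges_bad[OF V'(2,3), of e] by argo
        then show ?thesis unfolding nb by (simp only: H_def sgraph.sel)
      qed
      show ?thesis
      proof (cases "e \<in> edges G")
        case True
        then have "e \<notin> edges H" using e by simp
        then have "e \<in> bad_edges G A B" using True eH by (simp add: bad_edges_def)
        then show ?thesis by simp
      next
        case False
        then have "e \<in> edges H" using e by simp
        then have "\<not> (e \<subseteq> A \<or> e \<subseteq> B)" by (rule iffD1[OF eH])
        then have "a \<in> A \<and> b \<in> B \<or> b \<in> A \<and> a \<in> B" using ab(3,4) AB(1)[symmetric] unfolding ab(1) by simp argo
        then have "(a, b) \<in> missing G A B \<or> (b, a) \<in> missing G A B" using False ab by (auto simp: missing_def insert_commute)
        then have "?h (a, b) \<in> ?h ` missing G A B \<or> ?h (b, a) \<in> ?h ` missing G A B" by blast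
        then show ?thesis by (auto simp: ab(1) insert_commute)
      qed
    qed (use e2 in simp)
  qed
  have fm: "finite (missing G A B)" by (rule finite_missing[OF fAB])
  have "finite {e \<in> [verts G]\<^bsup>2\<^esup>. e \<inter> M \<noteq> {}}" using fV by (simp add: V_def finite_imp_finite_nsets)
  then have "card (sym_diff (edges G) (edges H)) \<le> card (bad_edges G A B \<union> ?h ` missing G A B \<union> {e \<in> [verts G]\<^bsup>2\<^esup>. e \<inter> M \<noteq> {}})"
    using finite_bad_edges[OF G] fm by (intro card_mono[OF _ sub]) auto
  also have "\<dots> \<le> card (bad_edges G A B) + card (missing G A B) + card M * n"
    using card_Un_le[of "bad_edges G A B \<union> ?h ` missing G A B" "{e \<in> [verts G]\<^bsup>2\<^esup>. e \<inter> M \<noteq> {}}"]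
      card_Un_le[of "bad_edges G A B" "?h ` missing G A B"] card_image_le[OF fm, of ?h]
      card_edges_at_set_le[OF G fM, unfolded n(1)] by linarith
  finally have "card (sym_diff (edges G) (edges H)) \<le> card (bad_edges G A B) + card (missing G A B) + card M * n" .
  from of_nat_mono[OF this, where 'a = real]
  have "real (card (sym_diff (edges G) (edges H))) \<le> real (card (bad_edges G A B)) + real (card (missing G A B)) + real (card M) * real n" by simp
  also have "real (card M) * real n \<le> (\<epsilon> / 4 * real n + 4) * real n" using cM by (intro mult_right_mono) auto
  finally have "real (card (sym_diff (edges G) (edges H))) \<le> 3 * \<delta> * real n ^ 2 + (\<epsilon> / 4 * real n + 4) * real n"
    using bad' miss by linarith
  moreover have "3 * \<delta> * real n ^ 2 \<le> \<epsilon> / 4 * real n ^ 2" using \<delta> by (intro mult_right_mono) auto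
  moreover have "4 * real n \<le> \<epsilon> / 4 * real n ^ 2"
  proof -
    have "16 \<le> \<epsilon> * real n" using n\<epsilon> \<epsilon> by (simp add: field_simps)
    then have "16 * real n \<le> \<epsilon> * real n * real n" by (intro mult_right_mono) auto
    then show ?thesis by (simp add: power2_eq_square)
  qed
  moreover have "(\<epsilon> / 4 * real n + 4) * real n = \<epsilon> / 4 * real n ^ 2 + 4 * real n" by (simp add: power2_eq_square algebra_simps)
  moreover have "0 \<le> \<epsilon> * real n ^ 2" using \<epsilon> by simp
  ultimately have "real (card (sym_diff (edges G) (edges H))) \<le> \<epsilon> * real n ^ 2" by linarith
  then show ?thesis using sH iso by (intro exI[of _ H]) (simp add: H_def V_def)
qed

text \<open>Uniqueness is \<open>extremal_structure\<close> with \<open>isomorphic_apex\<close>. For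
  closeness, an F-free graph has no embeddings at all, so
  \<open>few_embeddings_near_bipartite\<close> supplies the cut that \<open>near_extremal\<close>
  starts from.\<close>

theorem stable: "stable_graph F"
proof -
  obtain N1 where N1: "\<And>n. n \<ge> N1 \<Longrightarrow> ex_num n F = apex_size n \<and> (\<forall>G. extremal n F G \<longleftrightarrow>
     n_graph n G \<and> (\<exists>X A B. apex_core G X A B \<and> edges G = apex_edges X A B))"
    using extremal_structure by blast
  have unique: "extremal n F (apex_graph n) \<and> (\<forall>G. extremal n F G \<longrightarrow> isomorphic G (apex_graph n))" if n: "max N1 1 \<le> n" for n
  proof (intro conjI allI impI)
    have n': "n \<ge> N1" "n \<ge> 1" using n by auto
    note ag = apex_graph_core[OF n'(2)]
    show "extremal n F (apex_graph n)" using N1[OF n'(1)] ag by (simp add: n_graph_def)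
    fix G assume "extremal n F G"
    then obtain X A B where G: "n_graph n G" "apex_core G X A B" "edges G = apex_edges X A B" using N1[OF n'(1)] by blast
    obtain X0 A0 B0 where H: "apex_core (apex_graph n) X0 A0 B0" "edges (apex_graph n) = apex_edges X0 A0 B0" using ag(3) by blast
    have sG: "simple_graph G" "card (verts G) = card (verts (apex_graph n))" using G(1) ag(2) by (auto simp: n_graph_def)
    show "isomorphic G (apex_graph n)" by (rule isomorphic_apex[OF sG(1) ag(1) sG(2) G(2,3) H])
  qed
  have close: "\<exists>\<delta>>0. \<exists>N. \<forall>n\<ge>N. \<forall>G. n_graph n G \<and> free_of F G \<and> real (card (edges G)) \<ge> (1 - \<delta>) * real (ex_num n F) \<longrightarrow>
        (\<exists>H'. simple_graph H' \<and> verts H' = verts G \<and> isomorphic (apex_graph n) H' \<and>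
              real (card (sym_diff (edges G) (edges H'))) \<le> \<epsilon> * (real n)\<^sup>2)" if \<epsilon>: "\<epsilon> > 0" for \<epsilon> :: real
  proof -
    define \<delta> where "\<delta> = min (\<epsilon> / 12) (\<epsilon> ^ 2 / 32)"
    have \<delta>: "\<delta> > 0" "12 * \<delta> \<le> \<epsilon>" "32 * \<delta> \<le> \<epsilon> ^ 2" using \<epsilon> by (auto simp: \<delta>_def)
    obtain \<tau> N2 where \<tau>: "\<tau> > 0" and near: "\<forall>n\<ge>N2. \<forall>G :: nat sgraph. simple_graph G \<longrightarrow> card (verts G) = n \<longrightarrow>
      (1 / 4 - \<tau>) * real n ^ 2 \<le> card (edges G) \<longrightarrow> card (embeddings F G) \<le> \<tau> * real n ^ k \<longrightarrow>
      (\<exists>A\<subseteq>verts G. card (bad_edges G A (verts G - A)) \<le> \<delta> * real n ^ 2)"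
      using few_embeddings_near_bipartite[OF \<delta>(1), where ?'b = nat] by (elim exE conjE) (rule that; assumption)
    define \<gamma> where "\<gamma> = min 1 (min \<delta> \<tau>)"
    have \<gamma>: "\<gamma> > 0" "\<gamma> \<le> 1" "\<gamma> \<le> \<delta>" "\<gamma> \<le> \<tau>" using \<delta> \<tau> by (auto simp: \<gamma>_def)
    define N where "N = max (max N1 N2) (max 32 (nat \<lceil>16 / \<epsilon>\<rceil> + 1))"
    show ?thesis
    proof (rule exI[of _ \<gamma>], rule conjI[OF \<gamma>(1)], rule exI[of _ N], intro allI impI)
      fix n G assume n: "N \<le> n"
        and G: "n_graph n G \<and> free_of F G \<and> real (card (edges G)) \<ge> (1 - \<gamma>) * real (ex_num n F)"
      have nN: "n \<ge> N1" "n \<ge> N2" "n \<ge> 32" using n by (auto simp: N_def)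
      have n\<epsilon>: "16 / \<epsilon> \<le> real n" using n unfolding N_def by linarith
      have sG: "simple_graph G" "card (verts G) = n" using G by (auto simp: n_graph_def)
      have "real n ^ 2 / 4 \<le> real (ex_num n F)" using apex_size_ge[of n] N1[OF nN(1)] nN by simp
      then have "(1 - \<gamma>) * (real n ^ 2 / 4) \<le> (1 - \<gamma>) * real (ex_num n F)" using \<gamma> by (intro mult_left_mono) auto
      moreover have "(1 - \<gamma>) * (real n ^ 2 / 4) = real n ^ 2 / 4 - \<gamma> * real n ^ 2 / 4" by (simp add: left_diff_distrib)
      ultimately have e: "real n ^ 2 / 4 - \<gamma> * real n ^ 2 / 4 \<le> card (edges G)" using G by linarith
      have g1: "\<gamma> * real n ^ 2 \<le> \<delta> * real n ^ 2" "\<gamma> * real n ^ 2 \<le> \<tau> * real n ^ 2" "0 \<le> \<gamma> * real n ^ 2"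
        using \<gamma> by (auto intro: mult_right_mono)
      have "card (embeddings F G) = 0" using G by (simp add: free_of_def)
      then have "card (embeddings F G) \<le> \<tau> * real n ^ k" using \<tau> by simp
      moreover have "(1 / 4 - \<tau>) * real n ^ 2 = real n ^ 2 / 4 - \<tau> * real n ^ 2" by (simp add: algebra_simps)
      then have "(1 / 4 - \<tau>) * real n ^ 2 \<le> card (edges G)" using e g1 by linarith
      ultimately obtain A where A: "A \<subseteq> verts G" "card (bad_edges G A (verts G - A)) \<le> \<delta> * real n ^ 2"
        using near nN(2) sG by blast
      have "real n ^ 2 / 4 - \<delta> * real n ^ 2 \<le> card (edges G)" using e g1 by linarith
      then show "\<exists>H'. simple_graph H' \<and> verts H' = verts G \<and> isomorphic (apex_graph n) H' \<and>
              real (card (sym_diff (edges G) (edges H'))) \<le> \<epsilon> * (real n)\<^sup>2"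
        by (intro near_extremal[OF sG nN(3) A _ \<delta> \<epsilon> n\<epsilon>])
    qed
  qed
  show ?thesis
    unfolding stable_graph_def using unique close by (intro exI[of _ apex_graph] conjI exI[of _ "max N1 1"]) blast+
qed

end

section \<open>The threshold\<close>

lemma root_power:
  assumes "n > 0" "s \<ge> 1"
  shows "(real n powr (1 - 1 / real s)) ^ s = real n ^ (s - 1)"
proof -
  have "(real n powr (1 - 1 / real s)) ^ s = real n powr ((1 - 1 / real s) * real s)"
    using assms by (simp add: powr_power mult.commute)
  also have "(1 - 1 / real s) * real s = real (s - 1)" using assms by (simp add: field_simps of_nat_diff)
  also have "real n powr real (s - 1) = real n ^ (s - 1)" using assms by (intro powr_realpow) simp
  finally show ?thesis .
qed

context template
begin

definition core_copies :: "nat \<Rightarrow> nat \<Rightarrow> nat set" where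
  "core_copies n q = {num_copies F G | G :: nat sgraph. n_graph n G \<and> (\<exists>X A B. apex_core G X A B \<and> card (bad_edges G A B) = q)}"

text \<open>\<open>apex_edges\<close> contains every pair that is not inside a part. Adding q edges
  to an extremal graph therefore means having a core with exactly q inner edges.\<close>

lemma t_num_eq: "\<exists>N. \<forall>n\<ge>N. \<forall>q. t_num F n q = Inf (core_copies n q) \<and>
  h_num F n q = Inf {num_copies F G | G :: nat sgraph. n_graph n G \<and> card (edges G) = apex_size n + q}"
proof -
  obtain N where N: "\<And>n. n \<ge> N \<Longrightarrow> ex_num n F = apex_size n \<and> (\<forall>G. extremal n F G \<longleftrightarrow>
     n_graph n G \<and> (\<exists>X A B. apex_core G X A B \<and> edges G = apex_edges X A B))"
    using extremal_structure by blast
  show ?thesis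
  proof (rule exI[of _ N], intro allI impI conjI)
    fix n q assume n: "N \<le> n"
    have eq: "(\<exists>H. extremal n F H \<and> verts H = verts G \<and> edges H \<subseteq> edges G \<and> card (edges G - edges H) = q) \<longleftrightarrow>
      (\<exists>X A B. apex_core G X A B \<and> card (bad_edges G A B) = q)" if G: "n_graph n G" for G
    proof -
      have sG: "simple_graph G" "card (verts G) = n" using G by (auto simp: n_graph_def)
      have diff: "edges G - apex_edges X A B = bad_edges G A B" if core: "apex_core G X A B" for X A B
      proof -
        have "X \<notin> A \<union> B" "A \<inter> B = {}" using core by (auto simp: apex_core_def apex_cut_def)
        then have "apex_edges X A B \<inter> bad_edges G A B = {}"
          using apex_edges_bad[of X A B] by (auto simp: bad_edges_def)
        then show ?thesis using apex_core_card_edges(2)[OF sG(1) core] by blast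
      qed
      show ?thesis
      proof
        assume "\<exists>H. extremal n F H \<and> verts H = verts G \<and> edges H \<subseteq> edges G \<and> card (edges G - edges H) = q"
        then obtain H where H: "extremal n F H" "verts H = verts G" "edges H \<subseteq> edges G" "card (edges G - edges H) = q" by blast
        obtain X A B where c: "apex_core H X A B" "edges H = apex_edges X A B" using N[OF n] H(1) by blast
        have "apex_core G X A B" using c H by (simp add: apex_core_def apex_cut_def)
        moreover have "card (bad_edges G A B) = q" using diff[OF calculation] H(4) c(2) by simp
        ultimately show "\<exists>X A B. apex_core G X A B \<and> card (bad_edges G A B) = q" by blast
      next
        assume "\<exists>X A B. apex_core G X A B \<and> card (bad_edges G A B) = q"
        then obtain X A B where c: "apex_core G X A B" "card (bad_edges G A B) = q" by blast
        define H where "H = SGraph (verts G) (apex_edges X A B)"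
        have cut: "apex_cut G X A B" "apex_edges X A B \<subseteq> edges G" using c by (auto simp: apex_core_def)
        have "n_graph n H" using sG cut(2) by (auto simp: n_graph_def simple_graph_def H_def)
        moreover have "apex_core H X A B" using c by (simp add: apex_core_def apex_cut_def H_def)
        moreover have "edges H = apex_edges X A B" by (simp add: H_def)
        ultimately have "extremal n F H" using N[OF n] by blast
        then show "\<exists>H. extremal n F H \<and> verts H = verts G \<and> edges H \<subseteq> edges G \<and> card (edges G - edges H) = q"
          using diff[OF c(1)] c(2) cut(2) by (intro exI[of _ H]) (simp add: H_def)
      qed
    qed
    have "{num_copies F G | G. n_graph n G \<and> (\<exists>H. extremal n F H \<and> verts H = verts G \<and> edges H \<subseteq> edges G \<and>
          card (edges G - edges H) = q)} = core_copies n q"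
      unfolding core_copies_def using eq by blast
    then show "t_num F n q = Inf (core_copies n q)" by (simp add: t_num_def)
    show "h_num F n q = Inf {num_copies F G | G. n_graph n G \<and> card (edges G) = apex_size n + q}"
      using N[OF n] by (simp add: h_num_def)
  qed
qed

lemma star_graph_core_copies:
  assumes "n \<ge> 3" "q + 1 \<le> (n - 1) div 2"
  shows "num_copies F (star_graph n q) \<in> core_copies n q"
  using star_graph[OF assms] unfolding core_copies_def n_graph_def by blast

lemma core_copies_size:
  "core_copies n q \<subseteq> {num_copies F G | G :: nat sgraph. n_graph n G \<and> card (edges G) = apex_size n + q}"
  using apex_core_card_edges(1) unfolding core_copies_def n_graph_def by fastforce

text \<open>The star costs less than \<open>(q + 1 / 2) * main_term n\<close>, which by the
  dichotomy is less than any graph without a core. So the minimum over all graphs is attained by a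
  core.\<close>

lemma equality_range:
  assumes s2: "s \<ge> 2"
  shows "\<exists>\<epsilon>>0. \<exists>N. \<forall>n\<ge>N. \<forall>q. real q \<le> \<epsilon> * real n powr (1 - 1 / real s) \<longrightarrow> h_num F n q = t_num F n q"
proof -
  obtain N1 where N1: "\<And>n q. n \<ge> N1 \<Longrightarrow> t_num F n q = Inf (core_copies n q) \<and>
    h_num F n q = Inf {num_copies F G | G :: nat sgraph. n_graph n G \<and> card (edges G) = apex_size n + q}"
    using t_num_eq by blast
  obtain \<epsilon>1 N2 where \<epsilon>1: "\<epsilon>1 > 0" and main: "\<forall>n\<ge>N2. \<forall>G :: nat sgraph. \<forall>q. simple_graph G \<longrightarrow> card (verts G) = n \<longrightarrow>
    card (edges G) = apex_size n + q \<longrightarrow> real q \<le> \<epsilon>1 * real n \<longrightarrow>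
    (\<exists>X A B. apex_core G X A B) \<or> (real q + 1 / 2) * main_term n \<le> card (embeddings F G)"
    using core_or_many_copies[where ?'b = nat] by (elim exE conjE) (rule that; assumption)
  define T where "T = real (card (types2 F))"
  have T: "T > 0" using types2_pos by (simp add: T_def)
  define K where "K = real (k * k * 2 ^ k)"
  have K: "K > 0" using k_pos by (simp add: K_def)
  \<comment> \<open>With this choice the extra copies of the star number at most a quarter of
    \<open>main_term\<close>, inside the margin of one half.\<close>
  define \<theta> where "\<theta> = T * (1 / 2) ^ (k - 3) / (4 * K)"
  have \<theta>: "\<theta> > 0" "K * \<theta> = T * (1 / 2) ^ (k - 3) / 4" using T K by (auto simp: \<theta>_def)
  define \<epsilon> where "\<epsilon> = min (min \<epsilon>1 (1 / 8)) \<theta>"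
  have \<epsilon>: "\<epsilon> > 0" "\<epsilon> \<le> \<epsilon>1" "\<epsilon> \<le> 1 / 8" "\<epsilon> \<le> \<theta>" using \<epsilon>1 \<theta> by (auto simp: \<epsilon>_def)
  show ?thesis
  proof (rule exI[of _ \<epsilon>], rule conjI[OF \<epsilon>(1)], rule exI[of _ "max (max N1 N2) 32"], intro allI impI)
    fix n q assume n: "max (max N1 N2) 32 \<le> n" and q: "real q \<le> \<epsilon> * real n powr (1 - 1 / real s)"
    have nN: "n \<ge> N1" "n \<ge> N2" "n \<ge> 32" "n > 0" using n by auto
    have "real n powr (1 - 1 / real s) \<le> real n powr 1" using nN s2 by (intro powr_mono) auto
    then have pn: "real n powr (1 - 1 / real s) \<le> real n" using nN by simp
    have qn: "real q \<le> \<epsilon> * real n" using q mult_left_mono[OF pn, of \<epsilon>] \<epsilon>(1) by linarith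
    have qn1: "real q \<le> \<epsilon>1 * real n" using qn mult_right_mono[OF \<epsilon>(2), of "real n"] by simp
    have qn8: "real q \<le> real n / 8" using qn mult_right_mono[OF \<epsilon>(3), of "real n"] by simp
    then have m: "q + 1 \<le> (n - 1) div 2" using nN by linarith
    define S where "S = star_graph n q"
    define A where "A = {1..(n - 1) div 2}"
    define B where "B = {(n - 1) div 2 + 1..<n}"
    have n3: "n \<ge> 3" using nN by simp
    note sg = star_graph[OF n3 m, folded A_def B_def S_def]
    have cut: "apex_cut S 0 A B" using sg(3) by (simp add: apex_core_def)
    have cL: "card {2..q + 1} = q" by simp
    have "card (embeddings F S) \<le> card {2..q + 1} * (card (types F) * (real n / 2) ^ (k - 3))
      + real (k * k * 2 ^ k) * real (card {2..q + 1}) ^ s * real n ^ (k - 2 - s)"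
      using sg(4) s2 by (intro core_upper[OF sg(1) sg(2)[symmetric] cut sg(6,7) _ sg(8,9)]) auto
    then have up: "card (embeddings F S) \<le> real q * main_term n + K * real q ^ s * real n ^ (k - 2 - s)"
      unfolding cL by (simp add: main_term_def K_def types_eq(2)[OF s2])
    have "real q ^ s \<le> (\<epsilon> * real n powr (1 - 1 / real s)) ^ s" using q by (intro power_mono) auto
    also have "\<dots> = \<epsilon> ^ s * real n ^ (s - 1)" using root_power[OF nN(4) s1] by (simp add: power_mult_distrib)
    also have "\<dots> \<le> \<epsilon> * real n ^ (s - 1)"
      using \<epsilon> s1 power_decreasing[of 1 s \<epsilon>] by (intro mult_right_mono) auto
    finally have qs: "real q ^ s \<le> \<epsilon> * real n ^ (s - 1)" .
    have nk: "real n ^ (s - 1) * real n ^ (k - 2 - s) = real n ^ (k - 3)"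
    proof -
      have "k - 3 = (s - 1) + (k - 2 - s)" using s1 large by simp
      then show ?thesis by (metis power_add)
    qed
    have "K * real q ^ s * real n ^ (k - 2 - s) \<le> K * (\<theta> * real n ^ (s - 1)) * real n ^ (k - 2 - s)"
    proof (intro mult_right_mono mult_left_mono)
      have "\<epsilon> * real n ^ (s - 1) \<le> \<theta> * real n ^ (s - 1)" using \<epsilon> by (intro mult_right_mono) auto
      then show "real q ^ s \<le> \<theta> * real n ^ (s - 1)" using qs by linarith
    qed (use K in auto)
    also have "\<dots> = K * \<theta> * real n ^ (k - 3)" using nk by (simp add: mult.assoc)
    also have "\<dots> = main_term n / 4" by (simp add: \<theta>(2) main_term_def T_def power_divide)
    also have "\<dots> < main_term n / 2" using main_term_pos[OF nN(4)] by simp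
    finally have lessS: "card (embeddings F S) < (real q + 1 / 2) * main_term n"
      using up by (simp add: algebra_simps)
    define HH where "HH = {num_copies F G | G :: nat sgraph. n_graph n G \<and> card (edges G) = apex_size n + q}"
    have SC: "num_copies F S \<in> core_copies n q" unfolding S_def by (rule star_graph_core_copies[OF n3 m])
    have sub: "core_copies n q \<subseteq> HH" unfolding HH_def by (rule core_copies_size)
    have "Inf HH \<in> HH" using SC sub by (intro Inf_nat_def1) auto
    then obtain G :: "nat sgraph" where G: "Inf HH = num_copies F G" "n_graph n G" "card (edges G) = apex_size n + q"
      by (auto simp: HH_def)
    have sG: "simple_graph G" "card (verts G) = n" using G(2) by (auto simp: n_graph_def)
    have "(\<exists>X A B. apex_core G X A B) \<or> (real q + 1 / 2) * main_term n \<le> card (embeddings F G)"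
      by (rule main[rule_format, OF nN(2) sG G(3) qn1])
    moreover have "\<not> (real q + 1 / 2) * main_term n \<le> card (embeddings F G)"
    proof
      assume "(real q + 1 / 2) * main_term n \<le> card (embeddings F G)"
      then have "card (embeddings F S) < card (embeddings F G)" using lessS by linarith
      then have "num_copies F S < num_copies F G" by (rule num_copies_less[OF simple sg(1) sG(1)])
      moreover have "Inf HH \<le> num_copies F S" using SC sub by (intro cInf_lower) auto
      ultimately show False using G(1) by simp
    qed
    ultimately obtain X' A' B' where core: "apex_core G X' A' B'" by blast
    have "card (bad_edges G A' B') = q" using apex_core_card_edges(1)[OF sG(1) core] G(3) sG(2) by simp
    then have "Inf HH \<in> core_copies n q" using core G unfolding core_copies_def by blast
    then have "Inf (core_copies n q) \<le> Inf HH" by (intro cInf_lower) auto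
    moreover have "Inf HH \<le> Inf (core_copies n q)" using SC sub by (intro cInf_superset_mono) auto
    ultimately show "h_num F n q = t_num F n q" using N1[OF nN(1), of q] by (simp add: HH_def)
  qed
qed

text \<open>The competitor \<open>R\<close> is the core with a star of \<open>q + 1\<close> edges, less the edge between the apex and
  the centre of the star.\<close>

lemma strict_range:
  "\<exists>\<epsilon>>0. \<exists>N. \<forall>n\<ge>N. \<forall>q. real n powr (1 - 1 / real s) / \<epsilon> \<le> real q \<longrightarrow> real q \<le> \<epsilon> * real n \<longrightarrow> h_num F n q < t_num F n q"
proof -
  obtain N1 where N1: "\<And>n q. n \<ge> N1 \<Longrightarrow> t_num F n q = Inf (core_copies n q) \<and>
    h_num F n q = Inf {num_copies F G | G :: nat sgraph. n_graph n G \<and> card (edges G) = apex_size n + q}"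
    using t_num_eq by blast
  obtain c N2 where c: "c > 0" and low: "\<forall>n\<ge>N2. \<forall>G :: nat sgraph. \<forall>X A B. simple_graph G \<longrightarrow> card (verts G) = n \<longrightarrow> apex_core G X A B \<longrightarrow>
    N2 \<le> card (bad_edges G A B) \<longrightarrow> card (bad_edges G A B) \<le> n \<longrightarrow>
    card (bad_edges G A B) * (card (types1 F) * ((real n / 2) ^ (k - 3) - err * real n ^ (k - 3) / real n))
      + c * real (card (bad_edges G A B)) ^ s * real n ^ (k - 2 - s) \<le> card (embeddings F G)"
    using core_lower[where ?'b = nat] by (elim exE conjE) (rule that; assumption)
  define T where "T = real (card (types1 F))"
  have T: "T \<ge> 0" by (simp add: T_def)
  define K where "K = real (k * k * 2 ^ k)"
  have K: "K > 0" using k_pos by (simp add: K_def)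
  \<comment> \<open>Three contributions are to be beaten by the extra copies in the core: the main
    part of the one surplus edge, the copies of the competitor with at least s + 1 leaves, and the
    loss \<open>err\<close> in the lower bound.\<close>
  define M where "M = T + K * 2 ^ (s + 1) + T * err"
  have M: "M > 0" using T K err_pos by (simp add: M_def add_pos_nonneg add_nonneg_pos)
  \<comment> \<open>1 / 16 leaves room for a star with q + 1 edges in a part,
    \<open>1 / (N2 + 1)\<close> makes q large enough for \<open>core_lower\<close>, and
    \<open>c / (2 * M)\<close> makes the three contributions at most half of the gain.\<close>
  define \<epsilon> where "\<epsilon> = min (min (1 / 16) (1 / (real N2 + 1))) (c / (2 * M))"
  have \<epsilon>: "\<epsilon> > 0" "\<epsilon> \<le> 1 / 16" "\<epsilon> \<le> 1 / (real N2 + 1)" "\<epsilon> \<le> c / (2 * M)" using c M by (auto simp: \<epsilon>_def)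
  have M\<epsilon>: "M * \<epsilon> < c"
  proof -
    have "M * \<epsilon> \<le> M * (c / (2 * M))" using \<epsilon> M by (intro mult_left_mono) auto
    also have "\<dots> = c / 2" using M by simp
    finally show ?thesis using c by simp
  qed
  show ?thesis
  proof (rule exI[of _ \<epsilon>], rule conjI[OF \<epsilon>(1)], rule exI[of _ "max (max N1 N2) 32"], intro allI impI)
    fix n q assume n: "max (max N1 N2) 32 \<le> n" and ql: "real n powr (1 - 1 / real s) / \<epsilon> \<le> real q" and qu: "real q \<le> \<epsilon> * real n"
    have nN: "n \<ge> N1" "n \<ge> N2" "n \<ge> 32" "n > 0" "real n > 0" using n by auto
    have "1 \<le> real n powr (1 - 1 / real s)" using nN s1 by (intro ge_one_powr_ge_zero) auto
    then have "1 / \<epsilon> \<le> real q" using ql \<epsilon>(1) by (meson divide_right_mono less_imp_le order_trans)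
    moreover have "real N2 + 1 \<le> 1 / \<epsilon>" using \<epsilon>(1,3) by (simp add: field_simps)
    ultimately have qN: "N2 \<le> q" "1 \<le> q" by linarith+
    have qn16: "real q \<le> real n / 16" using qu mult_right_mono[OF \<epsilon>(2), of "real n"] by simp
    then have qn: "q \<le> n" by linarith
    have m: "(q + 1) + 1 \<le> (n - 1) div 2" "q + 1 \<le> (n - 1) div 2" using qn16 nN by linarith+
    have n3: "n \<ge> 3" using nN by simp
    define S where "S = star_graph n (q + 1)"
    define A where "A = {1..(n - 1) div 2}"
    define B where "B = {(n - 1) div 2 + 1..<n}"
    note sg = star_graph[OF n3 m(1), folded A_def B_def S_def]
    have cutS: "apex_cut S 0 A B" using sg(3) by (simp add: apex_core_def)
    define R where "R = SGraph (verts S) (edges S - {{0, 1}})"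
    have sR: "simple_graph R" "card (verts R) = n" using sg(1,2) by (auto simp: R_def simple_graph_def)
    have cutR: "apex_cut R 0 A B" using cutS by (simp add: apex_cut_def R_def)
    have "card (edges S) = apex_size n + (q + 1)" using apex_core_card_edges(1)[OF sg(1,3)] sg(2,5) by simp
    then have eR: "card (edges R) = apex_size n + q"
      using sg(10) finite_edges[OF sg(1)] by (simp add: R_def)
    have badR: "bad_edges R A B \<subseteq> (\<lambda>l. {1, l}) ` {2..q + 1 + 1}" using sg(4) by (auto simp: bad_edges_def R_def)
    have cL: "card {2..q + 1 + 1} = q + 1" by simp
    have "{0, 1} \<notin> edges R" by (simp add: R_def)
    then have "card (embeddings F R) \<le> card {2..q + 1 + 1} * (card (types1 F) * (real n / 2) ^ (k - 3))
      + real (k * k * 2 ^ k) * real (card {2..q + 1 + 1}) ^ (s + 1) * real n ^ (k - 2 - (s + 1))"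
      by (intro core_upper[OF sR(1) sR(2)[symmetric] cutR sg(6,7) badR sg(8,9)]) auto
    then have up: "card (embeddings F R) \<le> (real q + 1) * (T * (real n / 2) ^ (k - 3))
      + K * (real q + 1) ^ (s + 1) * real n ^ (k - 2 - (s + 1))"
      unfolding cL by (simp add: T_def K_def add.commute)
    define w where "w = real n ^ (k - 2 - s)"
    define Q where "Q = real q ^ s"
    have w0: "w > 0" and Q0: "Q > 0" using nN qN by (auto simp: w_def Q_def)
    have nk: "real n ^ (k - 3) = real n ^ (s - 1) * w"
    proof -
      have "k - 3 = (s - 1) + (k - 2 - s)" using s1 large by simp
      then show ?thesis unfolding w_def by (metis power_add)
    qed
    have nw: "w = real n * real n ^ (k - 2 - (s + 1))"
    proof -
      have "k - 2 - s = Suc (k - 2 - (s + 1))" using large by simp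
      then show ?thesis unfolding w_def by (metis power_Suc)
    qed
    \<comment> \<open>The lower bound on q raised to the power s. It makes one full main term, of
      order \<open>n ^ (k - 3)\<close>, a small multiple of the extra star count
      \<open>Q * w\<close>.\<close>
    have nq: "real n ^ (s - 1) \<le> \<epsilon> * Q"
    proof -
      have "real n powr (1 - 1 / real s) \<le> \<epsilon> * real q" using ql \<epsilon>(1) by (simp add: field_simps)
      then have "(real n powr (1 - 1 / real s)) ^ s \<le> (\<epsilon> * real q) ^ s" by (intro power_mono) auto
      then have "real n ^ (s - 1) \<le> \<epsilon> ^ s * Q" using root_power[OF nN(4) s1] by (simp add: power_mult_distrib Q_def)
      also have "\<dots> \<le> \<epsilon> * Q" using \<epsilon> s1 power_decreasing[of 1 s \<epsilon>] Q0 by (intro mult_right_mono) auto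
      finally show ?thesis .
    qed
    define y where "y = (real n / 2) ^ (k - 3)"
    have y0: "0 \<le> y" "y \<le> real n ^ (k - 3)" by (auto simp: y_def intro: power_mono)
    have t1: "T * y \<le> T * (\<epsilon> * Q * w)"
    proof -
      have "y \<le> real n ^ (s - 1) * w" using y0 nk by simp
      also have "\<dots> \<le> \<epsilon> * Q * w" using nq w0 by (intro mult_right_mono) auto
      finally show ?thesis using T by (intro mult_left_mono) auto
    qed
    have t2: "K * (real q + 1) ^ (s + 1) * real n ^ (k - 2 - (s + 1)) \<le> K * 2 ^ (s + 1) * (\<epsilon> * Q * w)"
    proof -
      have "(real q + 1) ^ (s + 1) \<le> (2 * real q) ^ (s + 1)" using qN by (intro power_mono) auto
      also have "\<dots> = 2 ^ (s + 1) * (real q * Q)" by (simp add: Q_def power_mult_distrib)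
      also have "\<dots> \<le> 2 ^ (s + 1) * (\<epsilon> * real n * Q)" using qu Q0 by (intro mult_left_mono mult_right_mono) auto
      finally have "K * (real q + 1) ^ (s + 1) * real n ^ (k - 2 - (s + 1)) \<le>
        K * (2 ^ (s + 1) * (\<epsilon> * real n * Q)) * real n ^ (k - 2 - (s + 1))"
        using K by (intro mult_right_mono mult_left_mono) auto
      also have "\<dots> = K * 2 ^ (s + 1) * (\<epsilon> * Q * w)" unfolding nw by (simp add: mult_ac)
      finally show ?thesis .
    qed
    have t3: "real q * (T * (err * real n ^ (k - 3) / real n)) \<le> T * err * (\<epsilon> * Q * w)"
    proof -
      have "real q / real n \<le> 1" using qn nN by simp
      then have "real q / real n * (T * err * real n ^ (k - 3)) \<le> 1 * (T * err * real n ^ (k - 3))"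
        using T err_pos by (intro mult_right_mono) auto
      also have "\<dots> = T * err * (real n ^ (s - 1) * w)" using nk by simp
      also have "\<dots> \<le> T * err * (\<epsilon> * Q * w)" using nq w0 T err_pos by (intro mult_left_mono mult_right_mono) auto
      finally show ?thesis by (simp add: mult_ac)
    qed
    have "T * (\<epsilon> * Q * w) + K * 2 ^ (s + 1) * (\<epsilon> * Q * w) + T * err * (\<epsilon> * Q * w) = M * \<epsilon> * (Q * w)"
      by (simp add: M_def algebra_simps)
    also have "\<dots> < c * (Q * w)" using M\<epsilon> Q0 w0 by (intro mult_strict_right_mono) auto
    \<comment> \<open>The left side is everything by which the competitor could exceed the leading
      part of a core with q inner edges.\<close>
    finally have key: "T * y + K * (real q + 1) ^ (s + 1) * real n ^ (k - 2 - (s + 1)) + real q * (T * (err * real n ^ (k - 3) / real n)) < c * Q * w"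
      using t1 t2 t3 by (simp only: mult.assoc)
    have less: "card (embeddings F R) < card (embeddings F G)"
      if G: "n_graph n G" and core: "apex_core G X' A' B'" and b: "card (bad_edges G A' B') = q" for G X' A' B'
    proof -
      have sG: "simple_graph G" "card (verts G) = n" using G by (auto simp: n_graph_def)
      have "real (card (bad_edges G A' B')) * (T * (y - err * real n ^ (k - 3) / real n))
        + c * real (card (bad_edges G A' B')) ^ s * w \<le> card (embeddings F G)"
        unfolding T_def y_def w_def by (rule low[rule_format, OF nN(2) sG core]) (use b qN qn in auto)
      then have "real q * (T * (y - err * real n ^ (k - 3) / real n)) + c * Q * w \<le> card (embeddings F G)"
        unfolding b Q_def .
      moreover have "real q * (T * (y - err * real n ^ (k - 3) / real n)) =
          real q * (T * y) - real q * (T * (err * real n ^ (k - 3) / real n))" by (simp add: algebra_simps)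
      moreover have "(real q + 1) * (T * y) = real q * (T * y) + T * y" by (simp add: algebra_simps)
      ultimately show ?thesis using up key unfolding y_def[symmetric] by linarith
    qed
    have "Inf (core_copies n q) \<in> core_copies n q"
      using star_graph_core_copies[OF n3 m(2)] by (intro Inf_nat_def1) auto
    then obtain G X' A' B' where G: "Inf (core_copies n q) = num_copies F G" "n_graph n G"
        "apex_core G X' A' B'" "card (bad_edges G A' B') = q"
      unfolding core_copies_def by blast
    have "simple_graph G" using G(2) by (simp add: n_graph_def)
    then have "num_copies F R < num_copies F G" using less[OF G(2-4)] by (intro num_copies_less simple sR)
    moreover have "h_num F n q \<le> num_copies F R"
    proof -
      have "num_copies F R \<in> {num_copies F G | G :: nat sgraph. n_graph n G \<and> card (edges G) = apex_size n + q}"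
        using sR eR unfolding n_graph_def by blast
      then show ?thesis using N1[OF nN(1), of q] by (simp add: cInf_lower)
    qed
    ultimately show "h_num F n q < t_num F n q" using N1[OF nN(1), of q] G(1) by simp
  qed
qed

lemma not_bipartite: "\<not> bipartite F"
proof
  assume "bipartite F"
  then obtain A B where AB: "A \<union> B = verts F" "A \<inter> B = {}" "\<forall>e\<in>edges F. \<exists>a\<in>A. \<exists>b\<in>B. e = {a, b}"
    by (auto simp: bipartite_def)
  obtain x y where e: "{x, y} \<in> edges F" "(x \<in> A) = (y \<in> A)" using critical[of _ "\<lambda>v. v \<in> A"] by blast
  obtain a b where "a \<in> A" "b \<in> B" "{x, y} = {a, b}" using AB(3) e(1) by blast
  then show False using e(2) AB(2) by (auto simp: doubleton_eq_iff)
qed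

theorem threshold:
  "simple_graph F \<and> \<not> bipartite F \<and> stable_graph F \<and>
    (\<exists>\<epsilon>::real. \<epsilon> > 0 \<and> (\<exists>N::nat. \<forall>n\<ge>N. \<forall>q::nat.
       (1 \<le> q \<and> real q \<le> \<epsilon> * real n powr (1 - 1 / real s) \<longrightarrow> h_num F n q = t_num F n q) \<and>
       (real n powr (1 - 1 / real s) / \<epsilon> \<le> real q \<and> real q \<le> \<epsilon> * real n \<longrightarrow> h_num F n q < t_num F n q)))"
proof (intro conjI simple not_bipartite stable)
  obtain \<epsilon>2 N2 where 2: "\<epsilon>2 > 0" and two: "\<And>n q. n \<ge> N2 \<Longrightarrow> real n powr (1 - 1 / real s) / \<epsilon>2 \<le> real q \<Longrightarrow>
      real q \<le> \<epsilon>2 * real n \<Longrightarrow> h_num F n q < t_num F n q"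
    using strict_range by blast
  obtain \<epsilon>1 N1 where 1: "\<epsilon>1 > 0" and one: "\<And>n q. n \<ge> N1 \<Longrightarrow> 1 \<le> q \<Longrightarrow> real q \<le> \<epsilon>1 * real n powr (1 - 1 / real s) \<Longrightarrow>
      h_num F n q = t_num F n q"
  proof (cases "s \<ge> 2")
    case True
    then show ?thesis using equality_range that by blast
  next
    case False
    then have "s = 1" using s1 by simp
    \<comment> \<open>For s = 1 the power of n equals 1, so no positive integer q satisfies the
      bound.\<close>
    then show ?thesis by (intro that[of "1 / 2" 1]) auto
  qed
  define \<epsilon> where "\<epsilon> = min \<epsilon>1 \<epsilon>2"
  have \<epsilon>: "\<epsilon> > 0" "\<epsilon> \<le> \<epsilon>1" "\<epsilon> \<le> \<epsilon>2" using 1 2 by (auto simp: \<epsilon>_def)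
  show "\<exists>\<epsilon>::real. \<epsilon> > 0 \<and> (\<exists>N::nat. \<forall>n\<ge>N. \<forall>q::nat.
       (1 \<le> q \<and> real q \<le> \<epsilon> * real n powr (1 - 1 / real s) \<longrightarrow> h_num F n q = t_num F n q) \<and>
       (real n powr (1 - 1 / real s) / \<epsilon> \<le> real q \<and> real q \<le> \<epsilon> * real n \<longrightarrow> h_num F n q < t_num F n q))"
  proof (rule exI[of _ \<epsilon>], rule conjI[OF \<epsilon>(1)], rule exI[of _ "max N1 N2"], intro allI impI conjI)
    fix n q assume n: "max N1 N2 \<le> n" and q: "1 \<le> q \<and> real q \<le> \<epsilon> * real n powr (1 - 1 / real s)"
    have "\<epsilon> * real n powr (1 - 1 / real s) \<le> \<epsilon>1 * real n powr (1 - 1 / real s)" using \<epsilon> by (intro mult_right_mono) auto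
    then show "h_num F n q = t_num F n q" using n q by (intro one) auto
  next
    fix n q assume n: "max N1 N2 \<le> n" and q: "real n powr (1 - 1 / real s) / \<epsilon> \<le> real q \<and> real q \<le> \<epsilon> * real n"
    have "real n powr (1 - 1 / real s) / \<epsilon>2 \<le> real n powr (1 - 1 / real s) / \<epsilon>" using \<epsilon> by (intro divide_left_mono) auto
    moreover have "\<epsilon> * real n \<le> \<epsilon>2 * real n" using \<epsilon> by (intro mult_right_mono) auto
    ultimately show "h_num F n q < t_num F n q" using n q by (intro two) auto
  qed
qed

end

section \<open>The template graph\<close>

text \<open>The final statement asks for a graph on natural numbers. All template properties are
  invariant under injective relabelling; colourings are pulled back along \<open>f\<close>, vertex
  sets pushed forward.\<close>

lemma template_image:
  fixes F :: "'a sgraph" and f :: "'a \<Rightarrow> 'b"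
  assumes "template F s" and f: "inj f"
  shows "template (SGraph (f ` verts F) ((`) f ` edges F)) s"
proof -
  interpret template F s by fact
  let ?F = "SGraph (f ` verts F) ((`) f ` edges F)"
  have "inj ((`) f)" using f by (simp add: inj_def inj_image_eq_iff)
  then have iff: "{f a, f b} \<in> (`) f ` edges F \<longleftrightarrow> {a, b} \<in> edges F" for a b
    using inj_image_mem_iff[of "(`) f" "{a, b}" "edges F"] by simp
  have ex: "\<exists>a b. a' = f a \<and> b' = f b \<and> {a, b} \<in> edges F" if e: "{a', b'} \<in> (`) f ` edges F" for a' b'
  proof -
    obtain d where d: "d \<in> edges F" "{a', b'} = f ` d" using e by auto
    obtain a b where ab: "d = {a, b}" using simple_graph_edgeE[OF simple d(1)] by metis
    then have "a' = f a \<and> b' = f b \<or> a' = f b \<and> b' = f a" using d(2) by (auto simp: doubleton_eq_iff)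
    then show ?thesis using d(1) ab by (metis insert_commute)
  qed
  have feq: "f a = f b \<longleftrightarrow> a = b" for a b using f by (simp add: inj_eq)
  have fmem: "f a \<in> f ` C \<longleftrightarrow> a \<in> C" for a C using f by (simp add: inj_image_mem_iff)
  have fdb: "{f a, f b} = {f c, f d} \<longleftrightarrow> {a, b} = {c, d}" for a b c d by (simp add: doubleton_eq_iff feq)
  have card_f: "card (f ` C) = card C" for C using f by (intro card_image) (auto intro: inj_on_subset)
  have t2: "(f x, f z, f u, f ` C) \<in> types2 ?F" if "(x, z, u, C) \<in> types2 F" for x z u C
  proof -
    have "(x, z, u, C) \<in> types F" using that types2_subset by auto
    then have t: "x \<in> verts F" "C \<subseteq> verts F - {x}" "z \<in> C" "u \<in> C" "{z, u} \<in> edges F"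
      "\<And>a b. {a, b} \<in> edges F \<Longrightarrow> a \<noteq> x \<Longrightarrow> b \<noteq> x \<Longrightarrow> {a, b} \<noteq> {z, u} \<Longrightarrow> (a \<in> C) \<noteq> (b \<in> C)"
      by (auto simp: types_def)
    have "(f x, f z, f u, f ` C) \<in> types ?F"
      unfolding types_def
    proof (clarsimp simp: fmem iff t, intro conjI allI impI)
      show "f ` C \<subseteq> f ` verts F - {f x}" using t(2) by (auto simp: feq)
      fix a' b' assume e: "{a', b'} \<in> (`) f ` edges F" and ne: "a' \<noteq> f x" "b' \<noteq> f x" "{a', b'} \<noteq> {f z, f u}"
      obtain a b where ab: "a' = f a" "b' = f b" "{a, b} \<in> edges F" using ex[OF e] by blast
      show "(a' \<in> f ` C) = (b' \<notin> f ` C)" using t(6)[OF ab(3)] ne by (simp add: ab(1,2) feq fdb fmem)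
    qed
    moreover have "{x, z} \<notin> edges F" "{x, u} \<notin> edges F" using that by (auto simp: types2_def)
    ultimately show ?thesis by (simp add: types2_def iff)
  qed
  show ?thesis
  proof
    show "simple_graph ?F"
      unfolding simple_graph_def
    proof (intro conjI subsetI)
      fix e assume "e \<in> edges ?F"
      then obtain d where d: "d \<in> edges F" "e = f ` d" by auto
      then have "d \<subseteq> verts F" "finite d" "card d = 2" using simple by (auto simp: simple_graph_def nsets_def)
      then show "e \<in> [verts ?F]\<^bsup>2\<^esup>" using d by (auto simp: nsets_def card_f)
    qed simp
    show "1 \<le> s" by (rule s1)
  next
    fix x' and c :: "'b \<Rightarrow> bool"
    \<comment> \<open>If \<open>x'\<close> is outside the range of \<open>f\<close>, any x will
      do.\<close>
    obtain x where x: "\<And>a. a \<noteq> x \<Longrightarrow> f a \<noteq> x'"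
      using feq by (cases "\<exists>x. x' = f x") auto
    obtain a b where ab: "{a, b} \<in> edges F" "a \<noteq> x" "b \<noteq> x" "c (f a) = c (f b)"
      using critical[of x "\<lambda>v. c (f v)"] by blast
    then show "\<exists>a b. {a, b} \<in> edges ?F \<and> a \<noteq> x' \<and> b \<noteq> x' \<and> c a = c b"
      using x by (intro exI[of _ "f a"] exI[of _ "f b"]) (simp add: iff)
  next
    fix x' z' and c :: "'b \<Rightarrow> bool" and D'
    assume s2: "2 \<le> s" and x': "x' \<in> verts ?F" and z': "z' \<in> verts ?F" and ne: "x' \<noteq> z'"
      and proper: "\<And>a b. {a, b} \<in> edges ?F \<Longrightarrow> {a, b} \<inter> {x', z'} = {} \<Longrightarrow> c a \<noteq> c b"
      and D': "D' = {w. {z', w} \<in> edges ?F \<and> w \<noteq> x' \<and> c w = c z'}"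
    obtain x z where xz: "x' = f x" "z' = f z" "x \<in> verts F" "z \<in> verts F" using x' z' by auto
    define D where "D = {w. {z, w} \<in> edges F \<and> w \<noteq> x \<and> c (f w) = c (f z)}"
    have DD: "D' = f ` D"
    proof
      show "D' \<subseteq> f ` D"
      proof
        fix w' assume w': "w' \<in> D'"
        then have "{f z, w'} \<in> (`) f ` edges F" by (simp add: D' xz)
        then obtain w where w: "w' = f w" "{z, w} \<in> edges F" using ex[of "f z" w'] by (auto simp: feq)
        then show "w' \<in> f ` D" using w' by (auto simp: D' D_def xz feq)
      qed
      show "f ` D \<subseteq> D'" by (auto simp: D' D_def xz feq iff)
    qed
    have "card D \<ge> s + 1 \<or> card D = s \<and> {x, z} \<in> edges F \<or> (\<exists>w. D = {w} \<and> {x, z} \<notin> edges F \<and> {x, w} \<notin> edges F)"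
    proof (rule star_types[OF s2 xz(3,4)])
      show "x \<noteq> z" using ne xz by auto
      fix a b assume ab: "{a, b} \<in> edges F" "{a, b} \<inter> {x, z} = {}"
      then show "c (f a) \<noteq> c (f b)" by (intro proper) (simp_all add: iff xz feq)
    qed (simp add: D_def)
    then show "s + 1 \<le> card D' \<or> card D' = s \<and> {x', z'} \<in> edges ?F \<or>
      (\<exists>w. D' = {w} \<and> {x', z'} \<notin> edges ?F \<and> {x', w} \<notin> edges ?F)"
      by (auto simp: DD card_f xz iff)
  next
    obtain x z u C where t: "(x, z, u, C) \<in> types2 F" and nc: "\<forall>v. \<not> ({x, v} \<in> edges F \<and> {z, v} \<in> edges F)"
      using type_ex by fastforce
    have "\<not> ({f x, v'} \<in> edges ?F \<and> {f z, v'} \<in> edges ?F)" for v'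
      using ex[of "f x" v'] ex[of "f z" v'] nc by (auto simp: feq)
    then show "\<exists>(x, z, u, C)\<in>types2 ?F. \<forall>v. \<not> ({x, v} \<in> edges ?F \<and> {z, v} \<in> edges ?F)"
      using t2[OF t] by (intro bexI[of _ "(f x, f z, f u, f ` C)"]) auto
  next
    obtain x z C L where st: "x \<in> verts F" "C \<subseteq> verts F - {x}" "z \<in> C" "{x, z} \<in> edges F" "L \<subseteq> C - {z}"
       "card L = s" "\<forall>l\<in>L. {z, l} \<in> edges F"
       and bi: "\<forall>a b. {a, b} \<in> edges F \<longrightarrow> a \<noteq> x \<longrightarrow> b \<noteq> x \<longrightarrow> (a \<in> C) = (b \<in> C) \<longrightarrow> (\<exists>l\<in>L. {a, b} = {z, l})"
      using star_ex by blast
    have "\<exists>l\<in>f ` L. {a', b'} = {f z, l}"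
      if e: "{a', b'} \<in> (`) f ` edges F" and ne: "a' \<noteq> f x" "b' \<noteq> f x" "(a' \<in> f ` C) = (b' \<in> f ` C)" for a' b'
    proof -
      obtain a b where ab: "a' = f a" "b' = f b" "{a, b} \<in> edges F" using ex[OF e] by blast
      have "a \<noteq> x" "b \<noteq> x" "(a \<in> C) = (b \<in> C)" using ne by (auto simp: ab(1,2) fmem)
      then obtain l where "l \<in> L" "{a, b} = {z, l}" using bi ab(3) by blast
      then show ?thesis by (intro bexI[of _ "f l"]) (simp_all add: ab(1,2) fdb)
    qed
    then have bi': "\<forall>a b. {a, b} \<in> edges ?F \<longrightarrow> a \<noteq> f x \<longrightarrow> b \<noteq> f x \<longrightarrow> (a \<in> f ` C) = (b \<in> f ` C) \<longrightarrow>
        (\<exists>l\<in>f ` L. {a, b} = {f z, l})" by simp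
    have 1: "f x \<in> verts ?F" "f ` C \<subseteq> verts ?F - {f x}" "f z \<in> f ` C" "{f x, f z} \<in> edges ?F"
      "f ` L \<subseteq> f ` C - {f z}" "card (f ` L) = s" "\<forall>l\<in>f ` L. {f z, l} \<in> edges ?F"
      using st by (auto simp: iff card_f feq)
    show "\<exists>x z C L. x \<in> verts ?F \<and> C \<subseteq> verts ?F - {x} \<and> z \<in> C \<and> {x, z} \<in> edges ?F \<and> L \<subseteq> C - {z} \<and>
       card L = s \<and> (\<forall>l\<in>L. {z, l} \<in> edges ?F) \<and>
       (\<forall>a b. {a, b} \<in> edges ?F \<longrightarrow> a \<noteq> x \<longrightarrow> b \<noteq> x \<longrightarrow> (a \<in> C) = (b \<in> C) \<longrightarrow> (\<exists>l\<in>L. {a, b} = {z, l}))"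
      by (intro exI[of _ "f x"] exI[of _ "f z"] exI[of _ "f ` C"] exI[of _ "f ` L"] conjI 1 bi')
  next
    fix same
    obtain C a1 b1 a2 b2 where pt: "two_edge_pattern F same C a1 b1 a2 b2" using pattern_ex by blast
    have "(a' \<in> f ` C) \<noteq> (b' \<in> f ` C)"
      if e: "{a', b'} \<in> (`) f ` edges F" and ne: "{a', b'} \<noteq> {f a1, f b1}" "{a', b'} \<noteq> {f a2, f b2}" for a' b'
    proof -
      obtain a b where ab: "a' = f a" "b' = f b" "{a, b} \<in> edges F" using ex[OF e] by blast
      then show ?thesis using pt ne by (auto simp: two_edge_pattern_def fdb fmem)
    qed
    then have "two_edge_pattern ?F same (f ` C) (f a1) (f b1) (f a2) (f b2)"
      using pt unfolding two_edge_pattern_def by (simp add: feq fmem iff)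
    then show "\<exists>C a1 b1 a2 b2. two_edge_pattern ?F same C a1 b1 a2 b2" by blast
  next
    show "s + 3 \<le> card (verts ?F)" using large by (simp add: card_f)
  next
    obtain col :: "'a \<Rightarrow> nat" where col: "\<forall>a b. {a, b} \<in> edges F \<longrightarrow> col a \<noteq> col b" "\<forall>a. col a < 3"
      using three_col by blast
    have "col (inv f a') \<noteq> col (inv f b')" if e: "{a', b'} \<in> (`) f ` edges F" for a' b'
      using ex[OF e] col(1) f by auto
    then show "\<exists>col :: 'b \<Rightarrow> nat. (\<forall>a b. {a, b} \<in> edges ?F \<longrightarrow> col a \<noteq> col b) \<and> (\<forall>a. col a < 3)"
      using col(2) by (intro exI[of _ "\<lambda>v. col (inv f v)"]) auto
  qed
qed

section \<open>The concrete graph\<close>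

datatype vertex = R nat | W nat | Y nat | U nat | Apex | Mate | Left | Mid | Right | Hub

text \<open>The odd cycles are the triangles on \<open>Apex\<close>, \<open>Mate\<close> and those using the path \<open>Left\<close>, \<open>Mid\<close>,
  \<open>Right\<close> the odd way round. The vertex \<open>Hub\<close> meets all of the latter that avoid \<open>Apex\<close>, and
  moving \<open>Hub\<close> to the other side leaves exactly its \<open>s\<close> edges to \<open>W\<close>; it is adjacent to \<open>Apex\<close>.\<close>

fun arc :: "nat \<Rightarrow> vertex \<Rightarrow> vertex \<Rightarrow> bool" where
  "arc s (R i) v = (case v of W j \<Rightarrow> True | Apex \<Rightarrow> True | Mate \<Rightarrow> True | _ \<Rightarrow> False)"
| "arc s (U i) v = (case v of Y j \<Rightarrow> True | Apex \<Rightarrow> True | Right \<Rightarrow> True | _ \<Rightarrow> False)"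
| "arc s Hub v = (case v of W j \<Rightarrow> j < s | Y j \<Rightarrow> True | Apex \<Rightarrow> True | _ \<Rightarrow> False)"
| "arc s Left v = (case v of W j \<Rightarrow> True | Mid \<Rightarrow> True | _ \<Rightarrow> False)"
| "arc s Apex v = (v = Mate)"
| "arc s Mid v = (v = Right)"
| "arc s _ v = False"

text \<open>Classes of size s + 2 serve two ends: one of their vertices can be chosen away from
  deleted ones, and a star swallowing a whole class exceeds s edges.\<close>

fun used :: "nat \<Rightarrow> vertex \<Rightarrow> bool" where
  "used s (R i) = (i < s + 2)" | "used s (W i) = (i < s + 2)"
| "used s (Y i) = (i < s + 2)" | "used s (U i) = (i < s + 2)" | "used s _ = True"

definition gadget :: "nat \<Rightarrow> vertex sgraph" where
  "gadget s = SGraph {v. used s v} {e. \<exists>a b. e = {a, b} \<and> used s a \<and> used s b \<and> arc s a b}"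

lemma arc_irrefl: "\<not> arc s a a"
  by (cases a) auto

lemma gadget_edge: "{a, b} \<in> edges (gadget s) \<longleftrightarrow> used s a \<and> used s b \<and> (arc s a b \<or> arc s b a)"
  by (auto simp: gadget_def doubleton_eq_iff)

lemma gadget_verts: "verts (gadget s) = R ` {..<s + 2} \<union> W ` {..<s + 2} \<union> Y ` {..<s + 2} \<union> U ` {..<s + 2}
    \<union> {Apex, Mate, Left, Mid, Right, Hub}" (is "_ = ?V")
proof -
  have "used s v \<longleftrightarrow> v \<in> ?V" for v by (cases v) auto
  then show ?thesis by (auto simp: gadget_def)
qed

lemma finite_gadget: "finite (verts (gadget s))"
  by (simp add: gadget_verts)

lemma gadget_simple: "simple_graph (gadget s)"
  unfolding simple_graph_def
proof (intro conjI subsetI finite_gadget)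
  fix e assume "e \<in> edges (gadget s)"
  then obtain a b where e: "e = {a, b}" "used s a" "used s b" "arc s a b" by (auto simp: gadget_def)
  then have "a \<noteq> b" using arc_irrefl by auto
  then show "e \<in> [verts (gadget s)]\<^bsup>2\<^esup>" using e by (auto simp: nsets_def gadget_def)
qed

lemma gadget_nbrs:
  "{Left, w} \<in> edges (gadget s) \<longleftrightarrow> w \<in> W ` {..<s + 2} \<union> {Mid}"
  "{Mid, w} \<in> edges (gadget s) \<longleftrightarrow> w \<in> {Left, Right}"
  "{Right, w} \<in> edges (gadget s) \<longleftrightarrow> w \<in> U ` {..<s + 2} \<union> {Mid}"
  "{Hub, w} \<in> edges (gadget s) \<longleftrightarrow> w \<in> W ` {..<s} \<union> Y ` {..<s + 2} \<union> {Apex}"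
  "{Apex, w} \<in> edges (gadget s) \<longleftrightarrow> w \<in> R ` {..<s + 2} \<union> U ` {..<s + 2} \<union> {Mate, Hub}"
  "{Mate, w} \<in> edges (gadget s) \<longleftrightarrow> w \<in> R ` {..<s + 2} \<union> {Apex}"
proof -
  have less: "j < s + 2 \<and> j < s \<longleftrightarrow> j < s" for j by auto
  show "{Left, w} \<in> edges (gadget s) \<longleftrightarrow> w \<in> W ` {..<s + 2} \<union> {Mid}"
    unfolding gadget_edge by (cases w) (simp_all add: image_iff)
  show "{Mid, w} \<in> edges (gadget s) \<longleftrightarrow> w \<in> {Left, Right}"
    unfolding gadget_edge by (cases w) simp_all
  show "{Right, w} \<in> edges (gadget s) \<longleftrightarrow> w \<in> U ` {..<s + 2} \<union> {Mid}"
    unfolding gadget_edge by (cases w) (simp_all add: image_iff)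
  show "{Hub, w} \<in> edges (gadget s) \<longleftrightarrow> w \<in> W ` {..<s} \<union> Y ` {..<s + 2} \<union> {Apex}"
    unfolding gadget_edge by (cases w) (simp_all add: image_iff less[simplified])
  show "{Apex, w} \<in> edges (gadget s) \<longleftrightarrow> w \<in> R ` {..<s + 2} \<union> U ` {..<s + 2} \<union> {Mate, Hub}"
    unfolding gadget_edge by (cases w) (simp_all add: image_iff)
  show "{Mate, w} \<in> edges (gadget s) \<longleftrightarrow> w \<in> R ` {..<s + 2} \<union> {Apex}"
    unfolding gadget_edge by (cases w) (simp_all add: image_iff)
qed

text \<open>Deleting x and z must destroy all odd cycles. The triangles force \<open>Apex\<close> or
  \<open>Mate\<close> to be deleted, and the seven-cycles Hub, W, Left, Mid, Right, U, Y force one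
  of \<open>Left\<close>, \<open>Mid\<close>, \<open>Right\<close>, \<open>Hub\<close>. The
  remaining colouring is then determined by two bits, and \<open>D\<close> is read off for each
  possible pair.\<close>

lemma gadget_star_types:
  fixes c :: "vertex \<Rightarrow> bool"
  assumes s2: "s \<ge> 2" and x: "x \<in> verts (gadget s)" and z: "z \<in> verts (gadget s)" and xz: "x \<noteq> z"
    and proper: "\<And>a b. {a, b} \<in> edges (gadget s) \<Longrightarrow> {a, b} \<inter> {x, z} = {} \<Longrightarrow> c a \<noteq> c b"
    and D: "D = {w. {z, w} \<in> edges (gadget s) \<and> w \<noteq> x \<and> c w = c z}"
  shows "card D \<ge> s + 1 \<or> card D = s \<and> {x, z} \<in> edges (gadget s) \<or>
    (\<exists>w. D = {w} \<and> {x, z} \<notin> edges (gadget s) \<and> {x, w} \<notin> edges (gadget s))"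
proof -
  have pr: "c a \<noteq> c b" if "used s a" "used s b" "arc s a b" "a \<noteq> x" "a \<noteq> z" "b \<noteq> x" "b \<noteq> z" for a b
    using proper[of a b] that by (auto simp: gadget_edge)
  have fD: "finite D"
  proof (rule finite_subset[OF _ finite_gadget[of s]])
    show "D \<subseteq> verts (gadget s)" using simple_graph_edge(2)[OF gadget_simple] by (auto simp: D)
  qed
  have big: ?thesis if "g ` {..<s + 2} \<subseteq> D" "inj g" for g :: "nat \<Rightarrow> vertex"
  proof -
    have "card (g ` {..<s + 2}) \<le> card D" using that fD by (intro card_mono)
    moreover have "card (g ` {..<s + 2}) = s + 2" using that(2) by (subst card_image) (auto intro: inj_on_subset)
    ultimately show ?thesis by simp
  qed
  have inj: "inj R" "inj W" "inj Y" "inj U" by (auto simp: inj_def)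
  \<comment> \<open>Three vertices of the class \<open>R\<close> cannot all be in {x, z}, so
    otherwise a triangle survives.\<close>
  have am: "Apex \<in> {x, z} \<or> Mate \<in> {x, z}"
  proof (rule ccontr)
    assume no: "\<not> ?thesis"
    have "R 0 \<notin> {x, z} \<or> R 1 \<notin> {x, z} \<or> R 2 \<notin> {x, z}" by auto
    then consider "R 0 \<notin> {x, z}" | "R 1 \<notin> {x, z}" | "R 2 \<notin> {x, z}" by blast
    then obtain i :: nat where i: "i < 3" "R i \<notin> {x, z}"
    proof cases
      case 1 then show ?thesis using that[of 0] by simp
    next
      case 2 then show ?thesis using that[of 1] by simp
    next
      case 3 then show ?thesis using that[of 2] by simp
    qed
    show False using pr[of "R i" Apex] pr[of "R i" Mate] pr[of Apex Mate] no i s2 by auto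
  qed
  have pick: "\<exists>i<2. g i \<noteq> a" if "inj g" for g :: "nat \<Rightarrow> vertex" and a
  proof -
    have "g 0 \<noteq> g 1" using that by (auto simp: inj_eq)
    then have "g 0 \<noteq> a \<or> g 1 \<noteq> a" by auto
    then show ?thesis by (metis one_less_numeral_iff semiring_norm(76) zero_less_numeral)
  qed
  \<comment> \<open>Otherwise a seven-cycle survives: each of the classes \<open>W\<close>,
    \<open>Y\<close>, \<open>U\<close> keeps a vertex among its two smallest indices.\<close>
  have other: "w \<in> {Left, Mid, Right, Hub}"
    if w: "{x, z} = {v, w}" "v = Apex \<or> v = Mate" for v w
  proof (rule ccontr)
    assume no: "w \<notin> {Left, Mid, Right, Hub}"
    obtain i where i: "i < 2" "W i \<noteq> w" using pick[OF inj(2)] by blast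
    obtain j where j: "j < 2" "Y j \<noteq> w" using pick[OF inj(3)] by blast
    obtain l where l: "l < 2" "U l \<noteq> w" using pick[OF inj(4)] by blast
    have out: "a \<noteq> x \<and> a \<noteq> z" if "a \<noteq> v" "a \<noteq> w" for a using that w(1) by (metis doubleton_eq_iff)
    have o: "Hub \<noteq> x \<and> Hub \<noteq> z" "Left \<noteq> x \<and> Left \<noteq> z" "Mid \<noteq> x \<and> Mid \<noteq> z" "Right \<noteq> x \<and> Right \<noteq> z"
      "W i \<noteq> x \<and> W i \<noteq> z" "Y j \<noteq> x \<and> Y j \<noteq> z" "U l \<noteq> x \<and> U l \<noteq> z"
      using no w(2) i j l by (auto intro!: out)
    have "c Hub \<noteq> c (W i)" by (rule pr) (use o i j l s2 in auto)
    moreover have "c Left \<noteq> c (W i)" by (rule pr) (use o i j l s2 in auto)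
    moreover have "c Left \<noteq> c Mid" by (rule pr) (use o i j l s2 in auto)
    moreover have "c Mid \<noteq> c Right" by (rule pr) (use o i j l s2 in auto)
    moreover have "c (U l) \<noteq> c Right" by (rule pr) (use o i j l s2 in auto)
    moreover have "c (U l) \<noteq> c (Y j)" by (rule pr) (use o i j l s2 in auto)
    moreover have "c Hub \<noteq> c (Y j)" by (rule pr) (use o i j l s2 in auto)
    ultimately show False by auto
  qed
  \<comment> \<open>Without \<open>Mate\<close> and \<open>Hub\<close> there is still the odd cycle
    Left, W, R, Apex, U, Right, Mid.\<close>
  have notMH: False if w: "{x, z} = {Mate, Hub}"
  proof -
    have out: "a \<noteq> x \<and> a \<noteq> z" if "a \<noteq> Mate" "a \<noteq> Hub" for a using that w by (metis doubleton_eq_iff)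
    have o: "Left \<noteq> x \<and> Left \<noteq> z" "Mid \<noteq> x \<and> Mid \<noteq> z" "Right \<noteq> x \<and> Right \<noteq> z" "Apex \<noteq> x \<and> Apex \<noteq> z"
      "W 0 \<noteq> x \<and> W 0 \<noteq> z" "R 0 \<noteq> x \<and> R 0 \<noteq> z" "U 0 \<noteq> x \<and> U 0 \<noteq> z"
      by (auto intro!: out)
    have "c Left \<noteq> c (W 0)" by (rule pr) (use o in auto)
    moreover have "c (R 0) \<noteq> c (W 0)" by (rule pr) (use o in auto)
    moreover have "c Left \<noteq> c Mid" by (rule pr) (use o in auto)
    moreover have "c Mid \<noteq> c Right" by (rule pr) (use o in auto)
    moreover have "c (U 0) \<noteq> c Right" by (rule pr) (use o in auto)
    moreover have "c (U 0) \<noteq> c Apex" by (rule pr) (use o in auto)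
    moreover have "c (R 0) \<noteq> c Apex" by (rule pr) (use o in auto)
    ultimately show False by auto
  qed
  define M where "M = {Apex, Mate, Left, Mid, Right, Hub}"
  obtain v w where vw: "{x, z} = {v, w}" "v = Apex \<or> v = Mate" using am by blast
  then have w: "w \<in> {Left, Mid, Right, Hub}" using other by blast
  have xM: "x \<in> M" "z \<in> M" using vw w by (auto simp: M_def doubleton_eq_iff)
  have out: "a \<noteq> x \<and> a \<noteq> z" if "a \<notin> M" for a using xM that by auto
  \<comment> \<open>\<open>R\<close> and \<open>W\<close> span a complete bipartite graph untouched
    by the deletion, so p fixes the colours of both classes; u below does the same for
    \<open>U\<close> and \<open>Y\<close>.\<close>
  define p where "p = c (R 0)"
  have cW: "c (W i) \<noteq> p" if "i < s + 2" for i
    unfolding p_def using pr[of "R 0" "W i"] out[of "R 0"] out[of "W i"] that by (auto simp: M_def)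
  have cR: "c (R i) = p" if "i < s + 2" for i
    using pr[of "R i" "W 0"] out[of "R i"] out[of "W 0"] that cW[of 0] by (auto simp: M_def)
  define u where "u = c (U 0)"
  have cY: "c (Y i) \<noteq> u" if "i < s + 2" for i
    unfolding u_def using pr[of "U 0" "Y i"] out[of "U 0"] out[of "Y i"] that by (auto simp: M_def)
  have cU: "c (U i) = u" if "i < s + 2" for i
    using pr[of "U i" "Y 0"] out[of "U i"] out[of "Y 0"] that cY[of 0] by (auto simp: M_def)
  have Apex: "c Apex \<noteq> p" "c Apex \<noteq> u" if "Apex \<notin> {x, z}"
    using pr[of "R 0" Apex] pr[of "U 0" Apex] out[of "R 0"] out[of "U 0"] that by (auto simp: M_def p_def u_def)
  have Mate: "c Mate \<noteq> p" if "Mate \<notin> {x, z}"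
    using pr[of "R 0" Mate] out[of "R 0"] that by (auto simp: M_def p_def)
  have Left: "c Left = p" if "Left \<notin> {x, z}"
    using pr[of Left "W 0"] out[of "W 0"] cW[of 0] that by (auto simp: M_def)
  have Hub: "c Hub = p" "c Hub = u" if "Hub \<notin> {x, z}"
    using pr[of Hub "W 0"] pr[of Hub "Y 0"] out[of "W 0"] out[of "Y 0"] cW[of 0] cY[of 0] that s2 by (auto simp: M_def)
  have Right: "c Right \<noteq> u" if "Right \<notin> {x, z}"
    using pr[of "U 0" Right] out[of "U 0"] that by (auto simp: M_def u_def)
  have MidL: "c Mid \<noteq> c Left" if "Mid \<notin> {x, z}" "Left \<notin> {x, z}"
    using pr[of Left Mid] that by auto
  have MidR: "c Mid \<noteq> c Right" if "Mid \<notin> {x, z}" "Right \<notin> {x, z}"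
    using pr[of Mid Right] that by auto
  \<comment> \<open>If \<open>Hub\<close> remains then u = p, and if the path Left, Mid, Right
    remains then u differs from p; these two facts decide the cases.\<close>
  consider "z = Left" "x = Apex \<or> x = Mate" | "z = Mid" "x = Apex \<or> x = Mate" | "z = Right" "x = Apex \<or> x = Mate"
    | "z = Hub" "x = Apex" | "z = Apex" "x \<in> {Left, Mid, Right}" | "z = Apex" "x = Hub"
    | "z = Mate" "x \<in> {Left, Mid, Right}"
    using vw w notMH by (auto simp: doubleton_eq_iff insert_commute)
  then show ?thesis
  proof cases
    case 1
    have u: "u = p" using 1 Apex Hub by auto
    then have m: "c Mid = p" using 1 MidR Right by auto
    show ?thesis
    proof (cases "c Left = p")
      case True
      have "D = {Mid}" unfolding D 1(1) gadget_nbrs using True m cW 1(2) by auto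
      then show ?thesis using 1 by (auto simp: gadget_edge)
    next
      case False
      then have "W ` {..<s + 2} \<subseteq> D" unfolding D 1(1) gadget_nbrs using cW 1(2) by auto
      then show ?thesis by (rule big[OF _ inj(2)])
    qed
  next
    case 2
    have u: "u = p" using 2 Apex Hub by auto
    have lr: "c Left = p" "c Right \<noteq> p" using 2 u Left Right by auto
    have "D = {Left} \<or> D = {Right}"
      unfolding D 2(1) gadget_nbrs using lr 2(2) by auto
    then show ?thesis using 2 by (auto simp: gadget_edge)
  next
    case 3
    have u: "u = p" using 3 Apex Hub by auto
    have m: "c Mid \<noteq> p" using 3 MidL Left by auto
    show ?thesis
    proof (cases "c Right = p")
      case True
      then have "U ` {..<s + 2} \<subseteq> D" unfolding D 3(1) gadget_nbrs using cU u 3(2) by auto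
      then show ?thesis by (rule big[OF _ inj(4)])
    next
      case False
      have "D = {Mid}" unfolding D 3(1) gadget_nbrs using False m cU u 3(2) by auto
      then show ?thesis using 3 by (auto simp: gadget_edge)
    qed
  next
    case 4
    have u: "u \<noteq> p" using 4 Left MidL MidR Right by auto
    show ?thesis
    proof (cases "c Hub = p")
      case True
      then have "Y ` {..<s + 2} \<subseteq> D" unfolding D 4(1) gadget_nbrs using cY u 4(2) by auto
      then show ?thesis by (rule big[OF _ inj(3)])
    next
      case False
      \<comment> \<open>The only way to use exactly s star edges: the colour of \<open>Hub\<close>
        agrees with \<open>W\<close> but not with \<open>Y\<close>. Here x = \<open>Apex\<close> is
        adjacent to z = \<open>Hub\<close>, as required.\<close>
      then have "D = W ` {..<s}" unfolding D 4(1) gadget_nbrs using cY cW u 4(2) by auto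
      moreover have "card (W ` {..<s}) = s" using inj(2) by (subst card_image) (auto intro: inj_on_subset)
      ultimately show ?thesis using 4 by (simp add: gadget_edge)
    qed
  next
    case 5
    have u: "u = p" using 5 Hub by auto
    have h: "c Hub = p" "c Mate \<noteq> p" using 5 Hub Mate by auto
    show ?thesis
    proof (cases "c Apex = p")
      case True
      then have "R ` {..<s + 2} \<subseteq> D" unfolding D 5(1) gadget_nbrs using cR 5(2) by auto
      then show ?thesis by (rule big[OF _ inj(1)])
    next
      case False
      have "D = {Mate}" unfolding D 5(1) gadget_nbrs using False h cU cR u 5(2) by auto
      then show ?thesis using 5 by (auto simp: gadget_edge)
    qed
  next
    case 6
    have u: "u \<noteq> p" using 6 Left MidL MidR Right by auto
    show ?thesis
    proof (cases "c Apex = p")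
      case True
      then have "R ` {..<s + 2} \<subseteq> D" unfolding D 6(1) gadget_nbrs using cR 6(2) by auto
      then show ?thesis by (rule big[OF _ inj(1)])
    next
      case False
      then have "U ` {..<s + 2} \<subseteq> D" unfolding D 6(1) gadget_nbrs using cU u 6(2) by auto
      then show ?thesis by (rule big[OF _ inj(4)])
    qed
  next
    case 7
    have a: "c Apex \<noteq> p" using 7 Apex by auto
    show ?thesis
    proof (cases "c Mate = p")
      case True
      then have "R ` {..<s + 2} \<subseteq> D" unfolding D 7(1) gadget_nbrs using cR 7(2) by auto
      then show ?thesis by (rule big[OF _ inj(1)])
    next
      case False
      have "D = {Apex}" unfolding D 7(1) gadget_nbrs using False a cR 7(2) by auto
      then show ?thesis using 7 by (auto simp: gadget_edge)
    qed
  qed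
qed

text \<open>For a symmetric property it suffices to inspect each edge in its listed direction, which
  halves the case distinctions.\<close>

lemma arc_proper:
  assumes "\<And>a b. used s a \<Longrightarrow> used s b \<Longrightarrow> arc s a b \<Longrightarrow> P a b" "\<And>a b. P a b \<Longrightarrow> P b a"
  shows "{a, b} \<in> edges (gadget s) \<Longrightarrow> P a b"
  using assms by (auto simp: gadget_edge)

text \<open>The triangles and the seven-cycle are disjoint, and \<open>R\<close> has a spare vertex,
  so no single deletion destroys all odd cycles. The other witnesses are bipartitions in which the
  cycles are broken at chosen edges.\<close>

lemma gadget_template:
  assumes s: "s \<ge> 1"
  shows "template (gadget s) s"
proof
  show "simple_graph (gadget s)" by (rule gadget_simple)
  show "1 \<le> s" by (rule s)
next
  fix x and c :: "vertex \<Rightarrow> bool"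
  show "\<exists>a b. {a, b} \<in> edges (gadget s) \<and> a \<noteq> x \<and> b \<noteq> x \<and> c a = c b"
  proof (rule ccontr)
    assume no: "\<not> ?thesis"
    then have pr: "c a \<noteq> c b" if "used s a" "used s b" "arc s a b" "a \<noteq> x" "b \<noteq> x" for a b
      using that by (auto simp: gadget_edge)
    show False
    proof (cases "x = Apex \<or> x = Mate")
      case True
      have "c Hub \<noteq> c (W 0)" by (rule pr) (use True s in auto)
      moreover have "c Left \<noteq> c (W 0)" by (rule pr) (use True s in auto)
      moreover have "c Left \<noteq> c Mid" by (rule pr) (use True s in auto)
      moreover have "c Mid \<noteq> c Right" by (rule pr) (use True s in auto)
      moreover have "c (U 0) \<noteq> c Right" by (rule pr) (use True s in auto)
      moreover have "c (U 0) \<noteq> c (Y 0)" by (rule pr) (use True s in auto)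
      moreover have "c Hub \<noteq> c (Y 0)" by (rule pr) (use True s in auto)
      ultimately show False by auto
    next
      case False
      obtain i :: nat where i: "i < 2" "R i \<noteq> x"
      proof (cases "R 0 = x")
        case True
        then show ?thesis using that[of 1] by auto
      next
        case False
        then show ?thesis using that[of 0] by auto
      qed
      have "c (R i) \<noteq> c Apex" by (rule pr) (use False i in auto)
      moreover have "c (R i) \<noteq> c Mate" by (rule pr) (use False i in auto)
      moreover have "c Apex \<noteq> c Mate" by (rule pr) (use False i in auto)
      ultimately show False by auto
    qed
  qed
next
  fix x z and c :: "vertex \<Rightarrow> bool" and D
  assume a: "2 \<le> s" "x \<in> verts (gadget s)" "z \<in> verts (gadget s)" "x \<noteq> z"
    and pr: "\<And>a b. {a, b} \<in> edges (gadget s) \<Longrightarrow> {a, b} \<inter> {x, z} = {} \<Longrightarrow> c a \<noteq> c b"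
    and D: "D = {w. {z, w} \<in> edges (gadget s) \<and> w \<noteq> x \<and> c w = c z}"
  show "s + 1 \<le> card D \<or> card D = s \<and> {x, z} \<in> edges (gadget s) \<or>
    (\<exists>w. D = {w} \<and> {x, z} \<notin> edges (gadget s) \<and> {x, w} \<notin> edges (gadget s))"
    by (rule gadget_star_types[OF a pr D])
next
  \<comment> \<open>\<open>Apex\<close> takes care of the triangles, and the seven-cycle is broken
    at the edge between \<open>Left\<close> and \<open>Mid\<close>, neither of which is adjacent to
    \<open>Apex\<close>.\<close>
  define C where "C = R ` {..<s + 2} \<union> U ` {..<s + 2} \<union> {Left, Mid, Hub}"
  have bi: "a \<noteq> Apex \<longrightarrow> b \<noteq> Apex \<longrightarrow> {a, b} \<noteq> {Left, Mid} \<longrightarrow> (a \<in> C) \<noteq> (b \<in> C)" if "{a, b} \<in> edges (gadget s)" for a b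
    using that
  proof (rule arc_proper[rotated 2])
    fix a b assume "used s a" "used s b" "arc s a b"
    then show "a \<noteq> Apex \<longrightarrow> b \<noteq> Apex \<longrightarrow> {a, b} \<noteq> {Left, Mid} \<longrightarrow> (a \<in> C) \<noteq> (b \<in> C)"
      by (cases a; cases b) (auto simp: C_def)
  qed (auto simp: insert_commute)
  have "(Apex, Left, Mid, C) \<in> types2 (gadget s)"
    unfolding types2_def types_def using bi by (auto simp: gadget_edge C_def gadget_verts)
  moreover have "\<not> ({Apex, v} \<in> edges (gadget s) \<and> {Left, v} \<in> edges (gadget s))" for v
    by (auto simp: gadget_nbrs)
  ultimately show "\<exists>(x, z, u, C)\<in>types2 (gadget s). \<forall>v. \<not> ({x, v} \<in> edges (gadget s) \<and> {z, v} \<in> edges (gadget s))"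
    by blast
next
  \<comment> \<open>\<open>Hub\<close> sits on the side of \<open>W\<close>: its s edges to
    \<open>W\<close> are the only ones inside a side.\<close>
  define C where "C = W ` {..<s + 2} \<union> U ` {..<s + 2} \<union> {Mate, Mid, Hub}"
  have bi: "a \<noteq> Apex \<longrightarrow> b \<noteq> Apex \<longrightarrow> (a \<in> C) = (b \<in> C) \<longrightarrow> (\<exists>l\<in>W ` {..<s}. {a, b} = {Hub, l})"
    if "{a, b} \<in> edges (gadget s)" for a b
    using that
  proof (rule arc_proper[rotated 2])
    fix a b assume "used s a" "used s b" "arc s a b"
    then show "a \<noteq> Apex \<longrightarrow> b \<noteq> Apex \<longrightarrow> (a \<in> C) = (b \<in> C) \<longrightarrow> (\<exists>l\<in>W ` {..<s}. {a, b} = {Hub, l})"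
      by (cases a; cases b) (auto simp: C_def)
  qed (auto simp: insert_commute)
  have st: "Apex \<in> verts (gadget s)" "C \<subseteq> verts (gadget s) - {Apex}" "Hub \<in> C" "{Apex, Hub} \<in> edges (gadget s)"
    "W ` {..<s} \<subseteq> C - {Hub}" "\<forall>l\<in>W ` {..<s}. {Hub, l} \<in> edges (gadget s)"
    by (auto simp: gadget_edge C_def gadget_verts)
  have cs: "card (W ` {..<s}) = s" by (subst card_image) (auto simp: inj_on_def)
  show "\<exists>x z C L. x \<in> verts (gadget s) \<and> C \<subseteq> verts (gadget s) - {x} \<and> z \<in> C \<and> {x, z} \<in> edges (gadget s) \<and>
      L \<subseteq> C - {z} \<and> card L = s \<and> (\<forall>l\<in>L. {z, l} \<in> edges (gadget s)) \<and>
      (\<forall>a b. {a, b} \<in> edges (gadget s) \<longrightarrow> a \<noteq> x \<longrightarrow> b \<noteq> x \<longrightarrow> (a \<in> C) = (b \<in> C) \<longrightarrow> (\<exists>l\<in>L. {a, b} = {z, l}))"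
    using bi by (intro exI[of _ Apex] exI[of _ Hub] exI[of _ C] exI[of _ "W ` {..<s}"] conjI st cs allI impI) simp
next
  fix same
  \<comment> \<open>The edge between \<open>Apex\<close> and \<open>Mate\<close> breaks the
    triangles. The seven-cycle is broken at Left-Mid, in the other side, or, after moving
    \<open>Mid\<close> over, at Mid-Right in the same side.\<close>
  define C0 where "C0 = W ` {..<s + 2} \<union> Y ` {..<s + 2} \<union> {Apex, Mate, Right}"
  have bi1: "{a, b} \<noteq> {Apex, Mate} \<longrightarrow> {a, b} \<noteq> {Mid, Right} \<longrightarrow> (a \<in> insert Mid C0) \<noteq> (b \<in> insert Mid C0)"
    if "{a, b} \<in> edges (gadget s)" for a b
    using that
  proof (rule arc_proper[rotated 2])
    fix a b assume "used s a" "used s b" "arc s a b"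
    then show "{a, b} \<noteq> {Apex, Mate} \<longrightarrow> {a, b} \<noteq> {Mid, Right} \<longrightarrow> (a \<in> insert Mid C0) \<noteq> (b \<in> insert Mid C0)"
      by (cases a; cases b) (auto simp: C0_def)
  qed (auto simp: insert_commute)
  have bi2: "{a, b} \<noteq> {Apex, Mate} \<longrightarrow> {a, b} \<noteq> {Left, Mid} \<longrightarrow> (a \<in> C0) \<noteq> (b \<in> C0)"
    if "{a, b} \<in> edges (gadget s)" for a b
    using that
  proof (rule arc_proper[rotated 2])
    fix a b assume "used s a" "used s b" "arc s a b"
    then show "{a, b} \<noteq> {Apex, Mate} \<longrightarrow> {a, b} \<noteq> {Left, Mid} \<longrightarrow> (a \<in> C0) \<noteq> (b \<in> C0)"
      by (cases a; cases b) (auto simp: C0_def)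
  qed (auto simp: insert_commute)
  show "\<exists>C a1 b1 a2 b2. two_edge_pattern (gadget s) same C a1 b1 a2 b2"
  proof (cases same)
    case True
    have "two_edge_pattern (gadget s) True (insert Mid C0) Apex Mate Mid Right"
      unfolding two_edge_pattern_def using bi1 by (auto simp: gadget_edge C0_def)
    then show ?thesis unfolding eq_True[THEN iffD2, OF True] by blast
  next
    case False
    have "two_edge_pattern (gadget s) False C0 Apex Mate Left Mid"
      unfolding two_edge_pattern_def using bi2 by (auto simp: gadget_edge C0_def)
    then show ?thesis unfolding eq_False[THEN iffD2, OF False] by blast
  qed
next
  have "card (R ` {..<s + 2} \<union> {Apex}) \<le> card (verts (gadget s))"
    using finite_gadget by (intro card_mono) (auto simp: gadget_verts)
  moreover have "card (R ` {..<s + 2} \<union> {Apex}) = s + 3"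
  proof -
    have "card (R ` {..<s + 2}) = s + 2" by (subst card_image) (auto simp: inj_on_def)
    then show ?thesis by (subst card_Un_disjoint) auto
  qed
  ultimately show "s + 3 \<le> card (verts (gadget s))" by simp
next
  define col where "col v = (case v of R i \<Rightarrow> 0 | U i \<Rightarrow> 0 | Left \<Rightarrow> 0 | Hub \<Rightarrow> 0 | Apex \<Rightarrow> 2 | Mid \<Rightarrow> 2 | _ \<Rightarrow> (1 :: nat))" for v
  have "col a \<noteq> col b" if "{a, b} \<in> edges (gadget s)" for a b
    using that
  proof (rule arc_proper[rotated 2])
    fix a b assume "used s a" "used s b" "arc s a b"
    then show "col a \<noteq> col b" by (cases a; cases b) (auto simp: col_def)
  qed auto
  moreover have "col a < 3" for a by (cases a) (auto simp: col_def)
  ultimately show "\<exists>col :: vertex \<Rightarrow> nat. (\<forall>a b. {a, b} \<in> edges (gadget s) \<longrightarrow> col a \<noteq> col b) \<and> (\<forall>a. col a < 3)"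
    by blast
qed

definition vertex_code :: "vertex \<Rightarrow> nat" where
  "vertex_code v = prod_encode (case v of R i \<Rightarrow> (0, i) | W i \<Rightarrow> (1, i) | Y i \<Rightarrow> (2, i) | U i \<Rightarrow> (3, i)
     | Apex \<Rightarrow> (4, 0) | Mate \<Rightarrow> (5, 0) | Left \<Rightarrow> (6, 0) | Mid \<Rightarrow> (7, 0) | Right \<Rightarrow> (8, 0) | Hub \<Rightarrow> (9, 0))"

lemma inj_vertex_code: "inj vertex_code"
proof (rule injI)
  fix v w assume "vertex_code v = vertex_code w"
  then show "v = w" unfolding vertex_code_def prod_encode_eq by (cases v; cases w) auto
qed

theorem theorem1p6:
  fixes s :: nat
  assumes "s \<ge> 1"
  shows "\<exists>F :: nat sgraph. simple_graph F \<and> \<not> bipartite F \<and> stable_graph F \<and>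
    (\<exists>\<epsilon>::real. \<epsilon> > 0 \<and> (\<exists>N::nat. \<forall>n\<ge>N. \<forall>q::nat.
       (1 \<le> q \<and> real q \<le> \<epsilon> * real n powr (1 - 1 / real s)
          \<longrightarrow> h_num F n q = t_num F n q) \<and>
       (real n powr (1 - 1 / real s) / \<epsilon> \<le> real q \<and> real q \<le> \<epsilon> * real n
          \<longrightarrow> h_num F n q < t_num F n q)))"
  by (rule exI, rule template.threshold[OF template_image[OF gadget_template[OF assms] inj_vertex_code]])

end
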